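(* Let $\gamma\ge0$. Assume $\mathbf{u}_0\in H_{\gamma+\omega}$ and $\mathbf{S}_0\in D_\gamma$. Then the weak problem (WF) with initial data $(\mathbf{u}_0,\mathbf{S}_0)$ has at least one solution $$(\mathbf{u},\mathbf{S})\in\left[\mathscr{C}^0(\mathbb{R}_+,H_{\gamma+\omega})\cap\mathscr{C}^0(\mathbb{R}_+^\ast,V)\cap L^p_{\mathrm{loc}}(\mathbb{R}_+,V)\right]\times\mathscr{C}^0(\mathbb{R}_+,D_\gamma),\qquad p\in[1,2/(2-\delta)).$$ Moreover, there exists $A>0$ such that for all $t\in\mathbb{R}_+$, $$\|\mathbf{u}(t)\|_{H_{\gamma+\omega}}+\|\mathbf{S}(t)\|_{D_\gamma}\le A\left(\|\mathbf{u}_0\|_{H_{\gamma+\omega}}+\|\mathbf{S}_0\|_{D_\gamma}\right).$$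
   Context: $\Omega\subset\mathbb{R}^3$ is a bounded domain with sufficiently smooth boundary; $0<\alpha<\beta<1$ are fixed, $\delta=\beta-\alpha$, $\omega=\delta/(2-\delta)$. $\mathbb{R}_+=[0,+\infty)$, $\mathbb{R}_+^\ast=(0,+\infty)$; $L^p_{\mathrm{loc}}(\mathbb{R}_+,X)$ means $L^p$ on every $[0,T]$. Fields are real-valued; $L^2(\Omega)^9$ is the space of $3\times 3$-matrix-valued $L^2$ fields, $A:B=\sum_{i,j}A_{ij}B_{ij}$, $\langle \mathbf{f}|\mathbf{g}\rangle_{L^2(\Omega)^9}=\int_\Omega \mathbf{f}:\mathbf{g}$, $[\nabla\mathbf{u}]_{ij}=\partial_j u_i$. For $\mathbf{S}$, which is a priori defined for $t>0$, continuity on $\mathbb{R}_+$ means continuous extension to $t=0$. $V=\{\mathbf{h}\in H^1_0(\Omega)^3:\nabla\cdot\mathbf{h}=0\}$ with $\langle \mathbf{f}|\mathbf{g}\rangle_V=\sum_{i,j}\int_\Omega\partial_j f_i\,\partial_j g_i\,d\mathbf{x}$; $H$ is the closure of $V$ in $L^2(\Omega)^3$, with the $L^2$ inner product. $0<\lambda_1\le\lambda_2\le\dots\to+\infty$ and $\mathbf{w}_k\in V$ are the eigenvalues and eigenfunctions of the Stokes operator: $\langle\mathbf{w}_k|\boldsymbol{\phi}\rangle_V=\lambda_k\langle\mathbf{w}_k|\boldsymbol{\phi}\rangle_H$ for all $\boldsymbol{\phi}\in V$, with $(\mathbf{w}_k)_{k\ge1}$ an orthonormal basis of $H$. $\boldsymbol{\epsilon}_k=\nabla\mathbf{w}_k/\sqrt{\lambda_k}$.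 For $\theta\ge0$: $\|\mathbf{f}\|_{H_\theta}^2=\sum_k\lambda_k^\theta|\langle\mathbf{f}|\mathbf{w}_k\rangle_H|^2$, $H_\theta=\{\mathbf{f}\in H:\|\mathbf{f}\|_{H_\theta}<\infty\}$; $\|\mathbf{f}\|_{D_\theta}^2=\sum_k\lambda_k^\theta|\langle\mathbf{f}|\boldsymbol{\epsilon}_k\rangle_{L^2(\Omega)^9}|^2+\|\Pi\mathbf{f}\|^2_{L^2(\Omega)^9}$, $D_\theta=\{\mathbf{f}\in L^2(\Omega)^9:\|\mathbf{f}\|_{D_\theta}<\infty\}$, where $\Pi$ is the orthogonal projection of $L^2(\Omega)^9$ onto the orthogonal complement of the span of $(\boldsymbol{\epsilon}_k)_{k\ge1}$. Weak problem (WF): a solution with data $(\mathbf{u}_0,\mathbf{S}_0)$ is a pair $(\mathbf{u},\mathbf{S})$ with $\mathbf{u}\in\mathscr{C}^0([0,+\infty),L^2(\Omega)^3)\cap L^1_{\mathrm{loc}}(\mathbb{R}_+,H^1_0(\Omega)^3)$, $\nabla\cdot\mathbf{u}=0$, $\mathbf{S}\in\mathscr{C}^0((0,+\infty),L^2(\Omega)^9)\cap L^1_{\mathrm{loc}}(\mathbb{R}_+,L^2(\Omega)^9)$, such that for all $\boldsymbol{\theta}\in V$, all $\mathbf{a}\in C_c^\infty(\Omega)^3$, all $\psi\in C^\infty([0,+\infty))$ vanishing in a neighborhood of $+\infty$, and all $i\in\{1,2,3\}$: $$\psi(0)\int_\Omega\mathbf{u}_0\cdot\boldsymbol{\theta}\,d\mathbf{x}+\int_0^{+\infty}\!\!\int_\Omega\mathbf{u}(t,\mathbf{x})\cdot\boldsymbol{\theta}(\mathbf{x})\psi'(t)\,d\mathbf{x}\,dt=\int_0^{+\infty}\!\!\int_\Omega(\mathbf{S}(t,\mathbf{x}):\nabla\boldsymbol{\theta}(\mathbf{x}))\psi(t)\,d\mathbf{x}\,dt,$$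 $$-\int_0^{+\infty}\!\!\int_\Omega\frac{\psi(\tau)}{\Gamma(1-\alpha)\tau^\alpha}\sum_j[\mathbf{S}_0]_{ij}a_j\,d\mathbf{x}\,d\tau-\int_0^{+\infty}\!\!\int_\tau^{+\infty}\!\!\int_\Omega\frac{\psi'(t)}{\Gamma(1-\alpha)\tau^\alpha}\sum_j[\mathbf{S}]_{ij}(t-\tau,\mathbf{x})a_j(\mathbf{x})\,d\mathbf{x}\,dt\,d\tau+\int_0^{+\infty}\!\!\int_\Omega\sum_j[\mathbf{S}]_{ij}(t,\mathbf{x})a_j(\mathbf{x})\psi(t)\,d\mathbf{x}\,dt$$ $$=-\frac{1}{\Gamma(1-\beta)}\int_0^{+\infty}\!\!\int_0^t\!\int_\Omega\frac{\psi(t)}{(t-\tau)^\beta}\Big\{(\nabla\cdot\mathbf{a})u_i+\sum_j u_j\,\partial_i a_j\Big\}(\tau,\mathbf{x})\,d\mathbf{x}\,d\tau\,dt.$$ *)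

theory Defs
  imports "HOL-Analysis.Analysis"
begin

type_synonym vec3 = "real^3"
type_synonym mat3 = "real^3^3"
type_synonym vfield = "vec3 \<Rightarrow> vec3"
type_synonym mfield = "vec3 \<Rightarrow> mat3"

text \<open>
  Elements of function spaces over \<open>\<Omega>\<close> are represented by functions on the whole of
  \<open>\<real>\<^sup>3\<close>, of which only the values on \<open>\<Omega>\<close>, up to a null set, matter. The norms below are
  therefore seminorms on representatives. A time-dependent field is a curried function of \<open>t\<close>
  and \<open>x\<close>. Matrices are indexed as \<open>A $ i $ j\<close>, so the inner product \<open>A \<bullet> B\<close> on
  \<^typ>\<open>mat3\<close> is \<open>A : B\<close>.
\<close>


section \<open>Smooth functions and domains\<close>

text \<open>For open \<open>S\<close>, all directional derivatives of order at most \<open>k\<close> exist and are continuous.\<close>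

primrec Ck_on :: "nat \<Rightarrow> 'a::real_normed_vector set \<Rightarrow> ('a \<Rightarrow> 'b::real_normed_vector) \<Rightarrow> bool" where
  "Ck_on 0 S f \<longleftrightarrow> continuous_on S f"
| "Ck_on (Suc k) S f \<longleftrightarrow>
     (\<forall>x\<in>S. f differentiable (at x)) \<and>
     (\<forall>v. Ck_on k S (\<lambda>x. frechet_derivative f (at x) v))"

definition partial :: "3 \<Rightarrow> (vec3 \<Rightarrow> 'b::real_normed_vector) \<Rightarrow> vec3 \<Rightarrow> 'b" where
  "partial j f x = frechet_derivative f (at x) (axis j 1)"

text \<open>\<open>C\<^sub>c\<^sup>\<infinity>(\<Omega>)\<close>, extended by zero.\<close>

definition test_functions :: "vec3 set \<Rightarrow> (vec3 \<Rightarrow> 'b::real_normed_vector) set" where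
  "test_functions \<Omega> =
     {\<phi>. (\<forall>k. Ck_on k UNIV \<phi>) \<and> compact (closure {x. \<phi> x \<noteq> 0}) \<and> closure {x. \<phi> x \<noteq> 0} \<subseteq> \<Omega>}"

text \<open>\<open>C\<^sup>\<infinity>([0,\<infinity>))\<close>, with one-sided derivatives at \<open>0\<close>; \<open>D n\<close> is the \<open>n\<close>-th derivative.\<close>

definition smooth_halfline :: "(real \<Rightarrow> real) \<Rightarrow> bool" where
  "smooth_halfline \<psi> \<longleftrightarrow>
     (\<exists>D :: nat \<Rightarrow> real \<Rightarrow> real. D 0 = \<psi> \<and>
        (\<forall>n. \<forall>t\<ge>0. (D n has_real_derivative D (Suc n) t) (at t within {0..})))"

definition time_test_functions :: "(real \<Rightarrow> real) set" where
  "time_test_functions = {\<psi>. smooth_halfline \<psi> \<and> (\<exists>T. \<forall>t\<ge>T. \<psi> t = 0)}"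

abbreviation time_deriv :: "(real \<Rightarrow> real) \<Rightarrow> real \<Rightarrow> real" where
  "time_deriv \<psi> t \<equiv> vector_derivative \<psi> (at t within {0..})"

text \<open>
  After an orthogonal change of coordinates \<open>R\<close>, the set is locally the region above the graph of
  a \<open>C\<^sup>k\<close> function.
\<close>

definition Ck_boundary :: "nat \<Rightarrow> vec3 set \<Rightarrow> bool" where
  "Ck_boundary k \<Omega> \<longleftrightarrow>
     (\<forall>x\<in>frontier \<Omega>. \<exists>r>0. \<exists>(R :: vec3 \<Rightarrow> vec3) (g :: real^2 \<Rightarrow> real).
        orthogonal_transformation R \<and> Ck_on k UNIV g \<and>
        \<Omega> \<inter> ball x r = {y \<in> ball x r. g (vector [R y $ 1, R y $ 2]) < R y $ 3})"

definition bounded_domain :: "vec3 set \<Rightarrow> bool" where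
  "bounded_domain \<Omega> \<longleftrightarrow> open \<Omega> \<and> connected \<Omega> \<and> bounded \<Omega> \<and> \<Omega> \<noteq> {}"


section \<open>Lebesgue and Sobolev spaces on the domain\<close>

definition L2 :: "vec3 set \<Rightarrow> (vec3 \<Rightarrow> 'b::euclidean_space) set" where
  "L2 \<Omega> = {f. f \<in> borel_measurable (lebesgue_on \<Omega>) \<and>
               integrable (lebesgue_on \<Omega>) (\<lambda>x. (norm (f x))\<^sup>2)}"

definition L2_inner :: "vec3 set \<Rightarrow> (vec3 \<Rightarrow> 'b::euclidean_space) \<Rightarrow> (vec3 \<Rightarrow> 'b) \<Rightarrow> real" where
  "L2_inner \<Omega> f g = (LINT x|lebesgue_on \<Omega>. f x \<bullet> g x)"

definition L2_norm :: "vec3 set \<Rightarrow> (vec3 \<Rightarrow> 'b::euclidean_space) \<Rightarrow> real" where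
  "L2_norm \<Omega> f = sqrt (L2_inner \<Omega> f f)"

definition has_weak_gradient :: "vec3 set \<Rightarrow> vfield \<Rightarrow> mfield \<Rightarrow> bool" where
  "has_weak_gradient \<Omega> f G \<longleftrightarrow> f \<in> L2 \<Omega> \<and> G \<in> L2 \<Omega> \<and>
     (\<forall>\<phi> \<in> test_functions \<Omega>. \<forall>i j.
        (LINT x|lebesgue_on \<Omega>. f x $ i * partial j \<phi> x) =
        - (LINT x|lebesgue_on \<Omega>. G x $ i $ j * (\<phi> x :: real)))"

definition H1 :: "vec3 set \<Rightarrow> vfield set" where
  "H1 \<Omega> = {f. \<exists>G. has_weak_gradient \<Omega> f G}"

text \<open>Unique up to a null set for \<open>f \<in> H1 \<Omega>\<close>.\<close>

definition wgrad :: "vec3 set \<Rightarrow> vfield \<Rightarrow> mfield" where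
  "wgrad \<Omega> f = (SOME G. has_weak_gradient \<Omega> f G)"

definition H1_norm :: "vec3 set \<Rightarrow> vfield \<Rightarrow> real" where
  "H1_norm \<Omega> f = sqrt ((L2_norm \<Omega> f)\<^sup>2 + (L2_norm \<Omega> (wgrad \<Omega> f))\<^sup>2)"

definition H10 :: "vec3 set \<Rightarrow> vfield set" where
  "H10 \<Omega> = {f \<in> H1 \<Omega>. \<exists>\<phi> :: nat \<Rightarrow> vfield.
     (\<forall>n. \<phi> n \<in> test_functions \<Omega>) \<and> (\<lambda>n. H1_norm \<Omega> (\<phi> n - f)) \<longlonglongrightarrow> 0}"

text \<open>Vanishing divergence in the sense of distributions on \<open>\<Omega>\<close>.\<close>

definition div_free :: "vec3 set \<Rightarrow> vfield \<Rightarrow> bool" where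
  "div_free \<Omega> f \<longleftrightarrow>
     (\<forall>\<phi> \<in> test_functions \<Omega>.
        (LINT x|lebesgue_on \<Omega>. (\<Sum>j\<in>UNIV. f x $ j * (partial j \<phi> x :: real))) = 0)"

definition V_space :: "vec3 set \<Rightarrow> vfield set" where
  "V_space \<Omega> = {h \<in> H10 \<Omega>. div_free \<Omega> h}"

definition V_inner :: "vec3 set \<Rightarrow> vfield \<Rightarrow> vfield \<Rightarrow> real" where
  "V_inner \<Omega> f g = L2_inner \<Omega> (wgrad \<Omega> f) (wgrad \<Omega> g)"

definition V_norm :: "vec3 set \<Rightarrow> vfield \<Rightarrow> real" where
  "V_norm \<Omega> f = sqrt (V_inner \<Omega> f f)"

definition H_space :: "vec3 set \<Rightarrow> vfield set" where
  "H_space \<Omega> = {f \<in> L2 \<Omega>. \<exists>v :: nat \<Rightarrow> vfield.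
     (\<forall>n. v n \<in> V_space \<Omega>) \<and> (\<lambda>n. L2_norm \<Omega> (v n - f)) \<longlonglongrightarrow> 0}"


section \<open>Stokes eigenfunctions and the associated scales of spaces\<close>

text \<open>The sequences are indexed from \<open>0\<close>: \<open>lam k\<close> and \<open>w k\<close> stand for \<open>\<lambda>\<^sub>k\<^sub>+\<^sub>1\<close> and \<open>w\<^sub>k\<^sub>+\<^sub>1\<close>.\<close>

definition stokes_eigensystem :: "vec3 set \<Rightarrow> (nat \<Rightarrow> real) \<Rightarrow> (nat \<Rightarrow> vfield) \<Rightarrow> bool" where
  "stokes_eigensystem \<Omega> lam w \<longleftrightarrow>
     0 < lam 0 \<and> mono lam \<and> filterlim lam at_top sequentially \<and>
     (\<forall>k. w k \<in> V_space \<Omega>) \<and>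
     (\<forall>k. \<forall>\<phi> \<in> V_space \<Omega>. V_inner \<Omega> (w k) \<phi> = lam k * L2_inner \<Omega> (w k) \<phi>) \<and>
     (\<forall>k l. L2_inner \<Omega> (w k) (w l) = (if k = l then 1 else 0)) \<and>
     (\<forall>f \<in> H_space \<Omega>.
        (\<lambda>n. L2_norm \<Omega> (\<lambda>x. f x - (\<Sum>k<n. L2_inner \<Omega> f (w k) *\<^sub>R w k x))) \<longlonglongrightarrow> 0)"

definition stokes_eps :: "vec3 set \<Rightarrow> (nat \<Rightarrow> real) \<Rightarrow> (nat \<Rightarrow> vfield) \<Rightarrow> nat \<Rightarrow> mfield" where
  "stokes_eps \<Omega> lam w k = (\<lambda>x. (1 / sqrt (lam k)) *\<^sub>R wgrad \<Omega> (w k) x)"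

definition H_scale :: "vec3 set \<Rightarrow> (nat \<Rightarrow> real) \<Rightarrow> (nat \<Rightarrow> vfield) \<Rightarrow> real \<Rightarrow> vfield set" where
  "H_scale \<Omega> lam w \<theta> =
     {f \<in> H_space \<Omega>. summable (\<lambda>k. lam k powr \<theta> * \<bar>L2_inner \<Omega> f (w k)\<bar>\<^sup>2)}"

definition H_scale_norm ::
    "vec3 set \<Rightarrow> (nat \<Rightarrow> real) \<Rightarrow> (nat \<Rightarrow> vfield) \<Rightarrow> real \<Rightarrow> vfield \<Rightarrow> real" where
  "H_scale_norm \<Omega> lam w \<theta> f = sqrt (\<Sum>k. lam k powr \<theta> * \<bar>L2_inner \<Omega> f (w k)\<bar>\<^sup>2)"

definition orth_complement :: "vec3 set \<Rightarrow> mfield set \<Rightarrow> mfield set" where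
  "orth_complement \<Omega> E = {g \<in> L2 \<Omega>. \<forall>e\<in>E. L2_inner \<Omega> g e = 0}"

text \<open>Orthogonal projection onto a closed subspace \<open>M\<close>, unique up to a null set.\<close>

definition orth_proj :: "vec3 set \<Rightarrow> mfield set \<Rightarrow> mfield \<Rightarrow> mfield" where
  "orth_proj \<Omega> M f = (SOME g. g \<in> M \<and> (\<forall>h\<in>M. L2_inner \<Omega> (f - g) h = 0))"

text \<open>The orthogonal complement of a set is that of its span.\<close>

definition Pi_proj :: "vec3 set \<Rightarrow> (nat \<Rightarrow> real) \<Rightarrow> (nat \<Rightarrow> vfield) \<Rightarrow> mfield \<Rightarrow> mfield" where
  "Pi_proj \<Omega> lam w = orth_proj \<Omega> (orth_complement \<Omega> (range (stokes_eps \<Omega> lam w)))"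

definition D_scale :: "vec3 set \<Rightarrow> (nat \<Rightarrow> real) \<Rightarrow> (nat \<Rightarrow> vfield) \<Rightarrow> real \<Rightarrow> mfield set" where
  "D_scale \<Omega> lam w \<theta> =
     {f \<in> L2 \<Omega>. summable (\<lambda>k. lam k powr \<theta> * \<bar>L2_inner \<Omega> f (stokes_eps \<Omega> lam w k)\<bar>\<^sup>2)}"

definition D_scale_norm ::
    "vec3 set \<Rightarrow> (nat \<Rightarrow> real) \<Rightarrow> (nat \<Rightarrow> vfield) \<Rightarrow> real \<Rightarrow> mfield \<Rightarrow> real" where
  "D_scale_norm \<Omega> lam w \<theta> f =
     sqrt ((\<Sum>k. lam k powr \<theta> * \<bar>L2_inner \<Omega> f (stokes_eps \<Omega> lam w k)\<bar>\<^sup>2)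
           + (L2_norm \<Omega> (Pi_proj \<Omega> lam w f))\<^sup>2)"


section \<open>Functions of time with values in a normed space\<close>

text \<open>A space of fields is given by a set \<open>X\<close> of representatives and a norm \<open>N\<close>.\<close>

definition continuous_into ::
    "real set \<Rightarrow> 'f::minus set \<Rightarrow> ('f \<Rightarrow> real) \<Rightarrow> (real \<Rightarrow> 'f) \<Rightarrow> bool" where
  "continuous_into I X N f \<longleftrightarrow>
     (\<forall>t\<in>I. f t \<in> X \<and> ((\<lambda>s. N (f s - f t)) \<longlongrightarrow> 0) (at t within I))"

text \<open>Bochner measurability: an almost everywhere limit of simple functions.\<close>

definition strongly_measurable ::
    "real measure \<Rightarrow> 'f::minus set \<Rightarrow> ('f \<Rightarrow> real) \<Rightarrow> (real \<Rightarrow> 'f) \<Rightarrow> bool" where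
  "strongly_measurable M X N f \<longleftrightarrow>
     (AE t in M. f t \<in> X) \<and>
     (\<exists>s. (\<forall>n::nat. simple_function M (s n) \<and> s n ` space M \<subseteq> X) \<and>
          (AE t in M. (\<lambda>n. N (s n t - f t)) \<longlonglongrightarrow> 0))"

definition Lp_loc ::
    "real \<Rightarrow> 'f::minus set \<Rightarrow> ('f \<Rightarrow> real) \<Rightarrow> (real \<Rightarrow> 'f) \<Rightarrow> bool" where
  "Lp_loc p X N f \<longleftrightarrow>
     (\<forall>T>0. strongly_measurable (lebesgue_on {0..T}) X N f \<and>
            integrable (lebesgue_on {0..T}) (\<lambda>t. N (f t) powr p))"


section \<open>The weak problem\<close>

definition momentum_equation ::
    "vec3 set \<Rightarrow> vfield \<Rightarrow> (real \<Rightarrow> vfield) \<Rightarrow> (real \<Rightarrow> mfield) \<Rightarrow> vfield \<Rightarrow> (real \<Rightarrow> real) \<Rightarrow> bool" where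
  "momentum_equation \<Omega> u0 u S \<theta> \<psi> \<longleftrightarrow>
     \<psi> 0 * (LINT x|lebesgue_on \<Omega>. u0 x \<bullet> \<theta> x)
     + (LINT t:{0..}|lebesgue. (LINT x|lebesgue_on \<Omega>. (u t x \<bullet> \<theta> x) * time_deriv \<psi> t))
     = (LINT t:{0..}|lebesgue. (LINT x|lebesgue_on \<Omega>. (S t x \<bullet> wgrad \<Omega> \<theta> x) * \<psi> t))"

definition constitutive_equation ::
    "vec3 set \<Rightarrow> real \<Rightarrow> real \<Rightarrow> mfield \<Rightarrow> (real \<Rightarrow> vfield) \<Rightarrow> (real \<Rightarrow> mfield)
      \<Rightarrow> vfield \<Rightarrow> (real \<Rightarrow> real) \<Rightarrow> 3 \<Rightarrow> bool" where
  "constitutive_equation \<Omega> \<alpha> \<beta> S0 u S a \<psi> i \<longleftrightarrow>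
     - (LINT \<tau>:{0..}|lebesgue. (LINT x|lebesgue_on \<Omega>.
          \<psi> \<tau> / (Gamma (1 - \<alpha>) * \<tau> powr \<alpha>) * (\<Sum>j\<in>UNIV. S0 x $ i $ j * a x $ j)))
     - (LINT \<tau>:{0..}|lebesgue. (LINT t:{\<tau>..}|lebesgue. (LINT x|lebesgue_on \<Omega>.
          time_deriv \<psi> t / (Gamma (1 - \<alpha>) * \<tau> powr \<alpha>)
            * (\<Sum>j\<in>UNIV. S (t - \<tau>) x $ i $ j * a x $ j))))
     + (LINT t:{0..}|lebesgue. (LINT x|lebesgue_on \<Omega>.
          (\<Sum>j\<in>UNIV. S t x $ i $ j * a x $ j) * \<psi> t))
     = - (1 / Gamma (1 - \<beta>)) *
       (LINT t:{0..}|lebesgue. (LINT \<tau>:{0..t}|lebesgue. (LINT x|lebesgue_on \<Omega>.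
          \<psi> t / (t - \<tau>) powr \<beta> *
            ((\<Sum>j\<in>UNIV. partial j a x $ j) * u \<tau> x $ i
             + (\<Sum>j\<in>UNIV. u \<tau> x $ j * partial i a x $ j)))))"

text \<open>
  The regularity required of \<open>u\<close> and \<open>S\<close> makes all the integrals in the two equations absolutely
  convergent. The value \<open>S 0\<close> is immaterial here.
\<close>

definition weak_solution ::
    "vec3 set \<Rightarrow> real \<Rightarrow> real \<Rightarrow> vfield \<Rightarrow> mfield \<Rightarrow> (real \<Rightarrow> vfield) \<Rightarrow> (real \<Rightarrow> mfield) \<Rightarrow> bool" where
  "weak_solution \<Omega> \<alpha> \<beta> u0 S0 u S \<longleftrightarrow>
     continuous_into {0..} (L2 \<Omega>) (L2_norm \<Omega>) u \<and>
     Lp_loc 1 (H10 \<Omega>) (H1_norm \<Omega>) u \<and>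
     (\<forall>t\<ge>0. div_free \<Omega> (u t)) \<and>
     continuous_into {0<..} (L2 \<Omega>) (L2_norm \<Omega>) S \<and>
     Lp_loc 1 (L2 \<Omega>) (L2_norm \<Omega>) S \<and>
     (\<forall>\<theta> \<in> V_space \<Omega>. \<forall>\<psi> \<in> time_test_functions. momentum_equation \<Omega> u0 u S \<theta> \<psi>) \<and>
     (\<forall>a \<in> test_functions \<Omega>. \<forall>\<psi> \<in> time_test_functions. \<forall>i.
        constitutive_equation \<Omega> \<alpha> \<beta> S0 u S a \<psi> i)"

end

theory Submission
  imports Defs "HOL-Complex_Analysis.Complex_Analysis"
begin

text \<open>
  Along the Stokes eigenfunctions the system decouples. The coefficients of \<open>u\<close> on \<open>w\<^sub>k\<close> and of
  \<open>S\<close> on \<open>\<epsilon>\<^sub>k\<close> satisfy a scalar system with parameter \<open>\<lambda> = \<lambda>\<^sub>k\<close>, whose Laplace symbol is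
  \<open>z\<^sup>a + z\<^sup>b + \<lambda>\<close> with \<open>a = 2 - \<delta>\<close> and \<open>b = 2 - \<beta>\<close>. Since \<open>a < 2\<close>, this symbol has no zero in a sector
  slightly larger than the right half plane, and it is comparable there to its value at \<open>\<bar>z\<bar>\<close>.
  Inverting the Laplace transform along the boundary rays of such a sector gives the scalar
  solutions, with bounds uniform in \<open>\<lambda>\<close> for the weights \<open>\<lambda>\<^bsup>\<omega>/2\<^esup>\<bar>u\<bar>\<close> and \<open>\<bar>s\<bar>\<close>, and with the smoothing
  estimate \<open>\<surd>\<lambda> \<bar>u(t)\<bar> \<le> C t\<^bsup>-a/2\<^esup> (1 + t)\<close>.

  The component of \<open>S\<close> orthogonal to all \<open>\<epsilon>\<^sub>k\<close> has two parts. The projection of \<open>S\<^sub>0\<close> relaxes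
  through the scalar solution \<open>R\<close> with \<open>\<lambda> = 0\<close>. The symmetric gradient moreover excites the
  transposes of the \<open>\<epsilon>\<^sub>k\<close>, which are orthogonal to all gradients of fields in \<open>V\<close> and hence do not enter
  the momentum equation; by linearity their coefficients are \<open>s\<^sub>k - R s\<^sub>k(0)\<close>.
\<close>


section \<open>Laplace transforms\<close>

text \<open>No differential or fractional operator is ever inverted in the time domain. Each scalar
  identity is an algebraic identity between transforms on \<open>z \<ge> 1\<close>, carried back to
  \<open>t > 0\<close> by uniqueness of the transform; the contour integrals serve only to estimate
  the functions so identified. The weights come from scaling. Where \<open>z\<close> has size
  \<open>lam powr (1 / a)\<close>, the terms \<open>z powr a\<close> and \<open>lam\<close> balance,
  so the initial velocity enters the stress with size
  \<open>sqrt lam * lam powr (1 / a - 1) = lam powr (1 / a - 1 / 2)\<close>. The exponent is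
  \<omega> / 2, which is why the velocity needs \<omega> more orders on the spectral scale than the
  stress. The term \<open>z powr b\<close> breaks the scaling, and there the positive lower bound
  \<open>lam 0\<close> of the eigenvalues enters. The range of \<open>p\<close> is that in which
  \<open>t powr (- (a / 2))\<close> lies in \<open>L^p\<close> near zero. The passage to fields uses
  finite eigenfunction sums, for which the equations are linear combinations of scalar ones. The
  constitutive equation is first integrated in time, so that only convolutions of continuous
  functions with locally integrable kernels remain, and these survive pointwise bounded
  limits.\<close>

text \<open>Under \<open>x = exp (- t)\<close> the hypothesis says that all moments on \<open>[0, 1]\<close> vanish.\<close>

lemma laplace_zero_imp_zero:
  fixes f :: "real \<Rightarrow> real"
  assumes int: "set_integrable lborel {0<..} (\<lambda>t. exp (- t) * f t)"
    and zero: "\<And>n::nat. (LINT t:{0<..}|lborel. exp (- ((real n + 1) * t)) * f t) = 0"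
    and cont: "continuous_on {0<..} f" and t: "t > 0"
  shows "f t = 0"
proof (rule ccontr)
  assume ft: "f t \<noteq> 0"
  \<comment> \<open>The factor \<open>exp (- s)\<close> is the Jacobian of
    \<open>x = exp (- s)\<close>, so integrals against \<open>g\<close> are integrals over the unit
    interval against the transported \<open>f\<close>.\<close>
  define g where "g s = indicator {0<..} s * (exp (- s) * f s)" for s :: real
  have g_int: "integrable lborel g"
    using int unfolding set_integrable_def g_def[abs_def] by simp
  then have gm [measurable]: "g \<in> borel_measurable borel" by simp
  have pow: "(\<integral>s. exp (- s) ^ n * g s \<partial>lborel) = 0" for n
  proof -
    have "(\<integral>s. exp (- s) ^ n * g s \<partial>lborel) = (LINT t:{0<..}|lborel. exp (- ((real n + 1) * t)) * f t)"
      unfolding set_lebesgue_integral_def g_def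
      by (intro Bochner_Integration.integral_cong)
        (auto simp: indicator_def exp_of_nat_mult[symmetric] mult_exp_exp[symmetric] algebra_simps
          simp flip: exp_add)
    then show ?thesis using zero by simp
  qed
  have bnd_int: "integrable lborel (\<lambda>s. h (exp (- s)) * g s)"
    if h: "continuous_on {0..1} h" for h :: "real \<Rightarrow> real"
  proof -
    \<comment> \<open>Only values of \<open>h\<close> on the unit interval matter, because
      \<open>g\<close> vanishes for \<open>s \<le> 0\<close>; clamping the argument gives a
      continuous, hence measurable, function on the whole line.\<close>
    define h' where "h' x = h (max 0 (min 1 x))" for x
    have h'c: "continuous_on UNIV h'"
      unfolding h'_def by (rule continuous_on_compose2[OF h]) (auto intro!: continuous_intros)
    have hm [measurable]: "h' \<in> borel_measurable borel"
      using h'c by (rule borel_measurable_continuous_onI)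
    have eq: "h (exp (- s)) * g s = h' (exp (- s)) * g s" for s
      by (auto simp: g_def h'_def indicator_def min_def max_def)
    obtain B where B: "\<And>x. x \<in> {0..1} \<Longrightarrow> norm (h x) \<le> B"
      using compact_imp_bounded[OF compact_continuous_image[OF h compact_Icc]]
      by (force simp: bounded_iff)
    have B': "norm (h' x) \<le> B" for x unfolding h'_def by (rule B) auto
    show ?thesis unfolding eq
    proof (rule Bochner_Integration.integrable_bound)
      show "integrable lborel (\<lambda>s. B * g s)" using g_int by simp
      show "AE s in lborel. norm (h' (exp (- s)) * g s) \<le> norm (B * g s)"
        unfolding norm_mult by (intro AE_I2 mult_right_mono order_trans[OF B']) auto
    qed measurable
  qed
  have poly0: "(\<integral>s. p (exp (- s)) * g s \<partial>lborel) = 0" if "real_polynomial_function p" for p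
  proof -
    obtain c n where p: "p = (\<lambda>x. \<Sum>i\<le>n. c i * x ^ i)"
      using \<open>real_polynomial_function p\<close> by (auto simp: real_polynomial_function_iff_sum)
    have "(\<integral>s. p (exp (- s)) * g s \<partial>lborel) = (\<integral>s. (\<Sum>i\<le>n. c i * (exp (- s) ^ i * g s)) \<partial>lborel)"
      by (simp add: p sum_distrib_right mult.assoc)
    also have "\<dots> = (\<Sum>i\<le>n. c i * (\<integral>s. exp (- s) ^ i * g s \<partial>lborel))"
      by (subst Bochner_Integration.integral_sum)
        (auto intro!: integrable_mult_right bnd_int[of "\<lambda>x. x ^ _"] continuous_intros)
    finally show ?thesis by (simp add: pow)
  qed
  have cont0: "(\<integral>s. h (exp (- s)) * g s \<partial>lborel) = 0"
    if h: "continuous_on {0..1} h" for h :: "real \<Rightarrow> real"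
  proof (rule ccontr)
    assume ne: "(\<integral>s. h (exp (- s)) * g s \<partial>lborel) \<noteq> 0" (is "?I \<noteq> 0")
    define M where "M = (\<integral>s. \<bar>g s\<bar> \<partial>lborel)"
    have M0: "M \<ge> 0" by (simp add: M_def)
    \<comment> \<open>The error made by the approximating polynomial is at most
      \<open>e * M\<close>, which is to stay below half of the supposedly nonzero integral; the
      \<open>+ 1\<close> covers \<open>M = 0\<close>.\<close>
    define e where "e = \<bar>?I\<bar> / (2 * (M + 1))"
    have e: "e > 0" using ne M0 by (simp add: e_def)
    obtain p where p: "real_polynomial_function p" "\<And>x. x \<in> {0..1} \<Longrightarrow> \<bar>h x - p x\<bar> < e"
      using Stone_Weierstrass_real_polynomial_function[OF compact_Icc h e] by auto
    have pc: "continuous_on {0..1} p"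
      using p(1) continuous_on_polymonial_function real_polynomial_function_eq by blast
    have "?I = (\<integral>s. h (exp (- s)) * g s \<partial>lborel) - (\<integral>s. p (exp (- s)) * g s \<partial>lborel)"
      using poly0[OF p(1)] by simp
    also have "\<dots> = (\<integral>s. (h (exp (- s)) - p (exp (- s))) * g s \<partial>lborel)"
      by (subst Bochner_Integration.integral_diff[symmetric])
        (auto intro!: bnd_int h pc simp: left_diff_distrib)
    also have "\<bar>\<dots>\<bar> \<le> (\<integral>s. e * \<bar>g s\<bar> \<partial>lborel)"
    proof (rule order_trans[OF integral_abs_bound], rule integral_mono)
      show "integrable lborel (\<lambda>s. \<bar>(h (exp (- s)) - p (exp (- s))) * g s\<bar>)"
        by (intro integrable_abs bnd_int[of "\<lambda>x. h x - p x"] continuous_intros h pc)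
      show "integrable lborel (\<lambda>s. e * \<bar>g s\<bar>)" using g_int by simp
      show "\<bar>(h (exp (- s)) - p (exp (- s))) * g s\<bar> \<le> e * \<bar>g s\<bar>" for s
        using p(2)[of "exp (-s)"] by (cases "s > 0") (auto simp: abs_mult g_def intro!: mult_right_mono)
    qed
    also have "\<dots> = e * M" by (simp add: M_def)
    also have "\<dots> = \<bar>?I\<bar> * (M / (2 * (M + 1)))" by (simp add: e_def)
    also have "\<dots> \<le> \<bar>?I\<bar> * (1/2)" using M0 by (intro mult_left_mono) (auto simp: field_simps)
    finally show False using ne by simp
  qed
  have tl: "((\<lambda>s. f s * f t) \<longlongrightarrow> f t * f t) (at t)"
    using cont t by (intro tendsto_intros) (auto simp: continuous_on_eq_continuous_at isCont_def)
  have "\<forall>\<^sub>F s in at t. f s * f t > 0"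
    by (rule order_tendstoD(1)[OF tl]) (use ft in \<open>auto simp: zero_less_mult_iff\<close>)
  then obtain d0 where d0: "d0 > 0" "\<And>s. s \<noteq> t \<Longrightarrow> dist s t < d0 \<Longrightarrow> f s * f t > 0"
    by (auto simp: eventually_at)
  define d where "d = min d0 t"
  have d: "d > 0" "d \<le> t" using d0 t by (auto simp: d_def)
  have pos: "f s * f t > 0" if "t - d < s" "s < t + d" for s
    using d0(2)[of s] that ft by (cases "s = t") (auto simp: d_def dist_real_def zero_less_mult_iff)
  \<comment> \<open>A tent in the variable \<open>exp (- s)\<close>, positive exactly for
    \<open>t - d < s < t + d\<close>, where \<open>f\<close> keeps the sign of \<open>f t\<close>.
    Multiplied by \<open>f t\<close> the integrand is nonnegative, so its zero integral contradicts
    positivity on an interval.\<close>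
  define h where "h y = max 0 (min (y - exp (-(t+d))) (exp (-(t-d)) - y))" for y
  have hc: "continuous_on {0..1} h" unfolding h_def by (intro continuous_intros)
  have hpos: "h (exp (-s)) > 0 \<longleftrightarrow> t - d < s \<and> s < t + d" for s
    by (auto simp: h_def less_max_iff_disj)
  have hge: "h y \<ge> 0" for y by (simp add: h_def)
  have nn: "h (exp (- s)) * g s * f t \<ge> 0" for s
  proof (cases "h (exp (-s)) > 0")
    case True
    then have "f s * f t > 0" using pos[of s] hpos[of s] by simp
    moreover have "h (exp (- s)) * g s * f t = (h (exp (- s)) * indicator {0<..} s * exp (- s)) * (f s * f t)"
      by (simp add: g_def)
    moreover have "h (exp (- s)) * indicator {0<..} s * exp (- s) \<ge> 0" using hge by simp
    ultimately show ?thesis by (metis mult_nonneg_nonneg less_imp_le)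
  next
    case False
    then have "h (exp (-s)) = 0" using hge[of "exp (-s)"] by auto
    then show ?thesis by simp
  qed
  have "(\<integral>s. h (exp (- s)) * g s * f t \<partial>lborel) = 0" using cont0[OF hc] by simp
  moreover have "integrable lborel (\<lambda>s. h (exp (- s)) * g s * f t)" using bnd_int[OF hc] by simp
  ultimately have ae: "AE s in lborel. h (exp (- s)) * g s * f t = 0"
    using integral_nonneg_eq_0_iff_AE[of lborel "\<lambda>s. h (exp (- s)) * g s * f t"] nn by auto
  have "h (exp (- s)) * g s * f t \<noteq> 0" if "s \<in> {t-d<..<t+d}" for s
    using that pos[of s] hpos[of s] d by (auto simp: g_def)
  with ae have "AE s in lborel. s \<notin> {t-d<..<t+d}" by (auto elim!: eventually_mono)
  then have "emeasure lborel {t-d<..<t+d} = 0"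
    by (subst (asm) AE_iff_measurable[of "{t-d<..<t+d}"]) auto
  then show False using d by simp
qed

text \<open>The real half-line \<open>z \<ge> 1\<close> already determines a continuous function on
  \<open>t > 0\<close>. Integrability is part of the notion because uniqueness, sums and Fubini's
  theorem for convolutions all need it, and because it yields local integrability.\<close>

definition has_laplace :: "(real \<Rightarrow> real) \<Rightarrow> (real \<Rightarrow> real) \<Rightarrow> bool" where
  "has_laplace f F \<longleftrightarrow> (\<forall>z\<ge>1. set_integrable lborel {0<..} (\<lambda>t. exp (- (z * t)) * f t) \<and>
     (LINT t:{0<..}|lborel. exp (- (z * t)) * f t) = F z)"

text \<open>The values at positive integers suffice. Continuity of both functions turns equality of
  transforms into equality at every \<open>t > 0\<close>; the value at zero remains
  undetermined.\<close>

lemma has_laplace_unique: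
  assumes f: "has_laplace f F" and g: "has_laplace g G" and eq: "\<And>z. z \<ge> 1 \<Longrightarrow> F z = G z"
    and c: "continuous_on {0<..} f" "continuous_on {0<..} g" and t: "t > 0"
  shows "f t = g t"
proof -
  have "f t - g t = 0"
  proof (rule laplace_zero_imp_zero[where f="\<lambda>t. f t - g t", OF _ _ _ t])
    show "set_integrable lborel {0<..} (\<lambda>t. exp (- t) * (f t - g t))"
    proof -
      have "set_integrable lborel {0<..} (\<lambda>t. exp (- (1 * t)) * f t)" "set_integrable lborel {0<..} (\<lambda>t. exp (- (1 * t)) * g t)"
        using f g unfolding has_laplace_def by blast+
      from set_integral_diff(1)[OF this] show ?thesis by (simp add: right_diff_distrib)
    qed
    show "(LINT t:{0<..}|lborel. exp (- ((real n + 1) * t)) * (f t - g t)) = 0" for n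
    proof -
      have "(LINT t:{0<..}|lborel. exp (- ((real n + 1) * t)) * (f t - g t)) =
        (LINT t:{0<..}|lborel. exp (- ((real n + 1) * t)) * f t) - (LINT t:{0<..}|lborel. exp (- ((real n + 1) * t)) * g t)"
        unfolding right_diff_distrib
        by (rule set_integral_diff) (use f g in \<open>auto simp: has_laplace_def\<close>)
      then show ?thesis using f g eq by (auto simp: has_laplace_def)
    qed
    show "continuous_on {0<..} (\<lambda>t. f t - g t)" by (intro continuous_intros c)
  qed
  then show ?thesis by simp
qed

section \<open>Sums, powers and convolutions of transforms\<close>

lemma has_laplace_add:
  assumes "has_laplace f F" "has_laplace g G"
  shows "has_laplace (\<lambda>t. f t + g t) (\<lambda>z. F z + G z)"
  using assms unfolding has_laplace_def by (auto simp: distrib_left set_integral_add)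

lemma has_laplace_cmult:
  assumes "has_laplace f F"
  shows "has_laplace (\<lambda>t. c * f t) (\<lambda>z. c * F z)"
proof -
  have e: "exp (- (z * t)) * (c * f t) = c * (exp (- (z * t)) * f t)" for z t by simp
  show ?thesis using assms unfolding has_laplace_def e by auto
qed

lemma has_laplace_cong:
  assumes "has_laplace f F" "\<And>z. z \<ge> 1 \<Longrightarrow> F z = G z" "\<And>t. t > 0 \<Longrightarrow> f t = g t"
  shows "has_laplace g G"
proof -
  have "set_integrable lborel {0<..} (\<lambda>t. exp (- (z * t)) * g t) = set_integrable lborel {0<..} (\<lambda>t. exp (- (z * t)) * f t)"
    "(LINT t:{0<..}|lborel. exp (- (z * t)) * g t) = (LINT t:{0<..}|lborel. exp (- (z * t)) * f t)" for z
    by (rule set_integrable_cong, simp_all add: assms(3)) (rule set_lebesgue_integral_cong, simp_all add: assms(3))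
  then show ?thesis using assms(1,2) unfolding has_laplace_def by simp
qed

text \<open>Euler's integral for \<open>Gamma p\<close>, rescaled by the factor
  \<open>z\<close>.\<close>

lemma has_laplace_power:
  assumes p: "p > 0"
  shows "has_laplace (\<lambda>t. t powr (p - 1) / Gamma p) (\<lambda>z. z powr (- p))"
  unfolding has_laplace_def
proof (intro allI impI)
  fix z :: real assume z: "z \<ge> 1"
  define q where "q t = indicator {0<..} t * (t powr (p - 1) / exp t)" for t :: real
  have qm [measurable]: "q \<in> borel_measurable borel" unfolding q_def by measurable
  have "((\<lambda>t. t powr (p - 1) / exp t) has_integral Gamma p) {0..}"
    by (rule Gamma_integral_real[OF p])
  then have "((\<lambda>t. if t \<in> {0..} then t powr (p - 1) / exp t else 0) has_integral Gamma p) UNIV"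
    by (subst has_integral_restrict_UNIV)
  then have qI: "(q has_integral Gamma p) UNIV"
    by (rule has_integral_spike[where S="{0}", rotated 2]) (auto simp: q_def indicator_def)
  have q: "has_bochner_integral lborel q (Gamma p)"
    by (rule has_bochner_integral_nn_integral[OF _ _ _ nn_integral_has_integral_lborel[OF qm _ qI]])
      (use p in \<open>auto simp: q_def Gamma_real_pos less_imp_le\<close>)
  have "has_bochner_integral lborel (\<lambda>x. q (0 + z * x)) (Gamma p /\<^sub>R \<bar>z\<bar>)"
    by (subst lborel_has_bochner_integral_real_affine_iff[symmetric]) (use q z in auto)
  then have "has_bochner_integral lborel (\<lambda>x. (z powr (1 - p) / Gamma p) * q (0 + z * x)) ((z powr (1 - p) / Gamma p) * (Gamma p /\<^sub>R \<bar>z\<bar>))"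
    by (rule has_bochner_integral_mult_right)
  also have "(\<lambda>x. (z powr (1 - p) / Gamma p) * q (0 + z * x)) = (\<lambda>t. indicator {0<..} t *\<^sub>R (exp (- (z * t)) * (t powr (p - 1) / Gamma p)))"
    using z by (auto simp: q_def indicator_def fun_eq_iff powr_mult exp_minus field_simps zero_less_mult_iff
        powr_add[symmetric] powr_diff)
  also have "(z powr (1 - p) / Gamma p) * (Gamma p /\<^sub>R \<bar>z\<bar>) = z powr (- p)"
    using z Gamma_real_pos[OF p] by (simp add: powr_diff powr_minus field_simps)
  finally show "set_integrable lborel {0<..} (\<lambda>t. exp (- (z * t)) * (t powr (p - 1) / Gamma p)) \<and>
         (LINT t:{0<..}|lborel. exp (- (z * t)) * (t powr (p - 1) / Gamma p)) = z powr - p"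
    unfolding set_integrable_def set_lebesgue_integral_def
    by (auto simp: has_bochner_integral_iff)
qed

text \<open>The order of the factors matters below: the first is the continuous one, the second may
  have an integrable singularity at zero. Only values on the open interval from \<open>0\<close> to
  \<open>t\<close> enter.\<close>

definition conv :: "(real \<Rightarrow> real) \<Rightarrow> (real \<Rightarrow> real) \<Rightarrow> real \<Rightarrow> real" where
  "conv f g t = (LINT s:{0<..<t}|lborel. f (t - s) * g s)"

text \<open>The weight \<open>exp (- (z * t))\<close> splits as a product over \<open>t - s\<close>
  and \<open>s\<close>. Absorbed into the two factors it leaves a plain convolution on the line, to
  which Fubini's theorem and translation invariance apply.\<close>

lemma has_laplace_conv:
  assumes f: "has_laplace f F" and g: "has_laplace g G"
  shows "has_laplace (conv f g) (\<lambda>z. F z * G z)"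
  unfolding has_laplace_def
proof (intro allI impI)
  fix z :: real assume z: "z \<ge> 1"
  define f0 where "f0 t = indicator {0<..} t * (exp (- (z * t)) * f t)" for t :: real
  define g0 where "g0 t = indicator {0<..} t * (exp (- (z * t)) * g t)" for t :: real
  have f0: "integrable lborel f0" "(\<integral>t. f0 t \<partial>lborel) = F z"
    and g0: "integrable lborel g0" "(\<integral>t. g0 t \<partial>lborel) = G z"
    using f g z unfolding has_laplace_def set_integrable_def set_lebesgue_integral_def f0_def[abs_def] g0_def[abs_def]
    by simp_all
  have [measurable]: "f0 \<in> borel_measurable borel" "g0 \<in> borel_measurable borel"
    using f0(1) g0(1) by auto
  define H where "H = (\<lambda>(s, t). f0 (t - s) * g0 s)"
  have Hm [measurable]: "H \<in> borel_measurable (lborel \<Otimes>\<^sub>M lborel)" unfolding H_def by measurable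
  have sh: "integrable lborel (\<lambda>t. f0 (t - s))" for s
    using lborel_integrable_real_affine[OF f0(1), of 1 "- s"] by simp
  have shI: "(\<integral>t. h (t - s) \<partial>lborel) = (\<integral>t. h t \<partial>lborel)" for s and h :: "real \<Rightarrow> real"
    using lborel_integral_real_affine[of 1 h "- s"] by simp
  have Hi: "integrable (lborel \<Otimes>\<^sub>M lborel) H"
  proof (rule lborel_pair.Fubini_integrable)
    show "integrable lborel (\<lambda>s. \<integral>t. norm (H (s, t)) \<partial>lborel)"
      unfolding H_def using g0(1) by (simp add: abs_mult shI[of "\<lambda>t. \<bar>f0 t\<bar>"])
    show "AE s in lborel. integrable lborel (\<lambda>t. H (s, t))"
      unfolding H_def using sh by simp
  qed measurable
  then have Hi': "integrable (lborel \<Otimes>\<^sub>M lborel) (case_prod (\<lambda>s t. H (s, t)))" by simp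
  have e: "(\<integral>s. H (s, t) \<partial>lborel) = indicator {0<..} t *\<^sub>R (exp (- (z * t)) * conv f g t)" for t
  proof (cases "t > 0")
    case True
    have "(\<integral>s. H (s, t) \<partial>lborel) = (\<integral>s. exp (- (z * t)) * (indicator {0<..<t} s *\<^sub>R (f (t - s) * g s)) \<partial>lborel)"
      by (intro Bochner_Integration.integral_cong)
        (auto simp: H_def f0_def g0_def indicator_def right_diff_distrib simp flip: exp_add)
    also have "\<dots> = exp (- (z * t)) * conv f g t" by (simp add: conv_def set_lebesgue_integral_def)
    finally show ?thesis using True by simp
  next
    case False
    have "H (s, t) = 0" for s using False by (auto simp: H_def f0_def g0_def indicator_def)
    then show ?thesis using False by simp
  qed
  have "integrable lborel (\<lambda>t. \<integral>s. H (s, t) \<partial>lborel)"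
    by (rule lborel_pair.integrable_snd[OF Hi'])
  moreover have "(\<integral>t. \<integral>s. H (s, t) \<partial>lborel \<partial>lborel) = (\<integral>s. \<integral>t. H (s, t) \<partial>lborel \<partial>lborel)"
    by (rule lborel_pair.Fubini_integral[OF Hi'])
  moreover have "(\<integral>s. \<integral>t. H (s, t) \<partial>lborel \<partial>lborel) = F z * G z"
    by (simp add: H_def shI f0 g0)
  ultimately show "set_integrable lborel {0<..} (\<lambda>t. exp (- (z * t)) * conv f g t) \<and>
         (LINT t:{0<..}|lborel. exp (- (z * t)) * conv f g t) = F z * G z"
    by (simp add: e set_integrable_def set_lebesgue_integral_def)
qed


section \<open>Inversion along the boundary rays of a sector\<close>

lemma integrable_exp_atLeast:
  fixes p :: real assumes p: "p > 0"
  shows "set_integrable lborel {0..} (\<lambda>x. exp (- (p * x)))"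
proof -
  have "((\<lambda>x::real. exp (-p*x)) has_integral exp (-p*0)/p) {0..}"
    by (rule has_integral_exp_minus_to_infinity[OF p])
  then have "((\<lambda>x. if x \<in> {0..} then exp (-p*x) else 0) has_integral exp (-p*0)/p) UNIV"
    by (subst has_integral_restrict_UNIV)
  then have h: "((\<lambda>x. indicator {0..} x * exp (- (p * x))) has_integral 1/p) UNIV"
    by (rule has_integral_eq[rotated, of _ _ UNIV "\<lambda>x. indicator {0..} x * exp (- (p * x))", THEN has_integral_eq_rhs]) (auto simp: indicator_def)
  have "has_bochner_integral lborel (\<lambda>x. indicator {0..} x * exp (- (p * x))) (1/p)"
    by (rule has_bochner_integral_nn_integral[OF _ _ _ nn_integral_has_integral_lborel[OF _ _ h]])
      (use p in auto)
  then show ?thesis by (simp add: set_integrable_def has_bochner_integral_iff)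
qed

lemma integrable_exp_abs:
  fixes p :: real assumes p: "p > 0"
  shows "integrable lborel (\<lambda>x. exp (- (p * \<bar>x\<bar>)))"
proof -
  have 1: "integrable lborel (\<lambda>x. indicator {0..} x * exp (- (p * x)))"
    using integrable_exp_atLeast[OF p] by (simp add: set_integrable_def)
  have 2: "integrable lborel (\<lambda>x. indicator {..0} x * exp (p * x))"
    using lborel_integrable_real_affine[OF 1, of "-1" 0]
    by (rule Bochner_Integration.integrable_cong[THEN iffD1, rotated -1]) (auto simp: indicator_def)
  show ?thesis
    by (rule Bochner_Integration.integrable_bound[OF Bochner_Integration.integrable_add[OF 1 2]])
      (auto simp: indicator_def abs_if)
qed

text \<open>The growing exponential controls the left end and the decaying one the right end. In the
  variable \<open>x = ln r\<close> these are the power bounds at zero and at infinity that make a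
  contour integral along a ray converge.\<close>

lemma integrable_two_sided_exp:
  fixes f :: "real \<Rightarrow> 'a :: {banach, second_countable_topology}"
  assumes [measurable]: "f \<in> borel_measurable borel" and p: "p > 0" "q < 0"
    and b: "\<And>x. norm (f x) \<le> C * exp (p * x)" "\<And>x. norm (f x) \<le> D * exp (q * x)"
  shows "integrable lborel f"
proof -
  have C: "C \<ge> 0" "D \<ge> 0" using b(1)[of 0] b(2)[of 0] norm_ge_zero[of "f 0"] by (simp_all, linarith+)
  define m where "m = min p (- q)"
  have m: "m > 0" using p by (simp add: m_def)
  show ?thesis
  proof (rule Bochner_Integration.integrable_bound)
    show "integrable lborel (\<lambda>x. (C + D) * exp (- (m * \<bar>x\<bar>)))"
      using integrable_exp_abs[OF m] by simp
    have "norm (f x) \<le> (C + D) * exp (- (m * \<bar>x\<bar>))" for x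
    proof (cases "x \<ge> 0")
      case True
      have "m * x \<le> (- q) * x" using True by (intro mult_right_mono) (auto simp: m_def)
      then have "q * x \<le> - (m * \<bar>x\<bar>)" using True by simp
      then have "D * exp (q * x) \<le> D * exp (- (m * \<bar>x\<bar>))" using C by (intro mult_left_mono) auto
      also have "\<dots> \<le> (C + D) * exp (- (m * \<bar>x\<bar>))" using C by (intro mult_right_mono) auto
      finally show ?thesis using b(2)[of x] by linarith
    next
      case False
      have "m * (- x) \<le> p * (- x)" using False by (intro mult_right_mono) (auto simp: m_def)
      then have "p * x \<le> - (m * \<bar>x\<bar>)" using False by (simp add: abs_if)
      then have "C * exp (p * x) \<le> C * exp (- (m * \<bar>x\<bar>))" using C by (intro mult_left_mono) auto
      also have "\<dots> \<le> (C + D) * exp (- (m * \<bar>x\<bar>))" using C by (intro mult_right_mono) auto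
      finally show ?thesis using b(1)[of x] by linarith
    qed
    then show "AE x in lborel. norm (f x) \<le> norm ((C + D) * exp (- (m * \<bar>x\<bar>)))"
      using C by auto
  qed simp
qed

text \<open>A vertical shift moves the path to the real axis, where path integrals are ordinary
  integrals.\<close>

lemma contour_integral_linepath_horizontal:
  assumes "l < r"
  shows "contour_integral (linepath (Complex l y) (Complex r y)) f = integral {l..r} (\<lambda>x. f (Complex x y))"
proof -
  have e: "linepath (Complex l y) (Complex r y) x = linepath (of_real l) (of_real r) x + Complex 0 y" for x
    by (auto simp: linepath_def complex_eq_iff algebra_simps)
  have d: "Complex r y - Complex l y = of_real r - of_real l" by (simp add: complex_eq_iff)
  have "contour_integral (linepath (Complex l y) (Complex r y)) f =
     contour_integral (linepath (of_real l) (of_real r)) (\<lambda>w. f (w + Complex 0 y))"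
    unfolding contour_integral_integral vector_derivative_linepath_at e d by simp
  also have "\<dots> = integral {l..r} (\<lambda>x. f (of_real x + Complex 0 y))"
    using assms by (subst contour_integral_linepath_Reals_eq) auto
  also have "(\<lambda>x. of_real x + Complex 0 y) = (\<lambda>x. Complex x y)" by (auto simp: complex_eq_iff)
  then have "(\<lambda>x. f (of_real x + Complex 0 y)) = (\<lambda>x. f (Complex x y))" by metis
  finally show ?thesis .
qed

lemma integral_Icc_tendsto_lborel:
  fixes f :: "real \<Rightarrow> 'a :: euclidean_space"
  assumes f: "integrable lborel f"
  shows "(\<lambda>n. integral {- real n..real n} f) \<longlonglongrightarrow> (\<integral>x. f x \<partial>lborel)"
proof -
  have [measurable]: "f \<in> borel_measurable borel" using f by auto
  have "(\<lambda>n. \<integral>x. indicator {- real n..real n} x *\<^sub>R f x \<partial>lborel) \<longlonglongrightarrow> (\<integral>x. f x \<partial>lborel)"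
  proof (rule integral_dominated_convergence[where w="\<lambda>x. norm (f x)"])
    show "AE x in lborel. (\<lambda>n. indicator {- real n..real n} x *\<^sub>R f x) \<longlonglongrightarrow> f x"
    proof (rule AE_I2)
      fix x :: real
      obtain N :: nat where N: "\<bar>x\<bar> \<le> real N" using real_arch_simple by blast
      show "(\<lambda>n. indicator {- real n..real n} x *\<^sub>R f x) \<longlonglongrightarrow> f x"
      proof (rule tendsto_eventually, rule eventually_sequentiallyI[of N])
        fix n assume "N \<le> n"
        then have "x \<in> {- real n..real n}" using N by auto
        then show "indicator {- real n..real n} x *\<^sub>R f x = f x" by simp
      qed
    qed
  qed (use f in \<open>auto simp: indicator_def\<close>)
  moreover have "(\<integral>x. indicator {- real n..real n} x *\<^sub>R f x \<partial>lborel) = integral {- real n..real n} f" for n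
    using set_borel_integral_eq_integral(2)[of "{- real n..real n}" f]
      integrable_mult_indicator[OF _ f, of "{- real n..real n}"]
    by (simp add: set_integrable_def set_lebesgue_integral_def)
  ultimately show ?thesis by simp
qed

text \<open>A point of argument \<open>y\<close> with \<open>cos y \<le> 0\<close> has nonpositive
  real part, so there is no cancellation in the real part of the difference. Hence the denominators
  below are bounded from below both by \<open>z\<close> and by a multiple of
  \<open>exp x\<close>.\<close>

lemma norm_diff_exp_ge:
  assumes "z > 0" "cos y \<le> 0"
  shows "norm (complex_of_real z - exp (Complex x y)) \<ge> z + exp x * (- cos y)"
proof -
  have "Re (complex_of_real z - exp (Complex x y)) = z + exp x * (- cos y)" by (simp add: Re_exp)
  then show ?thesis by (metis complex_Re_le_cmod)
qed

text \<open>In the variable \<open>w = ln z\<close> a sector becomes a strip. This is Cauchy's formula there; the integrals over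
  the two boundary lines are conjugate to each other.\<close>

lemma ray_cauchy:
  fixes g :: "complex \<Rightarrow> complex"
  assumes \<phi>: "0 < \<phi>" "\<phi> < \<phi>1" "\<phi>1 \<le> pi" "cos \<phi> < 0" and z: "z > 0"
    and pq: "p > 0" "q < 1"
    and hol: "g holomorphic_on {w. \<bar>Im w\<bar> < \<phi>1}"
    and b: "\<And>w. \<bar>Im w\<bar> \<le> \<phi> \<Longrightarrow> norm (g w) \<le> C * exp (p * Re w)"
           "\<And>w. \<bar>Im w\<bar> \<le> \<phi> \<Longrightarrow> norm (g w) \<le> C * exp (q * Re w)"
    and sym: "\<And>w. g (cnj w) = cnj (g w)"
  shows "integrable lborel (\<lambda>x. g (Complex x \<phi>) / (of_real z - exp (Complex x \<phi>)))"
    and "Im (\<integral>x. g (Complex x \<phi>) / (of_real z - exp (Complex x \<phi>)) \<partial>lborel) = pi * Re (g (of_real (ln z))) / z"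
proof -
  define G where "G w = g w / (of_real z - exp w)" for w
  define S where "S = {w. \<bar>Im w\<bar> < \<phi>1}"
  have S_eq: "S = {w. Im w < \<phi>1} \<inter> {w. Im w > - \<phi>1}" by (auto simp: S_def)
  have oS: "open S" unfolding S_eq by (intro open_Int open_halfspace_Im_lt open_halfspace_Im_gt)
  have cS: "connected S" unfolding S_eq
    by (intro convex_connected convex_Int convex_halfspace_Im_lt convex_halfspace_Im_gt)
  have C0: "C \<ge> 0" using b(1)[of 0] \<phi> norm_ge_zero[of "g 0"] by (simp, linarith)
  define w0 where "w0 = complex_of_real (ln z)"
  have ew0: "exp w0 = of_real z" using z by (simp add: w0_def exp_of_real)
  \<comment> \<open>The strip has half-width at most \<open>pi\<close>, so the period of
    \<open>exp\<close> leaves room for a single preimage of \<open>z\<close>, and the integrand has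
    a single pole.\<close>
  have zero_only: "w = w0" if "w \<in> S" "exp w = of_real z" for w
  proof -
    have "exp w = exp w0" using that ew0 by simp
    then obtain k :: int where k: "w = w0 + complex_of_real (2 * real_of_int k * pi) * \<i>" by (auto simp: exp_eq)
    then have "Im w = 2 * k * pi" by (simp add: w0_def)
    then have "\<bar>2 * real_of_int k * pi\<bar> < pi" using that(1) \<phi> by (simp add: S_def)
    then have lt: "\<bar>real_of_int k\<bar> * (2 * pi) < pi" by (simp add: abs_mult)
    have "1 * (2 * pi) \<le> \<bar>real_of_int k\<bar> * (2 * pi)" if "k \<noteq> 0"
      using that by (intro mult_right_mono) auto
    then have "k = 0" using lt pi_gt_zero by linarith
    then show ?thesis using k by simp
  qed
  have gc: "continuous_on S g" using hol holomorphic_on_imp_continuous_on by (simp add: S_def)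
  have holG: "G holomorphic_on S - {w0}"
    unfolding G_def using zero_only
    by (intro holomorphic_intros holomorphic_on_subset[OF hol]) (auto simp: S_def)
  have Gc: "continuous_on (S - {w0}) G" using holG by (rule holomorphic_on_imp_continuous_on)
  have w0S: "w0 \<in> S" using \<phi> by (auto simp: S_def w0_def)
  \<comment> \<open>The pole is simple; the sign comes from the order of the terms in
    \<open>z - exp w\<close>.\<close>
  have res: "residue G w0 = - g w0 / of_real z"
  proof (rule residue_simple'[OF oS w0S holG])
    have "(exp has_field_derivative exp w0) (at w0)" by (rule DERIV_exp)
    then have "((\<lambda>w. (exp w - exp w0) / (w - w0)) \<longlongrightarrow> exp w0) (at w0)"
      by (simp add: has_field_derivative_iff)
    moreover have "(g \<longlongrightarrow> g w0) (at w0)"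
      using gc oS w0S by (metis continuous_on_eq_continuous_at isCont_def)
    ultimately have "((\<lambda>w. - g w / ((exp w - exp w0) / (w - w0))) \<longlongrightarrow> - g w0 / exp w0) (at w0)"
      by (intro tendsto_intros) auto
    then have "((\<lambda>w. - g w / ((exp w - exp w0) / (w - w0))) \<longlongrightarrow> - g w0 / of_real z) (at w0)" by (simp add: ew0)
    moreover have "(\<lambda>w. - g w / ((exp w - exp w0) / (w - w0))) = (\<lambda>w. G w * (w - w0))"
      by (simp add: G_def ew0 fun_eq_iff divide_simps) (auto simp: algebra_simps)
    ultimately show "((\<lambda>w. G w * (w - w0)) \<longlongrightarrow> - g w0 / of_real z) (at w0)" by simp
  qed
  have line: "(\<lambda>x. G (Complex x y)) \<in> borel_measurable borel" if "\<bar>y\<bar> = \<phi>" for y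
  proof (rule borel_measurable_continuous_onI, rule continuous_on_compose2[OF Gc])
    show "continuous_on UNIV (\<lambda>x. Complex x y)" by (simp add: Complex_eq) (intro continuous_intros)
    show "range (\<lambda>x. Complex x y) \<subseteq> S - {w0}" using that \<phi> by (auto simp: S_def w0_def complex_eq_iff)
  qed
  have cosabs: "cos y = cos \<phi>" if "\<bar>y\<bar> = \<phi>" for y using that by (cases "y \<ge> 0") auto
  have Gint: "integrable lborel (\<lambda>x. G (Complex x y))" if y: "\<bar>y\<bar> = \<phi>" for y
  proof (rule integrable_two_sided_exp[OF line[OF y] pq(1), where q="q - 1"])
    show "q - 1 < 0" using pq by simp
    fix x
    have 1: "norm (complex_of_real z - exp (Complex x y)) \<ge> z + exp x * (- cos \<phi>)"
      using norm_diff_exp_ge[of z y x] z \<phi> cosabs[OF y] by simp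
    then have 2: "norm (complex_of_real z - exp (Complex x y)) \<ge> z"
      "norm (complex_of_real z - exp (Complex x y)) \<ge> exp x * (- cos \<phi>)"
      using mult_pos_pos[OF exp_gt_zero[of x], of "- cos \<phi>"] \<phi> z by (linarith, linarith)
    have 3: "exp x * (- cos \<phi>) > 0" using \<phi> by (intro mult_pos_pos) auto
    have "norm (G (Complex x y)) \<le> (C * exp (p * x)) / z"
      unfolding G_def norm_divide using b(1)[of "Complex x y"] y 2(1) z C0 by (intro frac_le) auto
    then show "norm (G (Complex x y)) \<le> (C / z) * exp (p * x)" by simp
    have "norm (G (Complex x y)) \<le> (C * exp (q * x)) / (exp x * (- cos \<phi>))"
      unfolding G_def norm_divide using b(2)[of "Complex x y"] y C0
      by (intro frac_le 2(2) 3) auto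
    also have "\<dots> = (C / (- cos \<phi>)) * exp ((q - 1) * x)"
      by (simp add: left_diff_distrib exp_diff)
    finally show "norm (G (Complex x y)) \<le> (C / (- cos \<phi>)) * exp ((q - 1) * x)" .
  qed
  from Gint[of \<phi>] \<phi> show "integrable lborel (\<lambda>x. g (Complex x \<phi>) / (of_real z - exp (Complex x \<phi>)))"
    by (simp add: G_def)
  define T where "T y n = contour_integral (linepath (Complex (- real n) y) (Complex (real n) y)) G" for y n
  define W where "W s n = contour_integral (linepath (Complex (s * real n) (-\<phi>)) (Complex (s * real n) \<phi>)) G" for s n
  have T_lim: "T y \<longlonglongrightarrow> (\<integral>x. G (Complex x y) \<partial>lborel)" if y: "\<bar>y\<bar> = \<phi>" for y
  proof (rule Lim_transform_eventually[OF integral_Icc_tendsto_lborel[OF Gint[OF y]]])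
    show "\<forall>\<^sub>F n in sequentially. integral {- real n..real n} (\<lambda>x. G (Complex x y)) = T y n"
      by (rule eventually_sequentiallyI[of 1]) (auto simp: T_def contour_integral_linepath_horizontal)
  qed
  have dist_ge: "norm (complex_of_real z - exp w) \<ge> \<bar>z - exp (Re w)\<bar>" for w
    using norm_triangle_ineq3[of "complex_of_real z" "exp w"] z by simp
  have seg: "Re w = x \<and> \<bar>Im w\<bar> \<le> \<phi>" if "w \<in> closed_segment (Complex x (-\<phi>)) (Complex x \<phi>)" for w x
    using that \<phi> by (auto simp: closed_segment_same_Re closed_segment_eq_real_ivl)
  have segS: "closed_segment (Complex x (-\<phi>)) (Complex x \<phi>) \<subseteq> S - {w0}" if "x \<noteq> ln z" for x
  proof
    fix w assume "w \<in> closed_segment (Complex x (-\<phi>)) (Complex x \<phi>)"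
    from seg[OF this] that \<phi> show "w \<in> S - {w0}" by (auto simp: S_def w0_def)
  qed
  have lim1: "(\<lambda>n. 2 * C / z * exp (- p * real n) * (2 * \<phi>)) \<longlonglongrightarrow> 0"
    "(\<lambda>n. 2 * C * exp ((q - 1) * real n) * (2 * \<phi>)) \<longlonglongrightarrow> 0"
  proof -
    have e: "(\<lambda>n. exp (- r * real n)) \<longlonglongrightarrow> 0" if "r > 0" for r
    proof -
      have "(\<lambda>n. exp (- r) ^ n) \<longlonglongrightarrow> 0" using that by (intro LIMSEQ_realpow_zero) auto
      then show ?thesis by (simp add: exp_of_nat_mult[symmetric] mult.commute)
    qed
    show "(\<lambda>n. 2 * C / z * exp (- p * real n) * (2 * \<phi>)) \<longlonglongrightarrow> 0"
      by (intro tendsto_mult_left_zero tendsto_mult_right_zero e pq)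
    have "1 - q > 0" using pq by simp
    from e[OF this] have "(\<lambda>n. exp ((q - 1) * real n)) \<longlonglongrightarrow> 0" by simp
    then show "(\<lambda>n. 2 * C * exp ((q - 1) * real n) * (2 * \<phi>)) \<longlonglongrightarrow> 0"
      by (intro tendsto_mult_left_zero tendsto_mult_right_zero)
  qed
  have evexp: "\<forall>\<^sub>F n in sequentially. r < exp (real n)" for r
    using filterlim_compose[OF exp_at_top filterlim_real_sequentially] by (simp add: filterlim_at_top_dense)
  have ev1: "\<forall>\<^sub>F n in sequentially. exp (- real n) < z / 2"
    using evexp[of "2/z"] by eventually_elim (use z in \<open>simp add: exp_minus field_simps\<close>)
  have ev2: "\<forall>\<^sub>F n in sequentially. exp (real n) > 2 * z" using evexp .
  have nlen: "norm (Complex x \<phi> - Complex x (-\<phi>)) = 2 * \<phi>" for x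
    using \<phi> by (simp add: Complex_eq_i cmod_def real_sqrt_mult)
  have cint: "G contour_integrable_on linepath (Complex x (-\<phi>)) (Complex x \<phi>)" if "x \<noteq> ln z" for x
    by (intro contour_integrable_continuous_linepath continuous_on_subset[OF Gc] segS[OF that])
  \<comment> \<open>On the left edge the denominator stays above \<open>z / 2\<close> and the bound
    with \<open>p > 0\<close> decays. On the right edge, treated next, the denominator exceeds
    \<open>exp (real n) / 2\<close>, which beats the growth allowed by \<open>q < 1\<close>.\<close>
  have W1: "W (-1) \<longlonglongrightarrow> 0"
  proof (rule Lim_null_comparison[OF _ lim1(1)])
    show "\<forall>\<^sub>F n in sequentially. norm (W (-1) n) \<le> 2 * C / z * exp (- p * real n) * (2 * \<phi>)"
      using ev1
    proof eventually_elim
      case (elim n)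
      have ne: "- real n \<noteq> ln z" using elim z by (smt (verit) exp_ln half_gt_zero_iff field_sum_of_halves)
      have "norm (G w) \<le> 2 * C / z * exp (- p * real n)"
        if "w \<in> closed_segment (Complex (-1 * real n) (-\<phi>)) (Complex (-1 * real n) \<phi>)" for w
      proof -
        have w: "Re w = - real n" "\<bar>Im w\<bar> \<le> \<phi>" using seg[OF that] by auto
        have "norm (G w) \<le> (C * exp (p * (- real n))) / (z / 2)"
          unfolding G_def norm_divide using b(1)[OF w(2)] dist_ge[of w] elim z w C0 by (intro frac_le) auto
        then show ?thesis by (simp add: mult_ac)
      qed
      then have "norm (W (-1) n) \<le> 2 * C / z * exp (- p * real n) * norm (Complex (-1 * real n) \<phi> - Complex (-1 * real n) (-\<phi>))"
        unfolding W_def using C0 z ne by (intro contour_integral_bound_linepath cint) auto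
      then show ?case unfolding nlen .
    qed
  qed
  have W2: "W 1 \<longlonglongrightarrow> 0"
  proof (rule Lim_null_comparison[OF _ lim1(2)])
    show "\<forall>\<^sub>F n in sequentially. norm (W 1 n) \<le> 2 * C * exp ((q - 1) * real n) * (2 * \<phi>)"
      using ev2
    proof eventually_elim
      case (elim n)
      have ne: "real n \<noteq> ln z" using elim z by auto
      have "norm (G w) \<le> 2 * C * exp ((q - 1) * real n)"
        if "w \<in> closed_segment (Complex (1 * real n) (-\<phi>)) (Complex (1 * real n) \<phi>)" for w
      proof -
        have w: "Re w = real n" "\<bar>Im w\<bar> \<le> \<phi>" using seg[OF that] by auto
        have "norm (G w) \<le> (C * exp (q * real n)) / (exp (real n) / 2)"
          unfolding G_def norm_divide using b(2)[OF w(2)] dist_ge[of w] elim z w C0 by (intro frac_le) auto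
        also have "\<dots> = 2 * C * exp ((q - 1) * real n)" by (simp add: left_diff_distrib exp_diff)
        finally show ?thesis .
      qed
      then have "norm (W 1 n) \<le> 2 * C * exp ((q - 1) * real n) * norm (Complex (1 * real n) \<phi> - Complex (1 * real n) (-\<phi>))"
        unfolding W_def using C0 z ne by (intro contour_integral_bound_linepath cint) auto
      then show ?case unfolding nlen .
    qed
  qed
  \<comment> \<open>The residue theorem for a rectangle wide enough to contain \<open>ln z\<close>.
    The top and left sides are traversed backwards, hence the two minus signs.\<close>
  have rect: "\<forall>\<^sub>F n in sequentially. T (-\<phi>) n + W 1 n - T \<phi> n - W (-1) n = 2 * pi * \<i> * (- g w0 / of_real z)"
    using ev1 ev2 eventually_gt_at_top[of 0]
  proof eventually_elim
    case (elim n)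
    define a1 a3 where "a1 = Complex (- real n) (-\<phi>)" and "a3 = Complex (real n) \<phi>"
    define a2 a4 where "a2 = Complex (real n) (-\<phi>)" and "a4 = Complex (- real n) \<phi>"
    have n1: "- real n < ln z" using elim(1) z by (subst exp_less_cancel_iff[symmetric]) (simp del: exp_less_cancel_iff)
    have n2: "ln z < real n" using elim(2) z by (subst exp_less_cancel_iff[symmetric]) (simp del: exp_less_cancel_iff)
    have inbox: "w0 \<in> box a1 a3" using n1 n2 \<phi> by (auto simp: in_box_complex_iff a1_def a3_def w0_def)
    have sub: "cbox a1 a3 \<subseteq> S" using \<phi> by (auto simp: in_cbox_complex_iff a1_def a3_def S_def)
    have le: "Re a1 \<le> Re a3" "Im a1 \<le> Im a3" using \<phi> by (auto simp: a1_def a3_def)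
    have pim: "path_image (rectpath a1 a3) \<subseteq> S - {w0}"
      using path_image_rectpath_cbox_minus_box[OF le] inbox sub by auto
    have R: "contour_integral (rectpath a1 a3) G = 2 * pi * \<i> * (\<Sum>p\<in>{w0}. winding_number (rectpath a1 a3) p * residue G p)"
    proof (rule Residue_theorem[OF oS cS _ holG valid_path_rectpath _ pim])
      show "\<forall>z. z \<notin> S \<longrightarrow> winding_number (rectpath a1 a3) z = 0"
        using winding_number_rectpath_outside[OF le] sub by auto
    qed auto
    have pi4: "path_image (rectpath a1 a3) = closed_segment a1 a2 \<union> closed_segment a2 a3 \<union> closed_segment a3 a4 \<union> closed_segment a4 a1"
      by (simp add: rectpath_def Let_def path_image_join Un_assoc a1_def a2_def a3_def a4_def)
    have ci: "G contour_integrable_on linepath a1 a2" "G contour_integrable_on linepath a2 a3"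
      "G contour_integrable_on linepath a3 a4" "G contour_integrable_on linepath a4 a1"
      using pim pi4 by (auto intro!: contour_integrable_continuous_linepath continuous_on_subset[OF Gc])
    have "contour_integral (rectpath a1 a3) G = contour_integral (linepath a1 a2) G + contour_integral (linepath a2 a3) G
      + contour_integral (linepath a3 a4) G + contour_integral (linepath a4 a1) G"
      using ci by (simp add: rectpath_def Let_def a1_def a2_def a3_def a4_def)
    also have "contour_integral (linepath a3 a4) G = - contour_integral (linepath a4 a3) G"
      using contour_integral_reversepath[of "linepath a4 a3" G] by simp
    also have "contour_integral (linepath a4 a1) G = - contour_integral (linepath a1 a4) G"
      using contour_integral_reversepath[of "linepath a1 a4" G] by simp
    finally have "contour_integral (rectpath a1 a3) G = T (-\<phi>) n + W 1 n - T \<phi> n - W (-1) n"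
      by (simp add: T_def W_def a1_def a2_def a3_def a4_def)
    then show ?case using R winding_number_rectpath[OF inbox] by (simp add: res)
  qed
  define I where "I = (\<integral>x. G (Complex x \<phi>) \<partial>lborel)"
  have "(\<lambda>n. T (-\<phi>) n + W 1 n - T \<phi> n - W (-1) n) \<longlonglongrightarrow> (\<integral>x. G (Complex x (-\<phi>)) \<partial>lborel) + 0 - I - 0"
    unfolding I_def using \<phi> by (intro tendsto_intros W1 W2 T_lim) auto
  moreover have "(\<lambda>n. T (-\<phi>) n + W 1 n - T \<phi> n - W (-1) n) \<longlonglongrightarrow> 2 * pi * \<i> * (- g w0 / of_real z)"
    by (rule tendsto_eventually[OF rect])
  ultimately have eq: "(\<integral>x. G (Complex x (-\<phi>)) \<partial>lborel) - I = 2 * pi * \<i> * (- g w0 / of_real z)"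
    using LIMSEQ_unique by fastforce
  \<comment> \<open>By this symmetry the difference of the two line integrals is
    \<open>cnj I - I\<close>, so the residue identity determines the imaginary part of
    \<open>I\<close>.\<close>
  have "G (Complex x (-\<phi>)) = cnj (G (Complex x \<phi>))" for x
  proof -
    have c: "Complex x (-\<phi>) = cnj (Complex x \<phi>)" by (simp add: complex_eq_iff)
    show ?thesis unfolding c G_def sym by (simp add: exp_cnj)
  qed
  then have "(\<integral>x. G (Complex x (-\<phi>)) \<partial>lborel) = cnj I" unfolding I_def by simp
  with eq have "cnj I - I = 2 * pi * \<i> * (- g w0 / of_real z)" by simp
  then have "Im (cnj I - I) = Im (2 * pi * \<i> * (- g w0 / of_real z))" by simp
  then have "- 2 * Im I = - 2 * pi * Re (g w0) / z" by (simp add: Re_divide_of_real)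
  then show "Im (\<integral>x. g (Complex x \<phi>) / (of_real z - exp (Complex x \<phi>)) \<partial>lborel) = pi * Re (g (of_real (ln z))) / z"
    by (simp add: I_def G_def w0_def)
qed

section \<open>Exponential integrals on the half-line and their analogues in the logarithmic
  variable\<close>

lemma has_bochner_integral_exp_complex:
  fixes s :: complex
  assumes s: "Re s > 0"
  shows "has_bochner_integral lborel (\<lambda>t. indicator {0<..} t *\<^sub>R exp (- (of_real t * s))) (1 / s)"
proof -
  define f where "f t = indicator {0<..} t *\<^sub>R exp (- (of_real t * s))" for t :: real
  have s0: "s \<noteq> 0" using s by auto
  have [measurable]: "f \<in> borel_measurable borel" unfolding f_def by measurable
  have dom: "integrable lborel (\<lambda>t. indicator {0..} t * exp (- (Re s * t)))"
    using integrable_exp_atLeast[OF s] by (simp add: set_integrable_def)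
  have fi: "integrable lborel f"
    by (rule Bochner_Integration.integrable_bound[OF dom])
      (auto simp: f_def indicator_def norm_exp_eq_Re mult.commute)
  have 1: "(\<lambda>n. \<integral>t. indicator {0..real n} t *\<^sub>R exp (- (of_real t * s)) \<partial>lborel) \<longlonglongrightarrow> (\<integral>t. f t \<partial>lborel)"
  proof (rule integral_dominated_convergence[OF _ _ dom])
    show "AE t in lborel. (\<lambda>n. indicator {0..real n} t *\<^sub>R exp (- (of_real t * s))) \<longlonglongrightarrow> f t"
      using AE_lborel_singleton[of 0]
    proof eventually_elim
      case (elim t)
      obtain N :: nat where N: "t \<le> real N" using real_arch_simple by blast
      show ?case
      proof (rule tendsto_eventually, rule eventually_sequentiallyI[of N])
        fix n assume "N \<le> n"
        then show "indicator {0..real n} t *\<^sub>R exp (- (of_real t * s)) = f t"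
          using N elim by (auto simp: f_def indicator_def)
      qed
    qed
    show "AE t in lborel. norm (indicator {0..real n} t *\<^sub>R exp (- (of_real t * s))) \<le> indicator {0..} t * exp (- (Re s * t))" for n
      by (auto simp: indicator_def norm_exp_eq_Re mult.commute)
  qed measurable
  have 2: "(\<integral>t. indicator {0..real n} t *\<^sub>R exp (- (of_real t * s)) \<partial>lborel) = - exp (- (of_real (real n) * s)) / s - (- exp (- (of_real 0 * s)) / s)" for n
  proof (rule integral_FTC_Icc)
    fix x
    have "((\<lambda>w. - exp (- (w * s)) / s) has_field_derivative exp (- (of_real x * s))) (at (of_real x))"
      using s0 by (auto intro!: derivative_eq_intros simp: field_simps)
    then show "((\<lambda>t. - exp (- (of_real t * s)) / s) has_vector_derivative exp (- (of_real x * s))) (at x within {0..real n})"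
      by (rule has_vector_derivative_real_field)
  qed (auto intro!: continuous_intros)
  have "(\<lambda>n. exp (- (of_real (real n) * s))) \<longlonglongrightarrow> 0"
  proof (rule tendsto_norm_zero_cancel)
    have "(\<lambda>n. exp (- Re s) ^ n) \<longlonglongrightarrow> 0" using s by (intro LIMSEQ_realpow_zero) auto
    then show "(\<lambda>n. norm (exp (- (of_real (real n) * s)))) \<longlonglongrightarrow> 0"
      by (simp add: norm_exp_eq_Re exp_of_nat_mult[symmetric])
  qed
  then have "(\<lambda>n. - exp (- (of_real (real n) * s)) / s - (- exp (- (of_real 0 * s)) / s)) \<longlonglongrightarrow> - 0 / s - (- exp (- (of_real 0 * s)) / s)"
    by (intro tendsto_intros s0)
  then have "(\<integral>t. f t \<partial>lborel) = 1 / s"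
    using LIMSEQ_unique[OF 1[unfolded 2]] by fastforce
  then show ?thesis using fi by (auto simp: f_def[abs_def] has_bochner_integral_iff)
qed

lemma integrable_exp_minus_exp:
  fixes c p :: real
  assumes c: "c > 0" and p: "p > 0"
  shows "integrable lborel (\<lambda>x. exp (p * x - c * exp x))"
proof (rule integrable_two_sided_exp[OF _ p, where q="-1" and C=1 and D="exp ((p+1) * (ln ((p+1)/c) - 1))"])
  fix x :: real
  show "norm (exp (p * x - c * exp x)) \<le> 1 * exp (p * x)" using c by simp
  \<comment> \<open>At this point the tangent of \<open>c * exp x\<close> has slope
    \<open>p + 1\<close>. By convexity the graph lies above it, and subtracting the tangent from
    \<open>p * x\<close> leaves an exponent of slope \<open>- 1\<close>.\<close>
  define s where "s = ln ((p+1)/c)"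
  have es: "c * exp s = p + 1" using c p by (simp add: s_def)
  have "(p + 1) * (1 + (x - s)) \<le> (p + 1) * exp (x - s)"
    using p exp_ge_add_one_self[of "x - s"] by (intro mult_left_mono) auto
  also have "\<dots> = c * (exp s * exp (x - s))" using es by (metis mult.assoc)
  also have "exp s * exp (x - s) = exp x" by (simp flip: exp_add)
  finally have "p * x - c * exp x \<le> (p+1) * (s - 1) + - 1 * x" by (simp add: algebra_simps)
  then show "norm (exp (p * x - c * exp x)) \<le> exp ((p+1) * (ln ((p+1)/c) - 1)) * exp (- 1 * x)"
    by (simp add: s_def flip: exp_add)
qed auto

text \<open>The shift of \<open>x\<close> by \<open>- ln t\<close> absorbs \<open>t\<close>; in the
  variable \<open>exp x\<close> it is the scaling of a Gamma integral.\<close>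

lemma integral_exp_minus_exp_scale:
  fixes c p t :: real
  assumes t: "t > 0"
  shows "(\<integral>x. exp (p * x - c * t * exp x) \<partial>lborel) = t powr (- p) * (\<integral>x. exp (p * x - c * exp x) \<partial>lborel)"
proof -
  have "(\<integral>x. exp (p * x - c * t * exp x) \<partial>lborel) = (\<integral>x. exp (p * (- ln t + 1 * x) - c * t * exp (- ln t + 1 * x)) \<partial>lborel)"
    by (subst lborel_integral_real_affine[of 1 _ "- ln t"]) auto
  also have "\<dots> = (\<integral>x. t powr (- p) * exp (p * x - c * exp x) \<partial>lborel)"
    using t by (intro Bochner_Integration.integral_cong)
      (auto simp: powr_def exp_add exp_diff exp_minus right_diff_distrib distrib_left field_simps)
  finally show ?thesis by simp
qed

lemma integrable_exp_minus_exp_scale: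
  fixes c p t :: real
  assumes "c > 0" "p > 0" "t > 0"
  shows "integrable lborel (\<lambda>x. exp (p * x - c * t * exp x))"
  using integrable_exp_minus_exp[of "c * t" p] assms by simp

text \<open>The inverse Laplace transform at \<open>t\<close> of \<open>F\<close>, where \<open>g w = exp w * F (exp w)\<close>. The contour consists of the
  rays \<open>\<bar>arg z\<bar> = \<phi>\<close>, parametrised by \<open>z = exp (Complex x (\<plusminus> \<phi>))\<close>; the two rays contribute conjugate
  values.\<close>

definition ilap :: "real \<Rightarrow> (complex \<Rightarrow> complex) \<Rightarrow> real \<Rightarrow> real" where
  "ilap \<phi> g t = Im (\<integral>x. exp (of_real t * exp (Complex x \<phi>)) * g (Complex x \<phi>) \<partial>lborel) / pi"

text \<open>An angle with negative cosine makes \<open>exp (t z)\<close> decay along the rays. The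
  larger angle \<open>\<phi>1\<close> leaves a margin of holomorphy around the contour, and the
  bound \<open>pi\<close> keeps \<open>exp\<close> injective on the open strip.\<close>

locale rays =
  fixes \<phi> \<phi>1 :: real
  assumes \<phi>: "0 < \<phi>" "\<phi> < \<phi>1" "\<phi>1 \<le> pi" "cos \<phi> < 0"
begin

text \<open>With \<open>z = exp w\<close> the two estimates are powers of the modulus of
  \<open>z\<close>: a positive power near zero and a power below \<open>1\<close> near infinity,
  just enough for the Cauchy kernel to be integrable on the rays. The conjugation symmetry makes the
  inverse transform real.\<close>

definition symbol :: "(complex \<Rightarrow> complex) \<Rightarrow> bool" where
  "symbol g \<longleftrightarrow> g holomorphic_on {w. \<bar>Im w\<bar> < \<phi>1} \<and> (\<forall>w. g (cnj w) = cnj (g w)) \<and>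
     (\<exists>C p q. p > 0 \<and> q < 1 \<and> (\<forall>w. \<bar>Im w\<bar> \<le> \<phi> \<longrightarrow>
        norm (g w) \<le> C * exp (p * Re w) \<and> norm (g w) \<le> C * exp (q * Re w)))"

lemma norm_exp_ray: "norm (exp (of_real t * exp (Complex x \<phi>))) = exp (- (- cos \<phi> * t * exp x))"
  by (simp add: norm_exp_eq_Re Re_exp)

lemma symbol_line:
  assumes "symbol g"
  shows "continuous_on UNIV (\<lambda>x. g (Complex x \<phi>))" "(\<lambda>x. g (Complex x \<phi>)) \<in> borel_measurable borel"
proof -
  have gc: "continuous_on {w. \<bar>Im w\<bar> < \<phi>1} g"
    using assms by (auto simp: symbol_def holomorphic_on_imp_continuous_on)
  show 1: "continuous_on UNIV (\<lambda>x. g (Complex x \<phi>))"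
    by (rule continuous_on_compose2[OF gc]) (use \<phi> in \<open>auto simp: Complex_eq intro!: continuous_intros\<close>)
  then show "(\<lambda>x. g (Complex x \<phi>)) \<in> borel_measurable borel" by (rule borel_measurable_continuous_onI)
qed

lemma measurable_exp_ray: "(\<lambda>x. exp (of_real t * exp (Complex x \<phi>))) \<in> borel_measurable borel"
  by (rule borel_measurable_continuous_onI) (auto simp: Complex_eq intro!: continuous_intros)

lemma ilap_integrable:
  assumes g: "symbol g" and t: "t > 0"
  shows "integrable lborel (\<lambda>x. exp (of_real t * exp (Complex x \<phi>)) * g (Complex x \<phi>))"
proof -
  obtain C p q where C: "p > 0" "q < 1" "\<And>w. \<bar>Im w\<bar> \<le> \<phi> \<Longrightarrow> norm (g w) \<le> C * exp (p * Re w)"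
    "\<And>w. \<bar>Im w\<bar> \<le> \<phi> \<Longrightarrow> norm (g w) \<le> C * exp (q * Re w)"
    using g unfolding symbol_def by blast
  have C0: "C \<ge> 0" using C(3)[of 0] \<phi> norm_ge_zero[of "g 0"] by (simp, linarith)
  show ?thesis
  proof (rule Bochner_Integration.integrable_bound)
    show "integrable lborel (\<lambda>x. C * exp (p * x - (- cos \<phi>) * t * exp x))"
      using integrable_exp_minus_exp_scale[of "- cos \<phi>" p t] \<phi> C t by simp
    show "AE x in lborel. norm (exp (of_real t * exp (Complex x \<phi>)) * g (Complex x \<phi>)) \<le> norm (C * exp (p * x - (- cos \<phi>) * t * exp x))"
    proof (rule AE_I2)
      fix x
      have "norm (exp (of_real t * exp (Complex x \<phi>)) * g (Complex x \<phi>)) \<le> exp (- (- cos \<phi> * t * exp x)) * (C * exp (p * x))"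
        unfolding norm_mult norm_exp_ray using C(3)[of "Complex x \<phi>"] \<phi> by (intro mult_left_mono) auto
      also have "\<dots> = norm (C * exp (p * x - (- cos \<phi>) * t * exp x))"
        using C0 by (simp add: exp_diff exp_minus field_simps exp_add)
      finally show "norm (exp (of_real t * exp (Complex x \<phi>)) * g (Complex x \<phi>)) \<le> norm (C * exp (p * x - (- cos \<phi>) * t * exp x))" .
    qed
  qed (use symbol_line(2)[OF g] measurable_exp_ray in measurable)
qed

lemma ilap_bound:
  assumes g: "symbol g" and t: "t \<ge> 0"
    and b: "\<And>x. exp (- (- cos \<phi> * t * exp x)) * norm (g (Complex x \<phi>)) \<le> G x" and G: "integrable lborel G"
  shows "\<bar>ilap \<phi> g t\<bar> \<le> (\<integral>x. G x \<partial>lborel)"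
proof -
  have nb: "norm (exp (of_real t * exp (Complex x \<phi>)) * g (Complex x \<phi>)) \<le> G x" for x
    unfolding norm_mult norm_exp_ray by (rule b)
  have fi: "integrable lborel (\<lambda>x. exp (of_real t * exp (Complex x \<phi>)) * g (Complex x \<phi>))"
    by (rule Bochner_Integration.integrable_bound[OF G])
      (use borel_measurable_times[OF measurable_exp_ray symbol_line(2)[OF g]] nb in
        \<open>auto intro!: AE_I2 order_trans[OF _ abs_ge_self] simp del: norm_exp_eq_Re\<close>)
  have "\<bar>Im (\<integral>x. exp (of_real t * exp (Complex x \<phi>)) * g (Complex x \<phi>) \<partial>lborel)\<bar>
      \<le> norm (\<integral>x. exp (of_real t * exp (Complex x \<phi>)) * g (Complex x \<phi>) \<partial>lborel)" by (rule abs_Im_le_cmod)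
  also have "\<dots> \<le> (\<integral>x. G x \<partial>lborel)"
    by (rule Bochner_Integration.integral_norm_bound_integral[OF fi G nb])
  finally have 1: "\<bar>Im (\<integral>x. exp (of_real t * exp (Complex x \<phi>)) * g (Complex x \<phi>) \<partial>lborel)\<bar> \<le> (\<integral>x. G x \<partial>lborel)" .
  have "\<bar>ilap \<phi> g t\<bar> \<le> \<bar>Im (\<integral>x. exp (of_real t * exp (Complex x \<phi>)) * g (Complex x \<phi>) \<partial>lborel)\<bar>"
    unfolding ilap_def abs_divide using pi_ge_two by (simp add: divide_le_eq mult_le_cancel_left1 abs_if)
  with 1 show ?thesis by linarith
qed

text \<open>Dominated convergence with a majorant required only near each \<open>t\<close>. On the
  open half-line the exponential at time \<open>t / 2\<close> provides it; up to
  \<open>t = 0\<close> the symbol itself has to be integrable.\<close>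

lemma ilap_continuous_dominated:
  assumes g: "symbol g" and A: "A \<subseteq> {0..}"
    and b: "\<And>t. t \<in> A \<Longrightarrow> \<exists>d>0. \<exists>G. integrable lborel G \<and> (\<forall>s\<in>A. \<bar>s - t\<bar> < d \<longrightarrow> (\<forall>x. exp (- (- cos \<phi> * s * exp x)) * norm (g (Complex x \<phi>)) \<le> G x))"
  shows "continuous_on A (ilap \<phi> g)"
  unfolding continuous_on_def
proof (intro ballI)
  fix t assume t: "t \<in> A"
  obtain d G where d: "d > 0" and G: "integrable lborel G"
    and b: "\<And>s x. s \<in> A \<Longrightarrow> \<bar>s - t\<bar> < d \<Longrightarrow> exp (- (- cos \<phi> * s * exp x)) * norm (g (Complex x \<phi>)) \<le> G x"
    using assms(3)[OF t] by blast
  have "((\<lambda>s. \<integral>x. exp (of_real s * exp (Complex x \<phi>)) * g (Complex x \<phi>) \<partial>lborel) \<longlongrightarrow>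
     (\<integral>x. exp (of_real t * exp (Complex x \<phi>)) * g (Complex x \<phi>) \<partial>lborel)) (at t within A)"
    unfolding tendsto_at_iff_sequentially o_def
  proof (intro allI impI)
    fix X assume X: "\<forall>i. X i \<in> A - {t}" "X \<longlonglongrightarrow> t"
    obtain N where N: "\<And>n. n \<ge> N \<Longrightarrow> \<bar>X n - t\<bar> < d"
      using X(2) d by (auto simp: LIMSEQ_def dist_real_def)
    note m = borel_measurable_times[OF measurable_exp_ray symbol_line(2)[OF g]]
    show "(\<lambda>n. \<integral>x. exp (of_real (X n) * exp (Complex x \<phi>)) * g (Complex x \<phi>) \<partial>lborel) \<longlonglongrightarrow>
      (\<integral>x. exp (of_real t * exp (Complex x \<phi>)) * g (Complex x \<phi>) \<partial>lborel)"
    proof (rule LIMSEQ_offset[of _ N], rule integral_dominated_convergence[where w=G])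
      show "AE x in lborel. (\<lambda>n. exp (of_real (X (n + N)) * exp (Complex x \<phi>)) * g (Complex x \<phi>))
          \<longlonglongrightarrow> exp (of_real t * exp (Complex x \<phi>)) * g (Complex x \<phi>)"
        by (intro AE_I2 tendsto_intros LIMSEQ_ignore_initial_segment X(2))
      show "AE x in lborel. norm (exp (of_real (X (n + N)) * exp (Complex x \<phi>)) * g (Complex x \<phi>)) \<le> G x" for n
        unfolding norm_mult norm_exp_ray using X(1) by (intro AE_I2 b N) auto
    qed (use m G in auto)
  qed
  then show "(ilap \<phi> g \<longlongrightarrow> ilap \<phi> g t) (at t within A)"
    unfolding ilap_def[abs_def] by (intro tendsto_intros) auto
qed

lemma ilap_continuous_pos:
  assumes g: "symbol g" shows "continuous_on {0<..} (ilap \<phi> g)"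
proof (rule ilap_continuous_dominated[OF g])
  fix t :: real assume t: "t \<in> {0<..}"
  let ?G = "\<lambda>x. exp (- (- cos \<phi> * (t/2) * exp x)) * norm (g (Complex x \<phi>))"
  have "integrable lborel ?G"
    using integrable_norm[OF ilap_integrable[OF g, of "t/2"]] t
    unfolding norm_mult norm_exp_ray by simp
  moreover have "exp (- (- cos \<phi> * s * exp x)) * norm (g (Complex x \<phi>)) \<le> ?G x" if "\<bar>s - t\<bar> < t / 2" for s x
  proof -
    have "- cos \<phi> * (t/2) * exp x \<le> - cos \<phi> * s * exp x"
      using that \<phi> by (intro mult_right_mono mult_left_mono) (auto simp: abs_if split: if_splits)
    then show ?thesis by (intro mult_right_mono) auto
  qed
  ultimately show "\<exists>d>0. \<exists>G. integrable lborel G \<and> (\<forall>s\<in>{0<..}. \<bar>s - t\<bar> < d \<longrightarrow> (\<forall>x. exp (- (- cos \<phi> * s * exp x)) * norm (g (Complex x \<phi>)) \<le> G x))"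
    using t by (intro exI[of _ "t/2"] conjI exI[of _ ?G]) auto
qed auto

lemma ilap_continuous_nonneg:
  assumes g: "symbol g" and i: "integrable lborel (\<lambda>x. g (Complex x \<phi>))"
  shows "continuous_on {0..} (ilap \<phi> g)"
proof (rule ilap_continuous_dominated[OF g])
  fix t :: real assume t: "t \<in> {0..}"
  have "exp (- (- cos \<phi> * s * exp x)) * norm (g (Complex x \<phi>)) \<le> norm (g (Complex x \<phi>))" if "s \<ge> 0" for s x
  proof -
    have "- cos \<phi> * s * exp x \<ge> 0" using that \<phi> by (intro mult_nonneg_nonneg) auto
    then have "exp (- (- cos \<phi> * s * exp x)) \<le> 1" by simp
    then show ?thesis using mult_right_mono[OF _ norm_ge_zero] by fastforce
  qed
  then show "\<exists>d>0. \<exists>G. integrable lborel G \<and> (\<forall>s\<in>{0..}. \<bar>s - t\<bar> < d \<longrightarrow> (\<forall>x. exp (- (- cos \<phi> * s * exp x)) * norm (g (Complex x \<phi>)) \<le> G x))"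
    using i by (intro exI[of _ 1] conjI exI[of _ "\<lambda>x. norm (g (Complex x \<phi>))"]) auto
qed auto

text \<open>Exchanging the time integral with the contour integral turns the exponential into the
  Cauchy kernel \<open>1 / (z - \<zeta> x)\<close>, and \<open>ray_cauchy\<close> evaluates the
  result. The exchange is absolutely convergent because \<open>z - \<zeta> x\<close> has real part
  at least \<open>z\<close> and at least a multiple of \<open>exp x\<close>.\<close>

lemma has_laplace_ilap:
  assumes g: "symbol g"
  shows "has_laplace (ilap \<phi> g) (\<lambda>z. Re (g (of_real (ln z))) / z)"
  unfolding has_laplace_def
proof (intro allI impI)
  fix z :: real assume z1: "z \<ge> 1"
  then have z: "z > 0" by simp
  obtain C p q where C: "p > 0" "q < 1" "\<And>w. \<bar>Im w\<bar> \<le> \<phi> \<Longrightarrow> norm (g w) \<le> C * exp (p * Re w)"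
    "\<And>w. \<bar>Im w\<bar> \<le> \<phi> \<Longrightarrow> norm (g w) \<le> C * exp (q * Re w)"
    using g unfolding symbol_def by blast
  have C0: "C \<ge> 0" using C(3)[of 0] \<phi> norm_ge_zero[of "g 0"] by (simp, linarith)
  have hol: "g holomorphic_on {w. \<bar>Im w\<bar> < \<phi>1}" and sym: "\<And>w. g (cnj w) = cnj (g w)"
    using g by (auto simp: symbol_def)
  note [measurable] = symbol_line(2)[OF g]
  define \<zeta> where "\<zeta> x = exp (Complex x \<phi>)" for x
  have \<zeta>: "\<zeta> x = of_real (exp x) * cis \<phi>" for x by (simp add: \<zeta>_def exp_eq_polar)
  have [measurable]: "\<zeta> \<in> borel_measurable borel" unfolding \<zeta>[abs_def] by measurable
  define H where "H = (\<lambda>(x, t). indicator {0<..} t *\<^sub>R (exp (- (of_real t * (of_real z - \<zeta> x))) * g (Complex x \<phi>)))"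
  have [measurable]: "H \<in> borel_measurable (lborel \<Otimes>\<^sub>M lborel)" unfolding H_def by measurable
  have Re\<zeta>: "Re (of_real z - \<zeta> x) = z + (- cos \<phi>) * exp x" for x by (simp add: \<zeta>_def Re_exp)
  have pos: "Re (of_real z - \<zeta> x) > 0" for x
    unfolding Re\<zeta> using z \<phi> mult_pos_pos[of "- cos \<phi>" "exp x"] by simp
  have Ht: "has_bochner_integral lborel (\<lambda>t. H (x, t)) (1 / (of_real z - \<zeta> x) * g (Complex x \<phi>))" for x
    using has_bochner_integral_mult_left[OF has_bochner_integral_exp_complex[OF pos[of x]], of "g (Complex x \<phi>)"]
    by (simp add: H_def)
  have nH: "norm (H (x, t)) = indicator {0<..} t * exp (- (t * (z + (- cos \<phi>) * exp x))) * norm (g (Complex x \<phi>))" for x t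
    using Re\<zeta>[of x] by (simp add: H_def norm_mult norm_exp_eq_Re abs_mult)
  have nHt: "(\<integral>t. norm (H (x, t)) \<partial>lborel) = norm (g (Complex x \<phi>)) / (z + (- cos \<phi>) * exp x)" for x
  proof -
    define r where "r = z + (- cos \<phi>) * exp x"
    have r: "r > 0" using pos[of x] by (simp only: r_def Re\<zeta>)
    have "has_bochner_integral lborel (\<lambda>t. complex_of_real (indicator {0<..} t * exp (- (t * r)))) (of_real (1/r))"
      using has_bochner_integral_exp_complex[of "of_real r"] r
      by (simp add: scaleR_conv_of_real exp_of_real[symmetric])
    then have "(\<integral>t. complex_of_real (indicator {0<..} t * exp (- (t * r))) \<partial>lborel) = of_real (1/r)"
      by (rule has_bochner_integral_integral_eq)
    then have "(\<integral>t. indicator {0<..} t * exp (- (t * r)) \<partial>lborel) = 1/r"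
      by (simp only: integral_complex_of_real of_real_eq_iff)
    then show ?thesis unfolding nH r_def[symmetric] by simp
  qed
  have Hi: "integrable (lborel \<Otimes>\<^sub>M lborel) H"
  proof (rule lborel_pair.Fubini_integrable)
    show "AE x in lborel. integrable lborel (\<lambda>t. H (x, t))" using Ht by (auto simp: has_bochner_integral_iff)
    show "integrable lborel (\<lambda>x. \<integral>t. norm (H (x, t)) \<partial>lborel)"
      unfolding nHt
    proof (rule integrable_two_sided_exp[of _ p "q - 1" "C / z" "C / (- cos \<phi>)"])
      fix x
      have e: "z + - cos \<phi> * exp x \<ge> z" "z + - cos \<phi> * exp x \<ge> (- cos \<phi>) * exp x" "(- cos \<phi>) * exp x > 0"
        using z \<phi> mult_pos_pos[of "- cos \<phi>" "exp x"] by (simp_all)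
      have "norm (g (Complex x \<phi>)) / (z + - cos \<phi> * exp x) \<le> (C * exp (p * x)) / z"
        using C(3)[of "Complex x \<phi>"] \<phi> C0 z by (intro frac_le e) auto
      then show "norm (norm (g (Complex x \<phi>)) / (z + - cos \<phi> * exp x)) \<le> C / z * exp (p * x)"
        using e z by simp
      have "norm (g (Complex x \<phi>)) / (z + - cos \<phi> * exp x) \<le> (C * exp (q * x)) / ((- cos \<phi>) * exp x)"
        using C(4)[of "Complex x \<phi>"] \<phi> C0 z by (intro frac_le e) auto
      also have "\<dots> = C / (- cos \<phi>) * exp ((q - 1) * x)" by (simp add: left_diff_distrib exp_diff)
      finally show "norm (norm (g (Complex x \<phi>)) / (z + - cos \<phi> * exp x)) \<le> C / (- cos \<phi>) * exp ((q - 1) * x)"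
        using e z by simp
    qed (use C in auto)
  qed measurable
  then have Hi': "integrable (lborel \<Otimes>\<^sub>M lborel) (case_prod (\<lambda>x t. H (x, t)))" by simp
  have Ix: "Im (\<integral>x. H (x, t) \<partial>lborel) = pi * (indicator {0<..} t *\<^sub>R (exp (- (z * t)) * ilap \<phi> g t))" for t
  proof -
    have "H (x, t) = of_real (indicator {0<..} t * exp (- (z * t))) * (exp (of_real t * exp (Complex x \<phi>)) * g (Complex x \<phi>))" for x
      by (simp add: H_def \<zeta>_def right_diff_distrib exp_diff exp_minus scaleR_conv_of_real exp_of_real[symmetric] field_simps)
    then have "(\<integral>x. H (x, t) \<partial>lborel) = of_real (indicator {0<..} t * exp (- (z * t))) * (\<integral>x. exp (of_real t * exp (Complex x \<phi>)) * g (Complex x \<phi>) \<partial>lborel)"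
      by (simp only: integral_mult_right_zero)
    then show ?thesis by (simp add: ilap_def)
  qed
  have i1: "integrable lborel (\<lambda>t. \<integral>x. H (x, t) \<partial>lborel)"
    by (rule lborel_pair.integrable_snd[OF Hi'])
  have e1: "(\<integral>t. \<integral>x. H (x, t) \<partial>lborel \<partial>lborel) = (\<integral>x. \<integral>t. H (x, t) \<partial>lborel \<partial>lborel)"
    by (rule lborel_pair.Fubini_integral[OF Hi'])
  have e2: "(\<integral>x. \<integral>t. H (x, t) \<partial>lborel \<partial>lborel) = (\<integral>x. g (Complex x \<phi>) / (of_real z - exp (Complex x \<phi>)) \<partial>lborel)"
    using has_bochner_integral_integral_eq[OF Ht] by (simp add: \<zeta>_def)
  have e3: "Im (\<integral>x. g (Complex x \<phi>) / (of_real z - exp (Complex x \<phi>)) \<partial>lborel) = pi * Re (g (of_real (ln z))) / z"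
    by (rule ray_cauchy(2)[OF \<phi> z C(1,2) hol C(3,4) sym])
  have "integrable lborel (\<lambda>t. Im (\<integral>x. H (x, t) \<partial>lborel))" using i1 by simp
  then have A: "integrable lborel (\<lambda>t. indicator {0<..} t *\<^sub>R (exp (- (z * t)) * ilap \<phi> g t))"
    unfolding Ix using pi_neq_zero by simp
  have "(\<integral>t. Im (\<integral>x. H (x, t) \<partial>lborel) \<partial>lborel) = pi * Re (g (of_real (ln z))) / z"
    using i1 e1 e2 e3 by simp
  then have "pi * (\<integral>t. indicator {0<..} t *\<^sub>R (exp (- (z * t)) * ilap \<phi> g t) \<partial>lborel) = pi * (Re (g (of_real (ln z))) / z)"
    unfolding Ix by simp
  then have B: "(\<integral>t. indicator {0<..} t *\<^sub>R (exp (- (z * t)) * ilap \<phi> g t) \<partial>lborel) = Re (g (of_real (ln z))) / z"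
    by (metis mult_left_cancel pi_neq_zero)
  show "set_integrable lborel {0<..} (\<lambda>t. exp (- (z * t)) * ilap \<phi> g t) \<and>
         (LINT t:{0<..}|lborel. exp (- (z * t)) * ilap \<phi> g t) = Re (g (of_real (ln z))) / z"
    using A B by (simp add: set_integrable_def set_lebesgue_integral_def)
qed
end

section \<open>Convolutions with locally integrable kernels\<close>

lemma has_laplace_locally_integrable:
  assumes "has_laplace f F"
  shows "set_integrable lborel {0<..<T} f"
proof -
  have 1: "integrable lborel (\<lambda>t. indicator {0<..} t * (exp (- t) * f t))"
    using assms[unfolded has_laplace_def, rule_format, of 1] by (simp add: set_integrable_def)
  have "integrable lborel (\<lambda>t. exp \<bar>T\<bar> * (indicator {0<..} t * (exp (- t) * f t)))" using 1 by simp
  then have "integrable lborel (\<lambda>t. indicator {0<..<T} t * exp t * (indicator {0<..} t * (exp (- t) * f t)))"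
  proof (rule Bochner_Integration.integrable_bound)
    show "(\<lambda>t. indicator {0<..<T} t * exp t * (indicator {0<..} t * (exp (- t) * f t))) \<in> borel_measurable lborel"
      by (rule borel_measurable_times[OF _ borel_measurable_integrable[OF 1]]) simp
    show "AE t in lborel. norm (indicator {0<..<T} t * exp t * (indicator {0<..} t * (exp (- t) * f t)))
        \<le> norm (exp \<bar>T\<bar> * (indicator {0<..} t * (exp (- t) * f t)))"
      unfolding norm_mult by (intro AE_I2 mult_right_mono) (auto simp: indicator_def)
  qed
  also have "(\<lambda>t. indicator {0<..<T} t * exp t * (indicator {0<..} t * (exp (- t) * f t))) = (\<lambda>t. indicator {0<..<T} t *\<^sub>R f t)"
    by (auto simp: fun_eq_iff indicator_def exp_minus)
  finally show ?thesis by (simp add: set_integrable_def)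
qed

text \<open>Dominated convergence against a multiple of the kernel on a fixed interval reaching past
  \<open>t\<close>. The moving domain of integration is put into an indicator, which converges
  except at the single point \<open>s = t\<close>.\<close>

lemma conv_continuous:
  fixes \<sigma> k :: "real \<Rightarrow> real"
  assumes \<sigma>: "continuous_on {0..} \<sigma>" and k: "\<And>T. set_integrable lborel {0<..<T} k"
  shows "continuous_on {0..} (conv \<sigma> k)"
  unfolding continuous_on_def tendsto_at_iff_sequentially o_def
proof (intro ballI allI impI)
  fix t :: real and X assume t: "t \<in> {0..}" and X: "\<forall>i. X i \<in> {0..} - {t}" "X \<longlonglongrightarrow> t"
  define \<tau> where "\<tau> x = \<sigma> (max 0 x)" for x
  have \<tau>c: "continuous_on UNIV \<tau>" unfolding \<tau>_def
    by (rule continuous_on_compose2[OF \<sigma>]) (auto intro!: continuous_intros)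
  then have [measurable]: "\<tau> \<in> borel_measurable borel" by (rule borel_measurable_continuous_onI)
  define T where "T = t + 1"
  have ki: "integrable lborel (\<lambda>s. indicator {0<..<T} s * k s)" using k[of T] by (simp add: set_integrable_def)
  then have [measurable]: "(\<lambda>s. indicator {0<..<T} s * k s) \<in> borel_measurable borel" by simp
  obtain B where B: "\<And>x. x \<in> {0..T} \<Longrightarrow> norm (\<tau> x) \<le> B"
    using compact_imp_bounded[OF compact_continuous_image[OF continuous_on_subset[OF \<tau>c] compact_Icc]]
    by (force simp: bounded_iff)
  obtain N where N: "\<And>n. n \<ge> N \<Longrightarrow> \<bar>X n - t\<bar> < 1"
    using LIMSEQ_D[OF X(2), of 1] by auto
  have e: "conv \<sigma> k u = (\<integral>s. indicator {0<..<u} s * \<tau> (u - s) * (indicator {0<..<T} s * k s) \<partial>lborel)" if "u \<le> T" for u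
    unfolding conv_def set_lebesgue_integral_def \<tau>_def using that
    by (intro Bochner_Integration.integral_cong) (auto simp: indicator_def)
  have tT: "t \<le> T" by (simp add: T_def)
  have XT: "X (n + N) \<le> T" for n using N[of "n + N"] by (auto simp: T_def abs_if split: if_splits)
  have "(\<lambda>n. \<integral>s. indicator {0<..<X (n + N)} s * \<tau> (X (n + N) - s) * (indicator {0<..<T} s * k s) \<partial>lborel) \<longlonglongrightarrow>
     (\<integral>s. indicator {0<..<t} s * \<tau> (t - s) * (indicator {0<..<T} s * k s) \<partial>lborel)"
  proof (rule integral_dominated_convergence[where w="\<lambda>s. \<bar>B\<bar> * norm (indicator {0<..<T} s * k s)"])
    have XN: "(\<lambda>n. X (n + N)) \<longlonglongrightarrow> t" by (rule LIMSEQ_ignore_initial_segment[OF X(2)])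
    show "AE s in lborel. (\<lambda>n. indicator {0<..<X (n + N)} s * \<tau> (X (n + N) - s) * (indicator {0<..<T} s * k s))
        \<longlonglongrightarrow> indicator {0<..<t} s * \<tau> (t - s) * (indicator {0<..<T} s * k s)"
      using AE_lborel_singleton[of t]
    proof eventually_elim
      case (elim s)
      have "\<forall>\<^sub>F n in sequentially. indicator {0<..<X (n + N)} s = (indicator {0<..<t} s :: real)"
      proof (cases "s < t")
        case True
        show ?thesis using order_tendstoD(1)[OF XN True] by eventually_elim (use True in \<open>auto simp: indicator_def\<close>)
      next
        case False
        then have "t < s" using elim by simp
        from order_tendstoD(2)[OF XN this] show ?thesis by eventually_elim (use \<open>t < s\<close> in \<open>auto simp: indicator_def\<close>)
      qed
      then have 1: "(\<lambda>n. indicator {0<..<X (n + N)} s) \<longlonglongrightarrow> (indicator {0<..<t} s :: real)" by (rule tendsto_eventually)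
      have "isCont \<tau> (t - s)" using \<tau>c by (simp add: continuous_on_eq_continuous_at)
      then have 2: "(\<lambda>n. \<tau> (X (n + N) - s)) \<longlonglongrightarrow> \<tau> (t - s)"
        by (rule isCont_tendsto_compose) (intro tendsto_intros XN)
      show ?case by (intro tendsto_intros 1 2)
    qed
    show "AE s in lborel. norm (indicator {0<..<X (n + N)} s * \<tau> (X (n + N) - s) * (indicator {0<..<T} s * k s)) \<le> \<bar>B\<bar> * norm (indicator {0<..<T} s * k s)" for n
      unfolding norm_mult[of _ "indicator {0<..<T} _ * k _"]
    proof (intro AE_I2 mult_right_mono)
      fix s
      have "\<bar>\<tau> (X (n + N) - s)\<bar> \<le> \<bar>B\<bar>" if "0 < s" "s < X (n + N)"
        using B[of "X (n + N) - s"] XT[of n] that by auto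
      then show "norm (indicator {0<..<X (n + N)} s * \<tau> (X (n + N) - s)) \<le> \<bar>B\<bar>"
        by (auto simp: indicator_def)
    qed auto
  qed (use ki in auto)
  then show "(\<lambda>n. conv \<sigma> k (X n)) \<longlonglongrightarrow> conv \<sigma> k t"
    unfolding e[OF XT, symmetric] e[OF tT, symmetric] by (rule LIMSEQ_offset[of _ N])
qed

lemma has_laplace_one: "has_laplace (\<lambda>t. 1) (\<lambda>z. 1 / z)"
  by (rule has_laplace_cong[OF has_laplace_power[of 1]]) (auto simp: powr_minus_divide)


section \<open>The scalar system\<close>

text \<open>Here \<open>a = 2 - \<delta>\<close> and \<open>b = 2 - \<beta>\<close>, so that \<open>\<alpha> = a - b\<close>.\<close>

locale frac_kernel =
  fixes a b :: real
  assumes ab: "1 < b" "b < a" "a < 2"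
begin

text \<open>The midpoint between \<open>pi / 2\<close>, beyond which \<open>exp (t z)\<close>
  decays, and \<open>pi / a\<close>, where \<open>z powr a\<close> reaches the negative real axis
  and zeros of the symbol can no longer be excluded. The interval is nonempty because
  \<open>a < 2\<close>.\<close>

definition \<phi> where "\<phi> = (pi / 2 + pi / a) / 2"
definition \<phi>1 where "\<phi>1 = pi / a"

lemma a_pos: "a > 0" using ab by simp

lemma \<phi>_bounds: "0 < \<phi>" "\<phi> < \<phi>1" "\<phi>1 \<le> pi" "pi / 2 < \<phi>" "a * \<phi> < pi"
proof -
  have 1: "pi / 2 < pi / a" using ab pi_gt_zero by (intro divide_strict_left_mono) auto
  have avg: "(x + y) / 2 < y \<and> x < (x + y) / 2" if "x < y" for x y :: real using that by auto
  show 2: "\<phi> < \<phi>1" unfolding \<phi>_def \<phi>1_def using avg[OF 1] by blast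
  show "pi / 2 < \<phi>" unfolding \<phi>_def using avg[OF 1] by blast
  then show "0 < \<phi>" using pi_gt_zero by linarith
  show "\<phi>1 \<le> pi" using ab pi_gt_zero by (simp add: \<phi>1_def divide_le_eq mult_le_cancel_left1)
  have "a * \<phi> < a * \<phi>1" using 2 a_pos by simp
  then show "a * \<phi> < pi" using a_pos by (simp add: \<phi>1_def)
qed

sublocale rays \<phi> \<phi>1
proof
  show "cos \<phi> < 0"
    using cos_monotone_0_pi[of "pi/2" \<phi>] \<phi>_bounds pi_gt_zero by simp
qed (use \<phi>_bounds in auto)

text \<open>\<open>c0\<close> is the rate of decay of \<open>exp (t z)\<close> along the rays;
  \<open>c1\<close> is the loss in comparing the modulus of the symbol with its value at the modulus
  of \<open>z\<close>.\<close>

definition c0 where "c0 = - cos \<phi>"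
definition c1 where "c1 = cos (a * \<phi> / 2)"

lemma c0_pos: "c0 > 0" using \<phi> by (simp add: c0_def)
lemma c1_pos: "c1 > 0"
  unfolding c1_def using \<phi>_bounds a_pos mult_pos_pos[of a \<phi>] by (intro cos_gt_zero) auto

text \<open>\<open>P lam\<close> is the symbol \<open>z\<^sup>a + z\<^sup>b + lam\<close> at \<open>z = exp w\<close>, and \<open>X lam x\<close> its value at \<open>w = x\<close>.\<close>

definition P :: "real \<Rightarrow> complex \<Rightarrow> complex" where
  "P lam w = exp (of_real a * w) + exp (of_real b * w) + of_real lam"
definition X :: "real \<Rightarrow> real \<Rightarrow> real" where
  "X lam x = exp (a * x) + exp (b * x) + lam"

section \<open>Lower bounds for the symbol in the sector\<close>

lemma X_pos: "lam \<ge> 0 \<Longrightarrow> X lam x > 0"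
  by (simp add: X_def add_pos_nonneg)

text \<open>Multiplication by \<open>cis (- (a * y / 2))\<close>, where \<open>y = Im w\<close>,
  gives the three terms the arguments \<open>a * y / 2\<close>, \<open>b * y - a * y / 2\<close> and
  \<open>- (a * y / 2)\<close>. As \<open>b\<close> lies between \<open>0\<close> and
  \<open>a\<close>, none exceeds the first in absolute value, so each real part is at least
  \<open>cos (a * y / 2)\<close> times the modulus.\<close>

lemma P_lower:
  assumes lam: "lam \<ge> 0" and w: "a * \<bar>Im w\<bar> \<le> pi"
  shows "cos (a * \<bar>Im w\<bar> / 2) * X lam (Re w) \<le> norm (P lam w)"
proof -
  define x y where "x = Re w" and "y = Im w"
  have e: "exp (of_real r * w) = of_real (exp (r * x)) * cis (r * y)" for r
    by (simp add: exp_eq_polar x_def y_def)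
  have "Re (cis (- (a * y / 2)) * P lam w) = exp (a * x) * cos (a * y / 2) + exp (b * x) * cos (b * y - a * y / 2) + lam * cos (a * y / 2)"
  proof -
    have "cis (- (a * y / 2)) * P lam w = of_real (exp (a * x)) * cis (a * y / 2) + of_real (exp (b * x)) * cis (b * y - a * y / 2) + of_real lam * cis (- (a * y / 2))"
      unfolding P_def e distrib_left mult.left_commute[of "cis _"] cis_mult by (simp add: algebra_simps)
    then show ?thesis by simp
  qed
  moreover have "cos (a * y / 2) \<le> cos (b * y - a * y / 2)"
  proof -
    have "\<bar>b * y - a * y / 2\<bar> = \<bar>b - a / 2\<bar> * \<bar>y\<bar>" by (simp flip: abs_mult add: algebra_simps)
    also have "\<dots> \<le> (a / 2) * \<bar>y\<bar>" using ab by (intro mult_right_mono) auto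
    also have "\<dots> = \<bar>a * y / 2\<bar>" using a_pos by (simp add: abs_mult)
    finally have "\<bar>b * y - a * y / 2\<bar> \<le> \<bar>a * y / 2\<bar>" .
    moreover have "a * \<bar>y\<bar> \<le> pi * 2" using w pi_gt_zero unfolding y_def by linarith
    then have "\<bar>a * y / 2\<bar> \<le> pi" using a_pos by (simp add: abs_mult)
    ultimately have "cos \<bar>a * y / 2\<bar> \<le> cos \<bar>b * y - a * y / 2\<bar>" by (intro cos_monotone_0_pi_le) auto
    then show ?thesis by (simp only: cos_abs_real)
  qed
  then have "exp (b * x) * cos (a * y / 2) \<le> exp (b * x) * cos (b * y - a * y / 2)" by (intro mult_left_mono) auto
  ultimately have "cos (a * y / 2) * X lam x \<le> Re (cis (- (a * y / 2)) * P lam w)"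
    by (simp add: X_def algebra_simps)
  also have "\<dots> \<le> norm (cis (- (a * y / 2)) * P lam w)" by (rule complex_Re_le_cmod)
  also have "\<dots> = norm (P lam w)" by (simp add: norm_mult)
  finally have "cos (a * y / 2) * X lam x \<le> norm (P lam w)" .
  moreover have "cos (a * \<bar>y\<bar> / 2) = cos (a * y / 2)" by (cases "y \<ge> 0") auto
  ultimately show ?thesis by (simp add: x_def y_def)
qed

lemma P_lower_strip:
  assumes lam: "lam \<ge> 0" and w: "\<bar>Im w\<bar> \<le> \<phi>"
  shows "c1 * X lam (Re w) \<le> norm (P lam w)"
proof -
  have 1: "a * \<bar>Im w\<bar> \<le> a * \<phi>" using w a_pos by simp
  then have "c1 \<le> cos (a * \<bar>Im w\<bar> / 2)" unfolding c1_def
    using \<phi>_bounds a_pos by (intro cos_monotone_0_pi_le) auto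
  then have "c1 * X lam (Re w) \<le> cos (a * \<bar>Im w\<bar> / 2) * X lam (Re w)"
    using X_pos[OF lam] by (intro mult_right_mono) (auto simp: less_imp_le)
  also have "\<dots> \<le> norm (P lam w)" using 1 \<phi>_bounds by (intro P_lower lam) linarith
  finally show ?thesis .
qed

lemma P_nonzero:
  assumes lam: "lam \<ge> 0" and w: "\<bar>Im w\<bar> < \<phi>1"
  shows "P lam w \<noteq> 0"
proof -
  have 1: "a * \<bar>Im w\<bar> < pi" using w a_pos by (simp add: \<phi>1_def field_simps)
  have "0 < cos (a * \<bar>Im w\<bar> / 2) * X lam (Re w)"
    using 1 a_pos X_pos[OF lam] pi_gt_zero by (intro mult_pos_pos cos_gt_zero_pi) (auto simp: less_le_trans[of _ 0])
  also have "\<dots> \<le> norm (P lam w)" using 1 by (intro P_lower lam) auto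
  finally show ?thesis by auto
qed

lemma quot_bound:
  assumes lam: "lam \<ge> 0" and w: "\<bar>Im w\<bar> \<le> \<phi>" and N: "norm (N w) \<le> M (Re w)"
  shows "norm (N w / P lam w) \<le> M (Re w) / X lam (Re w) / c1"
proof -
  have "norm (N w / P lam w) \<le> M (Re w) / (c1 * X lam (Re w))"
    unfolding norm_divide using N P_lower_strip[OF lam w] X_pos[OF lam] c1_pos
    by (intro frac_le) (auto intro: order_trans[OF norm_ge_zero])
  then show ?thesis by (simp add: mult.commute)
qed

text \<open>The constants \<open>K\<close> and \<open>K'\<close> may depend on \<open>lam\<close>:
  here only admissibility of the quotient is at stake, while uniform estimates are made separately
  for each kernel.\<close>

lemma symbol_quot:
  assumes lam: "lam \<ge> 0" and N: "N holomorphic_on UNIV" "\<And>w. N (cnj w) = cnj (N w)"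
    "\<And>w. norm (N w) \<le> M (Re w)"
    and pq: "p > 0" "q < 1" and M: "\<And>x. M x \<le> K * exp (p * x) * X lam x" "\<And>x. M x \<le> K' * exp (q * x) * X lam x"
  shows "symbol (\<lambda>w. N w / P lam w)"
  unfolding symbol_def
proof (intro conjI allI)
  show "(\<lambda>w. N w / P lam w) holomorphic_on {w. \<bar>Im w\<bar> < \<phi>1}"
    using P_nonzero[OF lam] unfolding P_def
    by (intro holomorphic_intros holomorphic_on_subset[OF N(1)]) auto
  show "N (cnj w) / P lam (cnj w) = cnj (N w / P lam w)" for w
    by (simp add: N(2) P_def exp_cnj)
  have "norm (N w / P lam w) \<le> (max K K' / c1) * exp (p * Re w) \<and> norm (N w / P lam w) \<le> (max K K' / c1) * exp (q * Re w)"
    if w: "\<bar>Im w\<bar> \<le> \<phi>" for w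
  proof -
    have Xp: "X lam (Re w) > 0" by (rule X_pos[OF lam])
    have q: "norm (N w / P lam w) \<le> M (Re w) / X lam (Re w) / c1" by (rule quot_bound[where N=N and M=M, OF lam w N(3)])
    have "M (Re w) / X lam (Re w) \<le> K * exp (p * Re w)" "M (Re w) / X lam (Re w) \<le> K' * exp (q * Re w)"
      using M Xp by (auto simp: divide_le_eq)
    moreover have "K * exp (p * Re w) \<le> max K K' * exp (p * Re w)" "K' * exp (q * Re w) \<le> max K K' * exp (q * Re w)"
      by (auto intro!: mult_right_mono)
    ultimately have "M (Re w) / X lam (Re w) \<le> max K K' * exp (p * Re w)" "M (Re w) / X lam (Re w) \<le> max K K' * exp (q * Re w)"
      by linarith+
    from this[THEN divide_right_mono, OF less_imp_le[OF c1_pos]]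
    show ?thesis using q by auto
  qed
  then show "\<exists>C p q. p > 0 \<and> q < 1 \<and> (\<forall>w. \<bar>Im w\<bar> \<le> \<phi> \<longrightarrow>
        norm (N w / P lam w) \<le> C * exp (p * Re w) \<and> norm (N w / P lam w) \<le> C * exp (q * Re w))"
    using pq by blast
qed

text \<open>An intermediate power is below \<open>1 + exp (a * x)\<close>; the first summand is paid
  for by \<open>lam\<close>, hence the factor \<open>1 / lam\<close>.\<close>

lemma exp_le_X:
  assumes lam: "lam > 0" and q: "0 \<le> q" "q \<le> a"
  shows "exp (q * x) \<le> (1 + 1 / lam) * X lam x"
proof -
  have "exp (q * x) \<le> 1 + exp (a * x)"
  proof (cases "x \<ge> 0")
    case True
    then have "q * x \<le> a * x" using q by (intro mult_right_mono)
    then show ?thesis by (simp add: add_increasing)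
  next
    case False
    then have "q * x \<le> 0" using q by (intro mult_nonneg_nonpos) auto
    then show ?thesis by (simp add: add_increasing2)
  qed
  moreover have "1 \<le> (1 / lam) * X lam x"
    using lam by (simp add: X_def field_simps)
  moreover have "exp (a * x) \<le> 1 * X lam x" using lam by (simp add: X_def)
  ultimately show ?thesis unfolding distrib_right by linarith
qed

text \<open>For exponents between \<open>b\<close> and \<open>a\<close> one of the two powers in
  \<open>X\<close> dominates, according to the sign of \<open>x\<close>. No help from
  \<open>lam\<close> is needed, so \<open>lam = 0\<close> is covered.\<close>

lemma exp_le_X':
  assumes lam: "lam \<ge> 0" and q: "b \<le> q" "q \<le> a"
  shows "exp (q * x) \<le> X lam x"
proof (cases "x \<ge> 0")
  case True
  then have "q * x \<le> a * x" using q by (intro mult_right_mono)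
  then have "exp (q * x) \<le> exp (a * x)" by simp
  then show ?thesis unfolding X_def using exp_gt_zero[of "b * x"] lam by linarith
next
  case False
  then have "q * x \<le> b * x" using q by (intro mult_right_mono_neg) auto
  then have "exp (q * x) \<le> exp (b * x)" by simp
  then show ?thesis unfolding X_def using exp_gt_zero[of "a * x"] lam by linarith
qed

text \<open>The functions \<open>e0\<close> to \<open>e3\<close> and \<open>eh\<close> have the Laplace transforms \<open>1 / Q\<close>, \<open>z\<^bsup>a - 2\<^esup> / Q\<close>,
  \<open>z\<^bsup>a - 1\<^esup> / Q\<close>, \<open>(1 - lam / Q) / z\<close> and \<open>- (z\<^sup>b + lam) / Q\<close>, where \<open>Q = z\<^sup>a + z\<^sup>b + lam\<close>.\<close>

definition N0 :: "complex \<Rightarrow> complex" where "N0 w = exp w"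
definition N1 :: "complex \<Rightarrow> complex" where "N1 w = exp (of_real (a - 1) * w)"
definition N2 :: "complex \<Rightarrow> complex" where "N2 w = exp (of_real a * w)"
definition N3 :: "complex \<Rightarrow> complex" where "N3 w = exp (of_real a * w) + exp (of_real b * w)"
definition Nh :: "real \<Rightarrow> complex \<Rightarrow> complex" where "Nh lam w = - (exp (of_real (b + 1) * w) + of_real lam * exp w)"

definition e0 where "e0 lam = ilap \<phi> (\<lambda>w. N0 w / P lam w)"
definition e1 where "e1 lam = ilap \<phi> (\<lambda>w. N1 w / P lam w)"
definition e2 where "e2 lam = ilap \<phi> (\<lambda>w. N2 w / P lam w)"
definition e3 where "e3 lam = ilap \<phi> (\<lambda>w. N3 w / P lam w)"
definition eh where "eh lam = ilap \<phi> (\<lambda>w. Nh lam w / P lam w)"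

lemmas N_defs = N0_def N1_def N2_def N3_def Nh_def

section \<open>Admissibility of the five numerators\<close>

lemma N_hol: "N0 holomorphic_on S" "N1 holomorphic_on S" "N2 holomorphic_on S" "N3 holomorphic_on S" "Nh lam holomorphic_on S"
  unfolding N_defs[abs_def] by (intro holomorphic_intros)+

lemma N_cnj: "N0 (cnj w) = cnj (N0 w)" "N1 (cnj w) = cnj (N1 w)" "N2 (cnj w) = cnj (N2 w)" "N3 (cnj w) = cnj (N3 w)" "Nh lam (cnj w) = cnj (Nh lam w)"
  by (simp_all add: N_defs exp_cnj)

lemma N_norm: "norm (N0 w) \<le> exp (Re w)" "norm (N1 w) \<le> exp ((a - 1) * Re w)" "norm (N2 w) \<le> exp (a * Re w)"
  "norm (N3 w) \<le> exp (a * Re w) + exp (b * Re w)" "lam \<ge> 0 \<Longrightarrow> norm (Nh lam w) \<le> exp ((b + 1) * Re w) + lam * exp (Re w)"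
  unfolding N_defs norm_minus_cancel by (auto intro!: order_trans[OF norm_triangle_ineq] simp: norm_exp_eq_Re norm_mult)

lemma symbol_0: "lam > 0 \<Longrightarrow> symbol (\<lambda>w. N0 w / P lam w)"
proof (rule symbol_quot[OF _ N_hol(1) N_cnj(1) N_norm(1), where p=1 and q=0 and K="1+1/lam" and K'="1+1/lam"])
  fix x assume lam: "lam > 0"
  show "exp x \<le> (1 + 1/lam) * exp (1 * x) * X lam x"
    using mult_left_mono[OF exp_le_X[OF lam, of 0 x], of "exp x"] a_pos by (simp add: mult_ac)
  show "exp x \<le> (1 + 1/lam) * exp (0 * x) * X lam x"
    using exp_le_X[OF lam, of 1 x] ab by simp
qed auto

lemma symbol_1: "lam > 0 \<Longrightarrow> symbol (\<lambda>w. N1 w / P lam w)"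
proof (rule symbol_quot[OF _ N_hol(2) N_cnj(2) N_norm(2), where p="a-1" and q=0 and K="1+1/lam" and K'="1+1/lam"])
  fix x assume lam: "lam > 0"
  show "exp ((a - 1) * x) \<le> (1 + 1/lam) * exp ((a - 1) * x) * X lam x"
    using mult_left_mono[OF exp_le_X[OF lam, of 0 x], of "exp ((a - 1) * x)"] a_pos by (simp add: mult_ac)
  show "exp ((a - 1) * x) \<le> (1 + 1/lam) * exp (0 * x) * X lam x"
    using exp_le_X[OF lam, of "a - 1" x] ab by simp
qed (use ab in auto)

text \<open>Near zero the numerator is compared with \<open>z powr b\<close> instead of
  \<open>lam\<close>. This keeps \<open>lam = 0\<close> admissible, the case of the relaxation
  function.\<close>

lemma symbol_2: "lam \<ge> 0 \<Longrightarrow> symbol (\<lambda>w. N2 w / P lam w)"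
proof (rule symbol_quot[OF _ N_hol(3) N_cnj(3) N_norm(3), where p="a-b" and q=0 and K=1 and K'=1])
  fix x assume lam: "lam \<ge> 0"
  have "exp (a * x) = exp ((a - b) * x) * exp (b * x)" by (simp add: algebra_simps flip: exp_add)
  also have "\<dots> \<le> exp ((a - b) * x) * X lam x" using exp_le_X'[OF lam, of b x] ab by (intro mult_left_mono) auto
  finally show "exp (a * x) \<le> 1 * exp ((a - b) * x) * X lam x" by simp
  show "exp (a * x) \<le> 1 * exp (0 * x) * X lam x"
    using exp_le_X'[OF lam, of a x] ab by simp
qed (use ab in auto)

lemma symbol_3: "lam > 0 \<Longrightarrow> symbol (\<lambda>w. N3 w / P lam w)"
proof (rule symbol_quot[OF _ N_hol(4) N_cnj(4) N_norm(4), where p="b" and q=0 and K="2 * (1+1/lam)" and K'=1])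
  fix x assume lam: "lam > 0"
  have "exp (a * x) + exp (b * x) = exp (b * x) * (exp ((a - b) * x) + exp (0 * x))" by (simp add: algebra_simps flip: exp_add)
  also have "\<dots> \<le> exp (b * x) * ((1 + 1/lam) * X lam x + (1 + 1/lam) * X lam x)"
    using ab by (intro mult_left_mono add_mono exp_le_X lam) auto
  finally show "exp (a * x) + exp (b * x) \<le> 2 * (1 + 1/lam) * exp (b * x) * X lam x" by (simp add: algebra_simps)
  show "exp (a * x) + exp (b * x) \<le> 1 * exp (0 * x) * X lam x"
    using lam by (simp add: X_def)
qed (use ab in auto)

text \<open>At infinity the quotient grows like \<open>z powr (1 - (a - b))\<close>, still below the
  first power because \<open>b < a\<close>. This is the singularity
  \<open>t powr (a - b - 1)\<close> of \<open>eh\<close> at zero.\<close>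

lemma symbol_h: "lam \<ge> 0 \<Longrightarrow> symbol (\<lambda>w. Nh lam w / P lam w)"
proof (rule symbol_quot[OF _ N_hol(5) N_cnj(5) N_norm(5), where p=1 and q="1-(a-b)" and K=1 and K'="1 + lam * (1 + 1/lam)"])
  fix x assume lam: "lam \<ge> 0"
  have e: "exp ((b + 1) * x) = exp x * exp (b * x)" by (simp add: algebra_simps flip: exp_add)
  have "exp x * (exp (b * x) + lam) \<le> exp x * X lam x" by (intro mult_left_mono) (auto simp: X_def)
  then show "exp ((b + 1) * x) + lam * exp x \<le> 1 * exp (1 * x) * X lam x" unfolding e by (simp add: algebra_simps)
  have "exp ((b + 1) * x) = exp ((1-(a-b)) * x) * exp (a * x)" by (simp add: algebra_simps flip: exp_add)
  also have "\<dots> \<le> exp ((1-(a-b)) * x) * X lam x" using ab by (intro mult_left_mono exp_le_X' lam) auto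
  finally have 1: "exp ((b + 1) * x) \<le> exp ((1-(a-b)) * x) * X lam x" .
  have 2: "lam * exp x \<le> lam * (exp ((1-(a-b)) * x) * ((1 + 1/lam) * X lam x))"
  proof (cases "lam = 0")
    case False
    have "exp x = exp ((1-(a-b)) * x) * exp ((a - b) * x)" by (simp add: algebra_simps flip: exp_add)
    also have "\<dots> \<le> exp ((1-(a-b)) * x) * ((1 + 1/lam) * X lam x)"
      using False lam ab by (intro mult_left_mono exp_le_X) auto
    finally show ?thesis using lam by (intro mult_left_mono)
  qed simp
  show "exp ((b + 1) * x) + lam * exp x \<le> (1 + lam * (1 + 1/lam)) * exp ((1-(a-b)) * x) * X lam x"
  proof -
    define k where "k = 1 + 1 / lam"
    show ?thesis using 1 2 unfolding k_def[symmetric] by (simp add: algebra_simps)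
  qed
qed (use ab in auto)

section \<open>Transforms of the kernels on the real half-line\<close>

definition Q :: "real \<Rightarrow> real \<Rightarrow> real" where "Q lam z = z powr a + z powr b + lam"

lemma Q_pos: "lam \<ge> 0 \<Longrightarrow> z \<ge> 1 \<Longrightarrow> Q lam z > 0"
  by (simp add: Q_def add_pos_nonneg)

lemma exp_of_real_ln: "z \<ge> 1 \<Longrightarrow> exp (of_real r * of_real (ln z)) = complex_of_real (z powr r)"
  by (simp add: powr_def flip: of_real_mult exp_of_real)

lemma exp_of_real_ln': "z \<ge> 1 \<Longrightarrow> exp (of_real (ln z)) = complex_of_real z"
  by (simp add: exp_of_real)

lemma P_ln: "z \<ge> 1 \<Longrightarrow> P lam (of_real (ln z)) = of_real (Q lam z)"
  by (simp add: P_def Q_def exp_of_real_ln)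

lemma laplace_0:
  assumes lam: "lam > 0"
  shows "has_laplace (e0 lam) (\<lambda>z. 1 / Q lam z)"
  unfolding e0_def
proof (rule has_laplace_cong[OF has_laplace_ilap[OF symbol_0[OF lam]]])
  fix z :: real assume z: "z \<ge> 1"
  have "N0 (of_real (ln z)) / P lam (of_real (ln z)) = of_real (z / Q lam z)"
    unfolding P_ln[OF z] N0_def exp_of_real_ln'[OF z] by simp
  then show "Re (N0 (of_real (ln z)) / P lam (of_real (ln z))) / z = 1 / Q lam z" using z by simp
qed auto

lemma laplace_1:
  assumes lam: "lam > 0"
  shows "has_laplace (e1 lam) (\<lambda>z. z powr (a - 2) / Q lam z)"
  unfolding e1_def
proof (rule has_laplace_cong[OF has_laplace_ilap[OF symbol_1[OF lam]]])
  fix z :: real assume z: "z \<ge> 1"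
  have "N1 (of_real (ln z)) / P lam (of_real (ln z)) = of_real (z powr (a - 1) / Q lam z)"
    unfolding P_ln[OF z] N1_def exp_of_real_ln[OF z] by simp
  moreover have "z powr (a - 1) = z powr (a - 2) * z"
    using z powr_add[of z "a - 2" 1] by simp
  ultimately show "Re (N1 (of_real (ln z)) / P lam (of_real (ln z))) / z = z powr (a - 2) / Q lam z" using z by simp
qed auto

lemma laplace_2:
  assumes lam: "lam \<ge> 0"
  shows "has_laplace (e2 lam) (\<lambda>z. z powr (a - 1) / Q lam z)"
  unfolding e2_def
proof (rule has_laplace_cong[OF has_laplace_ilap[OF symbol_2[OF lam]]])
  fix z :: real assume z: "z \<ge> 1"
  have "N2 (of_real (ln z)) / P lam (of_real (ln z)) = of_real (z powr a / Q lam z)"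
    unfolding P_ln[OF z] N2_def exp_of_real_ln[OF z] by simp
  moreover have "z powr a = z powr (a - 1) * z"
    using z powr_add[of z "a - 1" 1] by simp
  ultimately show "Re (N2 (of_real (ln z)) / P lam (of_real (ln z))) / z = z powr (a - 1) / Q lam z" using z by simp
qed auto

lemma laplace_3: "lam > 0 \<Longrightarrow> has_laplace (e3 lam) (\<lambda>z. (1 - lam / Q lam z) / z)"
proof -
  assume lam: "lam > 0"
  show ?thesis unfolding e3_def
  proof (rule has_laplace_cong[OF has_laplace_ilap[OF symbol_3[OF lam]]])
    fix z :: real assume z: "z \<ge> 1"
    have "Q lam z \<noteq> 0" using Q_pos[of lam z] lam z by simp
    then have "1 - lam / Q lam z = (z powr a + z powr b) / Q lam z" by (simp add: Q_def field_simps)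
    moreover have "N3 (of_real (ln z)) / P lam (of_real (ln z)) = of_real ((z powr a + z powr b) / Q lam z)"
      unfolding P_ln[OF z] N3_def exp_of_real_ln[OF z] by simp
    ultimately show "Re (N3 (complex_of_real (ln z)) / P lam (complex_of_real (ln z))) / z = (1 - lam / Q lam z) / z"
      by simp
  qed auto
qed

lemma laplace_h: "lam \<ge> 0 \<Longrightarrow> has_laplace (eh lam) (\<lambda>z. - (z powr b + lam) / Q lam z)"
proof -
  assume lam: "lam \<ge> 0"
  show ?thesis unfolding eh_def
  proof (rule has_laplace_cong[OF has_laplace_ilap[OF symbol_h[OF lam]]])
    fix z :: real assume z: "z \<ge> 1"
    have "Nh lam (complex_of_real (ln z)) = complex_of_real (- (z powr (b + 1) + lam * z))"
      unfolding Nh_def exp_of_real_ln[OF z] exp_of_real_ln'[OF z] by simp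
    then have "Nh lam (of_real (ln z)) / P lam (of_real (ln z)) = of_real (- (z powr (b + 1) + lam * z) / Q lam z)"
      unfolding P_ln[OF z] by simp
    then have "Re (Nh lam (complex_of_real (ln z)) / P lam (complex_of_real (ln z))) = - (z powr (b + 1) + lam * z) / Q lam z"
      by simp
    also have "- (z powr (b + 1) + lam * z) = z * (- (z powr b + lam))" using z by (simp add: powr_add algebra_simps)
    also have "z * (- (z powr b + lam)) / Q lam z / z = - (z powr b + lam) / Q lam z" using z by simp
    finally show "Re (Nh lam (complex_of_real (ln z)) / P lam (complex_of_real (ln z))) / z = - (z powr b + lam) / Q lam z" .
  qed auto
qed

text \<open>\<open>E lam\<close> agrees with \<open>e2 lam\<close> for \<open>t > 0\<close>. Its transform decays only like \<open>1 / z\<close>, so continuity at \<open>0\<close> is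
  not visible from the contour integral; the transform of the derivative \<open>eh\<close> gives it.\<close>

definition E where "E lam t = 1 + conv (\<lambda>_. 1) (eh lam) t"

lemma conv_one_continuous:
  assumes "has_laplace f F" shows "continuous_on {0..} (conv (\<lambda>_. 1) f)"
  by (rule conv_continuous) (auto intro: has_laplace_locally_integrable[OF assms])

lemma E_continuous: "lam \<ge> 0 \<Longrightarrow> continuous_on {0..} (E lam)"
  unfolding E_def[abs_def] by (intro continuous_intros conv_one_continuous[OF laplace_h])

text \<open>In transforms, \<open>1 / z - (z powr b + lam) / (z * Q lam z)\<close> equals
  \<open>z powr a / (z * Q lam z)\<close>. Both sides are continuous for \<open>t > 0\<close>,
  \<open>E\<close> even up to zero.\<close>

lemma E_eq:
  assumes lam: "lam \<ge> 0" and t: "t > 0"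
  shows "E lam t = e2 lam t"
proof (rule has_laplace_unique[OF _ laplace_2[OF lam] _ _ _ t])
  show "has_laplace (E lam) (\<lambda>z. 1 / z + 1 / z * (- (z powr b + lam) / Q lam z))"
    unfolding E_def[abs_def] by (intro has_laplace_add has_laplace_conv has_laplace_one laplace_h lam)
  show "1 / z + 1 / z * (- (z powr b + lam) / Q lam z) = z powr (a - 1) / Q lam z" if z: "z \<ge> 1" for z
  proof -
    have "z powr a = z powr (a - 1) * z" using z powr_add[of z "a - 1" 1] by simp
    then show ?thesis using Q_pos[OF lam z] z by (simp add: field_simps) (simp add: Q_def algebra_simps)
  qed
  show "continuous_on {0<..} (E lam)" by (rule continuous_on_subset[OF E_continuous[OF lam]]) auto
  show "continuous_on {0<..} (e2 lam)" unfolding e2_def by (rule ilap_continuous_pos[OF symbol_2[OF lam]])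
qed

lemma E_laplace: "lam \<ge> 0 \<Longrightarrow> has_laplace (E lam) (\<lambda>z. z powr (a - 1) / Q lam z)"
  by (rule has_laplace_cong[OF laplace_2]) (auto simp: E_eq)

text \<open>Integration in time divides the transform by \<open>z\<close>. Writing the result as one
  contour integral gives better bounds than integrating a bound for \<open>E\<close>.\<close>

lemma conv_one_E:
  assumes lam: "lam > 0" and t: "t > 0"
  shows "conv (\<lambda>_. 1) (E lam) t = e1 lam t"
proof (rule has_laplace_unique[OF _ laplace_1[OF lam] _ _ _ t])
  have lam0: "lam \<ge> 0" using lam by simp
  show "has_laplace (conv (\<lambda>_. 1) (E lam)) (\<lambda>z. 1 / z * (z powr (a - 1) / Q lam z))"
    by (intro has_laplace_conv has_laplace_one E_laplace lam0)
  show "1 / z * (z powr (a - 1) / Q lam z) = z powr (a - 2) / Q lam z" if z: "z \<ge> 1" for z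
  proof -
    have "z powr (a - 1) = z powr (a - 2) * z" using z powr_add[of z "a - 2" 1] by simp
    then show ?thesis using z by simp
  qed
  show "continuous_on {0<..} (conv (\<lambda>_. 1) (E lam))"
    by (rule continuous_on_subset[OF conv_one_continuous[OF E_laplace[OF lam0]]]) auto
  show "continuous_on {0<..} (e1 lam)" unfolding e1_def by (rule ilap_continuous_pos[OF symbol_1[OF lam]])
qed

text \<open>The subtraction is carried out in the symbol, leaving the numerator
  \<open>z powr a + z powr b\<close>. The decay in \<open>t\<close> of the left-hand side, invisible
  termwise, can then be read off.\<close>

lemma conv_one_e0:
  assumes lam: "lam > 0" and t: "t > 0"
  shows "1 + (- lam) * conv (\<lambda>_. 1) (e0 lam) t = e3 lam t"
proof (rule has_laplace_unique[OF _ laplace_3[OF lam] _ _ _ t])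
  show "has_laplace (\<lambda>t. 1 + (- lam) * conv (\<lambda>_. 1) (e0 lam) t) (\<lambda>z. 1 / z + (- lam) * (1 / z * (1 / Q lam z)))"
    by (intro has_laplace_add has_laplace_cmult has_laplace_conv has_laplace_one laplace_0 lam)
  show "1 / z + (- lam) * (1 / z * (1 / Q lam z)) = (1 - lam / Q lam z) / z" if z: "z \<ge> 1" for z
    using z by (simp add: diff_divide_distrib)
  show "continuous_on {0<..} (\<lambda>t. 1 + (- lam) * conv (\<lambda>_. 1) (e0 lam) t)"
    by (intro continuous_intros continuous_on_subset[OF conv_one_continuous[OF laplace_0[OF lam]]]) auto
  show "continuous_on {0<..} (e3 lam)" unfolding e3_def by (rule ilap_continuous_pos[OF symbol_3[OF lam]])
qed

text \<open>The contour integrals are bounded by \<open>K\<close> through the decay of \<open>exp (t z)\<close> along the rays, and by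
  \<open>J\<close> through the decay of the symbol.\<close>

definition K where "K p = (\<integral>x. exp (p * x - c0 * exp x) \<partial>lborel)"
definition J where "J p = (\<integral>x. exp (p * x) / (exp (a * x) + 1) \<partial>lborel)"

lemma K_nonneg: "K p \<ge> 0" by (simp add: K_def)
lemma J_nonneg: "J p \<ge> 0" unfolding J_def by (rule Bochner_Integration.integral_nonneg) (auto intro!: divide_nonneg_nonneg add_nonneg_nonneg)

lemma K_scale:
  assumes "p > 0" "t > 0"
  shows "integrable lborel (\<lambda>x. exp (p * x - c0 * t * exp x))"
    "(\<integral>x. exp (p * x - c0 * t * exp x) \<partial>lborel) = t powr (- p) * K p"
  using integrable_exp_minus_exp_scale[OF c0_pos assms] integral_exp_minus_exp_scale[OF assms(2), of p c0]
  by (simp_all add: K_def)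

text \<open>The shift by \<open>ln lam / a\<close> scales \<open>z\<close> by
  \<open>lam powr (1 / a)\<close>. Once \<open>z powr b\<close> is dropped from the denominator the
  dependence on \<open>lam\<close> is exact, which makes the later bounds uniform.\<close>

lemma J_scale:
  assumes p: "0 < p" "p < a" and lam: "lam > 0"
  shows "integrable lborel (\<lambda>x. exp (p * x) / (exp (a * x) + lam))"
    "(\<integral>x. exp (p * x) / (exp (a * x) + lam) \<partial>lborel) = lam powr (p / a - 1) * J p"
proof -
  have 1: "exp (a * x) + lam > 0" "exp (a * x) + lam \<ge> lam" "exp (a * x) + lam \<ge> exp (a * x)" for x
    using lam by (auto simp: add_pos_pos)
  show "integrable lborel (\<lambda>x. exp (p * x) / (exp (a * x) + lam))"
  proof (rule integrable_two_sided_exp[of _ p "p - a" "1/lam" 1])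
    fix x
    show "norm (exp (p * x) / (exp (a * x) + lam)) \<le> 1 / lam * exp (p * x)"
      using 1[of x] lam by (auto simp: abs_of_pos intro!: divide_left_mono mult_pos_pos add_pos_pos)
    have "exp (p * x) / (exp (a * x) + lam) \<le> exp (p * x) / exp (a * x)"
      using 1[of x] by (intro divide_left_mono) auto
    then show "norm (exp (p * x) / (exp (a * x) + lam)) \<le> 1 * exp ((p - a) * x)"
      using 1[of x] by (simp add: left_diff_distrib exp_diff abs_of_pos)
  qed (use p in auto)
  define l where "l = ln lam / a"
  have el: "exp (a * l) = lam" "exp (p * l) = lam powr (p / a)" using lam a_pos by (auto simp: l_def powr_def)
  have "(\<integral>x. exp (p * x) / (exp (a * x) + lam) \<partial>lborel) = (\<integral>x. exp (p * (l + 1 * x)) / (exp (a * (l + 1 * x)) + lam) \<partial>lborel)"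
    by (subst lborel_integral_real_affine[of 1 _ l]) auto
  also have "\<dots> = (\<integral>x. lam powr (p / a - 1) * (exp (p * x) / (exp (a * x) + 1)) \<partial>lborel)"
  proof (intro Bochner_Integration.integral_cong refl)
    fix x
    have "exp (p * (l + 1 * x)) = lam powr (p / a) * exp (p * x)" by (simp add: distrib_left exp_add el)
    moreover have "exp (a * (l + 1 * x)) + lam = lam * (exp (a * x) + 1)" by (simp add: distrib_left exp_add el)
    ultimately show "exp (p * (l + 1 * x)) / (exp (a * (l + 1 * x)) + lam) = lam powr (p / a - 1) * (exp (p * x) / (exp (a * x) + 1))"
      using lam by (simp add: powr_diff)
  qed
  finally show "(\<integral>x. exp (p * x) / (exp (a * x) + lam) \<partial>lborel) = lam powr (p / a - 1) * J p"
    unfolding J_def by (simp only: integral_mult_right_zero)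
qed

lemma ilap_quot_bound:
  assumes lam: "lam \<ge> 0" and sym: "symbol (\<lambda>w. N w / P lam w)" and t: "t \<ge> 0"
    and N: "\<And>w. norm (N w) \<le> M (Re w)"
    and G: "\<And>x. exp (- (c0 * t * exp x)) * (M x / X lam x) \<le> G x" "integrable lborel G"
  shows "\<bar>ilap \<phi> (\<lambda>w. N w / P lam w) t\<bar> \<le> (\<integral>x. G x \<partial>lborel) / c1"
proof -
  have "\<bar>ilap \<phi> (\<lambda>w. N w / P lam w) t\<bar> \<le> (\<integral>x. G x / c1 \<partial>lborel)"
  proof (rule ilap_bound[OF sym t])
    fix x
    have "norm (N (Complex x \<phi>) / P lam (Complex x \<phi>)) \<le> M x / X lam x / c1"
      using quot_bound[where N=N and M=M and w="Complex x \<phi>", OF lam _ N] \<phi>_bounds by simp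
    then have "exp (- (- cos \<phi> * t * exp x)) * norm (N (Complex x \<phi>) / P lam (Complex x \<phi>))
        \<le> exp (- (- cos \<phi> * t * exp x)) * (M x / X lam x / c1)" by (rule mult_left_mono) simp
    also have "\<dots> = (exp (- (c0 * t * exp x)) * (M x / X lam x)) / c1" by (simp add: c0_def)
    also have "\<dots> \<le> G x / c1" using G(1)[of x] c1_pos by (intro divide_right_mono) auto
    finally show "exp (- (- cos \<phi> * t * exp x)) * norm (N (Complex x \<phi>) / P lam (Complex x \<phi>)) \<le> G x / c1" .
  qed (use G in auto)
  then show ?thesis by simp
qed

section \<open>Size of the kernels in terms of time and eigenvalue\<close>

lemma exp_damp: "t \<ge> 0 \<Longrightarrow> exp (- (c0 * t * exp x)) \<le> 1"
  using c0_pos by simp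

lemma X_ge: "lam \<ge> 0 \<Longrightarrow> X lam x \<ge> exp (a * x) + lam" "X lam x \<ge> lam" "lam \<ge> 0 \<Longrightarrow> X lam x \<ge> exp (b * x)"
   "lam \<ge> 0 \<Longrightarrow> X lam x \<ge> exp (a * x)"
  by (auto simp: X_def add_nonneg_nonneg)

lemma damp_le: "t \<ge> 0 \<Longrightarrow> y \<ge> 0 \<Longrightarrow> y \<le> z \<Longrightarrow> exp (- (c0 * t * exp x)) * y \<le> z"
  using mult_right_mono[OF exp_damp, of t y x] by simp

lemma exp_merge: "exp (- (c0 * t * exp x)) * exp (p * x) = exp (p * x - c0 * t * exp x)"
  by (simp flip: exp_add)

lemma e0_bound:
  assumes lam: "lam > 0" and t: "t \<ge> 0"
  shows "\<bar>e0 lam t\<bar> \<le> lam powr (1 / a - 1) * J 1 / c1"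
proof -
  have lam0: "lam \<ge> 0" using lam by simp
  have "\<bar>e0 lam t\<bar> \<le> (\<integral>x. exp (1 * x) / (exp (a * x) + lam) \<partial>lborel) / c1"
    unfolding e0_def
  proof (rule ilap_quot_bound[OF lam0 symbol_0[OF lam] t N_norm(1)])
    show "exp (- (c0 * t * exp x)) * (exp x / X lam x) \<le> exp (1 * x) / (exp (a * x) + lam)" for x
      using X_ge(1)[OF lam0, of x] X_pos[OF lam0, of x] lam t
      by (intro damp_le) (auto intro!: divide_left_mono mult_pos_pos add_pos_pos divide_nonneg_pos)
    show "integrable lborel (\<lambda>x. exp (1 * x) / (exp (a * x) + lam))"
      by (rule J_scale) (use ab lam in auto)
  qed
  then show ?thesis using J_scale(2)[of 1 lam] ab lam by simp
qed

lemma e1_bound: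
  assumes lam: "lam > 0" and t: "t \<ge> 0"
  shows "\<bar>e1 lam t\<bar> \<le> lam powr (- (1 / a)) * J (a - 1) / c1"
proof -
  have lam0: "lam \<ge> 0" using lam by simp
  have "\<bar>e1 lam t\<bar> \<le> (\<integral>x. exp ((a - 1) * x) / (exp (a * x) + lam) \<partial>lborel) / c1"
    unfolding e1_def
  proof (rule ilap_quot_bound[OF lam0 symbol_1[OF lam] t N_norm(2)])
    show "exp (- (c0 * t * exp x)) * (exp ((a - 1) * x) / X lam x) \<le> exp ((a - 1) * x) / (exp (a * x) + lam)" for x
      using X_ge(1)[OF lam0, of x] X_pos[OF lam0, of x] lam t
      by (intro damp_le) (auto intro!: divide_left_mono mult_pos_pos add_pos_pos divide_nonneg_pos)
    show "integrable lborel (\<lambda>x. exp ((a - 1) * x) / (exp (a * x) + lam))"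
      by (rule J_scale) (use ab lam in auto)
  qed
  moreover have "(a - 1) / a - 1 = - (1 / a)" using a_pos by (simp add: field_simps)
  ultimately show ?thesis using J_scale(2)[of "a - 1" lam] ab lam by simp
qed

lemma e1_decay:
  assumes lam: "lam > 0" and t: "t > 0"
  shows "\<bar>e1 lam t\<bar> \<le> t powr (- (a - 1)) * K (a - 1) / lam / c1"
proof -
  have lam0: "lam \<ge> 0" and t0: "t \<ge> 0" using lam t by auto
  have "\<bar>e1 lam t\<bar> \<le> (\<integral>x. exp ((a - 1) * x - c0 * t * exp x) / lam \<partial>lborel) / c1"
    unfolding e1_def
  proof (rule ilap_quot_bound[OF lam0 symbol_1[OF lam] t0 N_norm(2)])
    show "exp (- (c0 * t * exp x)) * (exp ((a - 1) * x) / X lam x) \<le> exp ((a - 1) * x - c0 * t * exp x) / lam" for x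
      unfolding exp_merge[symmetric] times_divide_eq_right
      using X_ge(2)[of lam x] X_pos[OF lam0, of x] lam by (intro divide_left_mono) auto
    show "integrable lborel (\<lambda>x. exp ((a - 1) * x - c0 * t * exp x) / lam)"
      using K_scale(1)[of "a - 1" t] ab t by simp
  qed
  then show ?thesis using K_scale(2)[of "a - 1" t] ab t by simp
qed

lemma e2_decay:
  assumes lam: "lam > 0" and t: "t > 0"
  shows "\<bar>e2 lam t\<bar> \<le> t powr (- a) * K a / lam / c1"
proof -
  have lam0: "lam \<ge> 0" and t0: "t \<ge> 0" using lam t by auto
  have "\<bar>e2 lam t\<bar> \<le> (\<integral>x. exp (a * x - c0 * t * exp x) / lam \<partial>lborel) / c1"
    unfolding e2_def
  proof (rule ilap_quot_bound[OF lam0 symbol_2[OF lam0] t0 N_norm(3)])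
    show "exp (- (c0 * t * exp x)) * (exp (a * x) / X lam x) \<le> exp (a * x - c0 * t * exp x) / lam" for x
      unfolding exp_merge[symmetric] times_divide_eq_right
      using X_ge(2)[of lam x] X_pos[OF lam0, of x] lam by (intro divide_left_mono) auto
    show "integrable lborel (\<lambda>x. exp (a * x - c0 * t * exp x) / lam)"
      using K_scale(1)[of a t] ab t by simp
  qed
  then show ?thesis using K_scale(2)[of a t] ab t by simp
qed

text \<open>Without \<open>lam\<close> the only lower bound near \<open>z = 0\<close> is
  \<open>z powr b\<close>, so the decay drops from \<open>t powr (- a)\<close> to
  \<open>t powr (- (a - b))\<close>.\<close>

lemma e2_decay_0:
  assumes t: "t > 0"
  shows "\<bar>e2 0 t\<bar> \<le> t powr (- (a - b)) * K (a - b) / c1"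
proof -
  have t0: "t \<ge> 0" using t by auto
  have "\<bar>e2 0 t\<bar> \<le> (\<integral>x. exp ((a - b) * x - c0 * t * exp x) \<partial>lborel) / c1"
    unfolding e2_def
  proof (rule ilap_quot_bound[OF order_refl symbol_2[OF order_refl] t0 N_norm(3)])
    show "exp (- (c0 * t * exp x)) * (exp (a * x) / X 0 x) \<le> exp ((a - b) * x - c0 * t * exp x)" for x
      unfolding exp_merge[symmetric]
    proof (rule mult_left_mono)
      have "exp (a * x) / X 0 x \<le> exp (a * x) / exp (b * x)"
        using X_ge(3)[of 0 x] X_pos[of 0 x] by (intro divide_left_mono) auto
      then show "exp (a * x) / X 0 x \<le> exp ((a - b) * x)" by (simp add: left_diff_distrib exp_diff)
    qed simp
    show "integrable lborel (\<lambda>x. exp ((a - b) * x - c0 * t * exp x))"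
      using K_scale(1)[of "a - b" t] ab t by simp
  qed
  then show ?thesis using K_scale(2)[of "a - b" t] ab t by simp
qed

lemma e3_decay:
  assumes lam: "lam > 0" and t: "t > 0"
  shows "\<bar>e3 lam t\<bar> \<le> (t powr (- a) * K a + t powr (- b) * K b) / lam / c1"
proof -
  have lam0: "lam \<ge> 0" and t0: "t \<ge> 0" using lam t by auto
  note Ki = K_scale(1)[of a t] K_scale(1)[of b t]
  have "\<bar>e3 lam t\<bar> \<le> (\<integral>x. (exp (a * x - c0 * t * exp x) + exp (b * x - c0 * t * exp x)) / lam \<partial>lborel) / c1"
    unfolding e3_def
  proof (rule ilap_quot_bound[OF lam0 symbol_3[OF lam] t0 N_norm(4)])
    show "exp (- (c0 * t * exp x)) * ((exp (a * x) + exp (b * x)) / X lam x) \<le> (exp (a * x - c0 * t * exp x) + exp (b * x - c0 * t * exp x)) / lam" for x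
      unfolding exp_merge[symmetric] times_divide_eq_right distrib_left[symmetric]
      using X_ge(2)[of lam x] X_pos[OF lam0, of x] lam by (intro divide_left_mono mult_nonneg_nonneg add_nonneg_nonneg) auto
    show "integrable lborel (\<lambda>x. (exp (a * x - c0 * t * exp x) + exp (b * x - c0 * t * exp x)) / lam)"
      using Ki ab t by simp
  qed
  then show ?thesis using K_scale(2)[of a t] K_scale(2)[of b t] Ki ab t by simp
qed

text \<open>Interpolation between the trivial bound by \<open>1\<close> and the decay
  \<open>1 / lam\<close> halves all exponents. It is the source of the smoothing rate:
  \<open>t powr (- a)\<close> is not integrable at zero, but \<open>t powr (- (a / 2))\<close>
  is.\<close>

lemma e3_decay_sqrt:
  assumes lam: "lam > 0" and t: "t > 0"
  shows "\<bar>e3 lam t\<bar> \<le> (t powr (- (a / 2)) * K (a / 2) + t powr (- (b / 2)) * K (b / 2)) / sqrt lam / c1"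
proof -
  have lam0: "lam \<ge> 0" and t0: "t \<ge> 0" using lam t by auto
  note Ki = K_scale(1)[of "a / 2" t] K_scale(1)[of "b / 2" t]
  have "\<bar>e3 lam t\<bar> \<le> (\<integral>x. (exp (a / 2 * x - c0 * t * exp x) + exp (b / 2 * x - c0 * t * exp x)) / sqrt lam \<partial>lborel) / c1"
    unfolding e3_def
  proof (rule ilap_quot_bound[OF lam0 symbol_3[OF lam] t0 N_norm(4)])
    show "exp (- (c0 * t * exp x)) * ((exp (a * x) + exp (b * x)) / X lam x) \<le> (exp (a / 2 * x - c0 * t * exp x) + exp (b / 2 * x - c0 * t * exp x)) / sqrt lam" for x
    proof -
      define u v where "u = exp (a / 2 * x)" and "v = exp (b / 2 * x)"
      have uv: "u > 0" "v > 0" by (auto simp: u_def v_def)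
      have sq: "exp (a * x) = u\<^sup>2" "exp (b * x) = v\<^sup>2"
        by (auto simp: u_def v_def power2_eq_square simp flip: exp_add)
      have "(u\<^sup>2 + v\<^sup>2) * sqrt lam \<le> (u + v) * (u\<^sup>2 + v\<^sup>2 + lam)"
      proof -
        define r where "r = sqrt lam"
        have r: "r > 0" "lam = r\<^sup>2" using lam by (auto simp: r_def)
        define y where "y = u + v"
        have y: "u\<^sup>2 + v\<^sup>2 \<le> y\<^sup>2" "y > 0" using uv by (auto simp: y_def power2_eq_square algebra_simps)
        define q where "q = u\<^sup>2 + v\<^sup>2"
        have q: "0 \<le> q" "q \<le> y\<^sup>2" using y by (auto simp: q_def)
        have "q * r \<le> y * (q + r\<^sup>2)"
        \<comment> \<open>For \<open>r \<le> y\<close> the summand \<open>y * q\<close> suffices.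
          For \<open>r > y\<close>, the bound \<open>q \<le> y\<^sup>2\<close> gives
          \<open>q * r \<le> y * (y * r)\<close>, which is absorbed by
          \<open>y * r\<^sup>2\<close>.\<close>
        proof (cases "r \<le> y")
          case True
          have "q * r \<le> y * q" using mult_right_mono[OF True q(1)] by (simp add: mult.commute)
          moreover have "y * r\<^sup>2 \<ge> 0" using y by simp
          ultimately show ?thesis by (simp add: distrib_left)
        next
          case False
          have "q * r \<le> y\<^sup>2 * r" using q r by (intro mult_right_mono) auto
          also have "\<dots> = y * (y * r)" by (simp add: power2_eq_square)
          also have "\<dots> \<le> y * (r * r)" using False y r by (intro mult_left_mono mult_right_mono) auto
          also have "\<dots> \<le> y * (q + r\<^sup>2)" using y q by (intro mult_left_mono) (auto simp: power2_eq_square)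
          finally show ?thesis .
        qed
        then show ?thesis unfolding r(2)[symmetric] q_def y_def by (simp add: r_def)
      qed
      then have "(exp (a * x) + exp (b * x)) / X lam x \<le> (u + v) / sqrt lam"
        using X_pos[OF lam0, of x] lam uv unfolding X_def sq by (simp add: divide_le_eq pos_le_divide_eq mult.commute)
      then have "exp (- (c0 * t * exp x)) * ((exp (a * x) + exp (b * x)) / X lam x) \<le> exp (- (c0 * t * exp x)) * ((u + v) / sqrt lam)"
        by (rule mult_left_mono) simp
      then show ?thesis unfolding exp_merge[symmetric] times_divide_eq_right distrib_left[symmetric] u_def v_def .
    qed
    show "integrable lborel (\<lambda>x. (exp (a / 2 * x - c0 * t * exp x) + exp (b / 2 * x - c0 * t * exp x)) / sqrt lam)"
      using Ki ab t by simp
  qed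
  then show ?thesis using K_scale(2)[of "a / 2" t] K_scale(2)[of "b / 2" t] Ki ab t by simp
qed

text \<open>The two terms of the numerator are treated differently. The one growing at infinity
  needs the decay of \<open>exp (t z)\<close>; for the other the symbol itself decays, which gives a
  bound uniform in time.\<close>

lemma eh_bound:
  assumes lam: "lam \<ge> 0" and t: "t > 0"
  shows "\<bar>eh lam t\<bar> \<le> (t powr (a - b - 1) * K (1 - (a - b)) + lam powr (1 / a) * J 1) / c1"
proof -
  have t0: "t \<ge> 0" using t by auto
  have p: "1 - (a - b) > 0" using ab by simp
  define g where "g x = lam * (exp (1 * x) / (exp (a * x) + lam))" for x
  have g: "integrable lborel g" "(\<integral>x. g x \<partial>lborel) = lam powr (1 / a) * J 1"
  proof -
    have "integrable lborel g \<and> (\<integral>x. g x \<partial>lborel) = lam powr (1 / a) * J 1"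
    \<comment> \<open>The scaling formula requires \<open>lam > 0\<close>; for
      \<open>lam = 0\<close> both sides vanish, the power because
      \<open>0 powr _ = 0\<close>.\<close>
    proof (cases "lam = 0")
      case False
      then have "lam > 0" using lam by simp
      have i: "integrable lborel (\<lambda>x. exp (1 * x) / (exp (a * x) + lam))"
        "(\<integral>x. exp (1 * x) / (exp (a * x) + lam) \<partial>lborel) = lam powr (1 / a - 1) * J 1"
        by (rule J_scale; use ab \<open>lam > 0\<close> in simp)+
      have "(\<integral>x. g x \<partial>lborel) = lam * (lam powr (1 / a - 1) * J 1)"
        unfolding g_def[abs_def] i(2)[symmetric] by (rule integral_mult_right_zero)
      moreover have "integrable lborel g" unfolding g_def[abs_def] by (rule integrable_mult_right) (rule i(1))
      ultimately show ?thesis using \<open>lam > 0\<close> by (simp add: powr_diff)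
    qed (simp add: g_def[abs_def])
    then show "integrable lborel g" "(\<integral>x. g x \<partial>lborel) = lam powr (1 / a) * J 1" by auto
  qed
  have "\<bar>eh lam t\<bar> \<le> (\<integral>x. exp ((1 - (a - b)) * x - c0 * t * exp x) + g x \<partial>lborel) / c1"
    unfolding eh_def
  proof (rule ilap_quot_bound[OF lam symbol_h[OF lam] t0 N_norm(5)[OF lam]])
    show "exp (- (c0 * t * exp x)) * ((exp ((b + 1) * x) + lam * exp x) / X lam x) \<le> exp ((1 - (a - b)) * x - c0 * t * exp x) + g x" for x
      unfolding add_divide_distrib distrib_left exp_merge[symmetric]
    proof (rule add_mono)
      have "exp ((b + 1) * x) / X lam x \<le> exp ((b + 1) * x) / exp (a * x)"
        using X_ge(4)[OF lam, of x] X_pos[OF lam, of x] by (intro divide_left_mono) auto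
      also have "\<dots> = exp ((1 - (a - b)) * x)" by (simp add: algebra_simps flip: exp_diff)
      finally show "exp (- (c0 * t * exp x)) * (exp ((b + 1) * x) / X lam x) \<le> exp (- (c0 * t * exp x)) * exp ((1 - (a - b)) * x)"
        by (rule mult_left_mono) simp
      have "lam * exp x / X lam x \<le> lam * exp x / (exp (a * x) + lam)"
        using X_ge(1)[OF lam, of x] X_pos[OF lam, of x] lam by (intro divide_left_mono mult_pos_pos) (auto simp: add_pos_nonneg)
      then show "exp (- (c0 * t * exp x)) * (lam * exp x / X lam x) \<le> g x"
        using lam t0 X_pos[OF lam, of x] by (intro damp_le) (auto simp: g_def intro!: divide_nonneg_pos)
    qed
    show "integrable lborel (\<lambda>x. exp ((1 - (a - b)) * x - c0 * t * exp x) + g x)"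
      using K_scale(1)[OF p t] g by simp
  qed
  then show ?thesis using K_scale[OF p t] g by simp
qed
end

lemma powr_le_one_plus:
  fixes t r :: real assumes "t > 0" "0 \<le> r" "r \<le> 1" shows "t powr r \<le> 1 + t"
proof (cases "t \<le> 1")
  case True
  then have "t powr r \<le> 1" using assms by (intro powr_le1) auto
  then show ?thesis using assms by simp
next
  case False
  then have "t powr r \<le> t powr 1" using assms by (intro powr_mono) auto
  then show ?thesis using assms by simp
qed

lemma conv_zero: "conv f g 0 = 0"
  by (simp add: conv_def set_lebesgue_integral_def)

lemma conv_one_bound:
  assumes t: "t \<ge> 0" and f: "\<And>T. set_integrable lborel {0<..<T} f" and b: "\<And>s. 0 < s \<Longrightarrow> s < t \<Longrightarrow> \<bar>f s\<bar> \<le> B" 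
  shows "\<bar>conv (\<lambda>_. 1) f t\<bar> \<le> t * B"
proof -
  have "\<bar>conv (\<lambda>_. 1) f t\<bar> \<le> (\<integral>s. indicator {0<..<t} s * B \<partial>lborel)"
    unfolding conv_def set_lebesgue_integral_def real_norm_def[symmetric]
  proof (rule Bochner_Integration.integral_norm_bound_integral)
    show "integrable lborel (\<lambda>s. indicator {0<..<t} s *\<^sub>R (1 * f s))" using f[of t] by (simp add: set_integrable_def)
    show "norm (indicator {0<..<t} s *\<^sub>R (1 * f s)) \<le> indicator {0<..<t} s * B" for s
      using b[of s] by (auto simp: indicator_def)
  qed (use t in \<open>auto intro!: integrable_mult_left\<close>)
  then show ?thesis using t by simp
qed

lemma integral_powr_interval:
  fixes p t :: real assumes p: "p > 0" and t: "t > 0"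
  shows "has_bochner_integral lborel (\<lambda>s. indicator {0<..<t} s * s powr (p - 1)) (t powr p / p)"
proof -
  have "((\<lambda>s. s powr (p - 1)) has_integral (t powr (p - 1 + 1) / (p - 1 + 1))) {0..t}"
    by (rule has_integral_powr_from_0) (use p t in auto)
  then have "((\<lambda>s. if s \<in> {0..t} then s powr (p - 1) else 0) has_integral (t powr p / p)) UNIV"
    by (subst has_integral_restrict_UNIV) simp
  then have 1: "((\<lambda>s. indicator {0<..<t} s * s powr (p - 1)) has_integral (t powr p / p)) UNIV"
    by (rule has_integral_spike[where S="{0, t}", rotated 2]) (auto simp: indicator_def)
  show ?thesis
    by (rule has_bochner_integral_nn_integral[OF _ _ _ nn_integral_has_integral_lborel[OF _ _ 1]])
      (use p t in auto)
qed

context frac_kernel begin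

lemma conv_one_eh_bound:
  assumes lam: "lam \<ge> 0" and t: "t > 0"
  shows "\<bar>conv (\<lambda>_. 1) (eh lam) t\<bar> \<le> (t powr (a - b) / (a - b) * K (1 - (a - b)) + t * (lam powr (1 / a) * J 1)) / c1"
proof -
  have p: "a - b > 0" using ab by simp
  note I = integral_powr_interval[OF p t, unfolded has_bochner_integral_iff]
  let ?G = "\<lambda>s. (indicator {0<..<t} s * s powr (a - b - 1) * K (1 - (a - b)) + indicator {0<..<t} s * (lam powr (1 / a) * J 1)) / c1"
  have Gi: "integrable lborel (\<lambda>s. indicator {0<..<t} s * s powr (a - b - 1) * K (1 - (a - b)))"
     "integrable lborel (\<lambda>s. indicator {0<..<t} s * (lam powr (1 / a) * J 1))"
    using I t by (auto intro!: integrable_mult_left)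
  have "\<bar>conv (\<lambda>_. 1) (eh lam) t\<bar> \<le> (\<integral>s. ?G s \<partial>lborel)"
    unfolding conv_def set_lebesgue_integral_def real_norm_def[symmetric]
  proof (rule Bochner_Integration.integral_norm_bound_integral)
    show "integrable lborel (\<lambda>s. indicator {0<..<t} s *\<^sub>R (1 * eh lam s))"
      using has_laplace_locally_integrable[OF laplace_h[OF lam], of t] by (simp add: set_integrable_def)
    show "norm (indicator {0<..<t} s *\<^sub>R (1 * eh lam s)) \<le> ?G s" for s
      using eh_bound[OF lam, of s] by (auto simp: indicator_def)
    show "integrable lborel ?G" by (intro integrable_divide Bochner_Integration.integrable_add Gi)
  qed
  also have "\<dots> = (t powr (a - b) / (a - b) * K (1 - (a - b)) + t * (lam powr (1 / a) * J 1)) / c1"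
    using I t by (simp add: Bochner_Integration.integral_add[OF Gi])
  finally show ?thesis .
qed

text \<open>The constitutive equation, integrated once in time to get rid of the derivative of
  the fractional integral of \<open>s\<close>. The transform of \<open>kap p\<close> is \<open>z\<^bsup>-p\<^esup>\<close>.\<close>

definition kap :: "real \<Rightarrow> real \<Rightarrow> real" where "kap p t = t powr (p - 1) / Gamma p"

definition volterra :: "real \<Rightarrow> (real \<Rightarrow> real) \<Rightarrow> (real \<Rightarrow> real) \<Rightarrow> bool" where
  "volterra s0 s u \<longleftrightarrow> (\<forall>t\<ge>0. conv s (kap (1 - (a - b))) t - s0 * kap (2 - (a - b)) t + conv (\<lambda>_. 1) s t = conv (\<lambda>_. 1) (conv u (kap (b - 1))) t)"

text \<open>The assumption \<open>eq\<close> is the transform of the integrated equation multiplied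
  by \<open>z powr (b + 1)\<close>, which clears all negative powers.\<close>

lemma volterraI:
  assumes s: "has_laplace s F" "continuous_on {0..} s" and u: "has_laplace u G" "continuous_on {0..} u"
    and eq: "\<And>z. z \<ge> 1 \<Longrightarrow> (z powr a + z powr b) * F z = s0 * z powr (a - 1) + z * G z"
  shows "volterra s0 s u"
  unfolding volterra_def
proof (intro allI impI)
  fix t :: real assume "t \<ge> 0"
  have p: "1 - (a - b) > 0" "2 - (a - b) > 0" "b - 1 > 0" using ab by auto
  note k = has_laplace_power[OF p(1)] has_laplace_power[OF p(2)] has_laplace_power[OF p(3)]
  note k = k[folded kap_def]
  have k': "has_laplace (kap (1 - (a - b))) (\<lambda>z. z powr - (1 - (a - b)))" "has_laplace (kap (2 - (a - b))) (\<lambda>z. z powr - (2 - (a - b)))"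
    "has_laplace (kap (b - 1)) (\<lambda>z. z powr - (b - 1))"
    using k by (simp_all add: kap_def[abs_def])
  show "conv s (kap (1 - (a - b))) t - s0 * kap (2 - (a - b)) t + conv (\<lambda>_. 1) s t = conv (\<lambda>_. 1) (conv u (kap (b - 1))) t"
  \<comment> \<open>Uniqueness of transforms says nothing about \<open>t = 0\<close>. There the
    convolutions are over an empty interval and the data term vanishes because
    \<open>0 powr _ = 0\<close>.\<close>
  proof (cases "t = 0")
    case True
    then show ?thesis by (simp add: conv_zero kap_def)
  next
    case False
    then have t: "t > 0" using \<open>t \<ge> 0\<close> by simp
    have "conv s (kap (1 - (a - b))) t + (- s0) * kap (2 - (a - b)) t + conv (\<lambda>_. 1) s t = conv (\<lambda>_. 1) (conv u (kap (b - 1))) t"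
    proof (rule has_laplace_unique[OF _ _ _ _ _ t])
      show "has_laplace (\<lambda>t. conv s (kap (1 - (a - b))) t + (- s0) * kap (2 - (a - b)) t + conv (\<lambda>_. 1) s t)
        (\<lambda>z. F z * z powr - (1 - (a - b)) + (- s0) * z powr - (2 - (a - b)) + 1 / z * F z)"
        by (intro has_laplace_add has_laplace_cmult has_laplace_conv has_laplace_one k' s)
      have cL: "has_laplace (conv u (kap (b - 1))) (\<lambda>z. G z * z powr - (b - 1))"
        by (intro has_laplace_conv u k')
      show "has_laplace (conv (\<lambda>_. 1) (conv u (kap (b - 1)))) (\<lambda>z. 1 / z * (G z * z powr - (b - 1)))"
        by (intro has_laplace_conv has_laplace_one cL)
      show "F z * z powr - (1 - (a - b)) + (- s0) * z powr - (2 - (a - b)) + 1 / z * F z = 1 / z * (G z * z powr - (b - 1))" if z: "z \<ge> 1" for z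
      proof -
        have z1: "z powr (- 1) = 1 / z" using z by (simp add: powr_minus_divide)
        have "- (1 - (a - b)) = a + (- b + - 1)" "- (2 - (a - b)) = (a - 1) + (- b + - 1)" by simp_all
        then have e: "z powr - (1 - (a - b)) = z powr a * (z powr - b * (1 / z))" "z powr - (2 - (a - b)) = z powr (a - 1) * (z powr - b * (1 / z))"
          by (metis powr_add z1)+
        have e3: "1 / z = z powr b * (z powr - b * (1 / z))" using z by (simp add: powr_minus)
        have "F z * z powr - (1 - (a - b)) + (- s0) * z powr - (2 - (a - b)) + 1 / z * F z
           = (z powr - b * (1 / z)) * ((z powr a + z powr b) * F z - s0 * z powr (a - 1))"
          unfolding e by (subst (3) e3) (simp only: algebra_simps)
        also have "\<dots> = z powr - b * G z" using eq[OF z] z by simp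
        also have "- b = - (b - 1) + - 1" by simp
        also have "z powr (- (b - 1) + - 1) * G z = 1 / z * (G z * z powr - (b - 1))" unfolding powr_add z1 by simp
        finally show ?thesis .
      qed
      have ck: "continuous_on {0<..} (kap p)" for p
        unfolding kap_def[abs_def] divide_inverse by (intro continuous_intros) auto
      have sub: "continuous_on {0<..} f" if "continuous_on {0..} f" for f :: "real \<Rightarrow> real"
        by (rule continuous_on_subset[OF that]) auto
      show "continuous_on {0<..} (\<lambda>t. conv s (kap (1 - (a - b))) t + (- s0) * kap (2 - (a - b)) t + conv (\<lambda>_. 1) s t)"
        by (intro continuous_intros ck sub conv_continuous s conv_one_continuous[OF s(1)] has_laplace_locally_integrable[OF k'(1)])
      show "continuous_on {0<..} (conv (\<lambda>_. 1) (conv u (kap (b - 1))))"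
        by (intro sub conv_one_continuous[OF cL])
    qed
    then show ?thesis by simp
  qed
qed

text \<open>The witness is \<open>E 0\<close>. Up to time \<open>1\<close> it is bounded through the
  integral of \<open>eh 0\<close>, afterwards through the decay of the contour integral; neither
  estimate is bounded on the whole half-line.\<close>

lemma relaxation_function:
  obtains R :: "real \<Rightarrow> real" and C where "continuous_on {0..} R" "volterra 1 R (\<lambda>_. 0)" "\<And>t. t \<ge> 0 \<Longrightarrow> \<bar>R t\<bar> \<le> C"
proof
  show "continuous_on {0..} (E 0)" by (rule E_continuous) simp
  show "volterra 1 (E 0) (\<lambda>_. 0)"
  proof (rule volterraI[OF E_laplace E_continuous])
    show "has_laplace (\<lambda>_. 0) (\<lambda>z. 0)" using has_laplace_cmult[OF has_laplace_one, of 0] by simp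
    show "(z powr a + z powr b) * (z powr (a - 1) / Q 0 z) = 1 * z powr (a - 1) + z * 0" if "z \<ge> 1" for z
      using Q_pos[of 0 z] that by (simp add: Q_def)
  qed auto
  have p: "a - b > 0" "1 - (a - b) > 0" using ab by auto
  define C where "C = 1 + (1 / (a - b) * K (1 - (a - b))) / c1 + K (a - b) / c1"
  have nn: "(1 / (a - b) * K (1 - (a - b))) / c1 \<ge> 0" "K (a - b) / c1 \<ge> 0"
    using p c1_pos K_nonneg by (auto intro!: divide_nonneg_pos mult_nonneg_nonneg)
  show "\<bar>E 0 t\<bar> \<le> C" if t: "t \<ge> 0" for t
  proof -
    consider "t = 0" | "0 < t" "t \<le> 1" | "t > 1" using t by linarith
    then show ?thesis
    proof cases
      case 1
      then show ?thesis using nn by (simp add: E_def conv_zero C_def)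
    next
      case 2
      have "t powr (a - b) / (a - b) * K (1 - (a - b)) \<le> 1 / (a - b) * K (1 - (a - b))"
        using 2 p K_nonneg by (intro mult_right_mono divide_right_mono powr_le1) auto
      then have le: "t powr (a - b) / (a - b) * K (1 - (a - b)) / c1 \<le> (1 / (a - b) * K (1 - (a - b))) / c1"
        using c1_pos by (intro divide_right_mono) auto
      have "\<bar>conv (\<lambda>_. 1) (eh 0) t\<bar> \<le> t powr (a - b) / (a - b) * K (1 - (a - b)) / c1"
        using conv_one_eh_bound[of 0 t] 2 by simp
      with le have "\<bar>conv (\<lambda>_. 1) (eh 0) t\<bar> \<le> (1 / (a - b) * K (1 - (a - b))) / c1" by (rule order_trans[rotated])
      then show ?thesis using nn unfolding E_def C_def by linarith
    next
      case 3
      have "\<bar>E 0 t\<bar> \<le> t powr (- (a - b)) * K (a - b) / c1" using e2_decay_0[of t] E_eq[of 0 t] 3 by simp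
      also have "t powr (- (a - b)) \<le> t powr 0" using 3 p by (intro powr_mono) auto
      then have "t powr (- (a - b)) * K (a - b) / c1 \<le> 1 * K (a - b) / c1"
        using 3 c1_pos K_nonneg[of "a - b"] by (intro divide_right_mono mult_right_mono) auto
      finally show ?thesis using nn unfolding C_def by linarith
    qed
  qed
qed

lemma E_uniform_bound:
  assumes l0: "lam0 > 0" and lam: "lam \<ge> lam0" and t: "t \<ge> 0"
  shows "\<bar>E lam t\<bar> \<le> 1 + (lam0 powr (- (a - b) / a) / (a - b) * K (1 - (a - b)) + J 1 + K a) / c1"
proof -
  have lp: "lam > 0" "lam \<ge> 0" using l0 lam by auto
  have p: "a - b > 0" "1 - (a - b) > 0" using ab by auto
  define k where "k = lam0 powr (- (a - b) / a) / (a - b) * K (1 - (a - b))"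
  have k: "k \<ge> 0" using p K_nonneg by (auto simp: k_def intro!: mult_nonneg_nonneg divide_nonneg_nonneg)
  have nn: "k / c1 \<ge> 0" "J 1 / c1 \<ge> 0" "K a / c1 \<ge> 0" using k c1_pos K_nonneg J_nonneg by (auto intro!: divide_nonneg_pos)
  \<comment> \<open>The time scale on which \<open>t z\<close> and \<open>z powr a / lam\<close> are
    both of order one. Before \<open>T\<close> the integral of \<open>eh\<close> is bounded, after
    \<open>T\<close> the decay of \<open>e2\<close>. The lower bound \<open>lam0\<close> enters
    through the unscaled contribution \<open>t powr (a - b)\<close>.\<close>
  define T where "T = lam powr (- (1 / a))"
  have T: "T > 0" using lp by (simp add: T_def)
  consider "t = 0" | "0 < t" "t \<le> T" | "t > T" using t by linarith
  then have "\<bar>E lam t\<bar> \<le> 1 + (k / c1 + J 1 / c1 + K a / c1)"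
  proof cases
    case 1
    then show ?thesis using nn by (simp add: E_def conv_zero)
  next
    case 2
    have "t powr (a - b) \<le> T powr (a - b)" using 2 p by (intro powr_mono2) auto
    also have "\<dots> = lam powr (- (a - b) / a)"
      unfolding T_def powr_powr by (rule arg_cong[where f="(powr) lam"]) (use a_pos in \<open>simp add: field_simps\<close>)
    also have "\<dots> \<le> lam0 powr (- (a - b) / a)" using l0 lam p a_pos by (intro powr_mono2') (auto simp: divide_nonpos_pos)
    finally have "t powr (a - b) / (a - b) * K (1 - (a - b)) \<le> k"
      unfolding k_def using p K_nonneg by (intro mult_right_mono divide_right_mono) auto
    moreover have "t * (lam powr (1 / a) * J 1) \<le> T * (lam powr (1 / a) * J 1)"
      using 2 J_nonneg by (intro mult_right_mono) auto
    moreover have "T * (lam powr (1 / a) * J 1) = J 1" using lp by (simp add: T_def powr_minus)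
    ultimately have "(t powr (a - b) / (a - b) * K (1 - (a - b)) + t * (lam powr (1 / a) * J 1)) / c1 \<le> (k + J 1) / c1"
      using c1_pos by (intro divide_right_mono) auto
    then have "\<bar>conv (\<lambda>_. 1) (eh lam) t\<bar> \<le> k / c1 + J 1 / c1"
      using conv_one_eh_bound[OF lp(2) 2(1)] by (simp add: add_divide_distrib)
    then show ?thesis using nn unfolding E_def by linarith
  next
    case 3
    have t: "t > 0" using T 3 by simp
    have "t powr (- a) \<le> T powr (- a)" using 3 T a_pos by (intro powr_mono2') auto
    also have "\<dots> = lam" using lp a_pos by (simp add: T_def powr_powr)
    finally have "t powr (- a) * K a / lam / c1 \<le> lam * K a / lam / c1"
      using lp c1_pos K_nonneg[of a] by (intro divide_right_mono mult_right_mono) auto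
    also have "\<dots> = K a / c1" using lp by simp
    finally have "\<bar>E lam t\<bar> \<le> K a / c1" using e2_decay[OF lp(1) t] E_eq[OF lp(2) t] by simp
    then show ?thesis using nn by linarith
  qed
  then show ?thesis by (simp add: k_def add_divide_distrib)
qed

lemma velocity_uniform_bound:
  assumes l0: "lam0 > 0" and lam: "lam \<ge> lam0" and t: "t \<ge> 0"
  shows "\<bar>1 - lam * conv (\<lambda>_. 1) (e0 lam) t\<bar> \<le> 1 + (J 1 + K a + lam0 powr (b / a - 1) * K b) / c1"
proof -
  have lp: "lam > 0" "lam \<ge> 0" using l0 lam by auto
  define k where "k = lam0 powr (b / a - 1) * K b"
  have k: "k \<ge> 0" using K_nonneg by (auto simp: k_def intro!: mult_nonneg_nonneg)
  have nn: "k / c1 \<ge> 0" "J 1 / c1 \<ge> 0" "K a / c1 \<ge> 0" using k c1_pos K_nonneg J_nonneg by (auto intro!: divide_nonneg_pos)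
  \<comment> \<open>The same crossover time. Before it the bound of \<open>e0\<close> is integrated;
    after it the decay of \<open>e3\<close> is used, where \<open>t powr (- b)\<close> is at most
    \<open>lam * lam powr (b / a - 1)\<close> and the last power is bounded by its value at
    \<open>lam0\<close>.\<close>
  define T where "T = lam powr (- (1 / a))"
  have T: "T > 0" using lp by (simp add: T_def)
  have "\<bar>1 - lam * conv (\<lambda>_. 1) (e0 lam) t\<bar> \<le> 1 + (J 1 / c1 + K a / c1 + k / c1)"
  proof (cases "t \<le> T")
    case True
    define B where "B = lam powr (1 / a - 1) * J 1 / c1"
    have B0: "B \<ge> 0" unfolding B_def using c1_pos J_nonneg by (intro divide_nonneg_pos mult_nonneg_nonneg) auto
    have "\<bar>conv (\<lambda>_. 1) (e0 lam) t\<bar> \<le> t * B"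
      by (rule conv_one_bound[OF t has_laplace_locally_integrable[OF laplace_0[OF lp(1)]]])
        (unfold B_def, rule e0_bound[OF lp(1)], simp)
    also have "\<dots> \<le> T * B" using True B0 by (intro mult_right_mono)
    finally have "lam * \<bar>conv (\<lambda>_. 1) (e0 lam) t\<bar> \<le> lam * (T * B)" using lp by (intro mult_left_mono) auto
    also have "\<dots> = J 1 / c1" using lp by (simp add: T_def B_def powr_minus powr_diff)
    finally have "\<bar>lam * conv (\<lambda>_. 1) (e0 lam) t\<bar> \<le> J 1 / c1" using lp by (simp add: abs_mult)
    then show ?thesis using nn by linarith
  next
    case False
    then have t: "t > 0" using T by simp
    have "t powr (- a) \<le> T powr (- a)" using False T a_pos by (intro powr_mono2') auto
    also have "\<dots> = lam" using lp a_pos by (simp add: T_def powr_powr)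
    finally have 1: "t powr (- a) * K a \<le> lam * K a" using K_nonneg by (intro mult_right_mono) auto
    have "t powr (- b) \<le> T powr (- b)" using False T ab by (intro powr_mono2') auto
    also have "\<dots> = lam * lam powr (b / a - 1)" using lp a_pos by (simp add: T_def powr_powr powr_diff)
    also have "\<dots> \<le> lam * lam0 powr (b / a - 1)"
      using l0 lam lp ab by (intro mult_left_mono powr_mono2') auto
    finally have 2: "t powr (- b) * K b \<le> lam * k"
      unfolding k_def mult.assoc[symmetric] using K_nonneg by (intro mult_right_mono) auto
    have "\<bar>e3 lam t\<bar> \<le> (t powr (- a) * K a + t powr (- b) * K b) / lam / c1" by (rule e3_decay[OF lp(1) t])
    also have "\<dots> \<le> (lam * K a + lam * k) / lam / c1"
      using 1 2 lp c1_pos by (intro divide_right_mono add_mono) auto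
    also have "\<dots> = K a / c1 + k / c1" using lp c1_pos by (simp add: field_simps)
    finally have "\<bar>1 - lam * conv (\<lambda>_. 1) (e0 lam) t\<bar> \<le> K a / c1 + k / c1"
      using conv_one_e0[OF lp(1) t] by simp
    then show ?thesis using nn by linarith
  qed
  then show ?thesis by (simp add: k_def add_divide_distrib)
qed

text \<open>For \<open>a = 2 - \<delta>\<close> this is \<omega>. What the estimates use is
  \<open>om / 2 = 1 / a - 1 / 2\<close>.\<close>

definition om where "om = (2 - a) / a"

text \<open>The integrated momentum equation expresses the transform of \<open>u\<close> through
  that of \<open>s\<close>. Inserted into the constitutive equation it leaves \<open>Q lam z\<close>
  times the transform of \<open>s\<close> equal to
  \<open>s0 * z powr (a - 1) + u0 * sqrt lam\<close>, so \<open>s\<close> is a combination of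
  \<open>E\<close> and \<open>e0\<close>.\<close>

lemma scalar_solution_exists:
  assumes l0: "lam0 > 0"
  obtains C where "C > 0"
    "\<And>lam u0 s0. lam \<ge> lam0 \<Longrightarrow> \<exists>u s. continuous_on {0..} u \<and> continuous_on {0..} s \<and>
       (\<forall>t\<ge>0. u t = u0 - sqrt lam * conv (\<lambda>_. 1) s t) \<and> volterra s0 s (\<lambda>t. sqrt lam * u t) \<and>
       (\<forall>t\<ge>0. lam powr (om / 2) * \<bar>u t\<bar> \<le> C * (lam powr (om / 2) * \<bar>u0\<bar> + \<bar>s0\<bar>)) \<and>
       (\<forall>t\<ge>0. \<bar>s t\<bar> \<le> C * (lam powr (om / 2) * \<bar>u0\<bar> + \<bar>s0\<bar>)) \<and>
       (\<forall>t>0. sqrt lam * \<bar>u t\<bar> \<le> C * (t powr (- (a / 2)) * (1 + t)) * (lam powr (om / 2) * \<bar>u0\<bar> + \<bar>s0\<bar>))"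
proof -
  define S1 where "S1 = 1 + (lam0 powr (- (a - b) / a) / (a - b) * K (1 - (a - b)) + J 1 + K a) / c1"
  define U1 where "U1 = 1 + (J 1 + K a + lam0 powr (b / a - 1) * K b) / c1"
  define J0 where "J0 = J 1 / c1"
  define J1 where "J1 = J (a - 1) / c1"
  define W where "W = (K (a / 2) + K (b / 2)) / c1 * lam0 powr (- (om / 2))"
  define V where "V = K (a - 1) / c1"
  \<comment> \<open>All six constants are nonnegative, so the sum dominates each of them.\<close>
  define C where "C = S1 + U1 + J0 + J1 + W + V"
  have nnK: "K p / c1 \<ge> 0" "J p / c1 \<ge> 0" for p using c1_pos K_nonneg J_nonneg by (auto intro!: divide_nonneg_pos)
  have S1: "S1 \<ge> 1" "U1 \<ge> 1"
    using c1_pos K_nonneg J_nonneg ab by (auto simp: S1_def U1_def intro!: divide_nonneg_pos add_nonneg_nonneg mult_nonneg_nonneg)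
  have nn: "J0 \<ge> 0" "J1 \<ge> 0" "W \<ge> 0" "V \<ge> 0"
    using nnK by (auto simp: J0_def J1_def W_def V_def add_divide_distrib)
  have C: "C > 0" "S1 \<le> C" "U1 \<le> C" "J0 \<le> C" "J1 \<le> C" "W \<le> C" "V \<le> C" using S1 nn by (auto simp: C_def)
  have om: "om \<ge> 0" "om / 2 = 1 / a - 1 / 2" using ab a_pos by (auto simp: om_def field_simps)
  have "\<exists>u s. continuous_on {0..} u \<and> continuous_on {0..} s \<and>
       (\<forall>t\<ge>0. u t = u0 - sqrt lam * conv (\<lambda>_. 1) s t) \<and> volterra s0 s (\<lambda>t. sqrt lam * u t) \<and>
       (\<forall>t\<ge>0. lam powr (om / 2) * \<bar>u t\<bar> \<le> C * (lam powr (om / 2) * \<bar>u0\<bar> + \<bar>s0\<bar>)) \<and>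
       (\<forall>t\<ge>0. \<bar>s t\<bar> \<le> C * (lam powr (om / 2) * \<bar>u0\<bar> + \<bar>s0\<bar>)) \<and>
       (\<forall>t>0. sqrt lam * \<bar>u t\<bar> \<le> C * (t powr (- (a / 2)) * (1 + t)) * (lam powr (om / 2) * \<bar>u0\<bar> + \<bar>s0\<bar>))"
    if lam: "lam \<ge> lam0" for lam u0 s0
  proof -
    have lp: "lam > 0" "lam \<ge> 0" using l0 lam by auto
    have sq: "sqrt lam = lam powr (1/2)" "sqrt lam > 0" "sqrt lam * sqrt lam = lam" using lp by (auto simp: powr_half_sqrt)
    define L where "L = lam powr (om / 2)"
    have L: "L > 0" using lp by (simp add: L_def)
    define s where "s t = s0 * E lam t + (u0 * sqrt lam) * e0 lam t" for t
    define u where "u t = u0 * 1 + (- sqrt lam) * conv (\<lambda>_. 1) s t" for t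
    define F where "F z = s0 * (z powr (a - 1) / Q lam z) + (u0 * sqrt lam) * (1 / Q lam z)" for z
    have sL: "has_laplace s F" unfolding s_def[abs_def] F_def[abs_def]
      by (intro has_laplace_add has_laplace_cmult E_laplace laplace_0 lp)
    \<comment> \<open>Unlike that of \<open>e2\<close>, this symbol is integrable along the ray by
      itself, which gives continuity of \<open>e0\<close> up to \<open>t = 0\<close>.\<close>
    have "integrable lborel (\<lambda>x. N0 (Complex x \<phi>) / P lam (Complex x \<phi>))"
    proof (rule Bochner_Integration.integrable_bound)
      show "integrable lborel (\<lambda>x. exp (1 * x) / (exp (a * x) + lam) / c1)"
        by (intro integrable_divide J_scale) (use ab lp in auto)
      show "(\<lambda>x. N0 (Complex x \<phi>) / P lam (Complex x \<phi>)) \<in> borel_measurable lborel"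
        using symbol_line(2)[OF symbol_0[OF lp(1)]] by simp
      show "AE x in lborel. norm (N0 (Complex x \<phi>) / P lam (Complex x \<phi>)) \<le> norm (exp (1 * x) / (exp (a * x) + lam) / c1)"
      proof (rule AE_I2)
        fix x
        have "norm (N0 (Complex x \<phi>) / P lam (Complex x \<phi>)) \<le> exp x / X lam x / c1"
          using quot_bound[where N=N0 and M=exp and w="Complex x \<phi>", OF lp(2) _ N_norm(1)] \<phi>_bounds by simp
        also have "\<dots> \<le> exp x / (exp (a * x) + lam) / c1"
          using X_ge(1)[OF lp(2), of x] X_pos[OF lp(2), of x] lp c1_pos
          by (intro divide_right_mono divide_left_mono mult_pos_pos add_pos_pos) auto
        also have "\<dots> \<le> norm (exp (1 * x) / (exp (a * x) + lam) / c1)"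
          unfolding real_norm_def mult_1 by (rule abs_ge_self)
        finally show "norm (N0 (Complex x \<phi>) / P lam (Complex x \<phi>)) \<le> norm (exp (1 * x) / (exp (a * x) + lam) / c1)" .
      qed
    qed
    then have e0c: "continuous_on {0..} (e0 lam)"
      unfolding e0_def by (rule ilap_continuous_nonneg[OF symbol_0[OF lp(1)]])
    have sC: "continuous_on {0..} s" unfolding s_def[abs_def]
      by (intro continuous_intros E_continuous lp e0c)
    have uL: "has_laplace u (\<lambda>z. u0 * (1 / z) + (- sqrt lam) * (1 / z * F z))" unfolding u_def[abs_def]
      by (intro has_laplace_add has_laplace_cmult has_laplace_conv has_laplace_one sL)
    have uC: "continuous_on {0..} u" unfolding u_def[abs_def]
      by (intro continuous_intros conv_one_continuous[OF sL])
    have vol: "volterra s0 s (\<lambda>t. sqrt lam * u t)"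
    proof (rule volterraI[OF sL sC has_laplace_cmult[OF uL]])
      show "(z powr a + z powr b) * F z = s0 * z powr (a - 1) + z * (sqrt lam * (u0 * (1 / z) + (- sqrt lam) * (1 / z * F z)))" if z: "z \<ge> 1" for z
      proof -
        have "z * (sqrt lam * (u0 * (1 / z) + (- sqrt lam) * (1 / z * F z))) = sqrt lam * u0 - (sqrt lam * sqrt lam) * F z"
          using z by (simp add: algebra_simps)
        moreover have "Q lam z * F z = s0 * z powr (a - 1) + u0 * sqrt lam"
          using Q_pos[OF lp(2) z] by (simp add: F_def distrib_left)
        ultimately show ?thesis unfolding sq(3) Q_def by (simp add: algebra_simps)
      qed
    qed (intro continuous_intros uC)
    have convs: "conv (\<lambda>_. 1) s t = s0 * conv (\<lambda>_. 1) (E lam) t + (u0 * sqrt lam) * conv (\<lambda>_. 1) (e0 lam) t" for t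
    proof -
      have i: "set_integrable lborel {0<..<t} (\<lambda>r. s0 * E lam r)" "set_integrable lborel {0<..<t} (\<lambda>r. (u0 * sqrt lam) * e0 lam r)"
        using has_laplace_locally_integrable[OF E_laplace[OF lp(2)], of t] has_laplace_locally_integrable[OF laplace_0[OF lp(1)], of t]
        by (auto intro!: set_integrable_mult_right)
      have "conv (\<lambda>_. 1) s t = (LINT r:{0<..<t}|lborel. s0 * E lam r + (u0 * sqrt lam) * e0 lam r)"
        by (simp add: conv_def s_def)
      also have "\<dots> = (LINT r:{0<..<t}|lborel. s0 * E lam r) + (LINT r:{0<..<t}|lborel. (u0 * sqrt lam) * e0 lam r)"
        by (rule set_integral_add(2)[OF i])
      finally show ?thesis by (simp add: conv_def)
    qed
    have u_eq: "u t = u0 * (1 - lam * conv (\<lambda>_. 1) (e0 lam) t) - s0 * (sqrt lam * conv (\<lambda>_. 1) (E lam) t)" for t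
    proof -
      have "u t = u0 * (1 - (sqrt lam * sqrt lam) * conv (\<lambda>_. 1) (e0 lam) t) - s0 * (sqrt lam * conv (\<lambda>_. 1) (E lam) t)"
        unfolding u_def convs by (simp only: algebra_simps mult_1_left)
      then show ?thesis unfolding sq(3) .
    qed
    \<comment> \<open>This balance is the reason for the weight: it cancels the factor
      \<open>lam powr (- (1 / a))\<close> in the uniform bound of \<open>e1\<close>.\<close>
    have b1: "L * sqrt lam = lam powr (1 / a)"
      unfolding L_def sq(1) om(2) by (simp flip: powr_add)
    have A: "L * \<bar>u t\<bar> \<le> C * (L * \<bar>u0\<bar> + \<bar>s0\<bar>)" if t: "t \<ge> 0" for t
    proof -
      have "L * (sqrt lam * \<bar>conv (\<lambda>_. 1) (E lam) t\<bar>) \<le> J1"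
      proof (cases "t = 0")
        case False
        then have t: "t > 0" using t by simp
        have "L * (sqrt lam * \<bar>conv (\<lambda>_. 1) (E lam) t\<bar>) = lam powr (1 / a) * \<bar>e1 lam t\<bar>"
          using b1 conv_one_E[OF lp(1) t] by simp
        also have "\<dots> \<le> lam powr (1 / a) * (lam powr (- (1 / a)) * J (a - 1) / c1)"
          using e1_bound[OF lp(1), of t] t by (intro mult_left_mono) auto
        also have "\<dots> = J1" using lp by (simp add: J1_def powr_minus)
        finally show ?thesis .
      qed (use nn in \<open>simp add: conv_zero\<close>)
      then have 2: "\<bar>s0\<bar> * (L * (sqrt lam * \<bar>conv (\<lambda>_. 1) (E lam) t\<bar>)) \<le> \<bar>s0\<bar> * C" using C by (intro mult_left_mono) auto
      have "\<bar>1 - lam * conv (\<lambda>_. 1) (e0 lam) t\<bar> \<le> C" using velocity_uniform_bound[OF l0 lam t] C by (simp add: U1_def)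
      then have 1: "L * \<bar>u0\<bar> * \<bar>1 - lam * conv (\<lambda>_. 1) (e0 lam) t\<bar> \<le> L * \<bar>u0\<bar> * C" using L by (intro mult_left_mono) auto
      have "\<bar>u t\<bar> \<le> \<bar>u0\<bar> * \<bar>1 - lam * conv (\<lambda>_. 1) (e0 lam) t\<bar> + \<bar>s0\<bar> * (sqrt lam * \<bar>conv (\<lambda>_. 1) (E lam) t\<bar>)"
        unfolding u_eq using lp by (intro order_trans[OF abs_triangle_ineq4]) (simp add: abs_mult)
      then have "L * \<bar>u t\<bar> \<le> L * (\<bar>u0\<bar> * \<bar>1 - lam * conv (\<lambda>_. 1) (e0 lam) t\<bar> + \<bar>s0\<bar> * (sqrt lam * \<bar>conv (\<lambda>_. 1) (E lam) t\<bar>))"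
        using L by (intro mult_left_mono) auto
      then show ?thesis using 1 2 by (simp add: algebra_simps)
    qed
    have B: "\<bar>s t\<bar> \<le> C * (L * \<bar>u0\<bar> + \<bar>s0\<bar>)" if t: "t \<ge> 0" for t
    proof -
      have "\<bar>E lam t\<bar> \<le> C" using E_uniform_bound[OF l0 lam t] C by (simp add: S1_def)
      then have 1: "\<bar>s0\<bar> * \<bar>E lam t\<bar> \<le> \<bar>s0\<bar> * C" by (intro mult_left_mono) auto
      have "sqrt lam * \<bar>e0 lam t\<bar> \<le> sqrt lam * (lam powr (1 / a - 1) * J 1 / c1)"
        using e0_bound[OF lp(1) t] sq by (intro mult_left_mono) auto
      also have "\<dots> = L * J0"
      proof -
        have "sqrt lam * lam powr (1 / a - 1) = L" unfolding L_def sq(1) om(2) by (simp flip: powr_add)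
        then show ?thesis by (simp add: J0_def)
      qed
      also have "\<dots> \<le> L * C" using L C by (intro mult_left_mono) auto
      finally have 2: "\<bar>u0\<bar> * (sqrt lam * \<bar>e0 lam t\<bar>) \<le> \<bar>u0\<bar> * (L * C)" by (rule mult_left_mono) simp
      have "\<bar>s t\<bar> \<le> \<bar>s0\<bar> * \<bar>E lam t\<bar> + \<bar>u0\<bar> * (sqrt lam * \<bar>e0 lam t\<bar>)"
        unfolding s_def using lp by (intro order_trans[OF abs_triangle_ineq]) (simp add: abs_mult)
      then show ?thesis using 1 2 by (simp add: algebra_simps)
    qed
    have D: "sqrt lam * \<bar>u t\<bar> \<le> C * (t powr (- (a / 2)) * (1 + t)) * (L * \<bar>u0\<bar> + \<bar>s0\<bar>)" if t: "t > 0" for t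
    proof -
      define m where "m = t powr (- (a / 2)) * (1 + t)"
      have m0: "m \<ge> 0" using t by (simp add: m_def)
      have m1: "t powr (- (a / 2)) \<le> m" unfolding m_def using t by (simp add: mult_le_cancel_left1)
      \<comment> \<open>One majorant for all decay rates that occur: \<open>b / 2\<close> and
        \<open>a - 1\<close> are at most \<open>a / 2\<close> and differ from it by at most
        \<open>1\<close>.\<close>
      have mr: "t powr (- r) \<le> m" if r: "r \<le> a / 2" "a / 2 - r \<le> 1" for r
      proof -
        have "t powr (- r) = t powr (- (a / 2)) * t powr (a / 2 - r)" using t by (simp flip: powr_add)
        also have "\<dots> \<le> m" unfolding m_def using t r by (intro mult_left_mono powr_le_one_plus) auto
        finally show ?thesis .
      qed
      have e3: "sqrt lam * \<bar>1 - lam * conv (\<lambda>_. 1) (e0 lam) t\<bar> \<le> m * ((K (a / 2) + K (b / 2)) / c1)"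
      proof -
        have "sqrt lam * \<bar>1 - lam * conv (\<lambda>_. 1) (e0 lam) t\<bar> = sqrt lam * \<bar>e3 lam t\<bar>" using conv_one_e0[OF lp(1) t] by simp
        also have "\<dots> \<le> sqrt lam * ((t powr (- (a / 2)) * K (a / 2) + t powr (- (b / 2)) * K (b / 2)) / sqrt lam / c1)"
          using sq by (intro mult_left_mono e3_decay_sqrt lp t) auto
        also have "\<dots> = (t powr (- (a / 2)) * K (a / 2) + t powr (- (b / 2)) * K (b / 2)) / c1" using sq(2) by simp
        also have "\<dots> \<le> (m * K (a / 2) + m * K (b / 2)) / c1"
          using c1_pos K_nonneg ab m1 mr[of "b / 2"] by (intro divide_right_mono add_mono mult_right_mono) auto
        finally show ?thesis by (simp add: algebra_simps)
      qed
      \<comment> \<open>The bound for \<open>e3\<close> carries no weight on \<open>u0\<close>; the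
        weight is inserted at the cost of a negative power of \<open>lam0\<close>, since
        \<open>om \<ge> 0\<close>.\<close>
      have u0b: "\<bar>u0\<bar> \<le> lam0 powr (- (om / 2)) * (L * \<bar>u0\<bar>)"
      proof -
        have "lam0 powr (om / 2) \<le> L" unfolding L_def using l0 lam om by (intro powr_mono2) auto
        then have "lam0 powr (- (om / 2)) * lam0 powr (om / 2) \<le> lam0 powr (- (om / 2)) * L" by (intro mult_left_mono) auto
        then have "1 \<le> lam0 powr (- (om / 2)) * L" using l0 by (simp add: powr_minus)
        then have "1 * \<bar>u0\<bar> \<le> lam0 powr (- (om / 2)) * L * \<bar>u0\<bar>" by (intro mult_right_mono) auto
        then show ?thesis by (simp add: mult.assoc)
      qed
      have "\<bar>u0\<bar> * (sqrt lam * \<bar>1 - lam * conv (\<lambda>_. 1) (e0 lam) t\<bar>) \<le> (lam0 powr (- (om / 2)) * (L * \<bar>u0\<bar>)) * (m * ((K (a / 2) + K (b / 2)) / c1))"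
        by (rule mult_mono[OF u0b e3]) (use sq(2) L in auto)
      also have "\<dots> = W * (m * (L * \<bar>u0\<bar>))" by (simp add: W_def)
      also have "\<dots> \<le> C * (m * (L * \<bar>u0\<bar>))" using C m0 L by (intro mult_right_mono mult_nonneg_nonneg) auto
      finally have 1: "\<bar>u0\<bar> * (sqrt lam * \<bar>1 - lam * conv (\<lambda>_. 1) (e0 lam) t\<bar>) \<le> C * (m * (L * \<bar>u0\<bar>))" .
      have "lam * \<bar>conv (\<lambda>_. 1) (E lam) t\<bar> = lam * \<bar>e1 lam t\<bar>" using conv_one_E[OF lp(1) t] by simp
      also have "\<dots> \<le> lam * (t powr (- (a - 1)) * K (a - 1) / lam / c1)" using lp by (intro mult_left_mono e1_decay t) auto
      also have "\<dots> = t powr (- (a - 1)) * V" using lp by (simp add: V_def)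
      also have "\<dots> \<le> m * C" using mr[of "a - 1"] ab C nn m0 by (intro mult_mono) auto
      finally have 2: "\<bar>s0\<bar> * (lam * \<bar>conv (\<lambda>_. 1) (E lam) t\<bar>) \<le> \<bar>s0\<bar> * (m * C)" by (rule mult_left_mono) simp
      have "\<bar>u t\<bar> \<le> \<bar>u0\<bar> * \<bar>1 - lam * conv (\<lambda>_. 1) (e0 lam) t\<bar> + \<bar>s0\<bar> * (sqrt lam * \<bar>conv (\<lambda>_. 1) (E lam) t\<bar>)"
        unfolding u_eq using lp by (intro order_trans[OF abs_triangle_ineq4]) (simp add: abs_mult)
      then have "sqrt lam * \<bar>u t\<bar> \<le> sqrt lam * (\<bar>u0\<bar> * \<bar>1 - lam * conv (\<lambda>_. 1) (e0 lam) t\<bar> + \<bar>s0\<bar> * (sqrt lam * \<bar>conv (\<lambda>_. 1) (E lam) t\<bar>))"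
        using sq by (intro mult_left_mono) auto
      also have "\<dots> = \<bar>u0\<bar> * (sqrt lam * \<bar>1 - lam * conv (\<lambda>_. 1) (e0 lam) t\<bar>) + \<bar>s0\<bar> * ((sqrt lam * sqrt lam) * \<bar>conv (\<lambda>_. 1) (E lam) t\<bar>)"
        by (simp only: algebra_simps)
      also have "\<dots> = \<bar>u0\<bar> * (sqrt lam * \<bar>1 - lam * conv (\<lambda>_. 1) (e0 lam) t\<bar>) + \<bar>s0\<bar> * (lam * \<bar>conv (\<lambda>_. 1) (E lam) t\<bar>)"
        unfolding sq(3) ..
      also have "\<dots> \<le> C * (m * (L * \<bar>u0\<bar>)) + \<bar>s0\<bar> * (m * C)" using 1 2 by (rule add_mono)
      also have "\<dots> = C * m * (L * \<bar>u0\<bar> + \<bar>s0\<bar>)" by (simp add: algebra_simps)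
      finally show ?thesis unfolding m_def .
    qed
    show ?thesis
      using uC sC vol A B D unfolding L_def by (intro exI[of _ u] exI[of _ s]) (auto simp: u_def)
  qed
  with C(1) show ?thesis using that by blast
qed

end


section \<open>Smooth functions\<close>

declare Ck_on.simps(2) [simp del]

abbreviation smooth :: "('a::real_normed_vector \<Rightarrow> 'b::real_normed_vector) \<Rightarrow> bool" where
  "smooth f \<equiv> \<forall>k. Ck_on k UNIV f"

lemma frechet_eq: "(f has_derivative f') (at x) \<Longrightarrow> frechet_derivative f (at x) v = f' v"
  using frechet_derivative_at[of f f' x] by simp

section \<open>Closure properties of \<open>k\<close> times continuously differentiable
  functions\<close>

lemma Ck_on_SucI:
  assumes "\<And>x. (f has_derivative f' x) (at x)" "\<And>v. Ck_on k UNIV (\<lambda>x. f' x v)"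
  shows "Ck_on (Suc k) UNIV f"
proof -
  have "(\<lambda>x. frechet_derivative f (at x) v) = (\<lambda>x. f' x v)" for v
    using assms(1) by (auto simp: frechet_eq)
  then show ?thesis using assms unfolding Ck_on.simps differentiable_def by auto
qed

lemma Ck_on_SucD:
  assumes "Ck_on (Suc k) UNIV f"
  shows "(f has_derivative frechet_derivative f (at x)) (at x)" "Ck_on k UNIV (\<lambda>x. frechet_derivative f (at x) v)"
  using assms unfolding Ck_on.simps frechet_derivative_works by auto

lemma Ck_on_Suc_imp: "Ck_on (Suc k) UNIV f \<Longrightarrow> Ck_on k UNIV f"
proof (induction k arbitrary: f)
  case 0
  then show ?case unfolding Ck_on.simps
    by (auto intro!: differentiable_imp_continuous_on simp: differentiable_on_def differentiable_at_withinI)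
next
  case (Suc k)
  show ?case
    by (rule Ck_on_SucI[OF Ck_on_SucD(1)[OF Suc.prems]]) (rule Suc.IH[OF Ck_on_SucD(2)[OF Suc.prems]])
qed

lemma Ck_on_const: "Ck_on k UNIV (\<lambda>x. c)"
proof (induction k arbitrary: c)
  case (Suc k)
  show ?case by (rule Ck_on_SucI[OF has_derivative_const Suc.IH])
qed simp

lemma Ck_on_linear: "bounded_linear L \<Longrightarrow> Ck_on k UNIV L"
proof (cases k)
  case (Suc k')
  assume L: "bounded_linear L"
  show ?thesis unfolding Suc
    by (rule Ck_on_SucI[OF bounded_linear_imp_has_derivative[OF L] Ck_on_const])
qed (auto simp: linear_continuous_on)

lemma Ck_on_compose_linear: "bounded_linear L \<Longrightarrow> Ck_on k UNIV f \<Longrightarrow> Ck_on k UNIV (\<lambda>x. L (f x))"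
proof (induction k arbitrary: f)
  case 0
  then show ?case by (simp add: bounded_linear.continuous_on)
next
  case (Suc k)
  show ?case
    by (rule Ck_on_SucI[OF bounded_linear.has_derivative[OF Suc.prems(1) Ck_on_SucD(1)[OF Suc.prems(2)]]])
       (rule Suc.IH[OF Suc.prems(1) Ck_on_SucD(2)[OF Suc.prems(2)]])
qed

lemma Ck_on_add: "Ck_on k UNIV f \<Longrightarrow> Ck_on k UNIV g \<Longrightarrow> Ck_on k UNIV (\<lambda>x. f x + g x)"
proof (induction k arbitrary: f g)
  case (Suc k)
  show ?case
    by (rule Ck_on_SucI[OF has_derivative_add[OF Ck_on_SucD(1)[OF Suc.prems(1)] Ck_on_SucD(1)[OF Suc.prems(2)]]])
      (rule Suc.IH[OF Ck_on_SucD(2)[OF Suc.prems(1)] Ck_on_SucD(2)[OF Suc.prems(2)]])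
qed (auto intro: continuous_on_add)

lemma Ck_on_mult:
  fixes f g :: "'a::real_normed_vector \<Rightarrow> real"
  shows "Ck_on k UNIV f \<Longrightarrow> Ck_on k UNIV g \<Longrightarrow> Ck_on k UNIV (\<lambda>x. f x * g x)"
proof (induction k arbitrary: f g)
  case (Suc k)
  show ?case
    by (rule Ck_on_SucI[OF has_derivative_mult[OF Ck_on_SucD(1)[OF Suc.prems(1)] Ck_on_SucD(1)[OF Suc.prems(2)]]])
      (rule Ck_on_add[OF Suc.IH[OF Ck_on_Suc_imp[OF Suc.prems(1)] Ck_on_SucD(2)[OF Suc.prems(2)]]
          Suc.IH[OF Ck_on_SucD(2)[OF Suc.prems(1)] Ck_on_Suc_imp[OF Suc.prems(2)]]])
qed (auto intro: continuous_on_mult)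

lemma Ck_on_sum: "finite I \<Longrightarrow> (\<And>i. i \<in> I \<Longrightarrow> Ck_on k UNIV (f i)) \<Longrightarrow> Ck_on k UNIV (\<lambda>x. \<Sum>i\<in>I. f i x)"
  by (induction I rule: finite_induct) (auto intro: Ck_on_const Ck_on_add)

text \<open>Derivatives of \<open>p (1 / s) exp (- 1 / s)\<close> are of the same form, with another polynomial \<open>p\<close>.\<close>

definition flat :: "real poly \<Rightarrow> real \<Rightarrow> real" where
  "flat p s = (if s > 0 then poly p (1 / s) * exp (- (1 / s)) else 0)"

text \<open>For \<open>y = 1 / s\<close> the derivative in \<open>s\<close> is
  \<open>- y\<^sup>2\<close> times the derivative in \<open>y\<close>, and the latter sends
  \<open>p exp (- y)\<close> to \<open>(pderiv p - p) exp (- y)\<close>.\<close>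

definition flat_deriv :: "real poly \<Rightarrow> real poly" where
  "flat_deriv p = [:0, 0, 1:] * (p - pderiv p)"

lemma tendsto_poly_exp_minus: "((\<lambda>y. poly p y * exp (- y)) \<longlongrightarrow> (0::real)) at_top"
proof -
  have "((\<lambda>y. \<Sum>i\<le>degree p. coeff p i * (y ^ i / exp y)) \<longlongrightarrow> (\<Sum>i\<le>degree p. coeff p i * 0)) at_top"
    by (intro tendsto_intros tendsto_power_div_exp_0)
  then show ?thesis by (simp add: poly_altdef exp_minus sum_distrib_right divide_inverse mult.assoc)
qed

lemma DERIV_flat: "(flat p has_real_derivative flat (flat_deriv p) s) (at s)"
proof -
  consider "s > 0" | "s < 0" | "s = 0" by linarith
  then show ?thesis
  proof cases
    case 1
    have d1: "((\<lambda>s. 1 / s) has_real_derivative (- (1 / s\<^sup>2))) (at s)"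
      using 1 by (auto intro!: derivative_eq_intros simp: power2_eq_square)
    have "((\<lambda>s. poly p (1 / s) * exp (- (1 / s))) has_real_derivative
        (poly (pderiv p) (1 / s) * (- (1 / s\<^sup>2))) * exp (- (1 / s)) + (exp (- (1 / s)) * (- (- (1 / s\<^sup>2)))) * poly p (1 / s)) (at s)"
      by (rule DERIV_mult[OF DERIV_chain2[OF poly_DERIV d1] DERIV_chain2[OF DERIV_exp DERIV_minus[OF d1]]])
    also have "(poly (pderiv p) (1 / s) * (- (1 / s\<^sup>2))) * exp (- (1 / s)) + (exp (- (1 / s)) * (- (- (1 / s\<^sup>2)))) * poly p (1 / s) = flat (flat_deriv p) s"
      using 1 by (simp add: flat_def flat_deriv_def power2_eq_square) (simp add: algebra_simps diff_divide_distrib)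
    finally show ?thesis
      by (rule has_field_derivative_transform_within_open[where S="{0<..}"]) (use 1 in \<open>auto simp: flat_def\<close>)
  next
    case 2
    have "((\<lambda>s. 0) has_real_derivative 0) (at s)" by simp
    then have "(flat p has_real_derivative 0) (at s)"
      by (rule has_field_derivative_transform_within_open[where S="{..<0}"]) (use 2 in \<open>auto simp: flat_def\<close>)
    then show ?thesis using 2 by (simp add: flat_def)
  next
    case 3
    have "((\<lambda>h. flat p h / h) \<longlongrightarrow> 0) (at_right 0)"
    proof -
      \<comment> \<open>\<open>pCons 0 p\<close> multiplies the polynomial by its variable
        \<open>1 / h\<close>, which absorbs the division in the difference quotient.\<close>
      have "((\<lambda>h. poly (pCons 0 p) (1 / h) * exp (- (1 / h))) \<longlongrightarrow> 0) (at_right 0)"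
        using filterlim_compose[OF tendsto_poly_exp_minus[of "pCons 0 p"] filterlim_inverse_at_top_right]
        by (simp add: inverse_eq_divide)
      moreover have "\<forall>\<^sub>F h in at_right 0. poly (pCons 0 p) (1 / h) * exp (- (1 / h)) = flat p h / h"
        by (auto simp: eventually_at_right_field flat_def intro!: exI[of _ 1])
      ultimately show ?thesis by (rule Lim_transform_eventually)
    qed
    moreover have "((\<lambda>h. flat p h / h) \<longlongrightarrow> 0) (at_left 0)"
      by (rule tendsto_eventually) (auto simp: eventually_at_left_field flat_def intro!: exI[of _ "-1"])
    ultimately have "((\<lambda>h. flat p h / h) \<longlongrightarrow> 0) (at 0)" by (simp add: filterlim_at_split)
    then show ?thesis using 3 by (simp add: has_field_derivative_iff flat_def)
  qed
qed

lemma Ck_on_flat: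
  fixes g :: "'a::real_normed_vector \<Rightarrow> real"
  assumes g: "smooth g"
  shows "Ck_on k UNIV (\<lambda>x. flat p (g x))"
proof (induction k arbitrary: p)
  case 0
  have "continuous_on UNIV (flat p)" by (rule DERIV_continuous_on) (auto intro: DERIV_flat)
  moreover have "continuous_on UNIV g" using g[rule_format, of 0] by simp
  ultimately show ?case by (auto intro: continuous_on_compose2)
next
  case (Suc k)
  have "((\<lambda>x. flat p (g x)) has_derivative (\<lambda>v. flat (flat_deriv p) (g x) * frechet_derivative g (at x) v)) (at x)" for x
    using has_derivative_compose[OF Ck_on_SucD(1)[OF g[rule_format]] DERIV_flat[unfolded has_field_derivative_def]] .
  moreover have "Ck_on k UNIV (\<lambda>x. flat (flat_deriv p) (g x) * frechet_derivative g (at x) v)" for v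
    by (rule Ck_on_mult[OF Suc.IH Ck_on_SucD(2)[OF g[rule_format]]])
  ultimately show ?case by (rule Ck_on_SucI)
qed

section \<open>Bump functions and approximation of indicators of open sets\<close>

definition bump :: "real \<Rightarrow> real" where "bump = flat 1"

lemma bump_simps: "s \<le> 0 \<Longrightarrow> bump s = 0" "s > 0 \<Longrightarrow> bump s > 0" "bump s \<ge> 0" "bump s \<le> 1"
  by (auto simp: bump_def flat_def)

lemma bump_pos_iff: "bump s > 0 \<longleftrightarrow> s > 0"
  by (simp add: bump_def flat_def)

lemma smooth_bump: "smooth g \<Longrightarrow> Ck_on k UNIV (\<lambda>x. bump (g x))"
  unfolding bump_def by (rule Ck_on_flat)

lemma smooth_dist_sq: "Ck_on k UNIV (\<lambda>x::vec3. r - (norm (x - c))\<^sup>2)"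
proof -
  have e: "r - (norm (x - c))\<^sup>2 = r + (- 1) * (\<Sum>i\<in>UNIV. (x $ i + (- c $ i)) * (x $ i + (- c $ i)))" for x
    by (simp add: power2_norm_eq_inner inner_vec_def)
  show ?thesis unfolding e
    by (intro Ck_on_add Ck_on_mult Ck_on_sum Ck_on_const Ck_on_linear bounded_linear_vec_nth) auto
qed

text \<open>By Lindelof's theorem \<open>U\<close> is a countable union of balls whose closures lie
  in \<open>U\<close>. A finite sum of ball bumps has compact support in \<open>U\<close>, and
  composing \<open>bump\<close> with growing multiples pushes the values to \<open>1\<close>
  wherever the sum is eventually positive.\<close>

lemma open_bump_sequence:
  fixes U :: "vec3 set"
  assumes U: "open U" "U \<subseteq> \<Omega>"
  obtains \<phi> :: "nat \<Rightarrow> vec3 \<Rightarrow> real" where "\<And>n. \<phi> n \<in> test_functions \<Omega>" "\<And>n x. 0 \<le> \<phi> n x" "\<And>n x. \<phi> n x \<le> 1"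
    "\<And>x. (\<lambda>n. \<phi> n x) \<longlonglongrightarrow> indicator U x"
proof (cases "U = {}")
  case True
  show ?thesis
  proof (rule that[of "\<lambda>n x. 0"])
    show "(\<lambda>x. 0) \<in> test_functions \<Omega>" by (simp add: test_functions_def Ck_on_const)
  qed (auto simp: True)
next
  case False
  define \<F> where "\<F> = {ball c r | c r. r > 0 \<and> cball c r \<subseteq> U}"
  have UF: "\<Union>\<F> = U"
  proof
    show "\<Union>\<F> \<subseteq> U" unfolding \<F>_def using ball_subset_cball by fastforce
    show "U \<subseteq> \<Union>\<F>"
    proof
      fix x assume "x \<in> U"
      then obtain e where "e > 0" "cball x e \<subseteq> U" using U open_contains_cball by blast
      then show "x \<in> \<Union>\<F>" unfolding \<F>_def by (auto intro!: exI[of _ "ball x e"])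
    qed
  qed
  obtain \<F>' where F': "\<F>' \<subseteq> \<F>" "countable \<F>'" "\<Union>\<F>' = \<Union>\<F>"
    using Lindelof[of \<F>] by (auto simp: \<F>_def)
  have ne: "\<F>' \<noteq> {}" using F'(3) UF False by auto
  define B where "B = from_nat_into \<F>'"
  have rB: "range B = \<F>'" unfolding B_def by (rule range_from_nat_into[OF ne F'(2)])
  have ex: "\<exists>p. B i = ball (fst p) (snd p) \<and> snd p > 0 \<and> cball (fst p) (snd p) \<subseteq> U" for i
  proof -
    have "B i \<in> \<F>" using rB F'(1) by blast
    then show ?thesis unfolding \<F>_def by auto
  qed
  define p where "p i = (SOME p. B i = ball (fst p) (snd p) \<and> snd p > 0 \<and> cball (fst p) (snd p) \<subseteq> U)" for i
  define c r where "c i = fst (p i)" and "r i = snd (p i)" for i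
  have cr: "B i = ball (c i) (r i)" "r i > 0" "cball (c i) (r i) \<subseteq> U" for i
    using someI_ex[OF ex[of i]] unfolding c_def r_def p_def by blast+
  have UB: "U = (\<Union>i. ball (c i) (r i))" unfolding cr(1)[symmetric] using rB UF F'(3) by simp
  define b where "b i x = bump ((r i)\<^sup>2 - (norm (x - c i))\<^sup>2)" for i x
  have bpos: "b i x > 0 \<longleftrightarrow> x \<in> ball (c i) (r i)" for i x
  proof -
    have "(norm (x - c i))\<^sup>2 < (r i)\<^sup>2 \<longleftrightarrow> norm (x - c i) < r i"
      using cr(2)[of i] by (auto intro: power2_less_imp_less power_strict_mono simp: less_imp_le)
    moreover have "b i x > 0 \<longleftrightarrow> (norm (x - c i))\<^sup>2 < (r i)\<^sup>2"
      unfolding b_def bump_pos_iff by simp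
    ultimately show ?thesis by (simp add: dist_norm norm_minus_commute)
  qed
  have b0: "b i x \<ge> 0" for i x by (simp add: b_def bump_simps)
  \<comment> \<open>The factor \<open>real n\<close> sends the argument to infinity on
    \<open>U\<close>, where \<open>bump\<close> tends to \<open>1\<close>; outside \<open>U\<close>
    the sum is zero and stays zero.\<close>
  define \<phi> where "\<phi> n x = bump (real n * (\<Sum>i<n. b i x))" for n x
  have nz: "\<phi> n x \<noteq> 0 \<Longrightarrow> x \<in> (\<Union>i<n. cball (c i) (r i))" for n x
  proof (rule ccontr)
    assume a: "\<phi> n x \<noteq> 0" "x \<notin> (\<Union>i<n. cball (c i) (r i))"
    then have "x \<notin> ball (c i) (r i)" if "i < n" for i using that ball_subset_cball by blast
    then have "b i x = 0" if "i < n" for i using that bpos[of i x] b0[of i x] by auto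
    then have "(\<Sum>i<n. b i x) = 0" by simp
    then show False using a by (simp add: \<phi>_def bump_simps)
  qed
  show ?thesis
  proof (rule that[of \<phi>])
    fix n
    have co: "compact (\<Union>i<n. cball (c i) (r i))" by (intro compact_UN) auto
    have cl: "closure {x. \<phi> n x \<noteq> 0} \<subseteq> (\<Union>i<n. cball (c i) (r i))"
      by (rule closure_minimal) (use nz co compact_imp_closed in auto)
    have "smooth (\<lambda>x. real n * (\<Sum>i<n. b i x))"
      unfolding b_def by (intro allI Ck_on_mult Ck_on_const Ck_on_sum smooth_bump smooth_dist_sq) auto
    then have "smooth (\<phi> n)" unfolding \<phi>_def[abs_def] using smooth_bump by blast
    moreover have "compact (closure {x. \<phi> n x \<noteq> 0})"
    proof -
      have "bounded {x. \<phi> n x \<noteq> 0}"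
        by (rule bounded_subset[OF compact_imp_bounded[OF co]]) (use nz in auto)
      then show ?thesis by simp
    qed
    moreover have "closure {x. \<phi> n x \<noteq> 0} \<subseteq> \<Omega>" using cl cr(3) U(2) by blast
    ultimately show "\<phi> n \<in> test_functions \<Omega>" by (simp add: test_functions_def)
    show "0 \<le> \<phi> n x" "\<phi> n x \<le> 1" for x by (auto simp: \<phi>_def bump_simps)
  next
    fix x
    show "(\<lambda>n. \<phi> n x) \<longlonglongrightarrow> indicator U x"
    proof (cases "x \<in> U")
      case True
      then obtain i0 where i0: "x \<in> ball (c i0) (r i0)" using UB by blast
      then have pos: "b i0 x > 0" using bpos by blast
      have lim: "filterlim (\<lambda>n. real n * b i0 x) at_top sequentially"
        by (rule filterlim_at_top_mult_tendsto_pos[OF tendsto_const pos filterlim_real_sequentially])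
      have "(\<lambda>n. exp (- inverse (real n * b i0 x))) \<longlonglongrightarrow> exp (- 0)"
        by (intro tendsto_intros tendsto_inverse_0_at_top lim)
      then have l1: "(\<lambda>n. exp (- inverse (real n * b i0 x))) \<longlonglongrightarrow> 1" by simp
      have "(\<lambda>n. \<phi> n x) \<longlonglongrightarrow> 1"
      proof (rule tendsto_sandwich[OF _ _ l1 tendsto_const])
        show "\<forall>\<^sub>F n in sequentially. \<phi> n x \<le> 1" by (auto simp: \<phi>_def bump_simps)
        show "\<forall>\<^sub>F n in sequentially. exp (- inverse (real n * b i0 x)) \<le> \<phi> n x"
        proof (rule eventually_sequentiallyI[of "Suc i0"])
          fix n assume n: "Suc i0 \<le> n"
          have ge: "b i0 x \<le> (\<Sum>i<n. b i x)"
            using n b0 by (intro member_le_sum) auto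
          have np: "real n > 0" using n by simp
          have le: "real n * b i0 x \<le> real n * (\<Sum>i<n. b i x)" using ge np by simp
          have p: "0 < real n * b i0 x" using np pos by simp
          then have "\<phi> n x = exp (- inverse (real n * (\<Sum>i<n. b i x)))"
            using le by (simp add: \<phi>_def bump_def flat_def inverse_eq_divide)
          then show "exp (- inverse (real n * b i0 x)) \<le> \<phi> n x"
            using le_imp_inverse_le[OF le p] by simp
        qed
      qed
      then show ?thesis using True by simp
    next
      case False
      have "\<phi> n x = 0" for n using nz[of n x] False cr(3) by blast
      then show ?thesis using False by simp
    qed
  qed
qed


section \<open>Square-integrable fields\<close>

lemma L2I:
  assumes "f \<in> borel_measurable (lebesgue_on \<Omega>)" "integrable (lebesgue_on \<Omega>) (\<lambda>x. (norm (f x))\<^sup>2)"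
  shows "f \<in> L2 \<Omega>"
  using assms by (simp add: L2_def)

lemma L2D:
  assumes "f \<in> L2 \<Omega>"
  shows "f \<in> borel_measurable (lebesgue_on \<Omega>)" "integrable (lebesgue_on \<Omega>) (\<lambda>x. (norm (f x))\<^sup>2)"
  using assms by (auto simp: L2_def)

lemma L2_inner_integrable:
  assumes "f \<in> L2 \<Omega>" "g \<in> L2 \<Omega>"
  shows "integrable (lebesgue_on \<Omega>) (\<lambda>x. f x \<bullet> g x)"
proof (rule Bochner_Integration.integrable_bound)
  show "integrable (lebesgue_on \<Omega>) (\<lambda>x. (norm (f x))\<^sup>2 + (norm (g x))\<^sup>2)"
    using L2D[OF assms(1)] L2D[OF assms(2)] by simp
  show "(\<lambda>x. f x \<bullet> g x) \<in> borel_measurable (lebesgue_on \<Omega>)"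
    using L2D[OF assms(1)] L2D[OF assms(2)] by simp
  show "AE x in lebesgue_on \<Omega>. norm (f x \<bullet> g x) \<le> norm ((norm (f x))\<^sup>2 + (norm (g x))\<^sup>2)"
  proof (rule AE_I2)
    fix x
    have "\<bar>f x \<bullet> g x\<bar> \<le> norm (f x) * norm (g x)" by (rule Cauchy_Schwarz_ineq2)
    also have "\<dots> \<le> (norm (f x))\<^sup>2 + (norm (g x))\<^sup>2"
    proof -
      have "2 * (norm (f x) * norm (g x)) \<le> (norm (f x))\<^sup>2 + (norm (g x))\<^sup>2"
        using sum_squares_bound[of "norm (f x)" "norm (g x)"] by (simp add: mult.assoc)
      moreover have "0 \<le> norm (f x) * norm (g x)" by simp
      ultimately show ?thesis by linarith
    qed
    finally show "norm (f x \<bullet> g x) \<le> norm ((norm (f x))\<^sup>2 + (norm (g x))\<^sup>2)" by simp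
  qed
qed

lemma L2_add:
  assumes "f \<in> L2 \<Omega>" "g \<in> L2 \<Omega>"
  shows "(\<lambda>x. f x + g x) \<in> L2 \<Omega>"
proof (rule L2I)
  have "integrable (lebesgue_on \<Omega>) (\<lambda>x. (norm (f x))\<^sup>2 + (norm (g x))\<^sup>2 + 2 * (f x \<bullet> g x))"
    using L2D[OF assms(1)] L2D[OF assms(2)] L2_inner_integrable[OF assms] by simp
  then show "integrable (lebesgue_on \<Omega>) (\<lambda>x. (norm (f x + g x))\<^sup>2)"
    by (simp add: power2_norm_eq_inner inner_add inner_commute algebra_simps)
qed (use L2D[OF assms(1)] L2D[OF assms(2)] in simp)

lemma L2_scale: "f \<in> L2 \<Omega> \<Longrightarrow> (\<lambda>x. c *\<^sub>R f x) \<in> L2 \<Omega>"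
  by (auto simp: L2_def power_mult_distrib)

lemma L2_zero: "(\<lambda>x. 0) \<in> L2 \<Omega>"
  by (auto simp: L2_def)

lemma L2_diff:
  assumes "f \<in> L2 \<Omega>" "g \<in> L2 \<Omega>"
  shows "(\<lambda>x. f x - g x) \<in> L2 \<Omega>"
  using L2_add[OF assms(1) L2_scale[OF assms(2), of "-1"]] by simp

lemma L2_sum: "finite I \<Longrightarrow> (\<And>i. i \<in> I \<Longrightarrow> f i \<in> L2 \<Omega>) \<Longrightarrow> (\<lambda>x. \<Sum>i\<in>I. f i x) \<in> L2 \<Omega>"
  by (induction I rule: finite_induct) (auto intro: L2_zero L2_add)

lemma L2_inner_commute: "L2_inner \<Omega> f g = L2_inner \<Omega> g f"
  by (simp add: L2_inner_def inner_commute)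

lemma L2_inner_add_left:
  assumes "f \<in> L2 \<Omega>" "g \<in> L2 \<Omega>" "h \<in> L2 \<Omega>"
  shows "L2_inner \<Omega> (\<lambda>x. f x + g x) h = L2_inner \<Omega> f h + L2_inner \<Omega> g h"
  using L2_inner_integrable[OF assms(1,3)] L2_inner_integrable[OF assms(2,3)]
  by (simp add: L2_inner_def inner_add_left)

lemma L2_inner_diff_left:
  assumes "f \<in> L2 \<Omega>" "g \<in> L2 \<Omega>" "h \<in> L2 \<Omega>"
  shows "L2_inner \<Omega> (\<lambda>x. f x - g x) h = L2_inner \<Omega> f h - L2_inner \<Omega> g h"
  using L2_inner_integrable[OF assms(1,3)] L2_inner_integrable[OF assms(2,3)]
  by (simp add: L2_inner_def inner_diff_left)

lemma L2_inner_scale_left: "L2_inner \<Omega> (\<lambda>x. c *\<^sub>R f x) h = c * L2_inner \<Omega> f h"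
  by (simp add: L2_inner_def)

lemma L2_inner_add_right:
  assumes "f \<in> L2 \<Omega>" "g \<in> L2 \<Omega>" "h \<in> L2 \<Omega>"
  shows "L2_inner \<Omega> h (\<lambda>x. f x + g x) = L2_inner \<Omega> h f + L2_inner \<Omega> h g"
  using L2_inner_add_left[OF assms] by (simp add: L2_inner_commute)

lemma L2_inner_scale_right: "L2_inner \<Omega> h (\<lambda>x. c *\<^sub>R f x) = c * L2_inner \<Omega> h f"
  by (simp add: L2_inner_def)

lemma L2_inner_sum_left:
  assumes "finite I" "\<And>i. i \<in> I \<Longrightarrow> f i \<in> L2 \<Omega>" "h \<in> L2 \<Omega>"
  shows "L2_inner \<Omega> (\<lambda>x. \<Sum>i\<in>I. f i x) h = (\<Sum>i\<in>I. L2_inner \<Omega> (f i) h)"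
  using assms
proof (induction I rule: finite_induct)
  case (insert i I)
  then show ?case using L2_inner_add_left[of "f i" \<Omega> "\<lambda>x. \<Sum>i\<in>I. f i x" h] L2_sum[of I f \<Omega>] by simp
qed (simp add: L2_inner_def)

lemma L2_inner_self_nonneg: "L2_inner \<Omega> f f \<ge> 0"
  by (simp add: L2_inner_def)

lemma L2_norm_sq: "(L2_norm \<Omega> f)\<^sup>2 = L2_inner \<Omega> f f"
  by (simp add: L2_norm_def L2_inner_self_nonneg)

lemma L2_norm_sq_integral: "(L2_norm \<Omega> f)\<^sup>2 = (LINT x|lebesgue_on \<Omega>. (norm (f x))\<^sup>2)"
  by (simp add: L2_norm_sq L2_inner_def power2_norm_eq_inner)

lemma L2_norm_nonneg: "L2_norm \<Omega> f \<ge> 0"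
  by (simp add: L2_norm_def L2_inner_self_nonneg)

lemma L2_inner_cong_AE:
  assumes "AE x in lebesgue_on \<Omega>. f x = f' x" "AE x in lebesgue_on \<Omega>. g x = g' x"
    "f \<in> L2 \<Omega>" "f' \<in> L2 \<Omega>" "g \<in> L2 \<Omega>" "g' \<in> L2 \<Omega>"
  shows "L2_inner \<Omega> f g = L2_inner \<Omega> f' g'"
  unfolding L2_inner_def
proof (rule integral_cong_AE)
  show "AE x in lebesgue_on \<Omega>. f x \<bullet> g x = f' x \<bullet> g' x"
    using assms(1,2) by eventually_elim simp
qed (use assms(3-) in \<open>auto dest!: L2D(1)\<close>)

lemma L2_norm_cong_AE:
  assumes "AE x in lebesgue_on \<Omega>. f x = g x" "f \<in> L2 \<Omega>" "g \<in> L2 \<Omega>"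
  shows "L2_norm \<Omega> f = L2_norm \<Omega> g"
  using L2_inner_cong_AE[OF assms(1) assms(1)] assms by (simp add: L2_norm_def)

lemma L2_norm_scale: "L2_norm \<Omega> (\<lambda>x. c *\<^sub>R f x) = \<bar>c\<bar> * L2_norm \<Omega> f"
  by (simp add: L2_norm_def L2_inner_scale_left L2_inner_scale_right real_sqrt_mult flip: mult.assoc)

lemma L2_norm_minus_commute: "L2_norm \<Omega> (\<lambda>x. f x - g x) = L2_norm \<Omega> (\<lambda>x. g x - f x)"
  by (simp add: L2_norm_def L2_inner_def inner_diff_left inner_diff_right algebra_simps inner_commute)

text \<open>The polynomial \<open>A * t\<^sup>2 + 2 * B * t + D\<close> is the squared norm of a
  combination of \<open>f\<close> and \<open>g\<close>, hence nonnegative; its minimum gives the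
  inequality.\<close>

lemma L2_Cauchy_Schwarz:
  assumes f: "f \<in> L2 \<Omega>" and g: "g \<in> L2 \<Omega>"
  shows "\<bar>L2_inner \<Omega> f g\<bar> \<le> L2_norm \<Omega> f * L2_norm \<Omega> g"
proof -
  define A B D where "A = L2_inner \<Omega> f f" and "B = L2_inner \<Omega> f g" and "D = L2_inner \<Omega> g g"
  have q: "A * t\<^sup>2 + 2 * B * t + D \<ge> 0" for t
  proof -
    have "0 \<le> L2_inner \<Omega> (\<lambda>x. t *\<^sub>R f x + g x) (\<lambda>x. t *\<^sub>R f x + g x)" by (rule L2_inner_self_nonneg)
    also have "\<dots> = A * t\<^sup>2 + 2 * B * t + D"
      unfolding L2_inner_add_left[OF L2_scale[OF f] g L2_add[OF L2_scale[OF f] g]]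
        L2_inner_add_right[OF L2_scale[OF f] g g] L2_inner_add_right[OF L2_scale[OF f] g L2_scale[OF f]] L2_inner_add_right[OF L2_scale[OF f] g f]
        L2_inner_scale_left L2_inner_scale_right A_def B_def D_def L2_inner_commute[of \<Omega> g f]
      by (simp add: power2_eq_square algebra_simps)
    finally show ?thesis .
  qed
  have AD: "A \<ge> 0" "D \<ge> 0" by (auto simp: A_def D_def L2_inner_self_nonneg)
  have "B\<^sup>2 \<le> A * D"
  proof (cases "A = 0")
    case True
    have "B = 0"
    proof (rule ccontr)
      assume "B \<noteq> 0"
      \<comment> \<open>If \<open>A = 0\<close> the polynomial is affine, and at this argument its
        value would be \<open>- 1\<close>.\<close>
      then show False using q[of "- (D + 1) / (2 * B)"] True by (simp add: field_simps)
    qed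
    then show ?thesis using True by simp
  next
    case False
    then have A: "A > 0" using AD by simp
    have "A * (- B / A)\<^sup>2 + 2 * B * (- B / A) + D \<ge> 0" by (rule q)
    also have "A * (- B / A)\<^sup>2 + 2 * B * (- B / A) + D = D - B\<^sup>2 / A"
      using A by (simp add: power2_eq_square field_simps)
    finally show ?thesis using A by (simp add: field_simps)
  qed
  then have "sqrt (B\<^sup>2) \<le> sqrt (A * D)" by (rule real_sqrt_le_mono)
  then show ?thesis by (simp add: real_sqrt_mult L2_norm_def A_def B_def D_def)
qed

lemma L2_norm_triangle:
  assumes f: "f \<in> L2 \<Omega>" and g: "g \<in> L2 \<Omega>"
  shows "L2_norm \<Omega> (\<lambda>x. f x + g x) \<le> L2_norm \<Omega> f + L2_norm \<Omega> g"
proof (rule power2_le_imp_le)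
  have "(L2_norm \<Omega> (\<lambda>x. f x + g x))\<^sup>2 = (L2_norm \<Omega> f)\<^sup>2 + 2 * L2_inner \<Omega> f g + (L2_norm \<Omega> g)\<^sup>2"
    unfolding L2_norm_sq by (subst L2_inner_add_left[OF f g L2_add[OF f g]])
      (simp add: L2_inner_add_right[OF f g] f g L2_inner_commute[of \<Omega> g f])
  also have "\<dots> \<le> (L2_norm \<Omega> f)\<^sup>2 + 2 * (L2_norm \<Omega> f * L2_norm \<Omega> g) + (L2_norm \<Omega> g)\<^sup>2"
    using L2_Cauchy_Schwarz[OF f g] by auto
  also have "\<dots> = (L2_norm \<Omega> f + L2_norm \<Omega> g)\<^sup>2" by (simp add: power2_sum)
  finally show "(L2_norm \<Omega> (\<lambda>x. f x + g x))\<^sup>2 \<le> (L2_norm \<Omega> f + L2_norm \<Omega> g)\<^sup>2" .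
qed (simp add: L2_norm_nonneg)

lemma L2_norm_triangle_diff:
  assumes f: "f \<in> L2 \<Omega>" and g: "g \<in> L2 \<Omega>" and h: "h \<in> L2 \<Omega>"
  shows "L2_norm \<Omega> (\<lambda>x. f x - h x) \<le> L2_norm \<Omega> (\<lambda>x. f x - g x) + L2_norm \<Omega> (\<lambda>x. g x - h x)"
  using L2_norm_triangle[OF L2_diff[OF f g] L2_diff[OF g h]] by simp

lemma L2_norm_diff_abs:
  assumes f: "f \<in> L2 \<Omega>" and g: "g \<in> L2 \<Omega>"
  shows "\<bar>L2_norm \<Omega> f - L2_norm \<Omega> g\<bar> \<le> L2_norm \<Omega> (\<lambda>x. f x - g x)"
  using L2_norm_triangle_diff[OF f g L2_zero] L2_norm_triangle_diff[OF g f L2_zero] L2_norm_minus_commute[of \<Omega> f g] by simp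

text \<open>Riesz--Fischer: a rapidly Cauchy subsequence converges almost everywhere, and Fatou's lemma
  identifies its limit.\<close>

lemma L2_complete:
  fixes f :: "nat \<Rightarrow> vec3 \<Rightarrow> 'b::euclidean_space"
  assumes fin: "emeasure (lebesgue_on \<Omega>) (space (lebesgue_on \<Omega>)) \<noteq> \<infinity>"
    and f: "\<And>n. f n \<in> L2 \<Omega>"
    and cauchy: "\<And>e. e > 0 \<Longrightarrow> \<exists>N. \<forall>m\<ge>N. \<forall>n\<ge>N. L2_norm \<Omega> (\<lambda>x. f m x - f n x) < e"
  shows "\<exists>g \<in> L2 \<Omega>. (\<lambda>n. L2_norm \<Omega> (\<lambda>x. f n x - g x)) \<longlonglongrightarrow> 0"
proof -
  let ?M = "lebesgue_on \<Omega>"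
  interpret finite_measure ?M by (rule finite_measureI) (use fin in simp)
  note [measurable] = L2D(1)[OF f]
  obtain N where N: "\<And>k m n. m \<ge> N k \<Longrightarrow> n \<ge> N k \<Longrightarrow> L2_norm \<Omega> (\<lambda>x. f m x - f n x) < (1/2)^k"
    using cauchy[of "(1/2)^_"] by (simp, metis)
  \<comment> \<open>A partial sum of the thresholds exceeds each of them, so \<open>r k\<close> and
    \<open>r (Suc k)\<close> both lie beyond \<open>N k\<close>.\<close>
  define r where "r k = (\<Sum>i\<le>k. N i)" for k
  have rN: "N k \<le> r k" "N k \<le> r (Suc k)" for k
    unfolding r_def by (intro member_le_sum; simp)+
  define d where "d k x = f (r (Suc k)) x - f (r k) x" for k x
  have dL: "d k \<in> L2 \<Omega>" for k unfolding d_def by (intro L2_diff f)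
  have dn: "L2_norm \<Omega> (d k) < (1/2)^k" for k unfolding d_def using N rN by blast
  note [measurable] = L2D(1)[OF dL]
  define C where "C = sqrt (measure ?M (space ?M))"
  have one: "(\<lambda>x. 1::real) \<in> L2 \<Omega>" by (auto simp: L2_def)
  \<comment> \<open>Cauchy-Schwarz against the constant \<open>1\<close>, square integrable because
    the measure is finite. The summable L1 norms give pointwise absolute convergence almost
    everywhere.\<close>
  have d1: "(LINT x|?M. norm (d k x)) \<le> C * (1/2)^k" and d1i: "integrable ?M (\<lambda>x. norm (d k x))" for k
  proof -
    have nd: "(\<lambda>x. norm (d k x)) \<in> L2 \<Omega>" using L2D[OF dL[of k]] by (auto simp: L2_def)
    have "\<bar>L2_inner \<Omega> (\<lambda>x. 1) (\<lambda>x. norm (d k x))\<bar> \<le> L2_norm \<Omega> (\<lambda>x. 1::real) * L2_norm \<Omega> (\<lambda>x. norm (d k x))"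
      by (rule L2_Cauchy_Schwarz[OF one nd])
    moreover have "L2_norm \<Omega> (\<lambda>x. 1::real) = C" by (simp add: L2_norm_def L2_inner_def C_def)
    moreover have "L2_norm \<Omega> (\<lambda>x. norm (d k x)) = L2_norm \<Omega> (d k)"
      by (simp add: L2_norm_def L2_inner_def power2_norm_eq_inner[symmetric] power2_eq_square)
    moreover have "C * L2_norm \<Omega> (d k) \<le> C * (1/2)^k" using dn[of k] by (intro mult_left_mono) (auto simp: C_def)
    ultimately show "(LINT x|?M. norm (d k x)) \<le> C * (1/2)^k" by (simp add: L2_inner_def)
    show "integrable ?M (\<lambda>x. norm (d k x))" using L2_inner_integrable[OF one nd] by simp
  qed
  have "(\<integral>\<^sup>+x. (\<Sum>k. ennreal (norm (d k x))) \<partial>?M) = (\<Sum>k. \<integral>\<^sup>+x. ennreal (norm (d k x)) \<partial>?M)"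
    by (rule nn_integral_suminf) simp
  also have "\<dots> = (\<Sum>k. ennreal (LINT x|?M. norm (d k x)))"
    by (intro suminf_cong nn_integral_eq_integral d1i) auto
  also have "\<dots> \<le> (\<Sum>k. ennreal (C * (1/2)^k))"
    by (intro suminf_le ennreal_leI d1) auto
  also have "\<dots> = ennreal (\<Sum>k. C * (1/2)^k)"
    by (intro suminf_ennreal2) (auto simp: C_def intro!: summable_mult summable_geometric)
  also have "\<dots> < \<infinity>" by simp
  finally have "AE x in ?M. (\<Sum>k. ennreal (norm (d k x))) \<noteq> \<infinity>"
    by (intro nn_integral_noteq_infinite) auto
  then have conv: "AE x in ?M. convergent (\<lambda>k. f (r k) x)"
  proof eventually_elim
    case (elim x)
    then have "summable (\<lambda>k. norm (d k x))"
      by (intro summable_suminf_not_top) (auto simp: top_unique)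
    then have "summable (\<lambda>k. d k x)" by (rule summable_norm_cancel)
    then have "convergent (\<lambda>n. \<Sum>k<n. d k x)" by (simp add: summable_iff_convergent)
    moreover have "(\<Sum>k<n. d k x) = f (r n) x - f (r 0) x" for n
      unfolding d_def by (rule sum_lessThan_telescope)
    ultimately have "convergent (\<lambda>n. f (r n) x - f (r 0) x)" by simp
    then have "convergent (\<lambda>n. (f (r n) x - f (r 0) x) + f (r 0) x)" by (intro convergent_add convergent_const)
    then show ?case by simp
  qed
  define g where "g x = lim (\<lambda>k. f (r k) x)" for x
  have [measurable]: "g \<in> borel_measurable ?M" unfolding g_def by measurable
  \<comment> \<open>Fatou's lemma as the index \<open>r j\<close> tends to infinity. A single bound
    yields integrability of the limit and the rate of convergence of the full sequence.\<close>
  have key: "integrable ?M (\<lambda>x. (norm (f n x - g x))\<^sup>2) \<and> (LINT x|?M. (norm (f n x - g x))\<^sup>2) \<le> ((1/2)^k)\<^sup>2" if n: "n \<ge> N k" for n k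
  proof -
    have "(\<integral>\<^sup>+x. ennreal ((norm (f n x - g x))\<^sup>2) \<partial>?M) = (\<integral>\<^sup>+x. liminf (\<lambda>j. ennreal ((norm (f n x - f (r j) x))\<^sup>2)) \<partial>?M)"
    proof (rule nn_integral_cong_AE, use conv in eventually_elim)
      case (elim x)
      then have "(\<lambda>j. f (r j) x) \<longlonglongrightarrow> g x" by (simp add: g_def convergent_LIMSEQ_iff)
      then have "(\<lambda>j. ennreal ((norm (f n x - f (r j) x))\<^sup>2)) \<longlonglongrightarrow> ennreal ((norm (f n x - g x))\<^sup>2)"
        by (intro tendsto_intros tendsto_ennrealI)
      from lim_imp_Liminf[OF trivial_limit_sequentially this] show ?case by simp
    qed
    also have "\<dots> \<le> liminf (\<lambda>j. \<integral>\<^sup>+x. ennreal ((norm (f n x - f (r j) x))\<^sup>2) \<partial>?M)"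
      by (rule nn_integral_liminf) simp
    also have "\<dots> \<le> ennreal (((1/2)^k)\<^sup>2)"
    proof (rule order_trans[OF Liminf_le_Limsup Limsup_bounded], simp, rule eventually_sequentiallyI[of k])
      fix j assume "k \<le> j"
      then have "N k \<le> r j" unfolding r_def by (intro member_le_sum) auto
      then have "L2_norm \<Omega> (\<lambda>x. f n x - f (r j) x) < (1/2)^k" using N n by blast
      then have "(L2_norm \<Omega> (\<lambda>x. f n x - f (r j) x))\<^sup>2 \<le> ((1/2)^k)\<^sup>2"
        by (intro power_mono) (auto simp: L2_norm_nonneg)
      then show "(\<integral>\<^sup>+x. ennreal ((norm (f n x - f (r j) x))\<^sup>2) \<partial>?M) \<le> ennreal (((1/2)^k)\<^sup>2)"
        using L2D(2)[OF L2_diff[OF f f], of n "r j"]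
        by (subst nn_integral_eq_integral) (auto simp: L2_norm_sq_integral)
    qed
    finally have le: "(\<integral>\<^sup>+x. ennreal ((norm (f n x - g x))\<^sup>2) \<partial>?M) \<le> ennreal (((1/2)^k)\<^sup>2)" .
    have i: "integrable ?M (\<lambda>x. (norm (f n x - g x))\<^sup>2)"
    proof (rule integrableI_bounded)
      show "(\<integral>\<^sup>+x. ennreal (norm ((norm (f n x - g x))\<^sup>2)) \<partial>?M) < \<infinity>"
        using le by (simp add: le_less_trans[OF _ ennreal_less_top])
    qed simp
    moreover have "(LINT x|?M. (norm (f n x - g x))\<^sup>2) \<le> ((1/2)^k)\<^sup>2"
      using le i by (subst (asm) nn_integral_eq_integral) auto
    ultimately show ?thesis by simp
  qed
  have "(\<lambda>x. f (N 0) x - g x) \<in> L2 \<Omega>" using key[of 0 "N 0"] by (intro L2I) auto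
  from L2_diff[OF f this, of "N 0"] have gL: "g \<in> L2 \<Omega>" by simp
  have "(\<lambda>n. L2_norm \<Omega> (\<lambda>x. f n x - g x)) \<longlonglongrightarrow> 0"
  proof (rule LIMSEQ_I)
    fix e :: real assume e: "e > 0"
    obtain k where k: "(1/2)^k < e" using real_arch_pow_inv[OF e, of "1/2"] by auto
    have "norm (L2_norm \<Omega> (\<lambda>x. f n x - g x) - 0) < e" if "n \<ge> N k" for n
    proof -
      have "(L2_norm \<Omega> (\<lambda>x. f n x - g x))\<^sup>2 \<le> ((1/2)^k)\<^sup>2"
        using key[OF that] by (simp add: L2_norm_sq_integral)
      then have "L2_norm \<Omega> (\<lambda>x. f n x - g x) \<le> (1/2)^k" by (rule power2_le_imp_le) simp
      then show ?thesis using k by (simp add: L2_norm_nonneg)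
    qed
    then show "\<exists>no. \<forall>n\<ge>no. norm (L2_norm \<Omega> (\<lambda>x. f n x - g x) - 0) < e" by blast
  qed
  then show ?thesis using gL by blast
qed

section \<open>Orthonormal systems and series expansions\<close>

definition orthonormal :: "vec3 set \<Rightarrow> (nat \<Rightarrow> vec3 \<Rightarrow> 'b::euclidean_space) \<Rightarrow> bool" where
  "orthonormal \<Omega> e \<longleftrightarrow> (\<forall>k. e k \<in> L2 \<Omega>) \<and> (\<forall>k l. L2_inner \<Omega> (e k) (e l) = (if k = l then 1 else 0))"

text \<open>The coefficients are an argument instead of being computed from \<open>f\<close>. The
  system need not be complete: the solution is built from prescribed coefficients, and its
  components lie in different closed spans.\<close>

definition expands :: "vec3 set \<Rightarrow> (nat \<Rightarrow> vec3 \<Rightarrow> 'b::euclidean_space) \<Rightarrow> (nat \<Rightarrow> real) \<Rightarrow> (vec3 \<Rightarrow> 'b) \<Rightarrow> bool" where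
  "expands \<Omega> e c f \<longleftrightarrow> f \<in> L2 \<Omega> \<and> (\<lambda>n. L2_norm \<Omega> (\<lambda>x. f x - (\<Sum>k<n. c k *\<^sub>R e k x))) \<longlonglongrightarrow> 0"

lemma orthonormalD:
  assumes "orthonormal \<Omega> e"
  shows "e k \<in> L2 \<Omega>" "L2_inner \<Omega> (e k) (e l) = (if k = l then 1 else 0)"
  using assms by (auto simp: orthonormal_def)

lemma L2_comb: "orthonormal \<Omega> e \<Longrightarrow> finite I \<Longrightarrow> (\<lambda>x. \<Sum>k\<in>I. c k *\<^sub>R e k x) \<in> L2 \<Omega>"
  by (intro L2_sum L2_scale orthonormalD)

lemma L2_inner_comb_left:
  assumes "\<And>k. e k \<in> L2 \<Omega>" "finite I" "h \<in> L2 \<Omega>"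
  shows "L2_inner \<Omega> (\<lambda>x. \<Sum>k\<in>I. c k *\<^sub>R e k x) h = (\<Sum>k\<in>I. c k * L2_inner \<Omega> (e k) h)"
  using assms by (subst L2_inner_sum_left) (auto intro: L2_scale simp: L2_inner_scale_left)

lemma L2_norm_comb:
  assumes e: "orthonormal \<Omega> e" and I: "finite I"
  shows "(L2_norm \<Omega> (\<lambda>x. \<Sum>k\<in>I. c k *\<^sub>R e k x))\<^sup>2 = (\<Sum>k\<in>I. (c k)\<^sup>2)"
proof -
  let ?f = "\<lambda>x. \<Sum>k\<in>I. c k *\<^sub>R e k x"
  have f: "?f \<in> L2 \<Omega>" by (rule L2_comb[OF e I])
  have 1: "L2_inner \<Omega> (e k) ?f = c k" if "k \<in> I" for k
  proof -
    have "L2_inner \<Omega> (e k) ?f = (\<Sum>l\<in>I. c l * L2_inner \<Omega> (e l) (e k))"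
      by (subst L2_inner_commute) (rule L2_inner_comb_left[OF orthonormalD(1)[OF e] I orthonormalD(1)[OF e]])
    also have "\<dots> = (\<Sum>l\<in>I. if l = k then c l else 0)" by (intro sum.cong) (auto simp: orthonormalD(2)[OF e])
    finally show ?thesis using I that by simp
  qed
  have "(L2_norm \<Omega> ?f)\<^sup>2 = (\<Sum>k\<in>I. c k * L2_inner \<Omega> (e k) ?f)"
    unfolding L2_norm_sq by (rule L2_inner_comb_left[OF orthonormalD(1)[OF e] I f])
  also have "\<dots> = (\<Sum>k\<in>I. (c k)\<^sup>2)" using 1 by (intro sum.cong) (auto simp: power2_eq_square)
  finally show ?thesis .
qed

lemma expands_L2: "expands \<Omega> e c f \<Longrightarrow> f \<in> L2 \<Omega>"
  by (simp add: expands_def)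

lemma expands_inner:
  assumes e: "\<And>k. e k \<in> L2 \<Omega>" and f: "expands \<Omega> e c f" and g: "g \<in> L2 \<Omega>"
  shows "(\<lambda>k. c k * L2_inner \<Omega> (e k) g) sums L2_inner \<Omega> f g"
  unfolding sums_def
proof (rule LIM_zero_cancel, rule Lim_null_comparison[OF always_eventually])
  have sL: "(\<lambda>x. \<Sum>k<n. c k *\<^sub>R e k x) \<in> L2 \<Omega>" for n by (intro L2_sum L2_scale e) auto
  show "\<forall>n. norm ((\<Sum>k<n. c k * L2_inner \<Omega> (e k) g) - L2_inner \<Omega> f g)
      \<le> L2_norm \<Omega> (\<lambda>x. f x - (\<Sum>k<n. c k *\<^sub>R e k x)) * L2_norm \<Omega> g"
  proof
    fix n
    have "(\<Sum>k<n. c k * L2_inner \<Omega> (e k) g) - L2_inner \<Omega> f g = - L2_inner \<Omega> (\<lambda>x. f x - (\<Sum>k<n. c k *\<^sub>R e k x)) g"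
      using L2_inner_diff_left[OF expands_L2[OF f] sL g] L2_inner_comb_left[of e \<Omega>, OF e finite_lessThan g] by simp
    then show "norm ((\<Sum>k<n. c k * L2_inner \<Omega> (e k) g) - L2_inner \<Omega> f g)
      \<le> L2_norm \<Omega> (\<lambda>x. f x - (\<Sum>k<n. c k *\<^sub>R e k x)) * L2_norm \<Omega> g"
      using L2_Cauchy_Schwarz[OF L2_diff[OF expands_L2[OF f] sL] g] by simp
  qed
  show "(\<lambda>n. L2_norm \<Omega> (\<lambda>x. f x - (\<Sum>k<n. c k *\<^sub>R e k x)) * L2_norm \<Omega> g) \<longlonglongrightarrow> 0"
    using f unfolding expands_def by (intro tendsto_mult_left_zero) auto
qed

lemma expands_coeff:
  assumes e: "orthonormal \<Omega> e" and f: "expands \<Omega> e c f"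
  shows "L2_inner \<Omega> f (e k) = c k"
proof -
  have "(\<lambda>l. c l * L2_inner \<Omega> (e l) (e k)) sums L2_inner \<Omega> f (e k)"
    by (rule expands_inner[OF orthonormalD(1)[OF e] f orthonormalD(1)[OF e]])
  moreover have "(\<lambda>l. c l * L2_inner \<Omega> (e l) (e k)) sums c k"
    using sums_single[of k c] by (simp add: orthonormalD(2)[OF e] if_distrib[of "\<lambda>x. c _ * x"] cong: if_cong)
  ultimately show ?thesis by (rule sums_unique2)
qed

lemma expands_norm:
  assumes e: "orthonormal \<Omega> e" and f: "expands \<Omega> e c f"
  shows "(\<lambda>k. (c k)\<^sup>2) sums (L2_norm \<Omega> f)\<^sup>2"
proof -
  have "(\<lambda>k. c k * L2_inner \<Omega> (e k) f) sums L2_inner \<Omega> f f"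
    by (rule expands_inner[OF orthonormalD(1)[OF e] f expands_L2[OF f]])
  moreover have "c k * L2_inner \<Omega> (e k) f = (c k)\<^sup>2" for k
    using expands_coeff[OF e f, of k] by (simp add: L2_inner_commute power2_eq_square)
  ultimately show ?thesis by (simp add: L2_norm_sq)
qed

lemma expands_lincomb:
  assumes e: "\<And>k. e k \<in> L2 \<Omega>" and f: "expands \<Omega> e c f" and g: "expands \<Omega> e d g"
  shows "expands \<Omega> e (\<lambda>k. r * c k + s * d k) (\<lambda>x. r *\<^sub>R f x + s *\<^sub>R g x)"
  unfolding expands_def
proof
  show "(\<lambda>x. r *\<^sub>R f x + s *\<^sub>R g x) \<in> L2 \<Omega>" by (intro L2_add L2_scale expands_L2[OF f] expands_L2[OF g])
  have sL: "(\<lambda>x. f x - (\<Sum>k<n. c k *\<^sub>R e k x)) \<in> L2 \<Omega>" "(\<lambda>x. g x - (\<Sum>k<n. d k *\<^sub>R e k x)) \<in> L2 \<Omega>" for n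
    by (intro L2_diff L2_sum L2_scale e expands_L2[OF f] expands_L2[OF g]; simp)+
  show "(\<lambda>n. L2_norm \<Omega> (\<lambda>x. r *\<^sub>R f x + s *\<^sub>R g x - (\<Sum>k<n. (r * c k + s * d k) *\<^sub>R e k x))) \<longlonglongrightarrow> 0"
  proof (rule Lim_null_comparison[OF always_eventually])
    show "\<forall>n. norm (L2_norm \<Omega> (\<lambda>x. r *\<^sub>R f x + s *\<^sub>R g x - (\<Sum>k<n. (r * c k + s * d k) *\<^sub>R e k x)))
      \<le> \<bar>r\<bar> * L2_norm \<Omega> (\<lambda>x. f x - (\<Sum>k<n. c k *\<^sub>R e k x)) + \<bar>s\<bar> * L2_norm \<Omega> (\<lambda>x. g x - (\<Sum>k<n. d k *\<^sub>R e k x))"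
    proof
      fix n
      have "(\<lambda>x. r *\<^sub>R f x + s *\<^sub>R g x - (\<Sum>k<n. (r * c k + s * d k) *\<^sub>R e k x)) =
        (\<lambda>x. r *\<^sub>R (f x - (\<Sum>k<n. c k *\<^sub>R e k x)) + s *\<^sub>R (g x - (\<Sum>k<n. d k *\<^sub>R e k x)))"
        by (simp add: scaleR_left_distrib sum.distrib scaleR_right_diff_distrib scaleR_sum_right algebra_simps)
      then show "norm (L2_norm \<Omega> (\<lambda>x. r *\<^sub>R f x + s *\<^sub>R g x - (\<Sum>k<n. (r * c k + s * d k) *\<^sub>R e k x)))
      \<le> \<bar>r\<bar> * L2_norm \<Omega> (\<lambda>x. f x - (\<Sum>k<n. c k *\<^sub>R e k x)) + \<bar>s\<bar> * L2_norm \<Omega> (\<lambda>x. g x - (\<Sum>k<n. d k *\<^sub>R e k x))"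
        using L2_norm_triangle[OF L2_scale[OF sL(1)] L2_scale[OF sL(2)], of r n s n] by (simp add: L2_norm_scale L2_norm_nonneg)
    qed
    show "(\<lambda>n. \<bar>r\<bar> * L2_norm \<Omega> (\<lambda>x. f x - (\<Sum>k<n. c k *\<^sub>R e k x)) + \<bar>s\<bar> * L2_norm \<Omega> (\<lambda>x. g x - (\<Sum>k<n. d k *\<^sub>R e k x))) \<longlonglongrightarrow> 0"
      using f g unfolding expands_def by (intro tendsto_add_zero tendsto_mult_right_zero) auto
  qed
qed

lemma expands_diff:
  assumes "\<And>k. e k \<in> L2 \<Omega>" "expands \<Omega> e c f" "expands \<Omega> e d g"
  shows "expands \<Omega> e (\<lambda>k. c k - d k) (\<lambda>x. f x - g x)"
  using expands_lincomb[OF assms, of 1 "-1"] by simp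

lemma expands_exists:
  fixes e :: "nat \<Rightarrow> vec3 \<Rightarrow> 'b::euclidean_space"
  assumes fin: "emeasure (lebesgue_on \<Omega>) (space (lebesgue_on \<Omega>)) \<noteq> \<infinity>"
    and e: "orthonormal \<Omega> e" and c: "summable (\<lambda>k. (c k)\<^sup>2)"
  shows "\<exists>f. expands \<Omega> e c f"
proof -
  define s where "s n x = (\<Sum>k<n. c k *\<^sub>R e k x)" for n x
  have sL: "s n \<in> L2 \<Omega>" for n unfolding s_def by (rule L2_comb[OF e]) simp
  have d: "(L2_norm \<Omega> (\<lambda>x. s m x - s n x))\<^sup>2 = (\<Sum>k\<in>{n..<m}. (c k)\<^sup>2)" if "n \<le> m" for m n
  proof -
    have "(\<lambda>x. s m x - s n x) = (\<lambda>x. \<Sum>k\<in>{n..<m}. c k *\<^sub>R e k x)"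
    proof
      fix x
      have "(\<Sum>k<n. c k *\<^sub>R e k x) + (\<Sum>k\<in>{n..<m}. c k *\<^sub>R e k x) = (\<Sum>k<m. c k *\<^sub>R e k x)"
        using sum.atLeastLessThan_concat[of 0 n m "\<lambda>k. c k *\<^sub>R e k x"] that by (simp add: lessThan_atLeast0)
      then show "s m x - s n x = (\<Sum>k\<in>{n..<m}. c k *\<^sub>R e k x)" by (simp add: s_def algebra_simps)
    qed
    then show ?thesis using L2_norm_comb[OF e, of "{n..<m}" c] by simp
  qed
  have cauchy: "\<exists>N. \<forall>m\<ge>N. \<forall>n\<ge>N. L2_norm \<Omega> (\<lambda>x. s m x - s n x) < \<epsilon>" if \<epsilon>: "\<epsilon> > 0" for \<epsilon>
  proof -
    obtain N where N: "\<And>m n. m \<ge> N \<Longrightarrow> norm (\<Sum>k\<in>{m..<n}. (c k)\<^sup>2) < \<epsilon>\<^sup>2"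
      using c[unfolded summable_Cauchy] \<epsilon> by (metis zero_less_power)
    have 1: "L2_norm \<Omega> (\<lambda>x. s m x - s n x) < \<epsilon>" if "n \<ge> N" "n \<le> m" for m n
    proof (rule power2_less_imp_less)
      show "(L2_norm \<Omega> (\<lambda>x. s m x - s n x))\<^sup>2 < \<epsilon>\<^sup>2" using N[OF that(1), of m] d[OF that(2)] by auto
    qed (use \<epsilon> in auto)
    have "L2_norm \<Omega> (\<lambda>x. s m x - s n x) < \<epsilon>" if "n \<ge> N" "m \<ge> N" for m n
      using 1[of n m] 1[of m n] that L2_norm_minus_commute[of \<Omega> "s m" "s n"] by (cases "n \<le> m") auto
    then show ?thesis by blast
  qed
  obtain g where "g \<in> L2 \<Omega>" "(\<lambda>n. L2_norm \<Omega> (\<lambda>x. s n x - g x)) \<longlonglongrightarrow> 0"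
    using L2_complete[OF fin sL cauchy] by blast
  then have "expands \<Omega> e c g" unfolding expands_def s_def using L2_norm_minus_commute[of \<Omega> g] by (auto simp: s_def)
  then show ?thesis by blast
qed

text \<open>The projection onto the first vectors satisfies that its squared norm is its inner
  product with \<open>f\<close>, so Cauchy-Schwarz bounds its norm by that of
  \<open>f\<close>.\<close>

lemma bessel:
  assumes e: "orthonormal \<Omega> e" and f: "f \<in> L2 \<Omega>"
  shows "summable (\<lambda>k. (L2_inner \<Omega> f (e k))\<^sup>2)"
proof (rule summableI_nonneg_bounded)
  fix n
  let ?c = "\<lambda>k. L2_inner \<Omega> f (e k)"
  let ?s = "\<lambda>x. \<Sum>k<n. ?c k *\<^sub>R e k x"
  have s: "?s \<in> L2 \<Omega>" by (rule L2_comb[OF e]) simp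
  have "L2_inner \<Omega> ?s f = (\<Sum>k<n. (?c k)\<^sup>2)"
    using L2_inner_comb_left[OF orthonormalD(1)[OF e] _ f, of "{..<n}" ?c]
    by (simp add: L2_inner_commute[of \<Omega> _ f] power2_eq_square)
  moreover have "(L2_norm \<Omega> ?s)\<^sup>2 = (\<Sum>k<n. (?c k)\<^sup>2)" by (rule L2_norm_comb[OF e]) simp
  ultimately have "(L2_norm \<Omega> ?s)\<^sup>2 \<le> L2_norm \<Omega> ?s * L2_norm \<Omega> f"
    using L2_Cauchy_Schwarz[OF s f] by simp
  then have "L2_norm \<Omega> ?s \<le> L2_norm \<Omega> f"
    using L2_norm_nonneg[of \<Omega> ?s] L2_norm_nonneg[of \<Omega> f] by (auto simp: power2_eq_square mult_le_cancel_left)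
  then have "(L2_norm \<Omega> ?s)\<^sup>2 \<le> (L2_norm \<Omega> f)\<^sup>2" by (intro power_mono L2_norm_nonneg)
  then show "(\<Sum>k<n. (?c k)\<^sup>2) \<le> (L2_norm \<Omega> f)\<^sup>2" using L2_norm_comb[OF e, of "{..<n}" ?c] by simp
qed simp


section \<open>Weak gradients\<close>

text \<open>Test functions approximate indicators of open sets, so a Borel representative
  \<open>g\<close> has integral zero over each of them. The measures with densities given by the
  positive and negative parts of \<open>g\<close> agree on this intersection-stable generator, hence
  everywhere, which forces both parts to vanish.\<close>

lemma fundamental_lemma:
  fixes N :: "vec3 \<Rightarrow> real"
  assumes \<Omega>: "open \<Omega>" and N: "integrable (lebesgue_on \<Omega>) N"
    and z: "\<And>\<phi>. \<phi> \<in> test_functions \<Omega> \<Longrightarrow> (LINT x|lebesgue_on \<Omega>. N x * \<phi> x) = 0"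
  shows "AE x in lebesgue_on \<Omega>. N x = 0"
proof -
  have \<Omega>s: "\<Omega> \<in> sets lebesgue" using \<Omega> by auto
  define N0 where "N0 x = indicator \<Omega> x * N x" for x
  have N0: "integrable lebesgue N0"
    using N \<Omega>s by (simp add: integrable_restrict_space N0_def[abs_def])
  obtain g where g[measurable]: "g \<in> borel_measurable lborel" and ae: "AE x in lborel. N0 x = g x"
    using completion_ex_borel_measurable_real[OF borel_measurable_integrable[OF N0]] by auto
  have ae': "AE x in lebesgue. N0 x = g x" using ae by (rule AE_completion)
  have gl: "integrable lebesgue g"
    by (rule integrable_cong_AE_imp[OF N0]) (use ae' g in \<open>auto intro: measurable_completion\<close>)
  then have gi: "integrable lborel g" using g by (simp add: integrable_completion)
  have test: "(\<integral>x. g x * \<phi> x \<partial>lborel) = 0" if \<phi>: "\<phi> \<in> test_functions \<Omega>" for \<phi>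
  proof -
    have c: "continuous_on UNIV \<phi>" using \<phi> by (auto simp: test_functions_def dest: spec[of _ 0])
    then have [measurable]: "\<phi> \<in> borel_measurable borel" by (rule borel_measurable_continuous_onI)
    have "(\<integral>x. g x * \<phi> x \<partial>lborel) = (\<integral>x. g x * \<phi> x \<partial>lebesgue)"
      by (rule integral_completion[symmetric]) simp
    also have "\<dots> = (\<integral>x. N0 x * \<phi> x \<partial>lebesgue)"
    proof (rule integral_cong_AE)
      show "(\<lambda>x. g x * \<phi> x) \<in> borel_measurable lebesgue" by (rule measurable_completion) simp
      show "(\<lambda>x. N0 x * \<phi> x) \<in> borel_measurable lebesgue"
        by (intro borel_measurable_times borel_measurable_integrable[OF N0] measurable_completion) simp
      show "AE x in lebesgue. g x * \<phi> x = N0 x * \<phi> x" using ae' by eventually_elim simp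
    qed
    also have "\<dots> = (LINT x|lebesgue_on \<Omega>. N x * \<phi> x)"
      using \<Omega>s by (simp add: integral_restrict_space N0_def mult.assoc)
    finally show ?thesis using z[OF \<phi>] by simp
  qed
  have off: "AE x in lborel. x \<notin> \<Omega> \<longrightarrow> g x = 0" using ae by eventually_elim (auto simp: N0_def)
  have openz: "(\<integral>x. g x * indicator U x \<partial>lborel) = 0" if U: "open U" for U
  proof -
    obtain \<phi> where \<phi>: "\<And>n. \<phi> n \<in> test_functions \<Omega>" "\<And>n x. 0 \<le> \<phi> n x" "\<And>n x. \<phi> n x \<le> (1::real)"
      "\<And>x. (\<lambda>n. \<phi> n x) \<longlonglongrightarrow> indicator (U \<inter> \<Omega>) x"
      using open_bump_sequence[of "U \<inter> \<Omega>" \<Omega>] U \<Omega> by auto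
    have c: "continuous_on UNIV (\<phi> n)" for n using \<phi>(1)[of n] by (auto simp: test_functions_def dest: spec[of _ 0])
    have [measurable]: "\<phi> n \<in> borel_measurable borel" for n using c by (rule borel_measurable_continuous_onI)
    have [measurable]: "U \<in> sets borel" "\<Omega> \<in> sets borel" using U \<Omega> by auto
    have "(\<lambda>n. \<integral>x. g x * \<phi> n x \<partial>lborel) \<longlonglongrightarrow> (\<integral>x. g x * indicator (U \<inter> \<Omega>) x \<partial>lborel)"
    proof (rule integral_dominated_convergence[where w="\<lambda>x. \<bar>g x\<bar>"])
      show "AE x in lborel. norm (g x * \<phi> n x) \<le> \<bar>g x\<bar>" for n
      proof (rule AE_I2)
        fix x
        have "\<bar>g x\<bar> * \<bar>\<phi> n x\<bar> \<le> \<bar>g x\<bar> * 1" using \<phi>(2,3)[of n x] by (intro mult_left_mono) auto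
        then show "norm (g x * \<phi> n x) \<le> \<bar>g x\<bar>" by (simp add: abs_mult)
      qed
      show "AE x in lborel. (\<lambda>n. g x * \<phi> n x) \<longlonglongrightarrow> g x * indicator (U \<inter> \<Omega>) x"
        by (intro AE_I2 tendsto_intros \<phi>(4))
    qed (use gi in auto)
    then have "(\<integral>x. g x * indicator (U \<inter> \<Omega>) x \<partial>lborel) = 0"
      using test[OF \<phi>(1)] by (simp add: LIMSEQ_const_iff)
    moreover have "(\<integral>x. g x * indicator (U \<inter> \<Omega>) x \<partial>lborel) = (\<integral>x. g x * indicator U x \<partial>lborel)"
    proof (rule integral_cong_AE)
      show "AE x in lborel. g x * indicator (U \<inter> \<Omega>) x = g x * indicator U x"
        using off by eventually_elim (auto simp: indicator_def)
    qed auto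
    ultimately show ?thesis by simp
  qed
  have eq: "density lborel (\<lambda>x. ennreal (g x)) = density lborel (\<lambda>x. ennreal (- g x))"
  proof (rule measure_eqI_generator_eq[where E="{U. open U}" and \<Omega>=UNIV and A="\<lambda>_. UNIV"])
    show "Int_stable {U::vec3 set. open U}" by (auto simp: Int_stable_def)
    have s: "sets (borel :: vec3 measure) = sigma_sets UNIV {U. open U}" by (simp add: borel_def)
    then show "sets (density lborel (\<lambda>x. ennreal (g x))) = sigma_sets UNIV {U. open U}"
      "sets (density lborel (\<lambda>x. ennreal (- g x))) = sigma_sets UNIV {U. open U}" by auto
    show "emeasure (density lborel (\<lambda>x. ennreal (g x))) X = emeasure (density lborel (\<lambda>x. ennreal (- g x))) X" if "X \<in> {U. open U}" for X
    proof -
      have X: "open X" "X \<in> sets lborel" using that by auto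
      have i: "integrable lborel (\<lambda>x. g x * indicator X x)"
        using integrable_mult_indicator[OF X(2) gi] by (simp add: mult.commute)
      have f: "(\<integral>\<^sup>+x. ennreal (g x * indicator X x) \<partial>lborel) \<noteq> \<infinity>" "(\<integral>\<^sup>+x. ennreal (- (g x * indicator X x)) \<partial>lborel) \<noteq> \<infinity>"
        using i unfolding real_integrable_def by auto
      have "enn2real (\<integral>\<^sup>+x. ennreal (g x * indicator X x) \<partial>lborel) = enn2real (\<integral>\<^sup>+x. ennreal (- (g x * indicator X x)) \<partial>lborel)"
        using openz[OF X(1)] real_lebesgue_integral_def[OF i] by simp
      from arg_cong[OF this, of ennreal]
      have "(\<integral>\<^sup>+x. ennreal (g x * indicator X x) \<partial>lborel) = (\<integral>\<^sup>+x. ennreal (- (g x * indicator X x)) \<partial>lborel)"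
        using f unfolding infinity_ennreal_def less_top by (simp add: ennreal_enn2real)
      moreover have "ennreal (g x * indicator X x) = ennreal (g x) * indicator X x" "ennreal (- (g x * indicator X x)) = ennreal (- g x) * indicator X x" for x
        by (auto simp: indicator_def)
      ultimately show ?thesis using X by (simp add: emeasure_density)
    qed
    show "emeasure (density lborel (\<lambda>x. ennreal (g x))) UNIV \<noteq> \<infinity>" for i :: nat
      using gi unfolding real_integrable_def by (simp add: emeasure_density)
  qed auto
  have "AE x in lborel. ennreal (g x) = ennreal (- g x)"
    by (rule sigma_finite_measure.density_unique[OF lborel.sigma_finite_measure_axioms _ _ eq]) auto
  then have "AE x in lborel. g x = 0"
  proof eventually_elim
    case (elim x)
    show ?case by (cases "g x \<ge> 0") (use elim in \<open>auto simp: ennreal_neg\<close>)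
  qed
  with ae have "AE x in lborel. N0 x = 0" by eventually_elim simp
  then have "AE x in lebesgue. N0 x = 0" by (rule AE_completion)
  then show ?thesis using \<Omega>s by (auto simp: AE_restrict_space_iff N0_def elim!: eventually_mono)
qed

section \<open>Partial derivatives of smooth functions and test functions\<close>

lemma partial_has_derivative:
  assumes "smooth f"
  shows "((\<lambda>t. f (x + t *\<^sub>R axis j 1)) has_vector_derivative partial j f (x + t *\<^sub>R axis j 1)) (at t)"
proof -
  have f: "(f has_derivative frechet_derivative f (at y)) (at y)" for y
    using Ck_on_SucD(1)[OF assms[rule_format, of "Suc 0"]] .
  have "((\<lambda>t. x + t *\<^sub>R axis j 1) has_derivative (\<lambda>h. h *\<^sub>R axis j 1)) (at t)"
    by (auto intro!: derivative_eq_intros)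
  from has_derivative_compose[OF this f]
  have "((\<lambda>t. f (x + t *\<^sub>R axis j 1)) has_derivative (\<lambda>h. frechet_derivative f (at (x + t *\<^sub>R axis j 1)) (h *\<^sub>R axis j 1))) (at t)" .
  moreover have "frechet_derivative f (at y) (h *\<^sub>R axis j 1) = h *\<^sub>R partial j f y" for h y
    unfolding partial_def using has_derivative_bounded_linear[OF f] by (rule linear_scale[OF bounded_linear.linear])
  ultimately show ?thesis by (simp add: has_vector_derivative_def)
qed

lemma smooth_partial: "smooth f \<Longrightarrow> smooth (partial j f)"
  using Ck_on_SucD(2) unfolding partial_def[abs_def] by blast

lemma smooth_continuous: "smooth f \<Longrightarrow> continuous_on UNIV f"
  by (auto dest: spec[of _ 0])

lemma partial_eq: "(f has_derivative f') (at x) \<Longrightarrow> partial j f x = f' (axis j 1)"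
  by (simp add: partial_def frechet_eq)

lemma smooth_has_derivative: "smooth f \<Longrightarrow> (f has_derivative frechet_derivative f (at x)) (at x)"
  using Ck_on_SucD(1)[of 0 f] by blast

text \<open>The mean value theorem is applied in direction \<open>i\<close> to a difference in
  direction \<open>j\<close>, and then in direction \<open>j\<close> to the resulting
  derivative.\<close>

lemma second_difference:
  fixes f :: "vec3 \<Rightarrow> real"
  assumes f: "smooth f" and h: "h > 0"
  shows "\<exists>r s. 0 < r \<and> r < h \<and> 0 < s \<and> s < h \<and>
    f (x + h *\<^sub>R axis i 1 + h *\<^sub>R axis j 1) - f (x + h *\<^sub>R axis i 1) - f (x + h *\<^sub>R axis j 1) + f x
    = h * h * partial j (partial i f) (x + r *\<^sub>R axis i 1 + s *\<^sub>R axis j 1)"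
proof -
  let ?a = "axis i (1::real)" and ?b = "axis j (1::real)"
  define g where "g t = f (x + h *\<^sub>R ?b + t *\<^sub>R ?a) - f (x + t *\<^sub>R ?a)" for t
  have dg: "(g has_real_derivative (partial i f (x + h *\<^sub>R ?b + t *\<^sub>R ?a) - partial i f (x + t *\<^sub>R ?a))) (at t)" for t
    unfolding g_def has_real_derivative_iff_has_vector_derivative
    by (intro has_vector_derivative_diff partial_has_derivative f)
  obtain r where r: "0 < r" "r < h" "g h - g 0 = (h - 0) * (partial i f (x + h *\<^sub>R ?b + r *\<^sub>R ?a) - partial i f (x + r *\<^sub>R ?a))"
    using MVT2[OF h, of g, OF dg] by auto
  define k where "k s = partial i f (x + r *\<^sub>R ?a + s *\<^sub>R ?b)" for s
  have dk: "(k has_real_derivative partial j (partial i f) (x + r *\<^sub>R ?a + s *\<^sub>R ?b)) (at s)" for s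
    unfolding k_def has_real_derivative_iff_has_vector_derivative
    by (intro partial_has_derivative smooth_partial f)
  obtain s where s: "0 < s" "s < h" "k h - k 0 = (h - 0) * partial j (partial i f) (x + r *\<^sub>R ?a + s *\<^sub>R ?b)"
    using MVT2[OF h, of k, OF dk] by auto
  have "g h - g 0 = h * (k h - k 0)" using r(3) by (simp add: k_def add_ac)
  also have "\<dots> = h * h * partial j (partial i f) (x + r *\<^sub>R ?a + s *\<^sub>R ?b)" using s(3) by simp
  finally show ?thesis using r s by (intro exI[of _ r] exI[of _ s]) (simp add: g_def add_ac)
qed

text \<open>The second difference is symmetric in the two directions, so both mixed derivatives take
  a common value at points within \<open>2 * h\<close> of \<open>x\<close>; continuity gives the
  limit.\<close>

lemma partial_commute:
  fixes f :: "vec3 \<Rightarrow> real"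
  assumes f: "smooth f"
  shows "partial i (partial j f) x = partial j (partial i f) x"
proof -
  let ?a = "axis i (1::real)" and ?b = "axis j (1::real)"
  have ex: "\<exists>p q. norm (p - x) \<le> 2 * h \<and> norm (q - x) \<le> 2 * h \<and> partial j (partial i f) p = partial i (partial j f) q" if h: "h > 0" for h
  proof -
    obtain r s where 1: "0 < r" "r < h" "0 < s" "s < h"
      "f (x + h *\<^sub>R ?a + h *\<^sub>R ?b) - f (x + h *\<^sub>R ?a) - f (x + h *\<^sub>R ?b) + f x = h * h * partial j (partial i f) (x + r *\<^sub>R ?a + s *\<^sub>R ?b)"
      using second_difference[OF f h] by blast
    obtain r' s' where 2: "0 < r'" "r' < h" "0 < s'" "s' < h"
      "f (x + h *\<^sub>R ?b + h *\<^sub>R ?a) - f (x + h *\<^sub>R ?b) - f (x + h *\<^sub>R ?a) + f x = h * h * partial i (partial j f) (x + r' *\<^sub>R ?b + s' *\<^sub>R ?a)"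
      using second_difference[OF f h] by blast
    have "h * h * partial j (partial i f) (x + r *\<^sub>R ?a + s *\<^sub>R ?b) = h * h * partial i (partial j f) (x + r' *\<^sub>R ?b + s' *\<^sub>R ?a)"
    proof -
      have sw: "x + h *\<^sub>R ?b + h *\<^sub>R ?a = x + h *\<^sub>R ?a + h *\<^sub>R ?b" by (simp add: add_ac)
      show ?thesis using 1(5) 2(5) unfolding sw by linarith
    qed
    then have "partial j (partial i f) (x + r *\<^sub>R ?a + s *\<^sub>R ?b) = partial i (partial j f) (x + r' *\<^sub>R ?b + s' *\<^sub>R ?a)" using h by simp
    moreover have "norm (x + r *\<^sub>R ?a + s *\<^sub>R ?b - x) \<le> 2 * h" "norm (x + r' *\<^sub>R ?b + s' *\<^sub>R ?a - x) \<le> 2 * h"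
      using norm_triangle_ineq[of "r *\<^sub>R ?a" "s *\<^sub>R ?b"] norm_triangle_ineq[of "r' *\<^sub>R ?b" "s' *\<^sub>R ?a"] 1 2
      by (auto simp: norm_axis_1 add.assoc)
    ultimately show ?thesis by blast
  qed
  define h where "h n = inverse (real (Suc n))" for n
  have hp: "h n > 0" for n by (simp add: h_def)
  have h0: "(\<lambda>n. 2 * h n) \<longlonglongrightarrow> 0" using tendsto_mult[OF tendsto_const LIMSEQ_inverse_real_of_nat, of 2] by (simp add: h_def)
  obtain p q where pq: "\<And>n. norm (p n - x) \<le> 2 * h n" "\<And>n. norm (q n - x) \<le> 2 * h n"
    "\<And>n. partial j (partial i f) (p n) = partial i (partial j f) (q n)"
    using ex[OF hp] by metis
  have lim: "p \<longlonglongrightarrow> x" "q \<longlonglongrightarrow> x"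
    by (rule LIM_zero_cancel, rule Lim_null_comparison[OF always_eventually h0], use pq in auto)+
  have c: "isCont (partial k (partial l f)) x" for k l
    using smooth_continuous[OF smooth_partial[OF smooth_partial[OF f]]] by (simp add: continuous_on_eq_continuous_at)
  have "(\<lambda>n. partial j (partial i f) (p n)) \<longlonglongrightarrow> partial j (partial i f) x"
    "(\<lambda>n. partial i (partial j f) (q n)) \<longlonglongrightarrow> partial i (partial j f) x"
    using lim by (auto intro: isCont_tendsto_compose[OF c])
  then show ?thesis unfolding pq(3) using LIMSEQ_unique by blast
qed

text \<open>Difference quotients have integral zero by translation invariance. They converge to the
  derivative, and the mean value theorem gives a uniform bound on a ball enlarged by the maximal
  step \<open>1\<close>.\<close>

lemma integral_partial_zero:
  fixes f :: "vec3 \<Rightarrow> real"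
  assumes f: "smooth f" and K: "compact K" "\<And>x. x \<notin> K \<Longrightarrow> f x = 0"
  shows "(\<integral>x. partial j f x \<partial>lborel) = 0"
proof -
  let ?e = "axis j (1::real) :: vec3"
  have fc: "continuous_on UNIV f" and pc: "continuous_on UNIV (partial j f)"
    using smooth_continuous f smooth_partial by blast+
  have [measurable]: "f \<in> borel_measurable borel" "partial j f \<in> borel_measurable borel"
    using fc pc by (auto intro: borel_measurable_continuous_onI)
  obtain R where R: "\<And>x. x \<in> K \<Longrightarrow> norm x \<le> R" using compact_imp_bounded[OF K(1)] by (auto simp: bounded_iff)
  have f0: "f x = 0" if "norm x > R" for x using K(2) R that by fastforce
  have p0: "partial j f x = 0" if "norm x > R" for x
  proof -
    have "(f has_derivative (\<lambda>h. 0)) (at x)"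
      by (rule has_derivative_transform_within_open[of "\<lambda>_. 0" _ _ _ "{x. norm x > R}"])
        (use that f0 in \<open>auto intro!: open_Collect_less continuous_intros\<close>)
    then show ?thesis by (simp add: partial_eq)
  qed
  obtain B where B: "\<And>x. x \<in> cball 0 R \<Longrightarrow> norm (partial j f x) \<le> B"
    using compact_imp_bounded[OF compact_continuous_image[OF continuous_on_subset[OF pc] compact_cball, of 0 R]]
    by (force simp: bounded_iff)
  define B' where "B' = max B 0"
  have B': "\<bar>partial j f x\<bar> \<le> B'" for x using B[of x] p0[of x] by (cases "norm x \<le> R") (auto simp: B'_def)
  have fi: "integrable lborel f"
  proof -
    have "integrable lborel (\<lambda>x. indicator (cball 0 R) x *\<^sub>R f x)"
      by (rule borel_integrable_compact) (auto intro: continuous_on_subset[OF fc])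
    moreover have "(\<lambda>x. indicator (cball 0 R) x *\<^sub>R f x) = f" using f0 by (auto simp: fun_eq_iff indicator_def)
    ultimately show ?thesis by simp
  qed
  have tr: "integrable lborel (\<lambda>x. f (c + x))" "(\<integral>x. f (c + x) \<partial>lborel) = (\<integral>x. f x \<partial>lborel)" for c
    using integrable_distr_eq[of "(+) c" lborel borel f] integral_distr[of "(+) c" lborel borel f] fi
    by (auto simp: lborel_distr_plus)
  define h where "h n = inverse (real (Suc n))" for n
  have hp: "h n > 0" "h n \<le> 1" for n by (auto simp: h_def divide_simps)
  define D where "D n x = (f (h n *\<^sub>R ?e + x) - f x) / h n" for n x
  have D0: "(\<integral>x. D n x \<partial>lborel) = 0" for n unfolding D_def using tr fi by simp
  have "(\<lambda>n. \<integral>x. D n x \<partial>lborel) \<longlonglongrightarrow> (\<integral>x. partial j f x \<partial>lborel)"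
  proof (rule integral_dominated_convergence[where w="\<lambda>x. indicator (cball 0 (R + 1)) x *\<^sub>R B'"])
    show "integrable lborel (\<lambda>x::vec3. indicator (cball 0 (R + 1)) x *\<^sub>R B')"
      by (rule borel_integrable_compact) auto
    show "AE x in lborel. (\<lambda>n. D n x) \<longlonglongrightarrow> partial j f x"
    proof (rule AE_I2)
      fix x
      have "((\<lambda>t. f (x + t *\<^sub>R ?e)) has_real_derivative partial j f (x + 0 *\<^sub>R ?e)) (at 0)"
        unfolding has_real_derivative_iff_has_vector_derivative by (rule partial_has_derivative[OF f])
      then have l: "((\<lambda>t. (f (x + t *\<^sub>R ?e) - f x) / t) \<longlongrightarrow> partial j f x) (at 0)"
        by (simp add: has_field_derivative_iff)
      have "filterlim h (at 0) sequentially"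
        unfolding filterlim_at using hp LIMSEQ_inverse_real_of_nat by (auto simp: h_def[abs_def])
      from filterlim_compose[OF l this] show "(\<lambda>n. D n x) \<longlonglongrightarrow> partial j f x"
        by (simp add: D_def add.commute)
    qed
    show "AE x in lborel. norm (D n x) \<le> indicator (cball 0 (R + 1)) x *\<^sub>R B'" for n
    proof (rule AE_I2)
      fix x
      have dz: "((\<lambda>t. f (x + t *\<^sub>R ?e)) has_real_derivative partial j f (x + t *\<^sub>R ?e)) (at t)" for t
        unfolding has_real_derivative_iff_has_vector_derivative by (rule partial_has_derivative[OF f])
      obtain z where z: "f (x + h n *\<^sub>R ?e) - f (x + 0 *\<^sub>R ?e) = (h n - 0) * partial j f (x + z *\<^sub>R ?e)"
        using MVT2[OF hp(1)[of n], of "\<lambda>t. f (x + t *\<^sub>R ?e)", OF dz] by auto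
      have b: "norm (D n x) \<le> B'" using z hp[of n] B' by (simp add: D_def add.commute)
      show "norm (D n x) \<le> indicator (cball 0 (R + 1)) x *\<^sub>R B'"
      proof (cases "norm x \<le> R + 1")
        case False
        have "norm x \<le> norm (h n *\<^sub>R ?e + x) + norm (h n *\<^sub>R ?e)"
          using norm_triangle_ineq4[of "h n *\<^sub>R ?e + x" "h n *\<^sub>R ?e"] by simp
        then have "norm (h n *\<^sub>R ?e + x) > R" using False hp[of n] by (simp add: norm_axis_1)
        then have "D n x = 0" using f0 False hp[of n] by (simp add: D_def)
        then show ?thesis using False by simp
      qed (use b in simp)
    qed
  qed (auto simp: D_def)
  then show ?thesis using D0 by (simp add: LIMSEQ_const_iff)
qed

lemma test_functionsD:
  assumes "\<phi> \<in> test_functions \<Omega>"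
  shows "smooth \<phi>" "compact (closure {x. \<phi> x \<noteq> 0})" "closure {x. \<phi> x \<noteq> 0} \<subseteq> \<Omega>" "x \<notin> closure {x. \<phi> x \<noteq> 0} \<Longrightarrow> \<phi> x = 0"
    "x \<notin> \<Omega> \<Longrightarrow> \<phi> x = 0"
  using assms closure_subset[of "{x. \<phi> x \<noteq> 0}"] by (auto simp: test_functions_def)

lemma partial_outside_support:
  assumes "x \<notin> closure {x. \<phi> x \<noteq> 0}"
  shows "partial j \<phi> x = 0"
proof -
  have "(\<phi> has_derivative (\<lambda>h. 0)) (at x)"
    by (rule has_derivative_transform_within_open[of "\<lambda>_. 0" _ _ _ "- closure {x. \<phi> x \<noteq> 0}"])
      (use assms closure_subset[of "{x. \<phi> x \<noteq> 0}"] in auto)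
  then show ?thesis by (simp add: partial_eq)
qed

lemma test_functionsI_support:
  assumes "smooth \<psi>" "\<phi> \<in> test_functions \<Omega>" "{x. \<psi> x \<noteq> 0} \<subseteq> closure {x. \<phi> x \<noteq> 0}"
  shows "\<psi> \<in> test_functions \<Omega>"
proof -
  have "closure {x. \<psi> x \<noteq> 0} \<subseteq> closure {x. \<phi> x \<noteq> 0}" using assms(3) by (rule closure_minimal) simp
  moreover from this have "compact (closure {x. \<psi> x \<noteq> 0})"
    using test_functionsD(2)[OF assms(2)] by (metis bounded_subset closed_closure compact_eq_bounded_closed)
  ultimately show ?thesis using assms test_functionsD(3)[OF assms(2)] by (auto simp: test_functions_def)
qed

lemma partial_test_function: "\<phi> \<in> test_functions \<Omega> \<Longrightarrow> partial j \<phi> \<in> test_functions \<Omega>"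
  by (rule test_functionsI_support[of _ \<phi>]) (use smooth_partial test_functionsD(1) partial_outside_support in \<open>blast+\<close>)

lemma component_test_function:
  fixes a :: vfield
  shows "a \<in> test_functions \<Omega> \<Longrightarrow> (\<lambda>x. a x $ i) \<in> test_functions \<Omega>"
  by (rule test_functionsI_support[of _ a])
    (use Ck_on_compose_linear[OF bounded_linear_vec_nth] test_functionsD(1) closure_subset[of "{x. a x \<noteq> 0}"] in \<open>(blast | force)+\<close>)

lemma partial_component:
  fixes a :: vfield
  assumes "smooth a"
  shows "partial j (\<lambda>x. a x $ i) x = partial j a x $ i"
  using partial_eq[OF bounded_linear.has_derivative[OF bounded_linear_vec_nth smooth_has_derivative[OF assms]], of j i x]
  by (simp add: partial_def)

lemma lebesgue_on_integral_support:
  fixes f :: "vec3 \<Rightarrow> real"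
  assumes "\<Omega> \<in> sets lebesgue" "f \<in> borel_measurable borel" "\<And>x. x \<notin> \<Omega> \<Longrightarrow> f x = 0"
  shows "(LINT x|lebesgue_on \<Omega>. f x) = (\<integral>x. f x \<partial>lborel)"
proof -
  have "(LINT x|lebesgue_on \<Omega>. f x) = (\<integral>x. indicator \<Omega> x *\<^sub>R f x \<partial>lebesgue)"
    using assms(1) by (simp add: integral_restrict_space)
  also have "(\<lambda>x. indicator \<Omega> x *\<^sub>R f x) = f" using assms(3) by (auto simp: fun_eq_iff indicator_def)
  also have "(\<integral>x. f x \<partial>lebesgue) = (\<integral>x. f x \<partial>lborel)" by (rule integral_completion) (use assms in simp)
  finally show ?thesis .
qed

text \<open>Only the product \<open>f \<phi>\<close> has to have compact support; its derivative
  integrates to zero over the whole space.\<close>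

lemma integration_by_parts:
  fixes f \<phi> :: "vec3 \<Rightarrow> real"
  assumes \<Omega>: "open \<Omega>" and f: "smooth f" and \<phi>: "\<phi> \<in> test_functions \<Omega>"
  shows "(LINT x|lebesgue_on \<Omega>. f x * partial j \<phi> x) = - (LINT x|lebesgue_on \<Omega>. partial j f x * \<phi> x)"
proof -
  note s = test_functionsD[OF \<phi>]
  have \<Omega>s: "\<Omega> \<in> sets lebesgue" using \<Omega> by auto
  define K where "K = closure {x. \<phi> x \<noteq> 0}"
  have cK: "compact K" using s(2) unfolding K_def .
  have K0: "\<phi> x = 0" "partial j \<phi> x = 0" if "x \<notin> K" for x
    using s(4)[of x] partial_outside_support[of x \<phi> j] that unfolding K_def by blast+
  have sm: "smooth (\<lambda>x. f x * \<phi> x)" using Ck_on_mult f s(1) by blast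
  have p: "partial j (\<lambda>x. f x * \<phi> x) x = f x * partial j \<phi> x + partial j f x * \<phi> x" for x
    unfolding partial_def[of j f] partial_def[of j \<phi>]
    by (rule partial_eq[OF has_derivative_mult[OF smooth_has_derivative[OF f] smooth_has_derivative[OF s(1)]]])
  have z: "(\<integral>x. partial j (\<lambda>x. f x * \<phi> x) x \<partial>lborel) = 0"
    by (rule integral_partial_zero[OF sm cK]) (simp add: K0)
  have c: "continuous_on UNIV f" "continuous_on UNIV \<phi>" "continuous_on UNIV (partial j f)" "continuous_on UNIV (partial j \<phi>)"
    by (intro smooth_continuous smooth_partial f s(1))+
  have int: "integrable lborel (\<lambda>x. u x * v x)" if "continuous_on UNIV u" "continuous_on UNIV v" "\<And>x. x \<notin> K \<Longrightarrow> v x = 0" for u v :: "vec3 \<Rightarrow> real"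
  proof -
    have "integrable lborel (\<lambda>x. indicator K x *\<^sub>R (u x * v x))"
      by (rule borel_integrable_compact[OF cK]) (use that in \<open>auto intro!: continuous_intros intro: continuous_on_subset\<close>)
    moreover have "(\<lambda>x. indicator K x *\<^sub>R (u x * v x)) = (\<lambda>x. u x * v x)" using that(3) by (auto simp: fun_eq_iff indicator_def)
    ultimately show ?thesis by simp
  qed
  have i: "integrable lborel (\<lambda>x. f x * partial j \<phi> x)" "integrable lborel (\<lambda>x. partial j f x * \<phi> x)"
    by (intro int c K0; simp)+
  have out: "x \<notin> K" if "x \<notin> \<Omega>" for x using that s(3) unfolding K_def by blast
  have "(LINT x|lebesgue_on \<Omega>. f x * partial j \<phi> x) = (\<integral>x. f x * partial j \<phi> x \<partial>lborel)"
    by (rule lebesgue_on_integral_support[OF \<Omega>s]) (use c K0 out in \<open>auto intro!: borel_measurable_continuous_onI continuous_intros\<close>)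
  moreover have "(LINT x|lebesgue_on \<Omega>. partial j f x * \<phi> x) = (\<integral>x. partial j f x * \<phi> x \<partial>lborel)"
    by (rule lebesgue_on_integral_support[OF \<Omega>s]) (use c K0 out in \<open>auto intro!: borel_measurable_continuous_onI continuous_intros\<close>)
  moreover have "(\<integral>x. f x * partial j \<phi> x \<partial>lborel) + (\<integral>x. partial j f x * \<phi> x \<partial>lborel) = 0"
    using z i unfolding p by simp
  ultimately show ?thesis by simp
qed

definition grad :: "vfield \<Rightarrow> mfield" where
  "grad f x = (\<chi> i j. partial j f x $ i)"

definition converges_L2 :: "vec3 set \<Rightarrow> (nat \<Rightarrow> vec3 \<Rightarrow> 'b::euclidean_space) \<Rightarrow> (vec3 \<Rightarrow> 'b) \<Rightarrow> bool" where
  "converges_L2 \<Omega> f g \<longleftrightarrow> (\<forall>n. f n \<in> L2 \<Omega>) \<and> g \<in> L2 \<Omega> \<and> (\<lambda>n. L2_norm \<Omega> (\<lambda>x. f n x - g x)) \<longlonglongrightarrow> 0"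

lemma converges_L2_inner:
  assumes f: "converges_L2 \<Omega> f g" and h: "h \<in> L2 \<Omega>"
  shows "(\<lambda>n. L2_inner \<Omega> (f n) h) \<longlonglongrightarrow> L2_inner \<Omega> g h"
proof (rule LIM_zero_cancel, rule Lim_null_comparison[OF always_eventually])
  have fL: "f n \<in> L2 \<Omega>" "g \<in> L2 \<Omega>" for n using f by (auto simp: converges_L2_def)
  show "\<forall>n. norm (L2_inner \<Omega> (f n) h - L2_inner \<Omega> g h) \<le> L2_norm \<Omega> (\<lambda>x. f n x - g x) * L2_norm \<Omega> h"
    using L2_Cauchy_Schwarz[OF L2_diff[OF fL] h] by (simp add: L2_inner_diff_left[OF fL h])
  show "(\<lambda>n. L2_norm \<Omega> (\<lambda>x. f n x - g x) * L2_norm \<Omega> h) \<longlonglongrightarrow> 0"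
    using f by (intro tendsto_mult_left_zero) (auto simp: converges_L2_def)
qed

lemma converges_L2_lincomb:
  assumes "converges_L2 \<Omega> f g" "converges_L2 \<Omega> f' g'"
  shows "converges_L2 \<Omega> (\<lambda>n x. r *\<^sub>R f n x + s *\<^sub>R f' n x) (\<lambda>x. r *\<^sub>R g x + s *\<^sub>R g' x)"
  unfolding converges_L2_def
proof (intro conjI allI)
  have L: "f n \<in> L2 \<Omega>" "g \<in> L2 \<Omega>" "f' n \<in> L2 \<Omega>" "g' \<in> L2 \<Omega>" for n using assms by (auto simp: converges_L2_def)
  show "(\<lambda>x. r *\<^sub>R f n x + s *\<^sub>R f' n x) \<in> L2 \<Omega>" "(\<lambda>x. r *\<^sub>R g x + s *\<^sub>R g' x) \<in> L2 \<Omega>" for n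
    by (intro L2_add L2_scale L)+
  show "(\<lambda>n. L2_norm \<Omega> (\<lambda>x. r *\<^sub>R f n x + s *\<^sub>R f' n x - (r *\<^sub>R g x + s *\<^sub>R g' x))) \<longlonglongrightarrow> 0"
  proof (rule Lim_null_comparison[OF always_eventually])
    show "\<forall>n. norm (L2_norm \<Omega> (\<lambda>x. r *\<^sub>R f n x + s *\<^sub>R f' n x - (r *\<^sub>R g x + s *\<^sub>R g' x)))
      \<le> \<bar>r\<bar> * L2_norm \<Omega> (\<lambda>x. f n x - g x) + \<bar>s\<bar> * L2_norm \<Omega> (\<lambda>x. f' n x - g' x)"
    proof
      fix n
      have "(\<lambda>x. r *\<^sub>R f n x + s *\<^sub>R f' n x - (r *\<^sub>R g x + s *\<^sub>R g' x)) = (\<lambda>x. r *\<^sub>R (f n x - g x) + s *\<^sub>R (f' n x - g' x))"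
        by (simp add: algebra_simps)
      then show "norm (L2_norm \<Omega> (\<lambda>x. r *\<^sub>R f n x + s *\<^sub>R f' n x - (r *\<^sub>R g x + s *\<^sub>R g' x)))
        \<le> \<bar>r\<bar> * L2_norm \<Omega> (\<lambda>x. f n x - g x) + \<bar>s\<bar> * L2_norm \<Omega> (\<lambda>x. f' n x - g' x)"
        using L2_norm_triangle[OF L2_scale[OF L2_diff[OF L(1,2)]] L2_scale[OF L2_diff[OF L(3,4)]], of r n s n]
        by (simp add: L2_norm_scale L2_norm_nonneg)
    qed
    show "(\<lambda>n. \<bar>r\<bar> * L2_norm \<Omega> (\<lambda>x. f n x - g x) + \<bar>s\<bar> * L2_norm \<Omega> (\<lambda>x. f' n x - g' x)) \<longlonglongrightarrow> 0"
      using assms unfolding converges_L2_def by (intro tendsto_add_zero tendsto_mult_right_zero) auto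
  qed
qed

lemma converges_L2_const: "f \<in> L2 \<Omega> \<Longrightarrow> converges_L2 \<Omega> (\<lambda>n. f) f"
  by (simp add: converges_L2_def L2_norm_def L2_inner_def)

lemma expands_converges:
  assumes "\<And>k. e k \<in> L2 \<Omega>" "expands \<Omega> e c f"
  shows "converges_L2 \<Omega> (\<lambda>n x. \<Sum>k<n. c k *\<^sub>R e k x) f"
  using assms unfolding expands_def converges_L2_def
  by (auto intro!: L2_sum L2_scale simp: L2_norm_minus_commute[of _ "\<lambda>x. \<Sum>k<_. c k *\<^sub>R e k x"])

lemma continuous_on_axis: "continuous_on S f \<Longrightarrow> continuous_on S (\<lambda>x. axis i (f x))"
  unfolding axis_def
proof (rule continuous_on_vec_lambda)
  fix j assume "continuous_on S f"
  then show "continuous_on S (\<lambda>x. if j = i then f x else 0)" by (cases "j = i") simp_all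
qed

section \<open>Weak gradients and \<open>H10\<close> on a bounded open set\<close>

locale domain =
  fixes \<Omega> :: "vec3 set"
  assumes open_dom: "open \<Omega>" and bounded_dom: "bounded \<Omega>"
begin

lemma dom_lebesgue: "\<Omega> \<in> sets lebesgue" using open_dom by auto

lemma finite_dom: "emeasure (lebesgue_on \<Omega>) (space (lebesgue_on \<Omega>)) \<noteq> \<infinity>"
proof -
  have "\<Omega> \<in> lmeasurable" using open_dom bounded_dom lmeasurable_open by blast
  then show ?thesis using dom_lebesgue by (simp add: emeasure_restrict_space fmeasurable_def)
qed

lemma continuous_L2:
  fixes f :: "vec3 \<Rightarrow> 'b::euclidean_space"
  assumes "continuous_on UNIV f" shows "f \<in> L2 \<Omega>"
proof (rule L2I)
  have [measurable]: "f \<in> borel_measurable borel" using assms by (rule borel_measurable_continuous_onI)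
  have b: "f \<in> borel_measurable lebesgue" by (rule measurable_completion) simp
  then show m: "f \<in> borel_measurable (lebesgue_on \<Omega>)" by (rule measurable_restrict_space1)
  have "compact (f ` closure \<Omega>)"
    using assms bounded_dom by (intro compact_continuous_image) (auto intro: continuous_on_subset)
  then obtain B where B: "\<And>x. x \<in> closure \<Omega> \<Longrightarrow> norm (f x) \<le> B" using compact_imp_bounded by (force simp: bounded_iff)
  interpret finite_measure "lebesgue_on \<Omega>" by (rule finite_measureI) (use finite_dom in simp)
  show "integrable (lebesgue_on \<Omega>) (\<lambda>x. (norm (f x))\<^sup>2)"
  proof (rule integrable_const_bound[where B="B\<^sup>2"])
    show "AE x in lebesgue_on \<Omega>. norm ((norm (f x))\<^sup>2) \<le> B\<^sup>2"
      by (rule AE_I2) (use B closure_subset in \<open>auto simp: space_restrict_space intro!: power_mono\<close>)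
  qed (use m in simp)
qed

lemma smooth_L2: "smooth f \<Longrightarrow> f \<in> L2 \<Omega>" for f :: "vec3 \<Rightarrow> 'b::euclidean_space"
  by (intro continuous_L2 smooth_continuous)

lemma has_weak_gradient_iff:
  "has_weak_gradient \<Omega> f G \<longleftrightarrow> f \<in> L2 \<Omega> \<and> G \<in> L2 \<Omega> \<and>
     (\<forall>\<phi> \<in> test_functions \<Omega>. \<forall>i j. L2_inner \<Omega> f (\<lambda>x. axis i (partial j \<phi> x)) = - L2_inner \<Omega> G (\<lambda>x. axis i (axis j (\<phi> x))))"
  by (simp add: has_weak_gradient_def L2_inner_def inner_axis)

lemma test_L2:
  fixes \<phi> :: "vec3 \<Rightarrow> real"
  assumes "\<phi> \<in> test_functions \<Omega>"
  shows "(\<lambda>x. axis i (partial j \<phi> x)) \<in> L2 \<Omega>" "(\<lambda>x. axis i (axis j (\<phi> x))) \<in> L2 \<Omega>"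
    "(\<lambda>x. \<chi> j. partial j \<phi> x) \<in> L2 \<Omega>"
proof -
  have c: "continuous_on UNIV \<phi>" "continuous_on UNIV (partial j \<phi>)" for j
    using smooth_continuous smooth_partial test_functionsD(1)[OF assms] by blast+
  show "(\<lambda>x. axis i (partial j \<phi> x)) \<in> L2 \<Omega>" "(\<lambda>x. axis i (axis j (\<phi> x))) \<in> L2 \<Omega>"
    "(\<lambda>x. \<chi> j. partial j \<phi> x) \<in> L2 \<Omega>"
    by (intro continuous_L2 continuous_on_axis continuous_on_vec_lambda c)+
qed

lemma weak_gradientD:
  assumes "has_weak_gradient \<Omega> f G"
  shows "f \<in> L2 \<Omega>" "G \<in> L2 \<Omega>"
   "\<phi> \<in> test_functions \<Omega> \<Longrightarrow> L2_inner \<Omega> f (\<lambda>x. axis i (partial j \<phi> x)) = - L2_inner \<Omega> G (\<lambda>x. axis i (axis j (\<phi> x)))"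
  using assms unfolding has_weak_gradient_iff by auto

text \<open>The weak gradient is a closed operator: both sides of its defining identity are inner
  products with fixed square integrable fields.\<close>

lemma weak_gradient_limit:
  assumes "\<And>n. has_weak_gradient \<Omega> (f n) (F n)" "converges_L2 \<Omega> f g" "converges_L2 \<Omega> F G"
  shows "has_weak_gradient \<Omega> g G"
  unfolding has_weak_gradient_iff
proof (intro conjI ballI allI)
  fix \<phi> :: "vec3 \<Rightarrow> real" and i j assume \<phi>: "\<phi> \<in> test_functions \<Omega>"
  have 1: "(\<lambda>n. L2_inner \<Omega> (f n) (\<lambda>x. axis i (partial j \<phi> x))) \<longlonglongrightarrow> L2_inner \<Omega> g (\<lambda>x. axis i (partial j \<phi> x))"
    by (rule converges_L2_inner[OF assms(2) test_L2(1)[OF \<phi>]])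
  have 2: "(\<lambda>n. - L2_inner \<Omega> (F n) (\<lambda>x. axis i (axis j (\<phi> x)))) \<longlonglongrightarrow> - L2_inner \<Omega> G (\<lambda>x. axis i (axis j (\<phi> x)))"
    by (intro tendsto_intros converges_L2_inner[OF assms(3) test_L2(2)[OF \<phi>]])
  from 1 2 show "L2_inner \<Omega> g (\<lambda>x. axis i (partial j \<phi> x)) = - L2_inner \<Omega> G (\<lambda>x. axis i (axis j (\<phi> x)))"
    unfolding weak_gradientD(3)[OF assms(1) \<phi>] by (rule LIMSEQ_unique)
qed (use assms in \<open>auto simp: converges_L2_def\<close>)

lemma weak_gradient_lincomb:
  assumes f: "has_weak_gradient \<Omega> f F" and g: "has_weak_gradient \<Omega> g G"
  shows "has_weak_gradient \<Omega> (\<lambda>x. r *\<^sub>R f x + s *\<^sub>R g x) (\<lambda>x. r *\<^sub>R F x + s *\<^sub>R G x)"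
  unfolding has_weak_gradient_iff
proof (intro conjI ballI allI)
  note L = weak_gradientD(1,2)[OF f] weak_gradientD(1,2)[OF g]
  show "(\<lambda>x. r *\<^sub>R f x + s *\<^sub>R g x) \<in> L2 \<Omega>" "(\<lambda>x. r *\<^sub>R F x + s *\<^sub>R G x) \<in> L2 \<Omega>"
    by (intro L2_add L2_scale L)+
  fix \<phi> :: "vec3 \<Rightarrow> real" and i j assume \<phi>: "\<phi> \<in> test_functions \<Omega>"
  show "L2_inner \<Omega> (\<lambda>x. r *\<^sub>R f x + s *\<^sub>R g x) (\<lambda>x. axis i (partial j \<phi> x)) = - L2_inner \<Omega> (\<lambda>x. r *\<^sub>R F x + s *\<^sub>R G x) (\<lambda>x. axis i (axis j (\<phi> x)))"
    by (simp add: L2_inner_add_left L2_scale L test_L2[OF \<phi>] L2_inner_scale_left weak_gradientD(3)[OF f \<phi>] weak_gradientD(3)[OF g \<phi>])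
qed

lemma weak_gradient_zero: "has_weak_gradient \<Omega> (\<lambda>x. 0) (\<lambda>x. 0)"
  by (simp add: has_weak_gradient_iff L2_zero) (simp add: L2_inner_def)

lemma weak_gradient_sum:
  assumes "finite I" "\<And>i. i \<in> I \<Longrightarrow> has_weak_gradient \<Omega> (f i) (F i)"
  shows "has_weak_gradient \<Omega> (\<lambda>x. \<Sum>i\<in>I. c i *\<^sub>R f i x) (\<lambda>x. \<Sum>i\<in>I. c i *\<^sub>R F i x)"
  using assms
proof (induction I rule: finite_induct)
  case (insert i I)
  then show ?case using weak_gradient_lincomb[of "f i" "F i" "\<lambda>x. \<Sum>i\<in>I. c i *\<^sub>R f i x" "\<lambda>x. \<Sum>i\<in>I. c i *\<^sub>R F i x" "c i" 1] by simp
qed (simp add: weak_gradient_zero)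

lemma L2_imp_integrable:
  fixes f :: "vec3 \<Rightarrow> 'b::euclidean_space"
  assumes "f \<in> L2 \<Omega>" shows "integrable (lebesgue_on \<Omega>) (\<lambda>x. f x \<bullet> b)"
  using L2_inner_integrable[OF assms continuous_L2[of "\<lambda>x. b"]] by simp

text \<open>The fundamental lemma is applied to each entry of the difference. This makes the choice
  in \<open>wgrad\<close> immaterial for norms and inner products.\<close>

lemma weak_gradient_unique:
  assumes f: "has_weak_gradient \<Omega> f F" and g: "has_weak_gradient \<Omega> g G" and ae: "AE x in lebesgue_on \<Omega>. f x = g x"
  shows "AE x in lebesgue_on \<Omega>. F x = G x"
proof -
  note L = weak_gradientD(1,2)[OF f] weak_gradientD(1,2)[OF g]
  have "AE x in lebesgue_on \<Omega>. F x $ i $ j - G x $ i $ j = 0" for i j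
  proof (rule fundamental_lemma[OF open_dom])
    have "(F x - G x) \<bullet> axis i (axis j 1) = F x $ i $ j - G x $ i $ j" for x by (simp add: inner_axis)
    then show "integrable (lebesgue_on \<Omega>) (\<lambda>x. F x $ i $ j - G x $ i $ j)"
      using L2_imp_integrable[OF L2_diff[OF L(2,4)], of "axis i (axis j 1)"] by simp
    fix \<phi> :: "vec3 \<Rightarrow> real" assume \<phi>: "\<phi> \<in> test_functions \<Omega>"
    have "L2_inner \<Omega> f (\<lambda>x. axis i (partial j \<phi> x)) = L2_inner \<Omega> g (\<lambda>x. axis i (partial j \<phi> x))"
      by (rule L2_inner_cong_AE[OF ae]) (auto intro: L test_L2[OF \<phi>])
    then have "L2_inner \<Omega> F (\<lambda>x. axis i (axis j (\<phi> x))) = L2_inner \<Omega> G (\<lambda>x. axis i (axis j (\<phi> x)))"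
      using weak_gradientD(3)[OF f \<phi>] weak_gradientD(3)[OF g \<phi>] by simp
    then have "L2_inner \<Omega> (\<lambda>x. F x - G x) (\<lambda>x. axis i (axis j (\<phi> x))) = 0"
      using L2_inner_diff_left[OF L(2,4) test_L2(2)[OF \<phi>]] by simp
    then show "(LINT x|lebesgue_on \<Omega>. (F x $ i $ j - G x $ i $ j) * \<phi> x) = 0"
      by (simp add: L2_inner_def inner_axis)
  qed
  then have "AE x in lebesgue_on \<Omega>. \<forall>i j. F x $ i $ j - G x $ i $ j = 0"
    by (simp add: AE_all_countable)
  then show ?thesis by eventually_elim (simp add: vec_eq_iff)
qed

lemma wgrad_weak_gradient: "has_weak_gradient \<Omega> f G \<Longrightarrow> has_weak_gradient \<Omega> f (wgrad \<Omega> f)"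
  unfolding wgrad_def by (rule someI[where P="has_weak_gradient \<Omega> f"])

lemma wgrad_AE: "has_weak_gradient \<Omega> f G \<Longrightarrow> AE x in lebesgue_on \<Omega>. wgrad \<Omega> f x = G x"
  by (rule weak_gradient_unique[OF wgrad_weak_gradient]) auto

lemma H1_norm_eq: "has_weak_gradient \<Omega> f G \<Longrightarrow> H1_norm \<Omega> f = sqrt ((L2_norm \<Omega> f)\<^sup>2 + (L2_norm \<Omega> G)\<^sup>2)"
  using L2_norm_cong_AE[OF wgrad_AE weak_gradientD(2)[OF wgrad_weak_gradient] weak_gradientD(2)]
  by (auto simp: H1_norm_def)

lemma H1_norm_bounds:
  assumes "has_weak_gradient \<Omega> f G"
  shows "L2_norm \<Omega> f \<le> H1_norm \<Omega> f" "L2_norm \<Omega> G \<le> H1_norm \<Omega> f" "H1_norm \<Omega> f \<le> L2_norm \<Omega> f + L2_norm \<Omega> G"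
  unfolding H1_norm_eq[OF assms]
  by (auto simp: L2_norm_nonneg intro!: real_le_rsqrt sqrt_sum_squares_le_sum)

lemma V_inner_eq:
  assumes "has_weak_gradient \<Omega> f F" "has_weak_gradient \<Omega> g G"
  shows "V_inner \<Omega> f g = L2_inner \<Omega> F G"
  unfolding V_inner_def
  by (rule L2_inner_cong_AE[OF wgrad_AE[OF assms(1)] wgrad_AE[OF assms(2)]])
    (use assms weak_gradientD(2) wgrad_weak_gradient in blast)+

lemma V_norm_eq: "has_weak_gradient \<Omega> f F \<Longrightarrow> V_norm \<Omega> f = L2_norm \<Omega> F"
  by (simp add: V_norm_def V_inner_eq L2_norm_def)

lemma grad_weak_gradient:
  assumes "smooth a" shows "has_weak_gradient \<Omega> a (grad a)"
proof -
  have c: "smooth (\<lambda>x. a x $ i)" for i using Ck_on_compose_linear[OF bounded_linear_vec_nth] assms by blast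
  have "continuous_on UNIV (grad a)" unfolding grad_def
    by (intro continuous_on_vec_lambda continuous_on_component smooth_continuous[OF smooth_partial] assms)
  then have "grad a \<in> L2 \<Omega>" by (rule continuous_L2)
  moreover have "(LINT x|lebesgue_on \<Omega>. a x $ i * partial j \<phi> x) = - (LINT x|lebesgue_on \<Omega>. grad a x $ i $ j * \<phi> x)"
    if "\<phi> \<in> test_functions \<Omega>" for \<phi> :: "vec3 \<Rightarrow> real" and i j
    using integration_by_parts[OF open_dom c that] by (simp add: partial_component[OF assms] grad_def)
  ultimately show ?thesis using smooth_L2[OF assms] by (simp add: has_weak_gradient_def)
qed

text \<open>Replaces the norm of \<open>H1\<close>, which involves an arbitrary choice of gradient,
  by L2 convergence of the fields and of their classical gradients to any given weak
  gradient.\<close>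

lemma H10_iff:
  assumes f: "has_weak_gradient \<Omega> f G"
  shows "f \<in> H10 \<Omega> \<longleftrightarrow> (\<exists>\<phi>. (\<forall>n. \<phi> n \<in> test_functions \<Omega>) \<and> converges_L2 \<Omega> \<phi> f \<and> converges_L2 \<Omega> (\<lambda>n. grad (\<phi> n)) G)"
    (is "_ \<longleftrightarrow> (\<exists>\<phi>. ?P \<phi>)")
proof -
  have key: "(\<lambda>n. H1_norm \<Omega> (\<phi> n - f)) \<longlonglongrightarrow> 0 \<longleftrightarrow> converges_L2 \<Omega> \<phi> f \<and> converges_L2 \<Omega> (\<lambda>n. grad (\<phi> n)) G"
    if \<phi>: "\<And>n. \<phi> n \<in> test_functions \<Omega>" for \<phi>
  proof -
    note w = grad_weak_gradient[OF test_functionsD(1)[OF \<phi>]]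
    have d: "has_weak_gradient \<Omega> (\<phi> n - f) (\<lambda>x. grad (\<phi> n) x - G x)" for n
      using weak_gradient_lincomb[OF w[of n] f, of 1 "-1"] by (simp add: fun_diff_def)
    note b = H1_norm_bounds[OF d]
    have L: "\<phi> n \<in> L2 \<Omega>" "grad (\<phi> n) \<in> L2 \<Omega>" "f \<in> L2 \<Omega>" "G \<in> L2 \<Omega>" for n
      using weak_gradientD[OF w] weak_gradientD[OF f] by auto
    show ?thesis
    proof
      assume H: "(\<lambda>n. H1_norm \<Omega> (\<phi> n - f)) \<longlonglongrightarrow> 0"
      have "(\<lambda>n. L2_norm \<Omega> (\<phi> n - f)) \<longlonglongrightarrow> 0" "(\<lambda>n. L2_norm \<Omega> (\<lambda>x. grad (\<phi> n) x - G x)) \<longlonglongrightarrow> 0"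
        by (rule Lim_null_comparison[OF always_eventually H], simp add: abs_of_nonneg[OF L2_norm_nonneg] b)+
      then show "converges_L2 \<Omega> \<phi> f \<and> converges_L2 \<Omega> (\<lambda>n. grad (\<phi> n)) G"
        using L by (simp add: converges_L2_def fun_diff_def)
    next
      assume "converges_L2 \<Omega> \<phi> f \<and> converges_L2 \<Omega> (\<lambda>n. grad (\<phi> n)) G"
      then have "(\<lambda>n. L2_norm \<Omega> (\<phi> n - f) + L2_norm \<Omega> (\<lambda>x. grad (\<phi> n) x - G x)) \<longlonglongrightarrow> 0"
        by (intro tendsto_add_zero) (auto simp: converges_L2_def fun_diff_def)
      then show "(\<lambda>n. H1_norm \<Omega> (\<phi> n - f)) \<longlonglongrightarrow> 0"
        by (rule Lim_null_comparison[OF always_eventually, rotated])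
          (use b order_trans[OF L2_norm_nonneg b(1)] in simp)
    qed
  qed
  have "f \<in> H1 \<Omega>" using f by (auto simp: H1_def)
  then show ?thesis unfolding H10_def using key by auto
qed

lemma H10_lincomb:
  assumes f: "has_weak_gradient \<Omega> f F" "f \<in> H10 \<Omega>" and g: "has_weak_gradient \<Omega> g G" "g \<in> H10 \<Omega>"
  shows "(\<lambda>x. r *\<^sub>R f x + s *\<^sub>R g x) \<in> H10 \<Omega>"
proof -
  obtain \<phi> where \<phi>: "\<And>n. \<phi> n \<in> test_functions \<Omega>" "converges_L2 \<Omega> \<phi> f" "converges_L2 \<Omega> (\<lambda>n. grad (\<phi> n)) F"
    using f by (auto simp: H10_iff[OF f(1)])
  obtain \<psi> where \<psi>: "\<And>n. \<psi> n \<in> test_functions \<Omega>" "converges_L2 \<Omega> \<psi> g" "converges_L2 \<Omega> (\<lambda>n. grad (\<psi> n)) G"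
    using g by (auto simp: H10_iff[OF g(1)])
  define \<xi> where "\<xi> n x = r *\<^sub>R \<phi> n x + s *\<^sub>R \<psi> n x" for n x
  have sm: "smooth (\<xi> n)" for n unfolding \<xi>_def
    by (intro allI Ck_on_add Ck_on_compose_linear[OF bounded_linear_scaleR_right] test_functionsD(1)[OF \<phi>(1), rule_format] test_functionsD(1)[OF \<psi>(1), rule_format])
  have "\<xi> n \<in> test_functions \<Omega>" for n
  proof -
    let ?K = "closure {x. \<phi> n x \<noteq> 0} \<union> closure {x. \<psi> n x \<noteq> 0}"
    have "{x. \<xi> n x \<noteq> 0} \<subseteq> {x. \<phi> n x \<noteq> 0} \<union> {x. \<psi> n x \<noteq> 0}" by (auto simp: \<xi>_def)
    also have "\<dots> \<subseteq> ?K" by (intro Un_mono closure_subset)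
    finally have "{x. \<xi> n x \<noteq> 0} \<subseteq> ?K" .
    then have cl: "closure {x. \<xi> n x \<noteq> 0} \<subseteq> ?K" by (intro closure_minimal) auto
    have "compact ?K" using test_functionsD(2)[OF \<phi>(1)] test_functionsD(2)[OF \<psi>(1)] by (intro compact_Un)
    then have "compact (closure {x. \<xi> n x \<noteq> 0})" using cl
      by (metis bounded_subset closed_closure compact_eq_bounded_closed)
    then show ?thesis using sm cl test_functionsD(3)[OF \<phi>(1)] test_functionsD(3)[OF \<psi>(1)]
      unfolding test_functions_def by blast
  qed
  moreover have "converges_L2 \<Omega> \<xi> (\<lambda>x. r *\<^sub>R f x + s *\<^sub>R g x)" unfolding \<xi>_def by (rule converges_L2_lincomb[OF \<phi>(2) \<psi>(2)])
  moreover have "converges_L2 \<Omega> (\<lambda>n. grad (\<xi> n)) (\<lambda>x. r *\<^sub>R F x + s *\<^sub>R G x)"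
  proof -
    have "partial j (\<xi> n) x = r *\<^sub>R partial j (\<phi> n) x + s *\<^sub>R partial j (\<psi> n) x" for n j x
      unfolding partial_def[of j "\<phi> n"] partial_def[of j "\<psi> n"] \<xi>_def
      by (rule partial_eq) (intro has_derivative_add has_derivative_scaleR_right smooth_has_derivative
        test_functionsD(1)[OF \<phi>(1)] test_functionsD(1)[OF \<psi>(1)])
    then have "(\<lambda>n. grad (\<xi> n)) = (\<lambda>n x. r *\<^sub>R grad (\<phi> n) x + s *\<^sub>R grad (\<psi> n) x)"
      by (auto simp: fun_eq_iff grad_def vec_eq_iff)
    then show ?thesis using converges_L2_lincomb[OF \<phi>(3) \<psi>(3), of r s] by simp
  qed
  ultimately show ?thesis by (subst H10_iff[OF weak_gradient_lincomb[OF f(1) g(1)]]) blast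
qed

text \<open>A diagonal argument: each \<open>f n\<close> is replaced by a test function within
  \<open>1 / (n + 1)\<close> of it, for the field and for the gradient at once.\<close>

lemma H10_limit:
  assumes f: "\<And>n. has_weak_gradient \<Omega> (f n) (F n)" "\<And>n. f n \<in> H10 \<Omega>" and l: "converges_L2 \<Omega> f g" "converges_L2 \<Omega> F G"
  shows "g \<in> H10 \<Omega>"
proof -
  have ex: "\<exists>\<phi>\<in>test_functions \<Omega>. L2_norm \<Omega> (\<lambda>x. \<phi> x - f n x) \<le> inverse (real (Suc n)) \<and> L2_norm \<Omega> (\<lambda>x. grad \<phi> x - F n x) \<le> inverse (real (Suc n))" for n
  proof -
    obtain \<phi> where \<phi>: "\<And>n. \<phi> n \<in> test_functions \<Omega>" "converges_L2 \<Omega> \<phi> (f n)" "converges_L2 \<Omega> (\<lambda>n. grad (\<phi> n)) (F n)"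
      using f(2)[of n] by (auto simp: H10_iff[OF f(1)])
    have "(0::real) < inverse (real (Suc n))" by simp
    then have "\<forall>\<^sub>F m in sequentially. L2_norm \<Omega> (\<lambda>x. \<phi> m x - f n x) < inverse (real (Suc n))"
      "\<forall>\<^sub>F m in sequentially. L2_norm \<Omega> (\<lambda>x. grad (\<phi> m) x - F n x) < inverse (real (Suc n))"
      using \<phi>(2,3) unfolding converges_L2_def by (auto dest!: order_tendstoD(2))
    then have "\<forall>\<^sub>F m in sequentially. L2_norm \<Omega> (\<lambda>x. \<phi> m x - f n x) < inverse (real (Suc n)) \<and> L2_norm \<Omega> (\<lambda>x. grad (\<phi> m) x - F n x) < inverse (real (Suc n))"
      by (rule eventually_conj)
    then obtain m where "L2_norm \<Omega> (\<lambda>x. \<phi> m x - f n x) < inverse (real (Suc n)) \<and> L2_norm \<Omega> (\<lambda>x. grad (\<phi> m) x - F n x) < inverse (real (Suc n))"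
      by (auto simp: eventually_sequentially)
    then show ?thesis using \<phi>(1) less_imp_le by blast
  qed
  define \<phi> where "\<phi> n = (SOME \<phi>. \<phi> \<in> test_functions \<Omega> \<and> L2_norm \<Omega> (\<lambda>x. \<phi> x - f n x) \<le> inverse (real (Suc n)) \<and> L2_norm \<Omega> (\<lambda>x. grad \<phi> x - F n x) \<le> inverse (real (Suc n)))" for n
  have \<phi>: "\<phi> n \<in> test_functions \<Omega>" "L2_norm \<Omega> (\<lambda>x. \<phi> n x - f n x) \<le> inverse (real (Suc n))"
     "L2_norm \<Omega> (\<lambda>x. grad (\<phi> n) x - F n x) \<le> inverse (real (Suc n))" for n
    using someI_ex[OF ex[of n, unfolded Bex_def]] unfolding \<phi>_def by blast+
  have diag: "converges_L2 \<Omega> a c" if "converges_L2 \<Omega> b c" "\<And>n. a n \<in> L2 \<Omega>" "\<And>n. L2_norm \<Omega> (\<lambda>x. a n x - b n x) \<le> inverse (real (Suc n))"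
    for a b :: "nat \<Rightarrow> vec3 \<Rightarrow> 'b::euclidean_space" and c
    unfolding converges_L2_def
  proof (intro conjI allI)
    have L: "b n \<in> L2 \<Omega>" "c \<in> L2 \<Omega>" for n using that(1) by (auto simp: converges_L2_def)
    show "(\<lambda>n. L2_norm \<Omega> (\<lambda>x. a n x - c x)) \<longlonglongrightarrow> 0"
    proof (rule Lim_null_comparison[OF always_eventually])
      show "\<forall>n. norm (L2_norm \<Omega> (\<lambda>x. a n x - c x)) \<le> inverse (real (Suc n)) + L2_norm \<Omega> (\<lambda>x. b n x - c x)"
      proof
        fix n
        show "norm (L2_norm \<Omega> (\<lambda>x. a n x - c x)) \<le> inverse (real (Suc n)) + L2_norm \<Omega> (\<lambda>x. b n x - c x)"
          using L2_norm_triangle_diff[OF that(2)[of n] L(1)[of n] L(2)] that(3)[of n] L2_norm_nonneg[of \<Omega> "\<lambda>x. a n x - c x"] by simp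
      qed
      show "(\<lambda>n. inverse (real (Suc n)) + L2_norm \<Omega> (\<lambda>x. b n x - c x)) \<longlonglongrightarrow> 0"
        using that(1) unfolding converges_L2_def by (intro tendsto_add_zero LIMSEQ_inverse_real_of_nat) auto
    qed
  qed (use that in \<open>auto simp: converges_L2_def\<close>)
  note w = grad_weak_gradient[OF test_functionsD(1)[OF \<phi>(1)]]
  have "converges_L2 \<Omega> \<phi> g" "converges_L2 \<Omega> (\<lambda>n. grad (\<phi> n)) G"
    using diag[OF l(1) weak_gradientD(1)[OF w] \<phi>(2)] diag[OF l(2) weak_gradientD(2)[OF w] \<phi>(3)] by auto
  then show ?thesis
    by (subst H10_iff[OF weak_gradient_limit[OF f(1) l]]) (use \<phi>(1) in blast)
qed

section \<open>Divergence-free fields and the space \<open>V\<close>\<close>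

lemma div_free_iff: "div_free \<Omega> f \<longleftrightarrow> (\<forall>\<phi> \<in> test_functions \<Omega>. L2_inner \<Omega> f (\<lambda>x. \<chi> j. partial j \<phi> x) = 0)"
  by (simp add: div_free_def L2_inner_def inner_vec_def)

lemma div_free_limit:
  assumes "\<And>n. div_free \<Omega> (f n)" "converges_L2 \<Omega> f g"
  shows "div_free \<Omega> g"
  unfolding div_free_iff
proof
  fix \<phi> :: "vec3 \<Rightarrow> real" assume \<phi>: "\<phi> \<in> test_functions \<Omega>"
  have "(\<lambda>n. L2_inner \<Omega> (f n) (\<lambda>x. \<chi> j. partial j \<phi> x)) \<longlonglongrightarrow> L2_inner \<Omega> g (\<lambda>x. \<chi> j. partial j \<phi> x)"
    by (rule converges_L2_inner[OF assms(2) test_L2(3)[OF \<phi>]])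
  then show "L2_inner \<Omega> g (\<lambda>x. \<chi> j. partial j \<phi> x) = 0"
    using assms(1) \<phi> by (simp add: div_free_iff LIMSEQ_const_iff)
qed

lemma div_free_lincomb:
  assumes "f \<in> L2 \<Omega>" "g \<in> L2 \<Omega>" "div_free \<Omega> f" "div_free \<Omega> g"
  shows "div_free \<Omega> (\<lambda>x. r *\<^sub>R f x + s *\<^sub>R g x)"
  using assms unfolding div_free_iff
  by (simp add: L2_inner_add_left L2_scale L2_inner_scale_left test_L2)

lemma V_weak_gradient: "f \<in> V_space \<Omega> \<Longrightarrow> has_weak_gradient \<Omega> f (wgrad \<Omega> f)"
  using wgrad_weak_gradient by (auto simp: V_space_def H10_def H1_def)

lemma V_lincomb:
  assumes "f \<in> V_space \<Omega>" "g \<in> V_space \<Omega>"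
  shows "(\<lambda>x. r *\<^sub>R f x + s *\<^sub>R g x) \<in> V_space \<Omega>"
  using assms H10_lincomb[OF V_weak_gradient[OF assms(1)] _ V_weak_gradient[OF assms(2)]]
    div_free_lincomb[OF weak_gradientD(1)[OF V_weak_gradient[OF assms(1)]] weak_gradientD(1)[OF V_weak_gradient[OF assms(2)]]]
  by (auto simp: V_space_def)

lemma V_diff: "f \<in> V_space \<Omega> \<Longrightarrow> g \<in> V_space \<Omega> \<Longrightarrow> f - g \<in> V_space \<Omega>"
  using V_lincomb[of f g 1 "-1"] by (simp add: fun_diff_def)

lemma V_zero: "(\<lambda>x. 0) \<in> V_space \<Omega>"
proof -
  have z: "(\<lambda>x::vec3. 0::vec3) \<in> test_functions \<Omega>" by (simp add: test_functions_def Ck_on_const)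
  have g: "grad (\<lambda>x. 0) = (\<lambda>x. 0)"
    by (simp add: fun_eq_iff grad_def vec_eq_iff partial_eq[OF has_derivative_const])
  have "(\<lambda>x. 0) \<in> H10 \<Omega>"
    by (subst H10_iff[OF weak_gradient_zero])
      (intro exI[of _ "\<lambda>n x. 0"] conjI allI z converges_L2_const[OF L2_zero], unfold g, rule converges_L2_const[OF L2_zero])
  then show ?thesis by (simp add: V_space_def div_free_def)
qed

lemma V_sum:
  assumes "finite I" "\<And>i. i \<in> I \<Longrightarrow> f i \<in> V_space \<Omega>"
  shows "(\<lambda>x. \<Sum>i\<in>I. c i *\<^sub>R f i x) \<in> V_space \<Omega>"
  using assms
proof (induction I rule: finite_induct)
  case (insert i I)
  then show ?case using V_lincomb[of "f i" "\<lambda>x. \<Sum>i\<in>I. c i *\<^sub>R f i x" "c i" 1] by simp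
qed (simp add: V_zero)

lemma V_limit:
  assumes f: "\<And>n. f n \<in> V_space \<Omega>" "\<And>n. has_weak_gradient \<Omega> (f n) (F n)" and l: "converges_L2 \<Omega> f g" "converges_L2 \<Omega> F G"
  shows "g \<in> V_space \<Omega>"
  using H10_limit[OF f(2) _ l] div_free_limit[OF _ l(1)] f(1) by (auto simp: V_space_def)

lemma L2_transpose:
  fixes F G :: mfield
  assumes "F \<in> L2 \<Omega>" shows "(\<lambda>x. transpose (F x)) \<in> L2 \<Omega>"
proof (rule L2I)
  have c: "continuous_on UNIV (transpose :: mat3 \<Rightarrow> mat3)"
    unfolding transpose_def[abs_def] by (intro continuous_intros)
  show "(\<lambda>x. transpose (F x)) \<in> borel_measurable (lebesgue_on \<Omega>)"
    by (rule borel_measurable_continuous_on[OF c L2D(1)[OF assms]])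
  have "(norm (transpose (F x)))\<^sup>2 = (norm (F x))\<^sup>2" for x
  proof -
    have "transpose (F x) \<bullet> transpose (F x) = F x \<bullet> F x"
      by (simp add: inner_vec_def transpose_def) (rule sum.swap)
    then show ?thesis by (simp add: power2_norm_eq_inner)
  qed
  then show "integrable (lebesgue_on \<Omega>) (\<lambda>x. (norm (transpose (F x)))\<^sup>2)" using L2D(2)[OF assms] by simp
qed

lemma L2_inner_transpose: "L2_inner \<Omega> (\<lambda>x. transpose (F x)) (\<lambda>x. transpose (G x)) = L2_inner \<Omega> F (G :: mfield)"
proof -
  have "transpose A \<bullet> transpose B = A \<bullet> B" for A B :: mat3
    by (simp add: inner_vec_def transpose_def) (rule sum.swap)
  then show ?thesis by (simp add: L2_inner_def)
qed

text \<open>Two integrations by parts turn the inner product with the gradient of a test function into a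
  product of divergences.\<close>

lemma transpose_gradient_orthogonal:
  assumes f: "has_weak_gradient \<Omega> f F" "div_free \<Omega> f" and g: "has_weak_gradient \<Omega> g G" "g \<in> H10 \<Omega>"
  shows "L2_inner \<Omega> (\<lambda>x. transpose (F x)) G = 0"
proof -
  have FL: "F \<in> L2 \<Omega>" "f \<in> L2 \<Omega>" using weak_gradientD[OF f(1)] by auto
  note TL = L2_transpose[OF FL(1)]
  have test: "L2_inner \<Omega> (\<lambda>x. transpose (F x)) (grad \<phi>) = 0" if \<phi>: "\<phi> \<in> test_functions \<Omega>" for \<phi>
  proof -
    have sm: "smooth \<phi>" using test_functionsD(1)[OF \<phi>] .
    define \<phi>c where "\<phi>c i x = \<phi> x $ i" for i x
    have tc: "\<phi>c i \<in> test_functions \<Omega>" for i unfolding \<phi>c_def by (rule component_test_function[OF \<phi>])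
    have g: "grad \<phi> x = (\<chi> i j. partial j (\<phi>c i) x)" for x by (simp add: grad_def \<phi>c_def[abs_def] partial_component[OF sm])
    have tp: "partial j (\<phi>c i) \<in> test_functions \<Omega>" for i j by (rule partial_test_function[OF tc])
    have i1: "integrable (lebesgue_on \<Omega>) (\<lambda>x. F x $ j $ i * partial j (\<phi>c i) x)" for i j
      using L2_inner_integrable[OF FL(1) test_L2(2)[OF tp], of j i j i] by (simp add: inner_axis)
    have i2: "integrable (lebesgue_on \<Omega>) (\<lambda>x. f x $ j * partial j (partial i (\<phi>c i)) x)" for i j
      using L2_inner_integrable[OF FL(2) test_L2(1)[OF tp], of j j i i] by (simp add: inner_axis)
    have "L2_inner \<Omega> (\<lambda>x. transpose (F x)) (grad \<phi>) = (LINT x|lebesgue_on \<Omega>. (\<Sum>i\<in>UNIV. (\<Sum>j\<in>UNIV. F x $ j $ i * partial j (\<phi>c i) x)))"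
      by (simp add: L2_inner_def g inner_vec_def transpose_def)
    also have "\<dots> = (\<Sum>i\<in>UNIV. \<Sum>j\<in>UNIV. (LINT x|lebesgue_on \<Omega>. F x $ j $ i * partial j (\<phi>c i) x))"
      by (simp add: Bochner_Integration.integral_sum i1)
    also have "\<dots> = (\<Sum>i\<in>UNIV. \<Sum>j\<in>UNIV. - (LINT x|lebesgue_on \<Omega>. f x $ j * partial j (partial i (\<phi>c i)) x))"
    proof (intro sum.cong refl)
      fix i j
      have "(LINT x|lebesgue_on \<Omega>. f x $ j * partial i (partial j (\<phi>c i)) x) = - (LINT x|lebesgue_on \<Omega>. F x $ j $ i * partial j (\<phi>c i) x)"
        using f(1) tp unfolding has_weak_gradient_def by blast
      then show "(LINT x|lebesgue_on \<Omega>. F x $ j $ i * partial j (\<phi>c i) x) = - (LINT x|lebesgue_on \<Omega>. f x $ j * partial j (partial i (\<phi>c i)) x)"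
        using partial_commute[OF test_functionsD(1)[OF tc], of i j i] by simp
    qed
    also have "\<dots> = - (\<Sum>i\<in>UNIV. (LINT x|lebesgue_on \<Omega>. (\<Sum>j\<in>UNIV. f x $ j * partial j (partial i (\<phi>c i)) x)))"
      by (simp add: Bochner_Integration.integral_sum i2 sum_negf)
    also have "\<dots> = 0" using f(2) tp unfolding div_free_def by simp
    finally show ?thesis .
  qed
  \<comment> \<open>The field \<open>g\<close> needs zero boundary values only for this
    approximation by test functions; \<open>f\<close> contributes only its vanishing divergence
    inside the domain.\<close>
  obtain \<phi> where \<phi>: "\<And>n. \<phi> n \<in> test_functions \<Omega>" "converges_L2 \<Omega> (\<lambda>n. grad (\<phi> n)) G"
    using g by (auto simp: H10_iff[OF g(1)])
  have "(\<lambda>n. L2_inner \<Omega> (grad (\<phi> n)) (\<lambda>x. transpose (F x))) \<longlonglongrightarrow> L2_inner \<Omega> G (\<lambda>x. transpose (F x))"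
    by (rule converges_L2_inner[OF \<phi>(2) TL])
  then show ?thesis using test[OF \<phi>(1)] by (simp add: L2_inner_commute[of \<Omega> "grad _"] L2_inner_commute[of \<Omega> G] LIMSEQ_const_iff)
qed
end


section \<open>Weak equations in time\<close>

text \<open>Tailored to the weak equations: one factor may be singular but is integrable in
  \<open>s\<close>, the other is bounded and supported in a bounded range of
  \<open>t\<close>.\<close>

lemma fubini_bounded:
  fixes f :: "real \<Rightarrow> real" and G :: "real \<Rightarrow> real \<Rightarrow> real"
  assumes f: "integrable lborel f" and G: "(\<lambda>(s, t). G s t) \<in> borel_measurable (lborel \<Otimes>\<^sub>M lborel)"
    and b: "\<And>s t. \<bar>G s t\<bar> \<le> B * indicator {0..T} t"
  shows "(\<integral>t. (\<integral>s. f s * G s t \<partial>lborel) \<partial>lborel) = (\<integral>s. (\<integral>t. f s * G s t \<partial>lborel) \<partial>lborel)"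
proof -
  note [measurable] = G
  have [measurable]: "f \<in> borel_measurable borel" using f by simp
  have iT: "integrable lborel (\<lambda>t. B * indicator {0..T} t)" by (cases "T \<ge> 0") auto
  define H where "H = (\<lambda>(s, t). f s * G s t)"
  have Hm [measurable]: "H \<in> borel_measurable (lborel \<Otimes>\<^sub>M lborel)"
  proof -
    have "H = (\<lambda>p. f (fst p) * (\<lambda>(s, t). G s t) p)" by (auto simp: H_def)
    then show ?thesis by simp
  qed
  have Gi: "integrable lborel (G s)" for s
  proof (rule Bochner_Integration.integrable_bound[OF iT])
    have "(\<lambda>t. (\<lambda>(s, t). G s t) (s, t)) \<in> borel_measurable lborel" by measurable
    then show "G s \<in> borel_measurable lborel" by simp
    show "AE t in lborel. norm (G s t) \<le> norm (B * indicator {0..T} t)"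
      using b by (auto intro!: AE_I2 order_trans[OF b])
  qed
  have "integrable (lborel \<Otimes>\<^sub>M lborel) H"
  proof (rule lborel_pair.Fubini_integrable[OF Hm])
    show "AE s in lborel. integrable lborel (\<lambda>t. H (s, t))" using Gi by (simp add: H_def)
    show "integrable lborel (\<lambda>s. \<integral>t. norm (H (s, t)) \<partial>lborel)"
    proof (rule Bochner_Integration.integrable_bound)
      show "integrable lborel (\<lambda>s. (\<integral>t. B * indicator {0..T} t \<partial>lborel) * f s)" using f by simp
      show "AE s in lborel. norm (\<integral>t. norm (H (s, t)) \<partial>lborel) \<le> norm ((\<integral>t. B * indicator {0..T} t \<partial>lborel) * f s)"
      proof (rule AE_I2)
        fix s
        have "(\<integral>t. norm (G s t) \<partial>lborel) \<le> (\<integral>t. B * indicator {0..T} t \<partial>lborel)"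
          using Gi iT b by (intro integral_mono) auto
        then have "(\<integral>t. norm (G s t) \<partial>lborel) * \<bar>f s\<bar> \<le> \<bar>\<integral>t. B * indicator {0..T} t \<partial>lborel\<bar> * \<bar>f s\<bar>"
          by (intro mult_right_mono) auto
        moreover have "(\<integral>t. norm (H (s, t)) \<partial>lborel) = (\<integral>t. norm (G s t) \<partial>lborel) * \<bar>f s\<bar>"
          by (simp add: H_def abs_mult)
        ultimately show "norm (\<integral>t. norm (H (s, t)) \<partial>lborel) \<le> norm ((\<integral>t. B * indicator {0..T} t \<partial>lborel) * f s)"
          by (simp add: abs_mult)
      qed
    qed measurable
  qed
  then have "integrable (lborel \<Otimes>\<^sub>M lborel) (case_prod (\<lambda>s t. H (s, t)))" by simp
  from lborel_pair.Fubini_integral[OF this] show ?thesis by (simp add: H_def)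
qed

lemma time_testE:
  assumes "\<psi> \<in> time_test_functions"
  obtains \<psi>' T where "T > 0" "\<And>t. t \<ge> 0 \<Longrightarrow> time_deriv \<psi> t = \<psi>' t" "continuous_on UNIV \<psi>'"
    "\<And>t. t \<ge> T \<Longrightarrow> \<psi> t = 0" "\<And>t. t \<ge> T \<Longrightarrow> \<psi>' t = 0" "continuous_on {0..} \<psi>"
    "\<And>t. t \<ge> 0 \<Longrightarrow> (\<psi> has_vector_derivative \<psi>' t) (at t within {0..})"
proof -
  obtain D T0 where D: "D 0 = \<psi>" "\<And>n t. t \<ge> 0 \<Longrightarrow> (D n has_real_derivative D (Suc n) t) (at t within {0..})"
    and T0: "\<And>t. t \<ge> T0 \<Longrightarrow> \<psi> t = 0"
    using assms unfolding time_test_functions_def smooth_halfline_def by blast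
  \<comment> \<open>The \<open>+ 1\<close> puts \<open>T\<close> strictly beyond \<open>T0\<close>,
    so \<open>\<psi>\<close> vanishes near every \<open>t \<ge> T\<close> and its derivative does as
    well. Below, the derivative is extended by a constant to negative times to be continuous on the
    line.\<close>
  define T where "T = max T0 0 + 1"
  define \<psi>' where "\<psi>' t = D (Suc 0) (max 0 t)" for t
  have c: "continuous_on {0..} (D n)" for n
    using D(2) by (auto intro!: DERIV_continuous_on)
  have nb: "at t within {0..} \<noteq> bot" if "t \<ge> 0" for t :: real
  proof (cases "t = 0")
    case True
    then show ?thesis by (simp add: at_within_Ici_at_right)
  next
    case False
    then have "at t within {0..} = at t" using that by (intro at_within_interior) simp
    then show ?thesis by simp
  qed
  have hv: "(\<psi> has_vector_derivative \<psi>' t) (at t within {0..})" if "t \<ge> 0" for t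
    using D(2)[OF that, of 0] that by (simp add: D(1) \<psi>'_def has_real_derivative_iff_has_vector_derivative max_def)
  have td: "time_deriv \<psi> t = \<psi>' t" if "t \<ge> 0" for t
    by (rule vector_derivative_within[OF nb[OF that] hv[OF that]])
  have c': "continuous_on UNIV \<psi>'" unfolding \<psi>'_def
    by (rule continuous_on_compose2[OF c]) (auto intro!: continuous_intros)
  have z: "\<psi>' t = 0" if t: "t \<ge> T" for t
  proof -
    have t0: "t > T0" "t > 0" using t by (auto simp: T_def)
    have "at t within {0..} = at t" using t0 by (intro at_within_interior) simp
    then have 1: "(\<psi> has_vector_derivative \<psi>' t) (at t)" using hv[of t] t0 by simp
    have "((\<lambda>_. 0) has_vector_derivative 0) (at t)" by simp
    then have "(\<psi> has_vector_derivative 0) (at t)"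
      by (rule has_vector_derivative_transform_within_open[of _ _ _ "{T0<..}"]) (use t0 T0 in auto)
    from vector_derivative_unique_at[OF 1 this] show ?thesis .
  qed
  show ?thesis
    by (rule that[of T \<psi>']) (use td c' z hv c[of 0] T0 in \<open>auto simp: T_def D(1)\<close>)
qed

lemma time_test_integral_tail:
  assumes T: "\<And>t. t \<ge> T \<Longrightarrow> \<psi> t = 0" "\<And>t. t \<ge> T \<Longrightarrow> \<psi>' t = 0" and c: "continuous_on UNIV \<psi>'"
    and d: "\<And>t. t \<ge> 0 \<Longrightarrow> (\<psi> has_vector_derivative \<psi>' t) (at t within {0..})" and s: "s \<ge> 0"
  shows "(\<integral>t. indicator {s<..} t * \<psi>' t \<partial>lborel) = - (\<psi> s :: real)"
proof -
  define R where "R = max s T"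
  have R: "s \<le> R" "T \<le> R" by (auto simp: R_def)
  have "(\<integral>t. indicator {s..R} t *\<^sub>R \<psi>' t \<partial>lborel) = \<psi> R - \<psi> s"
  proof (rule integral_FTC_Icc[OF R(1)])
    show "(\<psi> has_vector_derivative \<psi>' x) (at x within {s..R})" if "s \<le> x" "x \<le> R" for x
      by (rule has_vector_derivative_within_subset[OF d]) (use that s in auto)
    show "continuous_on {s..R} \<psi>'" by (rule continuous_on_subset[OF c]) simp
  qed
  also have "(\<integral>t. indicator {s..R} t *\<^sub>R \<psi>' t \<partial>lborel) = (\<integral>t. indicator {s<..} t * \<psi>' t \<partial>lborel)"
  proof (rule integral_cong_AE)
    have [measurable]: "\<psi>' \<in> borel_measurable borel" using c by (rule borel_measurable_continuous_onI)
    show "(\<lambda>t. indicator {s..R} t *\<^sub>R \<psi>' t) \<in> borel_measurable lborel" "(\<lambda>t. indicator {s<..} t * \<psi>' t) \<in> borel_measurable lborel" by measurable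
    show "AE t in lborel. indicator {s..R} t *\<^sub>R \<psi>' t = indicator {s<..} t * \<psi>' t"
      using AE_lborel_singleton[of s] by eventually_elim (use T(2) R in \<open>auto simp: indicator_def\<close>)
  qed
  finally show ?thesis using T(1)[OF R(2)] by simp
qed

text \<open>Integration by parts for a primitive of a merely locally integrable \<open>h\<close>:
  after Fubini's theorem the inner integral of \<open>\<psi>'\<close> from \<open>s\<close> on is
  \<open>- \<psi> s\<close>. No boundary term arises because the primitive vanishes at zero.\<close>

lemma integral_deriv_conv_one:
  assumes T: "T > 0" "\<And>t. t \<ge> T \<Longrightarrow> \<psi> t = 0" "\<And>t. t \<ge> T \<Longrightarrow> \<psi>' t = 0" and c: "continuous_on UNIV \<psi>'"
    and d: "\<And>t. t \<ge> 0 \<Longrightarrow> (\<psi> has_vector_derivative \<psi>' t) (at t within {0..})"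
    and h: "\<And>T. set_integrable lborel {0<..<T} h"
  shows "(LINT t:{0<..}|lborel. \<psi>' t * conv (\<lambda>_. 1) h t) = - (LINT t:{0<..}|lborel. \<psi> t * h t)"
proof -
  have [measurable]: "\<psi>' \<in> borel_measurable borel" using c by (rule borel_measurable_continuous_onI)
  obtain B where B: "\<And>t. t \<in> {0..T} \<Longrightarrow> norm (\<psi>' t) \<le> B"
    using compact_imp_bounded[OF compact_continuous_image[OF continuous_on_subset[OF c] compact_Icc[of 0 T]]] by (force simp: bounded_iff)
  define f where "f s = indicator {0<..<T} s * h s" for s
  define k where "k t = indicator {0..T} t * \<psi>' t" for t
  have [measurable]: "k \<in> borel_measurable borel" unfolding k_def by measurable
  define G where "G s t = (if s < t then k t else 0)" for s t
  have f: "integrable lborel f" using h[of T] by (simp add: set_integrable_def f_def[abs_def])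
  have "(LINT t:{0<..}|lborel. \<psi>' t * conv (\<lambda>_. 1) h t) = (\<integral>t. (\<integral>s. f s * G s t \<partial>lborel) \<partial>lborel)"
    unfolding set_lebesgue_integral_def
  proof (rule Bochner_Integration.integral_cong[OF refl])
    fix t
    show "indicator {0<..} t *\<^sub>R (\<psi>' t * conv (\<lambda>_. 1) h t) = (\<integral>s. f s * G s t \<partial>lborel)"
    proof (cases "0 < t \<and> t < T")
      case True
      have "\<psi>' t * conv (\<lambda>_. 1) h t = (\<integral>s. \<psi>' t * (indicator {0<..<t} s *\<^sub>R (1 * h s)) \<partial>lborel)"
        by (simp add: conv_def set_lebesgue_integral_def)
      also have "\<dots> = (\<integral>s. f s * G s t \<partial>lborel)"
        using True by (intro Bochner_Integration.integral_cong) (auto simp: f_def G_def k_def indicator_def)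
      finally show ?thesis using True by simp
    next
      case False
      then have "(\<lambda>s. f s * G s t) = (\<lambda>s. 0)" using T(3)[of t] by (auto simp: f_def G_def k_def indicator_def fun_eq_iff)
      then have "(\<integral>s. f s * G s t \<partial>lborel) = 0" by (simp only: integral_zero)
      moreover have "indicator {0<..} t *\<^sub>R (\<psi>' t * conv (\<lambda>_. 1) h t) = 0" using False T(3)[of t] by (auto simp: indicator_def)
      ultimately show ?thesis by simp
    qed
  qed
  also have "\<dots> = (\<integral>s. (\<integral>t. f s * G s t \<partial>lborel) \<partial>lborel)"
  proof (rule fubini_bounded[OF f])
    show "(\<lambda>(s, t). G s t) \<in> borel_measurable (lborel \<Otimes>\<^sub>M lborel)" unfolding G_def by measurable
    show "\<bar>G s t\<bar> \<le> B * indicator {0..T} t" for s t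
      using B[of t] order_trans[OF norm_ge_zero B[of t]] by (auto simp: G_def k_def indicator_def)
  qed
  also have "\<dots> = (\<integral>s. - (indicator {0<..} s *\<^sub>R (\<psi> s * h s)) \<partial>lborel)"
  proof (rule Bochner_Integration.integral_cong[OF refl])
    fix s
    show "(\<integral>t. f s * G s t \<partial>lborel) = - (indicator {0<..} s *\<^sub>R (\<psi> s * h s))"
    proof (cases "0 < s \<and> s < T")
      case True
      have "(\<integral>t. G s t \<partial>lborel) = (\<integral>t. indicator {s<..} t * \<psi>' t \<partial>lborel)"
        using True T(3) by (intro Bochner_Integration.integral_cong) (auto simp: G_def k_def indicator_def)
      also have "\<dots> = - \<psi> s" using True by (intro time_test_integral_tail[OF T(2,3) c d]) auto
      finally show ?thesis using True by (simp add: f_def)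
    next
      case False
      then show ?thesis using T(2)[of s] by (auto simp: f_def indicator_def)
    qed
  qed
  finally show ?thesis by (simp add: set_lebesgue_integral_def)
qed

text \<open>The weak equations integrate against the completed measure, while convolutions and
  Fubini's theorem are set up on \<open>lborel\<close>; this is the passage between them.\<close>

lemma set_lebesgue_integral_lborel:
  fixes f g :: "real \<Rightarrow> real"
  assumes A: "A \<in> sets borel" and g: "(\<lambda>x. indicator A x * g x) \<in> borel_measurable borel" and eq: "\<And>x. x \<in> A \<Longrightarrow> f x = g x"
  shows "(LINT x:A|lebesgue. f x) = (LINT x:A|lborel. g x)"
proof -
  have "(LINT x:A|lebesgue. f x) = (\<integral>x. indicator A x * g x \<partial>lebesgue)"
    unfolding set_lebesgue_integral_def
    by (intro Bochner_Integration.integral_cong) (auto simp: indicator_def eq)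
  also have "\<dots> = (\<integral>x. indicator A x * g x \<partial>lborel)" by (rule integral_completion) (use g in simp)
  finally show ?thesis by (simp add: set_lebesgue_integral_def)
qed

lemma lborel_integral_null_boundary:
  fixes g :: "real \<Rightarrow> real"
  assumes "\<And>x. x \<noteq> c \<Longrightarrow> indicator A x = (indicator B x :: real)" "A \<in> sets borel" "B \<in> sets borel"
    "(\<lambda>x. indicator A x * g x) \<in> borel_measurable borel"
  shows "(LINT x:A|lborel. g x) = (LINT x:B|lborel. g x)"
proof -
  have B: "(\<lambda>x. indicator B x * g x) \<in> borel_measurable borel"
  proof -
    have "(\<lambda>x. indicator B x * g x) = (\<lambda>x. if x = c then indicator B c * g c else indicator A x * g x)"
      using assms(1) by (auto simp: fun_eq_iff)
    also have "\<dots> \<in> borel_measurable borel" by (intro measurable_If assms) auto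
    finally show ?thesis .
  qed
  show ?thesis unfolding set_lebesgue_integral_def
    by (rule integral_cong_AE) (use assms(4) B AE_lborel_singleton[of c] assms(1) in \<open>auto elim!: eventually_mono\<close>)
qed

text \<open>The simple functions sample \<open>f\<close> at times rounded up to a grid of mesh
  \<open>1 / (n + 1)\<close>. Rounding up keeps the sampling times positive even at
  \<open>t = 0\<close>, where \<open>f\<close> need not take values in \<open>X\<close>.\<close>

lemma strongly_measurable_continuous:
  assumes f: "continuous_into {0<..} X N f" and T: "T > 0"
  shows "strongly_measurable (lebesgue_on {0..T}) X N f"
proof -
  define r where "r n t = (real_of_int \<lfloor>real (Suc n) * t\<rfloor> + 1) / real (Suc n)" for n t
  have sp: "space (lebesgue_on {0..T}) = {0..T}" by (simp add: space_restrict_space)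
  have rt: "t < r n t" "r n t \<le> t + 1 / real (Suc n)" for n t
  proof -
    have 1: "real (Suc n) * t < real_of_int \<lfloor>real (Suc n) * t\<rfloor> + 1" by linarith
    then show "t < r n t" unfolding r_def by (subst pos_less_divide_eq) (simp_all add: mult.commute)
    have "real_of_int \<lfloor>real (Suc n) * t\<rfloor> \<le> real (Suc n) * t" by linarith
    then have "r n t \<le> (real (Suc n) * t + 1) / real (Suc n)" unfolding r_def by (intro divide_right_mono) auto
    then show "r n t \<le> t + 1 / real (Suc n)" by (simp add: add_divide_distrib)
  qed
  have rlim: "filterlim (\<lambda>n. r n t) (at t within {0<..}) sequentially" if "t > 0" for t
  proof -
    have "(\<lambda>n. t + inverse (real (Suc n))) \<longlonglongrightarrow> t + 0"
      by (intro tendsto_add tendsto_const LIMSEQ_inverse_real_of_nat)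
    then have lim: "(\<lambda>n. t + 1 / real (Suc n)) \<longlonglongrightarrow> t" by (simp only: inverse_eq_divide add_0_right)
    have "(\<lambda>n. r n t) \<longlonglongrightarrow> t"
    proof (rule tendsto_sandwich[where f="\<lambda>_. t" and h="\<lambda>n. t + 1 / real (Suc n)", OF _ _ tendsto_const lim])
      show "\<forall>\<^sub>F n in sequentially. t \<le> r n t" by (rule always_eventually) (simp add: rt less_imp_le)
      show "\<forall>\<^sub>F n in sequentially. r n t \<le> t + 1 / real (Suc n)" by (rule always_eventually) (blast intro: rt)
    qed
    moreover have "r n t \<in> {0<..}" "r n t \<noteq> t" for n using rt(1)[of t n] that by auto
    ultimately show ?thesis by (auto simp: filterlim_at intro!: always_eventually)
  qed
  have ne0: "AE t in lebesgue_on {0..T}. t \<noteq> 0 \<and> t \<in> {0..T}"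
  proof -
    have "AE t in lebesgue. t \<noteq> (0::real)" using AE_completion[OF AE_lborel_singleton[of "0::real"]] .
    then show ?thesis by (auto simp: AE_restrict_space_iff elim!: eventually_mono)
  qed
  have sf: "simple_function (lebesgue_on {0..T}) (r n)" for n
  proof (rule simple_function_borel_measurable)
    have "r n \<in> borel_measurable borel" unfolding r_def by measurable
    then have "r n \<in> borel_measurable lebesgue" by (intro measurable_completion) simp
    then show "r n \<in> borel_measurable (lebesgue_on {0..T})" by (rule measurable_restrict_space1)
    have "r n ` {0..T} \<subseteq> (\<lambda>k. (real_of_int k + 1) / real (Suc n)) ` {0..\<lfloor>real (Suc n) * T\<rfloor>}"
      unfolding r_def by (auto intro!: imageI floor_mono mult_left_mono)
    then show "finite (r n ` space (lebesgue_on {0..T}))" unfolding sp by (rule finite_subset) simp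
  qed
  show ?thesis unfolding strongly_measurable_def
  proof (intro conjI exI[of _ "\<lambda>n t. f (r n t)"] allI)
    show "AE t in lebesgue_on {0..T}. f t \<in> X" using ne0 by eventually_elim (use f in \<open>auto simp: continuous_into_def\<close>)
    show "simple_function (lebesgue_on {0..T}) (\<lambda>t. f (r n t))" for n by (rule simple_function_compose1[OF sf])
    show "(\<lambda>t. f (r n t)) ` space (lebesgue_on {0..T}) \<subseteq> X" for n
    proof -
      have "r n t > 0" if "t \<ge> 0" for t using rt(1)[of t n] that by linarith
      then show ?thesis using f by (auto simp: sp continuous_into_def)
    qed
    show "AE t in lebesgue_on {0..T}. (\<lambda>n. N (f (r n t) - f t)) \<longlonglongrightarrow> 0"
      using ne0
    proof eventually_elim
      case (elim t)
      then have t: "t > 0" by auto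
      then have "((\<lambda>s. N (f s - f t)) \<longlongrightarrow> 0) (at t within {0<..})" using f by (auto simp: continuous_into_def)
      from filterlim_compose[OF this rlim[OF t]] show ?case .
    qed
  qed
qed

text \<open>Near zero the \<open>p\<close>-th power is dominated by a multiple of
  \<open>t powr (- r * p)\<close>, integrable because \<open>r * p < 1\<close>. The value at
  \<open>t = 0\<close> is not controlled and is removed as a null set.\<close>

lemma Lp_loc_continuous:
  assumes f: "continuous_into {0<..} X N f" and N: "\<And>g h. g \<in> X \<Longrightarrow> h \<in> X \<Longrightarrow> \<bar>N g - N h\<bar> \<le> N (g - h)"
    and N0: "\<And>g. g \<in> X \<Longrightarrow> N g \<ge> 0"
    and b: "\<And>t. t > 0 \<Longrightarrow> N (f t) \<le> C * (t powr (- r) * (1 + t))" and r: "r \<ge> 0" and p: "p \<ge> 1" "r * p < 1"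
  shows "Lp_loc p X N f"
  unfolding Lp_loc_def
proof (intro allI impI conjI)
  fix T :: real assume T: "T > 0"
  show "strongly_measurable (lebesgue_on {0..T}) X N f" by (rule strongly_measurable_continuous[OF f T])
  have fX: "f t \<in> X" if "t > 0" for t using f that by (auto simp: continuous_into_def)
  have Nc: "continuous_on {0<..} (\<lambda>t. N (f t))"
    unfolding continuous_on_def
  proof
    fix t :: real assume t: "t \<in> {0<..}"
    show "((\<lambda>s. N (f s)) \<longlongrightarrow> N (f t)) (at t within {0<..})"
    proof (rule LIM_zero_cancel, rule Lim_null_comparison)
      show "((\<lambda>s. N (f s - f t)) \<longlongrightarrow> 0) (at t within {0<..})" using f t by (auto simp: continuous_into_def)
      show "\<forall>\<^sub>F s in at t within {0<..}. norm (N (f s) - N (f t)) \<le> N (f s - f t)"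
        using t N fX by (auto simp: eventually_at_filter)
    qed
  qed
  have C0: "C \<ge> 0" using b[of 1] N0[OF fX[of 1]] by simp
  define g where "g t = indicator {0<..} t * (N (f t) powr p)" for t
  have gm: "g \<in> borel_measurable borel"
  proof -
    have "(\<lambda>t. indicator {0<..} t *\<^sub>R N (f t)) \<in> borel_measurable borel"
      by (rule borel_measurable_continuous_on_indicator[OF _ Nc]) simp
    then have "(\<lambda>t. (indicator {0<..} t *\<^sub>R N (f t)) powr p) \<in> borel_measurable borel" by measurable
    also have "(\<lambda>t. (indicator {0<..} t *\<^sub>R N (f t)) powr p) = g" using p by (auto simp: g_def fun_eq_iff indicator_def)
    finally show ?thesis .
  qed
  have gi: "integrable lborel (\<lambda>t. indicator {0<..<T} t * g t)"
  proof (rule Bochner_Integration.integrable_bound)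
    show "integrable lborel (\<lambda>t. (C * (1 + T)) powr p * (indicator {0<..<T} t * t powr ((1 - r * p) - 1)))"
      using integral_powr_interval[of "1 - r * p" T] p T by (simp add: has_bochner_integral_iff)
    show "(\<lambda>t. indicator {0<..<T} t * g t) \<in> borel_measurable lborel" using gm by simp
    show "AE t in lborel. norm (indicator {0<..<T} t * g t) \<le> norm ((C * (1 + T)) powr p * (indicator {0<..<T} t * t powr ((1 - r * p) - 1)))"
    proof (rule AE_I2)
      fix t
      show "norm (indicator {0<..<T} t * g t) \<le> norm ((C * (1 + T)) powr p * (indicator {0<..<T} t * t powr ((1 - r * p) - 1)))"
      proof (cases "0 < t \<and> t < T")
        case True
        have "N (f t) \<le> C * (t powr (- r) * (1 + t))" using b True by simp
        also have "\<dots> \<le> C * (t powr (- r) * (1 + T))" using C0 True by (intro mult_left_mono) auto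
        finally have "N (f t) powr p \<le> ((C * (1 + T)) * t powr (- r)) powr p"
          using N0 fX True p by (intro powr_mono2) (auto simp: mult_ac)
        also have "\<dots> = (C * (1 + T)) powr p * t powr (- r * p)" using C0 T True by (simp add: powr_mult powr_powr)
        finally show ?thesis using True by (simp add: g_def)
      qed simp
    qed
  qed
  have "integrable lebesgue (\<lambda>t. indicator {0<..<T} t * g t)"
    using gi gm by (subst integrable_completion) auto
  then have "integrable lebesgue (\<lambda>t. indicator {0..T} t *\<^sub>R N (f t) powr p)"
  proof (rule integrable_cong_AE_imp)
    have "AE t in lborel. t \<noteq> 0 \<and> t \<noteq> T" using AE_lborel_singleton[of 0] AE_lborel_singleton[of T] by eventually_elim simp
    then show "AE t in lebesgue. indicator {0<..<T} t * g t = indicator {0..T} t *\<^sub>R N (f t) powr p"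
      by (intro AE_completion, elim eventually_mono) (use T in \<open>auto simp: g_def indicator_def\<close>)
    \<comment> \<open>Differs from a Borel function at most at the two endpoints, hence is Borel
      itself.\<close>
    define k where "k t = indicator {0..T} t *\<^sub>R N (f t) powr p" for t
    have "k = (\<lambda>t. if t = 0 then k 0 else if t = T then k T else indicator {0<..<T} t * g t)"
      by (auto simp: fun_eq_iff k_def g_def indicator_def)
    also have "\<dots> \<in> borel_measurable borel" using gm by (intro measurable_If) auto
    finally have "k \<in> borel_measurable lebesgue" by (intro measurable_completion) simp
    then show "(\<lambda>t. indicator {0..T} t *\<^sub>R N (f t) powr p) \<in> borel_measurable lebesgue"
      by (simp add: k_def[abs_def])
  qed
  then show "integrable (lebesgue_on {0..T}) (\<lambda>t. N (f t) powr p)"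
    by (simp add: integrable_restrict_space)
qed

section \<open>Scalar equations tested against functions of time\<close>

lemma continuous_indicator_measurable:
  fixes f :: "real \<Rightarrow> real"
  assumes "continuous_on {0..} f"
  shows "(\<lambda>x. indicator {0..} x * f x) \<in> borel_measurable borel"
  using borel_measurable_continuous_on_indicator[OF _ assms] by simp

lemma continuous_locally_integrable:
  fixes f :: "real \<Rightarrow> real"
  assumes "continuous_on {0..} f"
  shows "set_integrable lborel {0<..<T} f"
proof (rule set_integrable_subset)
  show "set_integrable lborel {0..T} f"
    unfolding set_integrable_def by (rule borel_integrable_compact) (auto intro: continuous_on_subset[OF assms])
qed auto

lemma continuous_vanishing_integrable:
  fixes f :: "real \<Rightarrow> real"
  assumes "continuous_on {0..} f" "\<And>t. t \<ge> T \<Longrightarrow> f t = 0"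
  shows "set_integrable lborel {0<..} f"
proof -
  have "set_integrable lborel {0<..<T} f" by (rule continuous_locally_integrable[OF assms(1)])
  moreover have "(\<lambda>x. indicator {0<..<T} x *\<^sub>R f x) = (\<lambda>x. indicator {0<..} x *\<^sub>R f x)"
    using assms(2) by (auto simp: indicator_def fun_eq_iff not_less)
  ultimately show ?thesis by (simp only: set_integrable_def)
qed

lemma half_line_integral:
  fixes f g :: "real \<Rightarrow> real"
  assumes g: "continuous_on {0..} g" and eq: "\<And>x. x \<ge> 0 \<Longrightarrow> f x = g x"
  shows "(LINT x:{0..}|lebesgue. f x) = (LINT x:{0<..}|lborel. g x)"
proof -
  have "(LINT x:{0..}|lebesgue. f x) = (LINT x:{0..}|lborel. g x)"
    by (rule set_lebesgue_integral_lborel) (use eq continuous_indicator_measurable[OF g] in auto)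
  also have "\<dots> = (LINT x:{0<..}|lborel. g x)"
    by (rule lborel_integral_null_boundary[of 0]) (use continuous_indicator_measurable[OF g] in \<open>auto simp: indicator_def\<close>)
  finally show ?thesis .
qed

lemma conv_one_continuous':
  fixes f :: "real \<Rightarrow> real"
  assumes "continuous_on {0..} f" shows "continuous_on {0..} (conv (\<lambda>_. 1) f)"
  by (rule conv_continuous) (auto intro: continuous_locally_integrable[OF assms])

text \<open>The integrated equation is multiplied by the derivative of \<open>\<psi>\<close> and
  integrated. The constant produces \<open>- p0 * \<psi> 0\<close>, the convolution is integrated by
  parts.\<close>

lemma momentum_scalar:
  fixes p \<sigma> :: "real \<Rightarrow> real"
  assumes \<sigma>: "continuous_on {0..} \<sigma>" and p: "\<And>t. t \<ge> 0 \<Longrightarrow> p t = p0 - conv (\<lambda>_. 1) \<sigma> t"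
    and \<psi>: "\<psi> \<in> time_test_functions"
  shows "\<psi> 0 * p0 + (LINT t:{0..}|lebesgue. p t * time_deriv \<psi> t) = (LINT t:{0..}|lebesgue. \<sigma> t * \<psi> t)"
proof -
  obtain \<psi>' T where T: "T > 0" "\<And>t. t \<ge> 0 \<Longrightarrow> time_deriv \<psi> t = \<psi>' t" "continuous_on UNIV \<psi>'"
    "\<And>t. t \<ge> T \<Longrightarrow> \<psi> t = 0" "\<And>t. t \<ge> T \<Longrightarrow> \<psi>' t = 0" "continuous_on {0..} \<psi>"
    "\<And>t. t \<ge> 0 \<Longrightarrow> (\<psi> has_vector_derivative \<psi>' t) (at t within {0..})"
    using time_testE[OF \<psi>] by metis
  have c': "continuous_on {0..} \<psi>'" by (rule continuous_on_subset[OF T(3)]) simp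
  have cc: "continuous_on {0..} (conv (\<lambda>_. 1) \<sigma>)" by (rule conv_one_continuous'[OF \<sigma>])
  have "(LINT t:{0..}|lebesgue. p t * time_deriv \<psi> t) = (LINT t:{0<..}|lborel. p0 * \<psi>' t - \<psi>' t * conv (\<lambda>_. 1) \<sigma> t)"
    by (rule half_line_integral) (auto simp: p T(2) algebra_simps intro!: continuous_intros c' cc)
  also have "\<dots> = (LINT t:{0<..}|lborel. p0 * \<psi>' t) - (LINT t:{0<..}|lborel. \<psi>' t * conv (\<lambda>_. 1) \<sigma> t)"
    by (intro set_integral_diff(2) continuous_vanishing_integrable[of _ T] continuous_intros c' cc) (auto simp: T(5))
  also have "(LINT t:{0<..}|lborel. p0 * \<psi>' t) = p0 * (- \<psi> 0)"
  proof -
    have "(\<integral>t. indicator {0<..} t * \<psi>' t \<partial>lborel) = - \<psi> 0"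
      by (rule time_test_integral_tail[where T=T]) (use T in auto)
    then show ?thesis by (simp add: set_lebesgue_integral_def mult.left_commute[of _ p0])
  qed
  also have "(LINT t:{0<..}|lborel. \<psi>' t * conv (\<lambda>_. 1) \<sigma> t) = - (LINT t:{0<..}|lborel. \<psi> t * \<sigma> t)"
    by (rule integral_deriv_conv_one[where T=T]) (use T continuous_locally_integrable[OF \<sigma>] in auto)
  also have "(LINT t:{0<..}|lborel. \<psi> t * \<sigma> t) = (LINT t:{0..}|lebesgue. \<sigma> t * \<psi> t)"
    by (rule half_line_integral[symmetric]) (auto intro!: continuous_intros \<sigma> T(6))
  finally show ?thesis by simp
qed

lemma conv_integrable:
  fixes \<sigma> k :: "real \<Rightarrow> real"
  assumes \<sigma>: "continuous_on {0..} \<sigma>" and k: "\<And>T. set_integrable lborel {0<..<T} k"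
  shows "integrable lborel (\<lambda>s. indicator {0<..<t} s * (\<sigma> (t - s) * k s))"
proof -
  define \<tau> where "\<tau> x = \<sigma> (max 0 x)" for x
  have \<tau>c: "continuous_on UNIV \<tau>" unfolding \<tau>_def
    by (rule continuous_on_compose2[OF \<sigma>]) (auto intro!: continuous_intros)
  then have [measurable]: "\<tau> \<in> borel_measurable borel" by (rule borel_measurable_continuous_onI)
  have ki: "integrable lborel (\<lambda>s. indicator {0<..<t} s * k s)" using k[of t] by (simp add: set_integrable_def)
  then have [measurable]: "(\<lambda>s. indicator {0<..<t} s * k s) \<in> borel_measurable borel" by simp
  obtain B where B: "\<And>x. x \<in> {0..t} \<Longrightarrow> norm (\<tau> x) \<le> B"
    using compact_imp_bounded[OF compact_continuous_image[OF continuous_on_subset[OF \<tau>c] compact_Icc]]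
    by (force simp: bounded_iff)
  have "integrable lborel (\<lambda>s. \<tau> (t - s) * (indicator {0<..<t} s * k s))"
  proof (rule Bochner_Integration.integrable_bound)
    show "integrable lborel (\<lambda>s. B * (indicator {0<..<t} s * k s))" using ki by simp
    show "AE s in lborel. norm (\<tau> (t - s) * (indicator {0<..<t} s * k s)) \<le> norm (B * (indicator {0<..<t} s * k s))"
    proof (rule AE_I2)
      fix s
      show "norm (\<tau> (t - s) * (indicator {0<..<t} s * k s)) \<le> norm (B * (indicator {0<..<t} s * k s))"
        using B[of "t - s"] by (cases "0 < s \<and> s < t") (auto simp: abs_mult intro!: mult_right_mono)
    qed
  qed simp
  moreover have "\<tau> (t - s) * (indicator {0<..<t} s * k s) = indicator {0<..<t} s * (\<sigma> (t - s) * k s)" for s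
    by (auto simp: \<tau>_def indicator_def)
  ultimately show ?thesis by simp
qed

lemma conv_lincomb:
  fixes \<sigma> \<tau> k :: "real \<Rightarrow> real"
  assumes \<sigma>: "continuous_on {0..} \<sigma>" "continuous_on {0..} \<tau>" and k: "\<And>T. set_integrable lborel {0<..<T} k"
  shows "conv (\<lambda>t. r * \<sigma> t + q * \<tau> t) k t = r * conv \<sigma> k t + q * conv \<tau> k t"
proof -
  have "conv (\<lambda>t. r * \<sigma> t + q * \<tau> t) k t = (\<integral>s. r * (indicator {0<..<t} s * (\<sigma> (t - s) * k s)) + q * (indicator {0<..<t} s * (\<tau> (t - s) * k s)) \<partial>lborel)"
    unfolding conv_def set_lebesgue_integral_def
    by (intro Bochner_Integration.integral_cong) (auto simp: algebra_simps)
  also have "\<dots> = (\<integral>s. r * (indicator {0<..<t} s * (\<sigma> (t - s) * k s)) \<partial>lborel) + (\<integral>s. q * (indicator {0<..<t} s * (\<tau> (t - s) * k s)) \<partial>lborel)"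
    by (intro Bochner_Integration.integral_add integrable_mult_right conv_integrable assms)
  finally show ?thesis by (simp add: conv_def set_lebesgue_integral_def)
qed

lemma conv_one_lincomb:
  fixes \<sigma> \<tau> :: "real \<Rightarrow> real"
  assumes "\<And>T. set_integrable lborel {0<..<T} \<sigma>" "\<And>T. set_integrable lborel {0<..<T} \<tau>"
  shows "conv (\<lambda>_. 1) (\<lambda>t. r * \<sigma> t + q * \<tau> t) t = r * conv (\<lambda>_. 1) \<sigma> t + q * conv (\<lambda>_. 1) \<tau> t"
proof -
  have "conv (\<lambda>_. 1) (\<lambda>t. r * \<sigma> t + q * \<tau> t) t = (LINT s:{0<..<t}|lborel. r * \<sigma> s + q * \<tau> s)" by (simp add: conv_def)
  also have "\<dots> = (LINT s:{0<..<t}|lborel. r * \<sigma> s) + (LINT s:{0<..<t}|lborel. q * \<tau> s)"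
    by (intro set_integral_add(2) set_integrable_mult_right assms)
  finally show ?thesis by (simp add: conv_def)
qed

lemma conv_limit:
  fixes \<sigma> :: "nat \<Rightarrow> real \<Rightarrow> real"
  assumes \<sigma>: "\<And>n. continuous_on {0..} (\<sigma> n)" "continuous_on {0..} \<tau>" and k: "\<And>T. set_integrable lborel {0<..<T} k"
    and b: "\<And>n s. 0 \<le> s \<Longrightarrow> s \<le> t \<Longrightarrow> \<bar>\<sigma> n s\<bar> \<le> B" and l: "\<And>s. 0 \<le> s \<Longrightarrow> s \<le> t \<Longrightarrow> (\<lambda>n. \<sigma> n s) \<longlonglongrightarrow> \<tau> s"
  shows "(\<lambda>n. conv (\<sigma> n) k t) \<longlonglongrightarrow> conv \<tau> k t"
  unfolding conv_def set_lebesgue_integral_def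
proof (rule integral_dominated_convergence[where w="\<lambda>s. B * norm (indicator {0<..<t} s * k s)"])
  show "integrable lborel (\<lambda>s. B * norm (indicator {0<..<t} s * k s))"
    using k[of t] by (intro integrable_mult_right integrable_norm) (simp add: set_integrable_def)
  show "(\<lambda>s. indicator {0<..<t} s *\<^sub>R (\<tau> (t - s) * k s)) \<in> borel_measurable lborel"
    "(\<lambda>s. indicator {0<..<t} s *\<^sub>R (\<sigma> n (t - s) * k s)) \<in> borel_measurable lborel" for n
    using borel_measurable_integrable[OF conv_integrable[OF \<sigma>(2) k, where t=t]] borel_measurable_integrable[OF conv_integrable[OF \<sigma>(1)[of n] k, where t=t]] by simp_all
  show "AE s in lborel. (\<lambda>n. indicator {0<..<t} s *\<^sub>R (\<sigma> n (t - s) * k s)) \<longlonglongrightarrow> indicator {0<..<t} s *\<^sub>R (\<tau> (t - s) * k s)"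
  proof (rule AE_I2)
    fix s
    show "(\<lambda>n. indicator {0<..<t} s *\<^sub>R (\<sigma> n (t - s) * k s)) \<longlonglongrightarrow> indicator {0<..<t} s *\<^sub>R (\<tau> (t - s) * k s)"
    proof (cases "0 < s \<and> s < t")
      case True
      then have "(\<lambda>n. \<sigma> n (t - s)) \<longlonglongrightarrow> \<tau> (t - s)" by (intro l) auto
      then show ?thesis by (intro tendsto_intros)
    qed auto
  qed
  show "AE s in lborel. norm (indicator {0<..<t} s *\<^sub>R (\<sigma> n (t - s) * k s)) \<le> B * norm (indicator {0<..<t} s * k s)" for n
  proof (rule AE_I2)
    fix s
    show "norm (indicator {0<..<t} s *\<^sub>R (\<sigma> n (t - s) * k s)) \<le> B * norm (indicator {0<..<t} s * k s)"
      using b[of "t - s" n] by (cases "0 < s \<and> s < t") (auto simp: abs_mult intro!: mult_right_mono)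
  qed
qed

lemma conv_one_limit:
  fixes \<sigma> :: "nat \<Rightarrow> real \<Rightarrow> real"
  assumes \<sigma>: "\<And>n. continuous_on {0..} (\<sigma> n)" "continuous_on {0..} \<tau>"
    and b: "\<And>n s. 0 \<le> s \<Longrightarrow> s \<le> t \<Longrightarrow> \<bar>\<sigma> n s\<bar> \<le> B" and l: "\<And>s. 0 \<le> s \<Longrightarrow> s \<le> t \<Longrightarrow> (\<lambda>n. \<sigma> n s) \<longlonglongrightarrow> \<tau> s"
  shows "(\<lambda>n. conv (\<lambda>_. 1) (\<sigma> n) t) \<longlonglongrightarrow> conv (\<lambda>_. 1) \<tau> t"
proof -
  \<comment> \<open>Reflection of the interval moves the varying function into the first factor,
    where \<open>conv_limit\<close> applies.\<close>
  have flip: "conv (\<lambda>_. 1) f t = conv f (\<lambda>_. 1) t" for f :: "real \<Rightarrow> real"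
  proof -
    have "conv (\<lambda>_. 1) f t = (\<integral>s. indicator {0<..<t} (t + (-1) * s) *\<^sub>R (1 * f (t + (-1) * s)) \<partial>lborel)"
      unfolding conv_def set_lebesgue_integral_def by (subst lborel_integral_real_affine[of "-1" _ t]) auto
    also have "\<dots> = conv f (\<lambda>_. 1) t" unfolding conv_def set_lebesgue_integral_def
      by (intro Bochner_Integration.integral_cong) (auto simp: indicator_def)
    finally show ?thesis .
  qed
  have "set_integrable lborel {0<..<T} (\<lambda>_. 1::real)" for T :: real
    by (rule continuous_locally_integrable) simp
  then show ?thesis unfolding flip by (intro conv_limit[where B=B] \<sigma> b l)
qed

context frac_kernel begin

lemma kap_integrable: "p > 0 \<Longrightarrow> set_integrable lborel {0<..<T} (kap p)"
  by (rule has_laplace_locally_integrable[of _ "\<lambda>z. z powr - p"])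
    (use has_laplace_power[of p] in \<open>simp add: kap_def[abs_def]\<close>)

lemma kap_pos: "1 - (a - b) > 0" "b - 1 > 0" "2 - (a - b) > 0"
  using ab by auto

lemma conv_kap_continuous: "p > 0 \<Longrightarrow> continuous_on {0..} u \<Longrightarrow> continuous_on {0..} (conv u (kap p))"
  by (intro conv_continuous kap_integrable)

section \<open>Stability of the integrated constitutive equation\<close>

lemma volterra_lincomb:
  assumes v: "volterra s0 s u" "volterra s0' s' u'"
    and c: "continuous_on {0..} s" "continuous_on {0..} s'" "continuous_on {0..} u" "continuous_on {0..} u'"
  shows "volterra (r * s0 + q * s0') (\<lambda>t. r * s t + q * s' t) (\<lambda>t. r * u t + q * u' t)"
  unfolding volterra_def
proof (intro allI impI)
  fix t :: real assume t: "t \<ge> 0"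
  have 1: "conv (\<lambda>t. r * u t + q * u' t) (kap (b - 1)) = (\<lambda>t. r * conv u (kap (b - 1)) t + q * conv u' (kap (b - 1)) t)"
    by (rule ext) (intro conv_lincomb c kap_integrable kap_pos)
  have "conv (\<lambda>_. 1) (conv (\<lambda>t. r * u t + q * u' t) (kap (b - 1))) t
     = r * conv (\<lambda>_. 1) (conv u (kap (b - 1))) t + q * conv (\<lambda>_. 1) (conv u' (kap (b - 1))) t"
    unfolding 1 by (intro conv_one_lincomb continuous_locally_integrable conv_kap_continuous kap_pos c)
  moreover have "conv (\<lambda>t. r * s t + q * s' t) (kap (1 - (a - b))) t = r * conv s (kap (1 - (a - b))) t + q * conv s' (kap (1 - (a - b))) t"
    by (intro conv_lincomb c kap_integrable kap_pos)
  moreover have "conv (\<lambda>_. 1) (\<lambda>t. r * s t + q * s' t) t = r * conv (\<lambda>_. 1) s t + q * conv (\<lambda>_. 1) s' t"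
    by (intro conv_one_lincomb continuous_locally_integrable c)
  moreover have "conv s (kap (1 - (a - b))) t - s0 * kap (2 - (a - b)) t + conv (\<lambda>_. 1) s t = conv (\<lambda>_. 1) (conv u (kap (b - 1))) t"
    "conv s' (kap (1 - (a - b))) t - s0' * kap (2 - (a - b)) t + conv (\<lambda>_. 1) s' t = conv (\<lambda>_. 1) (conv u' (kap (b - 1))) t"
    using v t unfolding volterra_def by auto
  moreover have "(r * A1 + q * A2) - (r * s0 + q * s0') * k + (r * B1 + q * B2) = r * C1 + q * C2"
    if "A1 - s0 * k + B1 = C1" "A2 - s0' * k + B2 = C2" for A1 A2 B1 B2 C1 C2 k :: real
    unfolding that[symmetric] by (simp add: algebra_simps)
  ultimately show "conv (\<lambda>t. r * s t + q * s' t) (kap (1 - (a - b))) t - (r * s0 + q * s0') * kap (2 - (a - b)) t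
     + conv (\<lambda>_. 1) (\<lambda>t. r * s t + q * s' t) t = conv (\<lambda>_. 1) (conv (\<lambda>t. r * u t + q * u' t) (kap (b - 1))) t"
    by metis
qed

text \<open>Each term passes to the limit by dominated convergence. The nested convolution needs an
  intermediate bound, uniform in \<open>n\<close>, for the inner one: \<open>B\<close> times the
  integral of the kernel.\<close>

lemma volterra_limit:
  fixes s u :: "nat \<Rightarrow> real \<Rightarrow> real"
  assumes v: "\<And>n. volterra (s0 n) (s n) (u n)"
    and c: "\<And>n. continuous_on {0..} (s n)" "\<And>n. continuous_on {0..} (u n)" "continuous_on {0..} s'" "continuous_on {0..} u'"
    and b: "\<And>n t. t \<ge> 0 \<Longrightarrow> \<bar>s n t\<bar> \<le> B" "\<And>n t. t \<ge> 0 \<Longrightarrow> \<bar>u n t\<bar> \<le> B"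
    and l: "s0 \<longlonglongrightarrow> s0'" "\<And>t. t \<ge> 0 \<Longrightarrow> (\<lambda>n. s n t) \<longlonglongrightarrow> s' t" "\<And>t. t \<ge> 0 \<Longrightarrow> (\<lambda>n. u n t) \<longlonglongrightarrow> u' t"
  shows "volterra s0' s' u'"
  unfolding volterra_def
proof (intro allI impI)
  fix t :: real assume t: "t \<ge> 0"
  have L1: "(\<lambda>n. conv (s n) (kap (1 - (a - b))) t - s0 n * kap (2 - (a - b)) t + conv (\<lambda>_. 1) (s n) t) \<longlonglongrightarrow>
      conv s' (kap (1 - (a - b))) t - s0' * kap (2 - (a - b)) t + conv (\<lambda>_. 1) s' t"
    by (intro tendsto_intros conv_limit[where B=B] conv_one_limit[where B=B] kap_integrable kap_pos c b l) auto
  define I where "I = (\<integral>s. norm (indicator {0<..<t} s * kap (b - 1) s) \<partial>lborel)"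
  have ki: "integrable lborel (\<lambda>s. norm (indicator {0<..<t} s * kap (b - 1) s))"
    using kap_integrable[OF kap_pos(2), of t] by (intro integrable_norm) (simp add: set_integrable_def)
  have B0: "B \<ge> 0" using b(1)[of 0 0] by simp
  have bd: "\<bar>conv (u n) (kap (b - 1)) r\<bar> \<le> B * I" if r: "0 \<le> r" "r \<le> t" for n r
  proof -
    have "\<bar>conv (u n) (kap (b - 1)) r\<bar> \<le> (\<integral>s. B * norm (indicator {0<..<t} s * kap (b - 1) s) \<partial>lborel)"
      unfolding conv_def set_lebesgue_integral_def real_norm_def[symmetric]
    proof (rule Bochner_Integration.integral_norm_bound_integral)
      show "integrable lborel (\<lambda>s. indicator {0<..<r} s *\<^sub>R (u n (r - s) * kap (b - 1) s))"
        using conv_integrable[OF c(2)[of n] kap_integrable[OF kap_pos(2)], where t=r] by simp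
      show "integrable lborel (\<lambda>s. B * norm (indicator {0<..<t} s * kap (b - 1) s))" using ki by (intro integrable_mult_right)
      show "norm (indicator {0<..<r} s *\<^sub>R (u n (r - s) * kap (b - 1) s)) \<le> B * norm (indicator {0<..<t} s * kap (b - 1) s)" for s
        using b(2)[of "r - s" n] r B0 by (cases "0 < s \<and> s < r") (auto simp: abs_mult intro!: mult_right_mono)
    qed
    also have "\<dots> = B * I" unfolding I_def by (rule integral_mult_right_zero)
    finally show ?thesis .
  qed
  have L2: "(\<lambda>n. conv (\<lambda>_. 1) (conv (u n) (kap (b - 1))) t) \<longlonglongrightarrow> conv (\<lambda>_. 1) (conv u' (kap (b - 1))) t"
    by (rule conv_one_limit[where B="B * I"])
      (auto intro!: conv_kap_continuous kap_pos c bd conv_limit[where B=B] kap_integrable b l)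
  have eq: "conv (s n) (kap (1 - (a - b))) t - s0 n * kap (2 - (a - b)) t + conv (\<lambda>_. 1) (s n) t = conv (\<lambda>_. 1) (conv (u n) (kap (b - 1))) t" for n
    using v[of n] t unfolding volterra_def by blast
  show "conv s' (kap (1 - (a - b))) t - s0' * kap (2 - (a - b)) t + conv (\<lambda>_. 1) s' t = conv (\<lambda>_. 1) (conv u' (kap (b - 1))) t"
    by (rule LIMSEQ_unique[OF L1[unfolded eq] L2])
qed

text \<open>The recursion of the Gamma function. It identifies the data term of the integrated
  equation as a primitive of the fractional kernel.\<close>

lemma conv_one_kap: "t > 0 \<Longrightarrow> conv (\<lambda>_. 1) (kap (1 - (a - b))) t = kap (2 - (a - b)) t"
proof -
  assume t: "t > 0"
  have p: "1 - (a - b) > 0" by (rule kap_pos)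
  have "conv (\<lambda>_. 1) (kap (1 - (a - b))) t = (\<integral>s. (indicator {0<..<t} s * s powr ((1 - (a - b)) - 1)) / Gamma (1 - (a - b)) \<partial>lborel)"
    by (simp add: conv_def kap_def set_lebesgue_integral_def)
  also have "\<dots> = (t powr (1 - (a - b)) / (1 - (a - b))) / Gamma (1 - (a - b))"
    using integral_powr_interval[OF p t] by (simp only: integral_divide_zero has_bochner_integral_iff)
  also have "\<dots> = t powr (1 - (a - b)) / Gamma ((1 - (a - b)) + 1)"
    using p by (subst Gamma_plus1) (auto simp: nonpos_Ints_def)
  also have "(1 - (a - b)) + 1 = 2 - (a - b)" by simp
  also have "t powr (1 - (a - b)) / Gamma (2 - (a - b)) = kap (2 - (a - b)) t"
  proof -
    have "2 - (a - b) - 1 = 1 - (a - b)" by simp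
    then show ?thesis unfolding kap_def by metis
  qed
  finally show ?thesis .
qed

text \<open>The integrated equation is paired with the derivative of \<open>\<psi>\<close>. Three of
  its terms are primitives and are integrated by parts; the fourth is the memory term, whose double
  integral is the pairing with \<open>conv \<sigma> k\<close> after Fubini's theorem.\<close>

lemma constitutive_scalar:
  fixes \<sigma> \<mu> :: "real \<Rightarrow> real"
  assumes \<sigma>: "continuous_on {0..} \<sigma>" and \<mu>: "continuous_on {0..} \<mu>" and v: "volterra \<sigma>0 \<sigma> \<mu>"
    and \<psi>: "\<psi> \<in> time_test_functions" and \<alpha>: "\<alpha> = a - b" and \<beta>: "\<beta> = 2 - b"
  shows "- (LINT \<tau>:{0..}|lebesgue. \<psi> \<tau> / (Gamma (1 - \<alpha>) * \<tau> powr \<alpha>) * \<sigma>0)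
    - (LINT \<tau>:{0..}|lebesgue. (LINT t:{\<tau>..}|lebesgue. time_deriv \<psi> t / (Gamma (1 - \<alpha>) * \<tau> powr \<alpha>) * \<sigma> (t - \<tau>)))
    + (LINT t:{0..}|lebesgue. \<sigma> t * \<psi> t)
    = 1 / Gamma (1 - \<beta>) * (LINT t:{0..}|lebesgue. (LINT \<tau>:{0..t}|lebesgue. \<psi> t / (t - \<tau>) powr \<beta> * \<mu> \<tau>))"
proof -
  obtain \<psi>' T where T: "T > 0" "\<And>t. t \<ge> 0 \<Longrightarrow> time_deriv \<psi> t = \<psi>' t" "continuous_on UNIV \<psi>'"
    "\<And>t. t \<ge> T \<Longrightarrow> \<psi> t = 0" "\<And>t. t \<ge> T \<Longrightarrow> \<psi>' t = 0" "continuous_on {0..} \<psi>"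
    "\<And>t. t \<ge> 0 \<Longrightarrow> (\<psi> has_vector_derivative \<psi>' t) (at t within {0..})"
    using time_testE[OF \<psi>] by metis
  have ibp: "(LINT t:{0<..}|lborel. \<psi>' t * conv (\<lambda>_. 1) f t) = - (LINT t:{0<..}|lborel. \<psi> t * f t)"
    if "\<And>R. set_integrable lborel {0<..<R} f" for f
    by (rule integral_deriv_conv_one[where T=T]) (use T that in auto)
  have c': "continuous_on {0..} \<psi>'" by (rule continuous_on_subset[OF T(3)]) simp
  have [measurable]: "\<psi>' \<in> borel_measurable borel" using T(3) by (rule borel_measurable_continuous_onI)
  define k where "k = kap (1 - \<alpha>)"
  define h where "h = conv \<mu> (kap (1 - \<beta>))"
  have ki: "set_integrable lborel {0<..<R} k" for R unfolding k_def \<alpha> by (intro kap_integrable kap_pos)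
  have hc: "continuous_on {0..} h" unfolding h_def using conv_kap_continuous[OF kap_pos(2) \<mu>] by (simp add: \<beta>)
  have k_eq: "1 / (Gamma (1 - \<alpha>) * \<tau> powr \<alpha>) = k \<tau>" for \<tau>
    by (simp add: k_def kap_def powr_minus_divide)
  have km: "k \<in> borel_measurable borel" unfolding k_def kap_def by measurable
  note [measurable] = km
  have k_div: "x / (Gamma (1 - \<alpha>) * \<tau> powr \<alpha>) = x * k \<tau>" for x \<tau> by (simp flip: k_eq)
  define \<tau>\<sigma> where "\<tau>\<sigma> x = \<sigma> (max 0 x)" for x
  have \<sigma>c: "continuous_on UNIV \<tau>\<sigma>" unfolding \<tau>\<sigma>_def
    by (rule continuous_on_compose2[OF \<sigma>]) (auto intro!: continuous_intros)
  then have [measurable]: "\<tau>\<sigma> \<in> borel_measurable borel" by (rule borel_measurable_continuous_onI)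
  have I1: "(LINT \<tau>:{0..}|lebesgue. \<psi> \<tau> / (Gamma (1 - \<alpha>) * \<tau> powr \<alpha>) * \<sigma>0) = \<sigma>0 * (LINT t:{0<..}|lborel. \<psi> t * k t)"
  proof -
    have m: "(\<lambda>x. indicator {0..} x * (\<psi> x * k x * \<sigma>0)) \<in> borel_measurable borel"
    proof -
      have "(\<lambda>x. (indicator {0..} x * \<psi> x) * (k x * \<sigma>0)) \<in> borel_measurable borel"
        by (intro borel_measurable_times continuous_indicator_measurable T(6) km) auto
      then show ?thesis by (simp add: mult.assoc)
    qed
    have "(LINT \<tau>:{0..}|lebesgue. \<psi> \<tau> / (Gamma (1 - \<alpha>) * \<tau> powr \<alpha>) * \<sigma>0) = (LINT t:{0..}|lborel. \<psi> t * k t * \<sigma>0)"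
      by (rule set_lebesgue_integral_lborel[OF _ m]) (auto simp: k_div)
    also have "\<dots> = (LINT t:{0<..}|lborel. \<psi> t * k t * \<sigma>0)"
      by (rule lborel_integral_null_boundary[of 0, OF _ _ _ m]) (auto simp: indicator_def)
    finally show ?thesis by simp
  qed
  obtain B where B: "\<And>t. t \<in> {0..T} \<Longrightarrow> norm (\<psi>' t) \<le> B"
    using compact_imp_bounded[OF compact_continuous_image[OF continuous_on_subset[OF T(3)] compact_Icc[of 0 T]]] by (force simp: bounded_iff)
  obtain B' where B': "\<And>t. t \<in> {0..T} \<Longrightarrow> norm (\<tau>\<sigma> t) \<le> B'"
    using compact_imp_bounded[OF compact_continuous_image[OF continuous_on_subset[OF \<sigma>c] compact_Icc[of 0 T]]] by (force simp: bounded_iff)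
  define f where "f s = indicator {0<..<T} s * k s" for s
  define k1 where "k1 t = indicator {0..T} t * \<psi>' t" for t
  have [measurable]: "k1 \<in> borel_measurable borel" unfolding k1_def by measurable
  define G where "G s t = (if 0 < s \<and> s < t then k1 t * \<tau>\<sigma> (t - s) else 0)" for s t
  have Gm: "(\<lambda>(s, t). G s t) \<in> borel_measurable (lborel \<Otimes>\<^sub>M lborel)" unfolding G_def by measurable
  have fi: "integrable lborel f" using ki[of T] by (simp add: set_integrable_def f_def[abs_def])
  have swap: "(\<integral>t. (\<integral>s. f s * G s t \<partial>lborel) \<partial>lborel) = (\<integral>s. (\<integral>t. f s * G s t \<partial>lborel) \<partial>lborel)"
  proof (rule fubini_bounded[OF fi Gm])
    show "\<bar>G s t\<bar> \<le> (B * B') * indicator {0..T} t" for s t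
    proof (cases "0 < s \<and> s < t \<and> t \<le> T")
      case True
      then have "\<bar>\<psi>' t\<bar> * \<bar>\<tau>\<sigma> (t - s)\<bar> \<le> B * B'" using B[of t] B'[of "t - s"] by (intro mult_mono) auto
      then show ?thesis using True by (simp add: G_def k1_def abs_mult)
    next
      case False
      have "0 \<le> B * B'" using order_trans[OF norm_ge_zero B[of 0]] order_trans[OF norm_ge_zero B'[of 0]] T(1) by (intro mult_nonneg_nonneg) auto
      then show ?thesis using False by (auto simp: G_def k1_def indicator_def)
    qed
  qed
  have I2: "(LINT \<tau>:{0..}|lebesgue. (LINT t:{\<tau>..}|lebesgue. time_deriv \<psi> t / (Gamma (1 - \<alpha>) * \<tau> powr \<alpha>) * \<sigma> (t - \<tau>)))
      = (LINT t:{0<..}|lborel. \<psi>' t * conv \<sigma> k t)"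
  proof -
    define F where "F s = (\<integral>t. f s * G s t \<partial>lborel)" for s
    have Fm: "F \<in> borel_measurable borel"
    proof -
      have "(\<lambda>s. \<integral>t. (\<lambda>p. f (fst p) * (\<lambda>(s, t). G s t) p) (s, t) \<partial>lborel) \<in> borel_measurable lborel"
        using Gm fi by (intro lborel.borel_measurable_lebesgue_integral) (simp add: split_beta')
      then show ?thesis by (simp add: F_def[abs_def])
    qed
    have inner: "(LINT t:{s..}|lebesgue. time_deriv \<psi> t / (Gamma (1 - \<alpha>) * s powr \<alpha>) * \<sigma> (t - s)) = F s" if s: "s \<ge> 0" for s
    \<comment> \<open>At \<open>s = 0\<close> the quotient has denominator zero, hence value zero,
      in agreement with \<open>k 0 = 0\<close>.\<close>
    proof (cases "s = 0")
      case True
      have k0: "k 0 = 0" by (simp add: k_def kap_def)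
      show ?thesis by (simp add: True k_div k0 F_def G_def)
    next
      case False
      have m: "(\<lambda>t. indicator {s..} t * (\<psi>' t * k s * \<tau>\<sigma> (t - s))) \<in> borel_measurable borel" by measurable
      have "(LINT t:{s..}|lebesgue. time_deriv \<psi> t / (Gamma (1 - \<alpha>) * s powr \<alpha>) * \<sigma> (t - s)) = (LINT t:{s..}|lborel. \<psi>' t * k s * \<tau>\<sigma> (t - s))"
        by (rule set_lebesgue_integral_lborel[OF _ m]) (use s in \<open>auto simp: k_div T(2) \<tau>\<sigma>_def\<close>)
      also have "\<dots> = (LINT t:{s<..}|lborel. \<psi>' t * k s * \<tau>\<sigma> (t - s))"
        by (rule lborel_integral_null_boundary[of s, OF _ _ _ m]) (auto simp: indicator_def)
      also have "\<dots> = F s"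
        unfolding set_lebesgue_integral_def F_def
      proof (rule Bochner_Integration.integral_cong[OF refl])
        fix t
        show "indicator {s<..} t *\<^sub>R (\<psi>' t * k s * \<tau>\<sigma> (t - s)) = f s * G s t"
          using s False T(5)[of t] by (auto simp: f_def G_def k1_def indicator_def)
      qed
      finally show ?thesis .
    qed
    have m0: "(\<lambda>s. indicator {0..} s * F s) \<in> borel_measurable borel" using Fm by measurable
    have "(LINT \<tau>:{0..}|lebesgue. (LINT t:{\<tau>..}|lebesgue. time_deriv \<psi> t / (Gamma (1 - \<alpha>) * \<tau> powr \<alpha>) * \<sigma> (t - \<tau>))) = (LINT s:{0..}|lborel. F s)"
      by (rule set_lebesgue_integral_lborel[OF _ m0], simp, rule inner, simp)
    also have "\<dots> = (\<integral>s. F s \<partial>lborel)"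
      unfolding set_lebesgue_integral_def
      by (rule Bochner_Integration.integral_cong[OF refl]) (auto simp: F_def f_def indicator_def)
    also have "\<dots> = (\<integral>t. (\<integral>s. f s * G s t \<partial>lborel) \<partial>lborel)" unfolding F_def by (rule swap[symmetric])
    also have "\<dots> = (LINT t:{0<..}|lborel. \<psi>' t * conv \<sigma> k t)"
      unfolding set_lebesgue_integral_def
    proof (rule Bochner_Integration.integral_cong[OF refl])
      fix t
      show "(\<integral>s. f s * G s t \<partial>lborel) = indicator {0<..} t *\<^sub>R (\<psi>' t * conv \<sigma> k t)"
      proof (cases "0 < t \<and> t < T")
        case True
        have "\<psi>' t * conv \<sigma> k t = (\<integral>s. \<psi>' t * (indicator {0<..<t} s *\<^sub>R (\<sigma> (t - s) * k s)) \<partial>lborel)"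
          by (simp add: conv_def set_lebesgue_integral_def)
        also have "\<dots> = (\<integral>s. f s * G s t \<partial>lborel)"
          using True by (intro Bochner_Integration.integral_cong) (auto simp: f_def G_def k1_def \<tau>\<sigma>_def indicator_def)
        finally show ?thesis using True by simp
      next
        case False
        then have "(\<lambda>s. f s * G s t) = (\<lambda>s. 0)" using T(5)[of t] by (auto simp: f_def G_def k1_def indicator_def fun_eq_iff)
        then have "(\<integral>s. f s * G s t \<partial>lborel) = 0" by (simp only: integral_zero)
        moreover have "indicator {0<..} t *\<^sub>R (\<psi>' t * conv \<sigma> k t) = 0" using False T(5)[of t] by (auto simp: indicator_def)
        ultimately show ?thesis by simp
      qed
    qed
    finally show ?thesis .
  qed
  have I3: "(LINT t:{0..}|lebesgue. \<sigma> t * \<psi> t) = (LINT t:{0<..}|lborel. \<psi> t * \<sigma> t)"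
    by (rule half_line_integral) (auto intro!: continuous_intros \<sigma> T(6))
  have I4: "1 / Gamma (1 - \<beta>) * (LINT t:{0..}|lebesgue. (LINT \<tau>:{0..t}|lebesgue. \<psi> t / (t - \<tau>) powr \<beta> * \<mu> \<tau>)) = (LINT t:{0<..}|lborel. \<psi> t * h t)"
  proof -
    define \<mu>' where "\<mu>' x = \<mu> (max 0 x)" for x
    have "continuous_on UNIV \<mu>'" unfolding \<mu>'_def
      by (rule continuous_on_compose2[OF \<mu>]) (auto intro!: continuous_intros)
    then have [measurable]: "\<mu>' \<in> borel_measurable borel" by (rule borel_measurable_continuous_onI)
    have G0: "Gamma (1 - \<beta>) \<noteq> 0" using Gamma_real_pos[OF kap_pos(2)] by (simp add: \<beta>)
    have inner: "(LINT \<tau>:{0..t}|lebesgue. \<psi> t / (t - \<tau>) powr \<beta> * \<mu> \<tau>) = \<psi> t * (Gamma (1 - \<beta>) * h t)" if t: "t \<ge> 0" for t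
    proof -
      define g where "g \<tau> = \<psi> t * ((t - \<tau>) powr (- \<beta>) * \<mu>' \<tau>)" for \<tau>
      have gm: "g \<in> borel_measurable borel" unfolding g_def by measurable
      have m: "(\<lambda>\<tau>. indicator A \<tau> * g \<tau>) \<in> borel_measurable borel" if "A \<in> sets borel" for A
        using gm that by measurable
      have "(LINT \<tau>:{0..t}|lebesgue. \<psi> t / (t - \<tau>) powr \<beta> * \<mu> \<tau>) = (LINT \<tau>:{0..t}|lborel. g \<tau>)"
        by (rule set_lebesgue_integral_lborel[OF _ m]) (auto simp: g_def \<mu>'_def powr_minus_divide)
      also have "\<dots> = (LINT \<tau>:{0..<t}|lborel. g \<tau>)"
        by (rule lborel_integral_null_boundary[of t, OF _ _ _ m]) (auto simp: indicator_def)
      also have "\<dots> = (LINT \<tau>:{0<..<t}|lborel. g \<tau>)"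
        by (rule lborel_integral_null_boundary[of 0, OF _ _ _ m]) (auto simp: indicator_def)
      also have "\<dots> = (\<integral>s. indicator {0<..<t} (t + (-1) * s) *\<^sub>R g (t + (-1) * s) \<partial>lborel)"
        unfolding set_lebesgue_integral_def by (subst lborel_integral_real_affine[of "-1" _ t]) auto
      also have "\<dots> = (\<integral>s. (\<psi> t * Gamma (1 - \<beta>)) * (indicator {0<..<t} s *\<^sub>R (\<mu> (t - s) * kap (1 - \<beta>) s)) \<partial>lborel)"
        using G0 by (intro Bochner_Integration.integral_cong) (auto simp: indicator_def g_def \<mu>'_def kap_def)
      also have "\<dots> = (\<psi> t * Gamma (1 - \<beta>)) * h t"
        unfolding h_def conv_def set_lebesgue_integral_def by (rule integral_mult_right_zero)
      finally show ?thesis by simp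
    qed
    have "(LINT t:{0..}|lebesgue. (LINT \<tau>:{0..t}|lebesgue. \<psi> t / (t - \<tau>) powr \<beta> * \<mu> \<tau>)) = (LINT t:{0<..}|lborel. \<psi> t * (Gamma (1 - \<beta>) * h t))"
      by (rule half_line_integral, intro continuous_intros T(6) hc, rule inner)
    also have "\<dots> = (LINT t:{0<..}|lborel. Gamma (1 - \<beta>) * (\<psi> t * h t))" by (simp add: mult.left_commute)
    finally show ?thesis using G0 by simp
  qed
  have cc: "continuous_on {0..} (conv (\<lambda>_. 1) k)" "continuous_on {0..} (conv (\<lambda>_. 1) \<sigma>)" "continuous_on {0..} (conv (\<lambda>_. 1) h)"
    by (rule conv_continuous; auto intro: ki continuous_locally_integrable \<sigma> hc)+
  \<comment> \<open>The integrated equation solved for its memory term, with the data term rewritten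
    as a primitive of \<open>k\<close>.\<close>
  have veq: "conv \<sigma> k t = \<sigma>0 * conv (\<lambda>_. 1) k t - conv (\<lambda>_. 1) \<sigma> t + conv (\<lambda>_. 1) h t" if "t > 0" for t
    using v conv_one_kap[OF that] that unfolding volterra_def k_def h_def \<alpha> \<beta> by (auto dest!: spec[of _ t])
  have "(LINT t:{0<..}|lborel. \<psi>' t * conv \<sigma> k t)
    = (LINT t:{0<..}|lborel. (\<sigma>0 * (\<psi>' t * conv (\<lambda>_. 1) k t) - \<psi>' t * conv (\<lambda>_. 1) \<sigma> t) + \<psi>' t * conv (\<lambda>_. 1) h t)"
    by (rule set_lebesgue_integral_cong) (auto simp: veq algebra_simps)
  also have "\<dots> = (LINT t:{0<..}|lborel. \<sigma>0 * (\<psi>' t * conv (\<lambda>_. 1) k t) - \<psi>' t * conv (\<lambda>_. 1) \<sigma> t) + (LINT t:{0<..}|lborel. \<psi>' t * conv (\<lambda>_. 1) h t)"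
    by (intro set_integral_add(2) continuous_vanishing_integrable[of _ T] continuous_intros c' cc) (auto simp: T(5))
  also have "(LINT t:{0<..}|lborel. \<sigma>0 * (\<psi>' t * conv (\<lambda>_. 1) k t) - \<psi>' t * conv (\<lambda>_. 1) \<sigma> t)
    = (LINT t:{0<..}|lborel. \<sigma>0 * (\<psi>' t * conv (\<lambda>_. 1) k t)) - (LINT t:{0<..}|lborel. \<psi>' t * conv (\<lambda>_. 1) \<sigma> t)"
    by (intro set_integral_diff(2) continuous_vanishing_integrable[of _ T] continuous_intros c' cc) (auto simp: T(5))
  also have "(LINT t:{0<..}|lborel. \<sigma>0 * (\<psi>' t * conv (\<lambda>_. 1) k t)) = \<sigma>0 * (LINT t:{0<..}|lborel. \<psi>' t * conv (\<lambda>_. 1) k t)" by simp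
  finally have "(LINT t:{0<..}|lborel. \<psi>' t * conv \<sigma> k t) = \<sigma>0 * (- (LINT t:{0<..}|lborel. \<psi> t * k t)) - (- (LINT t:{0<..}|lborel. \<psi> t * \<sigma> t)) + (- (LINT t:{0<..}|lborel. \<psi> t * h t))"
    unfolding ibp[OF ki] ibp[OF continuous_locally_integrable[OF \<sigma>]] ibp[OF continuous_locally_integrable[OF hc]] .
  then show ?thesis unfolding I1 I2 I3 I4 by simp
qed
end


section \<open>Expansions along Stokes eigenfunctions\<close>

lemma expands_cong_AE:
  assumes f: "expands \<Omega> e c f" and ae: "AE x in lebesgue_on \<Omega>. f x = g x" and g: "g \<in> L2 \<Omega>" and e: "\<And>k. e k \<in> L2 \<Omega>"
  shows "expands \<Omega> e c g"
proof -
  have s: "(\<lambda>x. \<Sum>k<n. c k *\<^sub>R e k x) \<in> L2 \<Omega>" for n by (intro L2_sum L2_scale e) auto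
  have "L2_norm \<Omega> (\<lambda>x. f x - (\<Sum>k<n. c k *\<^sub>R e k x)) = L2_norm \<Omega> (\<lambda>x. g x - (\<Sum>k<n. c k *\<^sub>R e k x))" for n
    by (rule L2_norm_cong_AE) (use ae in \<open>auto intro!: L2_diff s g expands_L2[OF f]\<close>)
  then show ?thesis using f g by (simp add: expands_def)
qed

text \<open>One expression for all norms of a series: weight \<open>1\<close> for L2,
  \<open>sqrt (lam k)\<close> for \<open>V\<close>, and \<open>lam k powr (\<theta> / 2)\<close> for
  the spectral scales.\<close>

definition weighted_norm :: "(nat \<Rightarrow> real) \<Rightarrow> (nat \<Rightarrow> real) \<Rightarrow> real" where
  "weighted_norm p c = sqrt (\<Sum>k. (p k * c k)\<^sup>2)"

lemma weighted_square_le: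
  fixes x y B :: real
  assumes "\<bar>x\<bar> \<le> B * y" shows "x\<^sup>2 \<le> B\<^sup>2 * y\<^sup>2"
proof -
  have "\<bar>x\<bar> \<le> \<bar>B * y\<bar>" using assms by linarith
  then show ?thesis unfolding abs_le_square_iff by (simp add: power_mult_distrib)
qed

lemma weighted_summable:
  fixes p c D :: "nat \<Rightarrow> real"
  assumes "\<And>k. \<bar>p k * c k\<bar> \<le> B * D k" "summable (\<lambda>k. (D k)\<^sup>2)"
  shows "summable (\<lambda>k. (p k * c k)\<^sup>2)"
proof (rule summable_comparison_test')
  show "summable (\<lambda>k. B\<^sup>2 * (D k)\<^sup>2)" by (intro summable_mult assms)
  show "norm ((p n * c n)\<^sup>2) \<le> B\<^sup>2 * (D n)\<^sup>2" for n
    using weighted_square_le[OF assms(1)[of n]] by simp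
qed

lemma weighted_norm_le:
  fixes p c D :: "nat \<Rightarrow> real"
  assumes b: "\<And>k. \<bar>p k * c k\<bar> \<le> B * D k" and s: "summable (\<lambda>k. (D k)\<^sup>2)" and B: "B \<ge> 0"
  shows "weighted_norm p c \<le> B * sqrt (\<Sum>k. (D k)\<^sup>2)"
proof -
  have "(\<Sum>k. (p k * c k)\<^sup>2) \<le> (\<Sum>k. B\<^sup>2 * (D k)\<^sup>2)"
  proof (rule suminf_le[OF _ weighted_summable[OF b s] summable_mult[OF s]])
    show "(p n * c n)\<^sup>2 \<le> B\<^sup>2 * (D n)\<^sup>2" for n
      by (rule weighted_square_le[OF b])
  qed
  also have "\<dots> = B\<^sup>2 * (\<Sum>k. (D k)\<^sup>2)" by (rule suminf_mult[OF s])
  finally have "weighted_norm p c \<le> sqrt (B\<^sup>2 * (\<Sum>k. (D k)\<^sup>2))" unfolding weighted_norm_def by simp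
  then show ?thesis using B by (simp add: real_sqrt_mult)
qed

text \<open>Tannery's theorem: every coefficient is continuous, and the tails are controlled by the
  square summable \<open>D\<close>. The factor \<open>g\<close> need only be continuous on
  \<open>I\<close>, so it may blow up at an excluded endpoint.\<close>

lemma weighted_norm_tendsto:
  fixes p D :: "nat \<Rightarrow> real" and c :: "nat \<Rightarrow> real \<Rightarrow> real"
  assumes t: "t \<in> I" and c: "\<And>k. continuous_on I (c k)" and g: "continuous_on I g"
    and b: "\<And>k s. s \<in> I \<Longrightarrow> \<bar>p k * c k s\<bar> \<le> g s * D k" and D: "\<And>k. D k \<ge> 0" and s: "summable (\<lambda>k. (D k)\<^sup>2)"
  shows "((\<lambda>s. weighted_norm p (\<lambda>k. c k s - c k t)) \<longlongrightarrow> 0) (at t within I)"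
proof -
  define B where "B = \<bar>g t\<bar> + 1"
  have "(g \<longlongrightarrow> g t) (at t within I)" using g t by (auto simp: continuous_on_def)
  then have "\<forall>\<^sub>F s in at t within I. g s < B" by (rule order_tendstoD) (simp add: B_def)
  moreover have "\<forall>\<^sub>F s in at t within I. s \<in> I" by (simp add: eventually_at_filter)
  ultimately have ev: "\<forall>\<^sub>F s in at t within I. \<forall>k. norm ((p k * (c k s - c k t))\<^sup>2) \<le> (2 * B)\<^sup>2 * (D k)\<^sup>2"
  proof eventually_elim
    case (elim s)
    show ?case
    proof
      fix k
      have 1: "\<bar>p k * c k s\<bar> \<le> B * D k" using b[OF elim(2), of k] D[of k] elim(1) by (meson less_imp_le mult_right_mono order_trans)
      have "g t * D k \<le> B * D k" by (rule mult_right_mono) (auto simp: D B_def)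
      then have "\<bar>p k * c k t\<bar> \<le> B * D k" using b[OF t, of k] by linarith
      with 1 have "\<bar>p k * (c k s - c k t)\<bar> \<le> \<bar>2 * B * D k\<bar>" by (simp add: algebra_simps)
      then show "norm ((p k * (c k s - c k t))\<^sup>2) \<le> (2 * B)\<^sup>2 * (D k)\<^sup>2"
        unfolding abs_le_square_iff by (simp add: power_mult_distrib)
    qed
  qed
  have "((\<lambda>s. \<Sum>k. (p k * (c k s - c k t))\<^sup>2) \<longlongrightarrow> (\<Sum>k. 0)) (at t within I)"
  proof (cases "at t within I = bot")
    case False
    show ?thesis
    proof (rule tannerys_theorem[where M="\<lambda>k. (2 * B)\<^sup>2 * (D k)\<^sup>2", THEN conjunct2, THEN conjunct2])
      show "((\<lambda>s. (p k * (c k s - c k t))\<^sup>2) \<longlongrightarrow> 0) (at t within I)" for k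
      proof -
        have "(c k \<longlongrightarrow> c k t) (at t within I)" using c[of k] t by (auto simp: continuous_on_def)
        then have "((\<lambda>s. (p k * (c k s - c k t))\<^sup>2) \<longlongrightarrow> (p k * (c k t - c k t))\<^sup>2) (at t within I)" by (intro tendsto_intros)
        then show ?thesis by simp
      qed
      show "\<forall>\<^sub>F (k, s) in prod_filter at_top (at t within I). norm ((p k * (c k s - c k t))\<^sup>2) \<le> (2 * B)\<^sup>2 * (D k)\<^sup>2"
        using eventually_prodI[OF eventually_True[of at_top] ev] by (auto elim: eventually_mono)
      show "summable (\<lambda>k. (2 * B)\<^sup>2 * (D k)\<^sup>2)" by (intro summable_mult s)
    qed (use False in simp)
  qed simp
  then have "((\<lambda>s. sqrt (\<Sum>k. (p k * (c k s - c k t))\<^sup>2)) \<longlongrightarrow> sqrt (\<Sum>k. 0)) (at t within I)" by (rule tendsto_real_sqrt)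
  then show ?thesis by (simp add: weighted_norm_def)
qed

lemma continuous_intoI:
  assumes "\<And>t. t \<in> I \<Longrightarrow> f t \<in> X" "\<And>t. t \<in> I \<Longrightarrow> (h t \<longlongrightarrow> 0) (at t within I)"
    "\<And>s t. s \<in> I \<Longrightarrow> t \<in> I \<Longrightarrow> 0 \<le> N (f s - f t) \<and> N (f s - f t) \<le> h t s"
  shows "continuous_into I X N f"
  unfolding continuous_into_def
proof (intro ballI conjI assms(1))
  fix t assume t: "t \<in> I"
  have I: "\<forall>\<^sub>F s in at t within I. s \<in> I" by (simp add: eventually_at_filter)
  show "((\<lambda>s. N (f s - f t)) \<longlongrightarrow> 0) (at t within I)"
  proof (rule tendsto_sandwich[where f="\<lambda>_. 0" and h="h t"])
    show "\<forall>\<^sub>F s in at t within I. 0 \<le> N (f s - f t)" "\<forall>\<^sub>F s in at t within I. N (f s - f t) \<le> h t s"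
      using I by (eventually_elim, use assms(3) t in blast)+
  qed (use assms(2) t in auto)
qed

lemma continuous_into_subset:
  assumes "continuous_into I X N f" "J \<subseteq> I"
  shows "continuous_into J X N f"
  using assms unfolding continuous_into_def by (blast intro: tendsto_within_subset)

lemma continuous_into_inner:
  assumes f: "continuous_into I (L2 \<Omega>) (L2_norm \<Omega>) f" and g: "g \<in> L2 \<Omega>"
  shows "continuous_on I (\<lambda>t. L2_inner \<Omega> (f t) g)"
  unfolding continuous_on_def
proof
  fix t assume t: "t \<in> I"
  have fL: "f s \<in> L2 \<Omega>" if "s \<in> I" for s using f that by (auto simp: continuous_into_def)
  have l: "((\<lambda>s. L2_norm \<Omega> (f s - f t)) \<longlongrightarrow> 0) (at t within I)" using f t by (auto simp: continuous_into_def)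
  have I: "\<forall>\<^sub>F s in at t within I. s \<in> I" by (simp add: eventually_at_filter)
  have "((\<lambda>s. L2_inner \<Omega> (f s) g - L2_inner \<Omega> (f t) g) \<longlongrightarrow> 0) (at t within I)"
  proof (rule Lim_null_comparison)
    show "((\<lambda>s. L2_norm \<Omega> (f s - f t) * L2_norm \<Omega> g) \<longlongrightarrow> 0) (at t within I)" using tendsto_mult_left_zero[OF l] .
    show "\<forall>\<^sub>F s in at t within I. norm (L2_inner \<Omega> (f s) g - L2_inner \<Omega> (f t) g) \<le> L2_norm \<Omega> (f s - f t) * L2_norm \<Omega> g"
      using I
    proof eventually_elim
      case (elim s)
      have "L2_inner \<Omega> (f s) g - L2_inner \<Omega> (f t) g = L2_inner \<Omega> (\<lambda>x. f s x - f t x) g"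
        by (rule L2_inner_diff_left[symmetric]) (use fL elim t g in auto)
      moreover have "\<bar>L2_inner \<Omega> (\<lambda>x. f s x - f t x) g\<bar> \<le> L2_norm \<Omega> (\<lambda>x. f s x - f t x) * L2_norm \<Omega> g"
        by (rule L2_Cauchy_Schwarz) (use fL elim t g in \<open>auto intro: L2_diff\<close>)
      ultimately show ?case by (simp add: fun_diff_def)
    qed
  qed
  then show "((\<lambda>s. L2_inner \<Omega> (f s) g) \<longlongrightarrow> L2_inner \<Omega> (f t) g) (at t within I)" by (rule LIM_zero_cancel)
qed

context domain begin

lemma weak_gradient_diff:
  assumes f: "has_weak_gradient \<Omega> f F" and g: "has_weak_gradient \<Omega> g G"
  shows "has_weak_gradient \<Omega> (f - g) (\<lambda>x. F x - G x)"
  using weak_gradient_lincomb[OF f g, of 1 "-1"] by (simp add: fun_diff_def)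

lemma V_norm_diff_abs:
  assumes "f \<in> V_space \<Omega>" "g \<in> V_space \<Omega>"
  shows "\<bar>V_norm \<Omega> f - V_norm \<Omega> g\<bar> \<le> V_norm \<Omega> (f - g)"
proof -
  note w = V_weak_gradient[OF assms(1)] V_weak_gradient[OF assms(2)]
  show ?thesis unfolding V_norm_eq[OF w(1)] V_norm_eq[OF w(2)] V_norm_eq[OF weak_gradient_diff[OF w]]
    by (rule L2_norm_diff_abs) (use w weak_gradientD(2) in auto)
qed

lemma H1_norm_diff_abs:
  assumes f: "has_weak_gradient \<Omega> f F" and g: "has_weak_gradient \<Omega> g G"
  shows "\<bar>H1_norm \<Omega> f - H1_norm \<Omega> g\<bar> \<le> H1_norm \<Omega> (f - g)"
proof -
  note L = weak_gradientD(1,2)[OF f] weak_gradientD(1,2)[OF g]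
  \<comment> \<open>The norm of \<open>H1\<close> is the Euclidean norm of this pair, so the reverse
    triangle inequality is that of the plane.\<close>
  define p q where "p = (L2_norm \<Omega> f, L2_norm \<Omega> F)" and "q = (L2_norm \<Omega> g, L2_norm \<Omega> G)"
  have "\<bar>H1_norm \<Omega> f - H1_norm \<Omega> g\<bar> = \<bar>norm p - norm q\<bar>"
    by (simp add: H1_norm_eq[OF f] H1_norm_eq[OF g] p_def q_def norm_Pair)
  also have "\<dots> \<le> norm (p - q)" by (rule norm_triangle_ineq3)
  also have "\<dots> = sqrt (\<bar>L2_norm \<Omega> f - L2_norm \<Omega> g\<bar>\<^sup>2 + \<bar>L2_norm \<Omega> F - L2_norm \<Omega> G\<bar>\<^sup>2)"
    by (simp add: p_def q_def norm_Pair)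
  also have "\<dots> \<le> sqrt ((L2_norm \<Omega> (f - g))\<^sup>2 + (L2_norm \<Omega> (\<lambda>x. F x - G x))\<^sup>2)"
    unfolding fun_diff_def by (intro real_sqrt_le_mono add_mono power_mono L2_norm_diff_abs L) auto
  also have "\<dots> = H1_norm \<Omega> (f - g)" by (rule H1_norm_eq[OF weak_gradient_diff[OF f g], symmetric])
  finally show ?thesis .
qed

text \<open>A vector test function placed in row \<open>i\<close> of a matrix. The gradient and its
  transpose produce the two terms on the right of the constitutive equation: divergence times the
  component \<open>i\<close>, and the pairing with the derivative in direction
  \<open>i\<close>.\<close>

lemma weak_gradient_row:
  assumes w: "has_weak_gradient \<Omega> w G" and a: "a \<in> test_functions \<Omega>"
  shows "L2_inner \<Omega> G (\<lambda>x. axis i (a x)) = - L2_inner \<Omega> w (\<lambda>x. axis i (\<Sum>j\<in>UNIV. partial j a x $ j))"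
    and "L2_inner \<Omega> (\<lambda>x. transpose (G x)) (\<lambda>x. axis i (a x)) = - L2_inner \<Omega> w (partial i a)"
proof -
  define ac where "ac j x = a x $ j" for j x
  have ac: "ac j \<in> test_functions \<Omega>" for j unfolding ac_def[abs_def] by (rule component_test_function[OF a])
  have p: "partial l (ac j) x = partial l a x $ j" for l j x
    unfolding ac_def[abs_def] by (rule partial_component[OF test_functionsD(1)[OF a]])
  have wd: "L2_inner \<Omega> (\<lambda>x. axis i (axis l (ac j x))) G = - L2_inner \<Omega> (\<lambda>x. axis i (partial l (ac j) x)) w" for i l j
    using weak_gradientD(3)[OF w ac, of i l j] by (simp add: L2_inner_commute)
  note L = weak_gradientD(1,2)[OF w] test_L2[OF ac]
  have "L2_inner \<Omega> G (\<lambda>x. axis i (a x)) = L2_inner \<Omega> (\<lambda>x. \<Sum>j\<in>UNIV. axis i (axis j (ac j x))) G"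
  proof -
    have "axis i (a x) = (\<Sum>j\<in>UNIV. axis i (axis j (ac j x)))" for x
      by (simp add: vec_eq_iff axis_def ac_def)
    then show ?thesis by (simp only: L2_inner_commute)
  qed
  also have "\<dots> = (\<Sum>j\<in>UNIV. L2_inner \<Omega> (\<lambda>x. axis i (axis j (ac j x))) G)" by (rule L2_inner_sum_left) (auto intro: L)
  also have "\<dots> = - (\<Sum>j\<in>UNIV. L2_inner \<Omega> (\<lambda>x. axis i (partial j (ac j) x)) w)" by (simp add: wd sum_negf)
  also have "(\<Sum>j\<in>UNIV. L2_inner \<Omega> (\<lambda>x. axis i (partial j (ac j) x)) w) = L2_inner \<Omega> (\<lambda>x. \<Sum>j\<in>UNIV. axis i (partial j (ac j) x)) w"
    by (rule L2_inner_sum_left[symmetric]) (auto intro: L)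
  also have "(\<lambda>x. \<Sum>j\<in>UNIV. axis i (partial j (ac j) x)) = (\<lambda>x. axis i (\<Sum>j\<in>UNIV. partial j a x $ j))"
    by (rule ext) (simp add: vec_eq_iff axis_def p)
  finally show "L2_inner \<Omega> G (\<lambda>x. axis i (a x)) = - L2_inner \<Omega> w (\<lambda>x. axis i (\<Sum>j\<in>UNIV. partial j a x $ j))"
    by (simp only: L2_inner_commute)
  have "L2_inner \<Omega> (\<lambda>x. transpose (G x)) (\<lambda>x. axis i (a x)) = L2_inner \<Omega> (\<lambda>x. transpose (transpose (G x))) (\<lambda>x. transpose (axis i (a x)))"
    by (rule L2_inner_transpose[symmetric])
  also have "\<dots> = L2_inner \<Omega> (\<lambda>x. \<Sum>j\<in>UNIV. axis j (axis i (ac j x))) G"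
  proof -
    have "transpose (axis i (a x)) = (\<Sum>j\<in>UNIV. axis j (axis i (ac j x)))" for x
    proof -
      have "axis j (axis i (ac j x)) $ r $ q = (if r = j then (if q = i then a x $ j else 0) else 0)" for j r q
        by (simp add: axis_def ac_def)
      then have "(\<Sum>j\<in>UNIV. axis j (axis i (ac j x))) $ r $ q = transpose (axis i (a x)) $ r $ q" for r q
        by (simp add: transpose_def) (simp add: axis_def)
      then show ?thesis by (simp add: vec_eq_iff)
    qed
    then show ?thesis by (simp only: transpose_transpose L2_inner_commute)
  qed
  also have "\<dots> = (\<Sum>j\<in>UNIV. L2_inner \<Omega> (\<lambda>x. axis j (axis i (ac j x))) G)" by (rule L2_inner_sum_left) (auto intro: L)
  also have "\<dots> = - (\<Sum>j\<in>UNIV. L2_inner \<Omega> (\<lambda>x. axis j (partial i (ac j) x)) w)" by (simp add: wd sum_negf)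
  also have "(\<Sum>j\<in>UNIV. L2_inner \<Omega> (\<lambda>x. axis j (partial i (ac j) x)) w) = L2_inner \<Omega> (\<lambda>x. \<Sum>j\<in>UNIV. axis j (partial i (ac j) x)) w"
    by (rule L2_inner_sum_left[symmetric]) (auto intro: L)
  also have "(\<lambda>x. \<Sum>j\<in>UNIV. axis j (partial i (ac j) x)) = partial i a"
    by (rule ext) (simp add: vec_eq_iff axis_def p)
  finally show "L2_inner \<Omega> (\<lambda>x. transpose (G x)) (\<lambda>x. axis i (a x)) = - L2_inner \<Omega> w (partial i a)"
    by (simp only: L2_inner_commute)
qed

end

section \<open>Eigenfunction series for velocity and stress\<close>

locale stokes = domain +
  fixes lam :: "nat \<Rightarrow> real" and w :: "nat \<Rightarrow> vfield"
  assumes eigensystem: "stokes_eigensystem \<Omega> lam w"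
begin

abbreviation "eps \<equiv> stokes_eps \<Omega> lam w"

definition epsT :: "nat \<Rightarrow> mfield" where "epsT k x = transpose (eps k x)"

lemma lam_ge: "lam 0 \<le> lam k" and lam_pos: "lam k > 0"
proof -
  show "lam 0 \<le> lam k" using eigensystem by (simp add: stokes_eigensystem_def mono_def)
  then show "lam k > 0" using eigensystem by (simp add: stokes_eigensystem_def)
qed

lemma w_V: "w k \<in> V_space \<Omega>" using eigensystem by (simp add: stokes_eigensystem_def)

lemma w_weak_gradient: "has_weak_gradient \<Omega> (w k) (\<lambda>x. sqrt (lam k) *\<^sub>R eps k x)"
  using V_weak_gradient[OF w_V[of k]] lam_pos[of k] by (simp add: stokes_eps_def)

lemma eps_weak_gradient: "has_weak_gradient \<Omega> (\<lambda>x. (1 / sqrt (lam k)) *\<^sub>R w k x) (eps k)"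
  using weak_gradient_lincomb[OF V_weak_gradient[OF w_V[of k]] weak_gradient_zero, of "1 / sqrt (lam k)" 0]
  by (simp add: stokes_eps_def[abs_def])

lemma eps_L2: "eps k \<in> L2 \<Omega>" by (rule weak_gradientD(2)[OF eps_weak_gradient])

text \<open>The eigenvalue relation divided by \<open>sqrt (lam k)\<close>. It makes
  \<open>eps\<close> orthonormal and produces the factor \<open>sqrt (lam k)\<close> coupling the
  two scalar equations.\<close>

lemma inner_eps_wgrad:
  assumes "\<phi> \<in> V_space \<Omega>"
  shows "L2_inner \<Omega> (eps k) (wgrad \<Omega> \<phi>) = sqrt (lam k) * L2_inner \<Omega> (w k) \<phi>"
proof -
  have "L2_inner \<Omega> (wgrad \<Omega> (w k)) (wgrad \<Omega> \<phi>) = lam k * L2_inner \<Omega> (w k) \<phi>"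
    using eigensystem assms by (simp add: stokes_eigensystem_def V_inner_def)
  then show ?thesis unfolding stokes_eps_def L2_inner_scale_left
    using real_div_sqrt[of "lam k"] lam_pos[of k] by (simp add: field_simps)
qed

lemma orthonormal_w: "orthonormal \<Omega> w"
  using eigensystem weak_gradientD(1)[OF w_weak_gradient] by (simp add: orthonormal_def stokes_eigensystem_def)

lemma w_L2: "w k \<in> L2 \<Omega>" by (rule orthonormalD(1)[OF orthonormal_w])

lemma orthonormal_eps: "orthonormal \<Omega> eps"
  unfolding orthonormal_def
proof (intro conjI allI eps_L2)
  fix k l
  have "L2_inner \<Omega> (eps k) (eps l) = 1 / sqrt (lam l) * L2_inner \<Omega> (eps k) (wgrad \<Omega> (w l))"
    unfolding stokes_eps_def[of _ _ _ l] by (rule L2_inner_scale_right)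
  also have "\<dots> = 1 / sqrt (lam l) * (sqrt (lam k) * L2_inner \<Omega> (w k) (w l))" by (simp only: inner_eps_wgrad[OF w_V])
  finally show "L2_inner \<Omega> (eps k) (eps l) = (if k = l then 1 else 0)"
    using lam_pos[of k] by (simp add: orthonormalD(2)[OF orthonormal_w] less_imp_neq[OF lam_pos, symmetric])
qed

lemma orthonormal_epsT: "orthonormal \<Omega> epsT"
  unfolding orthonormal_def epsT_def[abs_def]
  by (simp add: L2_inner_transpose L2_transpose eps_L2 orthonormalD(2)[OF orthonormal_eps])

lemma epsT_L2: "epsT k \<in> L2 \<Omega>" by (rule orthonormalD(1)[OF orthonormal_epsT])

lemma epsT_wgrad_zero: "\<phi> \<in> V_space \<Omega> \<Longrightarrow> L2_inner \<Omega> (epsT k) (wgrad \<Omega> \<phi>) = 0"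
  unfolding epsT_def[abs_def]
  by (rule transpose_gradient_orthogonal[OF eps_weak_gradient])
    (use V_lincomb[OF w_V[of k] V_zero, of "1 / sqrt (lam k)" 0] in \<open>auto simp: V_space_def intro: V_weak_gradient[unfolded V_space_def]\<close>)

lemma epsT_eps_zero: "L2_inner \<Omega> (epsT k) (eps l) = 0"
  unfolding stokes_eps_def[of _ _ _ l] L2_inner_scale_right epsT_wgrad_zero[OF w_V] by simp

lemma V_subset_H: "f \<in> V_space \<Omega> \<Longrightarrow> f \<in> H_space \<Omega>"
proof -
  assume f: "f \<in> V_space \<Omega>"
  then have fL: "f \<in> L2 \<Omega>" by (blast intro: weak_gradientD(1) V_weak_gradient)
  have "(\<lambda>n::nat. L2_norm \<Omega> (f - f)) \<longlonglongrightarrow> 0"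
    by (simp add: fun_diff_def L2_norm_def L2_inner_def)
  with f fL show ?thesis unfolding H_space_def by auto
qed

lemma H_expands: "f \<in> H_space \<Omega> \<Longrightarrow> expands \<Omega> w (\<lambda>k. L2_inner \<Omega> f (w k)) f"
  using eigensystem by (auto simp: stokes_eigensystem_def expands_def H_space_def)

lemma partial_sum_weak_gradient:
  "has_weak_gradient \<Omega> (\<lambda>x. \<Sum>k<n. c k *\<^sub>R w k x) (\<lambda>x. \<Sum>k<n. (sqrt (lam k) * c k) *\<^sub>R eps k x)"
  using weak_gradient_sum[of "{..<n}" w, OF _ w_weak_gradient, where c=c] by (simp add: mult.commute)

text \<open>Bessel's inequality makes the series of gradients converge; closedness of the weak
  gradient identifies its sum. Thus gradients of fields in \<open>V\<close> lie in the closed span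
  of \<open>eps\<close>.\<close>

lemma expands_wgrad:
  assumes \<phi>: "\<phi> \<in> V_space \<Omega>"
  shows "expands \<Omega> eps (\<lambda>k. sqrt (lam k) * L2_inner \<Omega> \<phi> (w k)) (wgrad \<Omega> \<phi>)"
proof -
  note wg = V_weak_gradient[OF \<phi>]
  have c: "L2_inner \<Omega> (wgrad \<Omega> \<phi>) (eps k) = sqrt (lam k) * L2_inner \<Omega> \<phi> (w k)" for k
    using inner_eps_wgrad[OF \<phi>, of k] by (simp add: L2_inner_commute)
  have "summable (\<lambda>k. (sqrt (lam k) * L2_inner \<Omega> \<phi> (w k))\<^sup>2)"
    using bessel[OF orthonormal_eps weak_gradientD(2)[OF wg]] by (simp only: c)
  from expands_exists[OF finite_dom orthonormal_eps this]
  obtain G where G: "expands \<Omega> eps (\<lambda>k. sqrt (lam k) * L2_inner \<Omega> \<phi> (w k)) G" by auto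
  have "has_weak_gradient \<Omega> \<phi> G"
    by (rule weak_gradient_limit[OF partial_sum_weak_gradient expands_converges[OF w_L2 H_expands[OF V_subset_H[OF \<phi>]]] expands_converges[OF eps_L2 G]])
  from weak_gradient_unique[OF this wg] have "AE x in lebesgue_on \<Omega>. G x = wgrad \<Omega> \<phi> x" by simp
  from expands_cong_AE[OF G this weak_gradientD(2)[OF wg] eps_L2] show ?thesis .
qed

text \<open>The partial sums are in \<open>V\<close>, and summability makes their gradients converge
  as well, so the limit stays in \<open>V\<close>.\<close>

lemma expands_V:
  assumes f: "expands \<Omega> w c f" and s: "summable (\<lambda>k. (sqrt (lam k) * c k)\<^sup>2)"
  shows "f \<in> V_space \<Omega>" "V_norm \<Omega> f = weighted_norm (\<lambda>k. sqrt (lam k)) c"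
proof -
  obtain G where G: "expands \<Omega> eps (\<lambda>k. sqrt (lam k) * c k) G"
    using expands_exists[OF finite_dom orthonormal_eps s] by auto
  note l = expands_converges[OF w_L2 f] expands_converges[OF eps_L2 G]
  show "f \<in> V_space \<Omega>" by (rule V_limit[OF V_sum partial_sum_weak_gradient l]) (auto intro: w_V)
  have "has_weak_gradient \<Omega> f G" by (rule weak_gradient_limit[OF partial_sum_weak_gradient l])
  then have "V_norm \<Omega> f = L2_norm \<Omega> G" by (rule V_norm_eq)
  then show "V_norm \<Omega> f = weighted_norm (\<lambda>k. sqrt (lam k)) c"
    using sums_unique[OF expands_norm[OF orthonormal_eps G]] L2_norm_nonneg[of \<Omega> G] real_sqrt_abs[of "L2_norm \<Omega> G"] by (simp add: weighted_norm_def)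
qed

lemma expands_H:
  assumes f: "expands \<Omega> w c f"
  shows "f \<in> H_space \<Omega>" "div_free \<Omega> f"
proof -
  note l = expands_converges[OF w_L2 f]
  have V: "(\<lambda>x. \<Sum>k<n. c k *\<^sub>R w k x) \<in> V_space \<Omega>" for n by (rule V_sum) (auto intro: w_V)
  show "div_free \<Omega> f" by (rule div_free_limit[OF _ l]) (use V in \<open>auto simp: V_space_def\<close>)
  show "f \<in> H_space \<Omega>" using l V unfolding H_space_def converges_L2_def fun_diff_def
    by (auto intro!: exI[of _ "\<lambda>n x. \<Sum>k<n. c k *\<^sub>R w k x"])
qed

lemma expands_L2_norm:
  assumes "orthonormal \<Omega> e" "expands \<Omega> e c f"
  shows "L2_norm \<Omega> f = weighted_norm (\<lambda>_. 1) c"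
  using sums_unique[OF expands_norm[OF assms]] L2_norm_nonneg[of \<Omega> f] real_sqrt_abs[of "L2_norm \<Omega> f"] by (simp add: weighted_norm_def)

lemma powr_half_square: "lam k powr \<theta> * x\<^sup>2 = (lam k powr (\<theta> / 2) * x)\<^sup>2"
proof -
  have "lam k powr \<theta> = (lam k powr (\<theta> / 2))\<^sup>2" by (simp add: power2_eq_square flip: powr_add)
  then show ?thesis by (simp add: power_mult_distrib)
qed

lemma expands_H_scale:
  assumes f: "expands \<Omega> w c f"
  shows "f \<in> H_scale \<Omega> lam w \<theta> \<longleftrightarrow> summable (\<lambda>k. (lam k powr (\<theta> / 2) * c k)\<^sup>2)"
    "H_scale_norm \<Omega> lam w \<theta> f = weighted_norm (\<lambda>k. lam k powr (\<theta> / 2)) c"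
  using expands_H(1)[OF f] by (simp_all add: H_scale_def H_scale_norm_def expands_coeff[OF orthonormal_w f] powr_half_square weighted_norm_def)

text \<open>The projection is an arbitrary choice among representatives. Testing its defining
  property with itself and with \<open>g\<close> shows that every choice has the norm of
  \<open>g\<close>.\<close>

lemma Pi_proj_norm:
  assumes f: "expands \<Omega> eps c f" and g: "g \<in> orth_complement \<Omega> (range eps)"
  shows "L2_norm \<Omega> (Pi_proj \<Omega> lam w (\<lambda>x. f x + g x)) = L2_norm \<Omega> g"
proof -
  define M where "M = orth_complement \<Omega> (range eps)"
  define h where "h x = f x + g x" for x
  define p where "p = Pi_proj \<Omega> lam w h"
  have inL2: "q \<in> L2 \<Omega>" if "q \<in> M" for q using that by (simp add: M_def orth_complement_def)
  have gM: "g \<in> M" using g by (simp add: M_def)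
  note fL = expands_L2[OF f]
  have hL: "h \<in> L2 \<Omega>" unfolding h_def[abs_def] by (rule L2_add[OF fL inL2[OF gM]])
  have fq: "L2_inner \<Omega> f q = 0" if "q \<in> M" for q
  proof -
    have "L2_inner \<Omega> (eps k) q = 0" for k using that L2_inner_commute[of \<Omega> "eps k" q] by (simp add: M_def orth_complement_def)
    then show ?thesis using expands_inner[OF eps_L2 f inL2[OF that]] by (simp add: sums_iff)
  qed
  have "h - g = f" by (rule ext) (simp add: h_def)
  then have ex: "g \<in> M \<and> (\<forall>q\<in>M. L2_inner \<Omega> (h - g) q = 0)" using fq gM by simp
  have "p = (SOME g. g \<in> M \<and> (\<forall>q\<in>M. L2_inner \<Omega> (h - g) q = 0))"
    by (simp add: p_def Pi_proj_def orth_proj_def M_def)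
  then have pM: "p \<in> M" and p0: "\<And>q. q \<in> M \<Longrightarrow> L2_inner \<Omega> (h - p) q = 0"
    using someI[where P="\<lambda>g. g \<in> M \<and> (\<forall>q\<in>M. L2_inner \<Omega> (h - g) q = 0)", OF ex] by auto
  have pq: "L2_inner \<Omega> p q = L2_inner \<Omega> h q" if "q \<in> M" for q
    using p0[OF that] L2_inner_diff_left[OF hL inL2[OF pM] inL2[OF that]] by (simp add: fun_diff_def)
  have gq: "L2_inner \<Omega> g q = L2_inner \<Omega> h q" if "q \<in> M" for q
    using fq[OF that] L2_inner_add_left[OF fL inL2[OF gM] inL2[OF that]] by (simp add: h_def[abs_def])
  have "L2_inner \<Omega> p p = L2_inner \<Omega> g g"
    using pq[OF pM] pq[OF gM] gq[OF pM] gq[OF gM] by (simp add: L2_inner_commute)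
  then show ?thesis by (simp add: p_def h_def[abs_def] L2_norm_def)
qed

lemma expands_D_scale:
  assumes f: "expands \<Omega> eps c f" and g: "g \<in> orth_complement \<Omega> (range eps)"
  shows "(\<lambda>x. f x + g x) \<in> D_scale \<Omega> lam w \<theta> \<longleftrightarrow> summable (\<lambda>k. (lam k powr (\<theta> / 2) * c k)\<^sup>2)"
    "(D_scale_norm \<Omega> lam w \<theta> (\<lambda>x. f x + g x)) = sqrt ((\<Sum>k. (lam k powr (\<theta> / 2) * c k)\<^sup>2) + (L2_norm \<Omega> g)\<^sup>2)"
proof -
  have gL: "g \<in> L2 \<Omega>" using g by (simp add: orth_complement_def)
  have "L2_inner \<Omega> (\<lambda>x. f x + g x) (eps k) = c k" for k
    using L2_inner_add_left[OF expands_L2[OF f] gL eps_L2[of k]] g expands_coeff[OF orthonormal_eps f] by (simp add: orth_complement_def)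
  moreover have "(\<lambda>x. f x + g x) \<in> L2 \<Omega>" by (rule L2_add[OF expands_L2[OF f] gL])
  ultimately show "(\<lambda>x. f x + g x) \<in> D_scale \<Omega> lam w \<theta> \<longleftrightarrow> summable (\<lambda>k. (lam k powr (\<theta> / 2) * c k)\<^sup>2)"
    "(D_scale_norm \<Omega> lam w \<theta> (\<lambda>x. f x + g x)) = sqrt ((\<Sum>k. (lam k powr (\<theta> / 2) * c k)\<^sup>2) + (L2_norm \<Omega> g)\<^sup>2)"
    by (simp_all add: D_scale_def D_scale_norm_def powr_half_square Pi_proj_norm[OF f g])
qed

lemma D_decompose:
  assumes h: "h \<in> L2 \<Omega>"
  obtains f g where "expands \<Omega> eps (\<lambda>k. L2_inner \<Omega> h (eps k)) f" "g \<in> orth_complement \<Omega> (range eps)" "h = (\<lambda>x. f x + g x)"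
proof -
  obtain f where f: "expands \<Omega> eps (\<lambda>k. L2_inner \<Omega> h (eps k)) f"
    using expands_exists[OF finite_dom orthonormal_eps bessel[OF orthonormal_eps h]] by auto
  define g where "g x = h x - f x" for x
  have "L2_inner \<Omega> g (eps k) = 0" for k
    unfolding g_def[abs_def] L2_inner_diff_left[OF h expands_L2[OF f] eps_L2] expands_coeff[OF orthonormal_eps f] by simp
  moreover have "g \<in> L2 \<Omega>" unfolding g_def[abs_def] by (rule L2_diff[OF h expands_L2[OF f]])
  ultimately have "g \<in> orth_complement \<Omega> (range eps)" by (auto simp: orth_complement_def)
  from that[OF f this] show ?thesis by (simp add: g_def fun_eq_iff)
qed

text \<open>The series of \<open>wgrad \<Omega> \<phi>\<close> along \<open>eps\<close> is tested
  termwise. The orthogonal part of the stress is therefore invisible in the momentum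
  equation.\<close>

lemma orth_complement_wgrad:
  assumes g: "g \<in> orth_complement \<Omega> (range eps)" and \<phi>: "\<phi> \<in> V_space \<Omega>"
  shows "L2_inner \<Omega> g (wgrad \<Omega> \<phi>) = 0"
proof -
  have gL: "g \<in> L2 \<Omega>" using g by (simp add: orth_complement_def)
  have "L2_inner \<Omega> (eps k) g = 0" for k using g L2_inner_commute[of \<Omega> "eps k" g] by (simp add: orth_complement_def)
  then show ?thesis
    using expands_inner[OF eps_L2 expands_wgrad[OF \<phi>] gL] by (simp add: sums_iff L2_inner_commute[of \<Omega> g])
qed

lemma epsT_orth_complement:
  assumes f: "expands \<Omega> epsT c f"
  shows "f \<in> orth_complement \<Omega> (range eps)"
  using expands_inner[OF epsT_L2 f eps_L2] expands_L2[OF f] by (auto simp: orth_complement_def epsT_eps_zero sums_iff)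

end

lemma weighted_norm_sq:
  assumes "summable (\<lambda>k. (p k * c k)\<^sup>2)"
  shows "(weighted_norm p c)\<^sup>2 = (\<Sum>k. (p k * c k)\<^sup>2)"
  unfolding weighted_norm_def by (intro real_sqrt_pow2 suminf_nonneg assms) simp

lemma weighted_norm_nonneg: "summable (\<lambda>k. (p k * c k)\<^sup>2) \<Longrightarrow> weighted_norm p c \<ge> 0"
  unfolding weighted_norm_def by (intro real_sqrt_ge_zero suminf_nonneg) auto

lemma orth_complement_lincomb:
  assumes "f \<in> orth_complement \<Omega> E" "g \<in> orth_complement \<Omega> E" "E \<subseteq> L2 \<Omega>"
  shows "(\<lambda>x. r *\<^sub>R f x + q *\<^sub>R g x) \<in> orth_complement \<Omega> E"
proof -
  have L: "f \<in> L2 \<Omega>" "g \<in> L2 \<Omega>" using assms by (auto simp: orth_complement_def)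
  have "L2_inner \<Omega> (\<lambda>x. r *\<^sub>R f x + q *\<^sub>R g x) e = 0" if "e \<in> E" for e
    using assms that L by (subst L2_inner_add_left) (auto simp: L2_inner_scale_left L2_scale orth_complement_def)
  with L show ?thesis by (auto simp: orth_complement_def intro!: L2_add L2_scale)
qed


section \<open>Assembling the solution\<close>

text \<open>\<open>c0\<close> and \<open>s0\<close> are the coefficients of the initial data on \<open>w\<close> and \<open>eps\<close>, \<open>P0\<close> is the component of the
  initial stress orthogonal to \<open>range eps\<close>, and \<open>U k\<close> and \<open>s k\<close> are the scalar solutions for \<open>lam k\<close>.\<close>

locale evolution = stokes + frac_kernel +
  fixes \<gamma> C CR :: real and R :: "real \<Rightarrow> real" and c0 s0 :: "nat \<Rightarrow> real" and P0 :: mfield and U s :: "nat \<Rightarrow> real \<Rightarrow> real"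
  assumes C: "C > 0" and gam: "\<gamma> \<ge> 0"
    and R: "continuous_on {0..} R" "volterra 1 R (\<lambda>_. 0)" "\<And>t. t \<ge> 0 \<Longrightarrow> \<bar>R t\<bar> \<le> CR"
    and P0: "P0 \<in> orth_complement \<Omega> (range eps)"
    and data: "summable (\<lambda>k. (lam k powr ((\<gamma> + om) / 2) * c0 k)\<^sup>2)" "summable (\<lambda>k. (lam k powr (\<gamma> / 2) * s0 k)\<^sup>2)"
    and U_cont: "\<And>k. continuous_on {0..} (U k)" and s_cont: "\<And>k. continuous_on {0..} (s k)"
    and U_eq: "\<And>k t. t \<ge> 0 \<Longrightarrow> U k t = c0 k - sqrt (lam k) * conv (\<lambda>_. 1) (s k) t"
    and s_eq: "\<And>k. volterra (s0 k) (s k) (\<lambda>t. sqrt (lam k) * U k t)"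
    and U_bound: "\<And>k t. t \<ge> 0 \<Longrightarrow> lam k powr (om / 2) * \<bar>U k t\<bar> \<le> C * (lam k powr (om / 2) * \<bar>c0 k\<bar> + \<bar>s0 k\<bar>)"
    and s_bound: "\<And>k t. t \<ge> 0 \<Longrightarrow> \<bar>s k t\<bar> \<le> C * (lam k powr (om / 2) * \<bar>c0 k\<bar> + \<bar>s0 k\<bar>)"
    and U_smoothing: "\<And>k t. t > 0 \<Longrightarrow> sqrt (lam k) * \<bar>U k t\<bar> \<le> C * (t powr (- (a / 2)) * (1 + t)) * (lam k powr (om / 2) * \<bar>c0 k\<bar> + \<bar>s0 k\<bar>)"
begin

text \<open>\<open>d\<close> is the size of the data of one scalar system and \<open>D\<close> the
  same with the weight of the scale. The square summable \<open>D\<close> dominates all coefficient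
  estimates; \<open>L\<close> is the price of dropping the weight, finite because the eigenvalues
  stay above \<open>lam 0\<close>.\<close>

definition "d k = lam k powr (om / 2) * \<bar>c0 k\<bar> + \<bar>s0 k\<bar>"
definition "D k = lam k powr (\<gamma> / 2) * d k"
definition "nD = sqrt (\<Sum>k. (D k)\<^sup>2)"
definition "L = lam 0 powr (- (\<gamma> / 2))"
definition "q k t = s k t - R t * s0 k"

section \<open>Weighted bounds for the coefficients\<close>

lemma CR_nonneg: "CR \<ge> 0" using R(3)[of 0] by simp

lemma L_pos: "L > 0" using lam_pos[of 0] by (simp add: L_def)

lemma d_nonneg: "d k \<ge> 0" by (simp add: d_def)
lemma D_nonneg: "D k \<ge> 0" by (simp add: D_def d_nonneg)

lemma D_square_le: "(D k)\<^sup>2 \<le> 2 * (lam k powr ((\<gamma> + om) / 2) * c0 k)\<^sup>2 + 2 * (lam k powr (\<gamma> / 2) * s0 k)\<^sup>2"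
proof -
  have "D k = \<bar>lam k powr ((\<gamma> + om) / 2) * c0 k\<bar> + \<bar>lam k powr (\<gamma> / 2) * s0 k\<bar>"
    by (simp add: D_def d_def abs_mult distrib_left add_divide_distrib powr_add mult.assoc)
  moreover have "(\<bar>x\<bar> + \<bar>y\<bar>)\<^sup>2 \<le> 2 * x\<^sup>2 + 2 * y\<^sup>2" for x y :: real
    using zero_le_power2[of "\<bar>x\<bar> - \<bar>y\<bar>"] by (simp add: power2_eq_square algebra_simps)
  ultimately show ?thesis by simp
qed

lemma D_summable: "summable (\<lambda>k. (D k)\<^sup>2)"
  by (rule summable_comparison_test'[of "\<lambda>k. 2 * (lam k powr ((\<gamma> + om) / 2) * c0 k)\<^sup>2 + 2 * (lam k powr (\<gamma> / 2) * s0 k)\<^sup>2"])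
    (use D_square_le in \<open>auto intro!: summable_add summable_mult data\<close>)

lemma nD_nonneg: "nD \<ge> 0"
  unfolding nD_def by (intro real_sqrt_ge_zero suminf_nonneg D_summable) simp

lemma nD_le: "nD \<le> 2 * (weighted_norm (\<lambda>k. lam k powr ((\<gamma> + om) / 2)) c0 + weighted_norm (\<lambda>k. lam k powr (\<gamma> / 2)) s0)"
  (is "_ \<le> 2 * (?X + ?Y)")
proof -
  note n = weighted_norm_nonneg[OF data(1)] weighted_norm_nonneg[OF data(2)]
  have "(\<Sum>k. (D k)\<^sup>2) \<le> (\<Sum>k. 2 * (lam k powr ((\<gamma> + om) / 2) * c0 k)\<^sup>2 + 2 * (lam k powr (\<gamma> / 2) * s0 k)\<^sup>2)"
    by (intro suminf_le D_square_le D_summable summable_add summable_mult data)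
  also have "\<dots> = 2 * ?X\<^sup>2 + 2 * ?Y\<^sup>2"
    unfolding weighted_norm_sq[OF data(1)] weighted_norm_sq[OF data(2)]
    by (simp only: suminf_add[OF summable_mult[OF data(1)] summable_mult[OF data(2)], symmetric] suminf_mult[OF data(1)] suminf_mult[OF data(2)])
  also have "\<dots> \<le> (2 * (?X + ?Y))\<^sup>2"
  proof -
    have "?X * ?Y \<ge> 0" using n by simp
    then show ?thesis by (simp add: power2_eq_square algebra_simps)
  qed
  finally have F: "(\<Sum>k. (D k)\<^sup>2) \<le> (2 * (?X + ?Y))\<^sup>2" .
  show ?thesis unfolding nD_def by (rule real_le_lsqrt[OF _ F]) (use n in simp)
qed

lemma d_le: "d k \<le> L * D k"
proof -
  have "lam 0 powr (\<gamma> / 2) \<le> lam k powr (\<gamma> / 2)"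
    by (intro powr_mono2) (use gam lam_ge[of k] lam_pos[of 0] in auto)
  then have "lam 0 powr (\<gamma> / 2) * d k \<le> D k" unfolding D_def by (intro mult_right_mono d_nonneg)
  then have "L * (lam 0 powr (\<gamma> / 2) * d k) \<le> L * D k" by (intro mult_left_mono) (use L_pos in auto)
  moreover have "L * (lam 0 powr (\<gamma> / 2) * d k) = d k"
    using lam_pos[of 0] by (simp add: L_def powr_minus field_simps)
  ultimately show ?thesis by simp
qed

lemma bound_trans: "x \<le> B * d k \<Longrightarrow> B \<ge> 0 \<Longrightarrow> x \<le> B * L * D k"
  using mult_left_mono[OF d_le[of k], of B] by (simp add: mult.assoc)

lemma U_H: "t \<ge> 0 \<Longrightarrow> \<bar>lam k powr ((\<gamma> + om) / 2) * U k t\<bar> \<le> C * D k"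
  using mult_left_mono[OF U_bound[of t k], of "lam k powr (\<gamma> / 2)"]
  by (simp add: D_def d_def abs_mult add_divide_distrib powr_add mult_ac)

lemma s_D: "t \<ge> 0 \<Longrightarrow> \<bar>lam k powr (\<gamma> / 2) * s k t\<bar> \<le> C * D k"
  using mult_left_mono[OF s_bound[of t k], of "lam k powr (\<gamma> / 2)"]
  by (simp add: D_def d_def abs_mult mult_ac)

lemma s_L2: "t \<ge> 0 \<Longrightarrow> \<bar>1 * s k t\<bar> \<le> C * L * D k"
  using s_bound[of t k] C by (intro bound_trans) (auto simp: d_def)

lemma q_L2:
  assumes t: "t \<ge> 0" shows "\<bar>1 * q k t\<bar> \<le> (C + CR) * L * D k"
proof (rule bound_trans)
  have "\<bar>R t * s0 k\<bar> \<le> CR * d k"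
    unfolding abs_mult by (intro mult_mono R t CR_nonneg) (auto simp: d_def)
  then show "\<bar>1 * q k t\<bar> \<le> (C + CR) * d k"
    using s_bound[OF t, of k] unfolding q_def d_def[symmetric] distrib_right by (simp only: mult_1)
qed (use C CR_nonneg in auto)

text \<open>The scalar bound controls only the weighted velocity. As \<open>om \<ge> 0\<close>, the
  weight is removed by comparison with \<open>lam 0\<close>.\<close>

lemma U_L2:
  assumes t: "t \<ge> 0" shows "\<bar>1 * U k t\<bar> \<le> lam 0 powr (- (om / 2)) * C * L * D k"
proof (rule bound_trans)
  have "om \<ge> 0" using ab by (simp add: om_def)
  then have "lam 0 powr (om / 2) \<le> lam k powr (om / 2)" by (intro powr_mono2) (use lam_ge[of k] lam_pos[of 0] in auto)
  then have "lam 0 powr (om / 2) * \<bar>U k t\<bar> \<le> lam k powr (om / 2) * \<bar>U k t\<bar>" by (rule mult_right_mono) simp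
  then have "lam 0 powr (om / 2) * \<bar>U k t\<bar> \<le> C * d k" using U_bound[OF t, of k] by (simp add: d_def)
  then have "lam 0 powr (- (om / 2)) * (lam 0 powr (om / 2) * \<bar>U k t\<bar>) \<le> lam 0 powr (- (om / 2)) * (C * d k)" by (rule mult_left_mono) simp
  then show "\<bar>1 * U k t\<bar> \<le> lam 0 powr (- (om / 2)) * C * d k"
    using lam_pos[of 0] by (simp add: powr_minus field_simps)
qed (use C in auto)

lemma U_V: "t > 0 \<Longrightarrow> \<bar>sqrt (lam k) * U k t\<bar> \<le> C * (t powr (- (a / 2)) * (1 + t)) * L * D k"
  using U_smoothing[of t k] lam_pos[of k] C by (intro bound_trans) (auto simp: d_def abs_mult)

lemma q_cont: "continuous_on {0..} (q k)"
  unfolding q_def[abs_def] by (intro continuous_intros s_cont R)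

text \<open>\<open>Sp t\<close> is the component of \<open>S t\<close> orthogonal to \<open>range eps\<close>. The choices below are meaningful for \<open>t \<ge> 0\<close>
  only.\<close>

definition "u t = (SOME f. expands \<Omega> w (\<lambda>k. U k t) f)"
definition "Sg t = (SOME f. expands \<Omega> eps (\<lambda>k. s k t) f)"
definition "St t = (SOME f. expands \<Omega> epsT (\<lambda>k. q k t) f)"
definition "Sp t = (\<lambda>x. R t *\<^sub>R P0 x + St t x)"
definition "S t = (\<lambda>x. Sg t x + Sp t x)"

lemma u_expands: "t \<ge> 0 \<Longrightarrow> expands \<Omega> w (\<lambda>k. U k t) (u t)"
  unfolding u_def using weighted_summable[OF U_L2 D_summable]
  by (intro someI_ex[where P="expands \<Omega> w (\<lambda>k. U k t)"] expands_exists finite_dom orthonormal_w) simp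

lemma Sg_expands: "t \<ge> 0 \<Longrightarrow> expands \<Omega> eps (\<lambda>k. s k t) (Sg t)"
  unfolding Sg_def using weighted_summable[OF s_L2 D_summable]
  by (intro someI_ex[where P="expands \<Omega> eps (\<lambda>k. s k t)"] expands_exists finite_dom orthonormal_eps) simp

lemma St_expands: "t \<ge> 0 \<Longrightarrow> expands \<Omega> epsT (\<lambda>k. q k t) (St t)"
  unfolding St_def using weighted_summable[OF q_L2 D_summable]
  by (intro someI_ex[where P="expands \<Omega> epsT (\<lambda>k. q k t)"] expands_exists finite_dom orthonormal_epsT) simp

lemma P0_L2: "P0 \<in> L2 \<Omega>" using P0 by (simp add: orth_complement_def)

lemma Sp_orth: "t \<ge> 0 \<Longrightarrow> Sp t \<in> orth_complement \<Omega> (range eps)"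
  using orth_complement_lincomb[OF P0 epsT_orth_complement[OF St_expands[of t]], of "R t" 1] eps_L2 by (auto simp: Sp_def)

lemma Sp_L2: "t \<ge> 0 \<Longrightarrow> Sp t \<in> L2 \<Omega>" using Sp_orth by (simp add: orth_complement_def)

lemma S_L2: "t \<ge> 0 \<Longrightarrow> S t \<in> L2 \<Omega>" unfolding S_def by (intro L2_add expands_L2[OF Sg_expands] Sp_L2)

section \<open>Continuity in time of velocity and stress\<close>

lemma tendsto_weighted:
  fixes p :: "nat \<Rightarrow> real" and c :: "nat \<Rightarrow> real \<Rightarrow> real"
  assumes "t \<in> I" "\<And>k. continuous_on I (c k)" "\<And>k r. r \<in> I \<Longrightarrow> \<bar>p k * c k r\<bar> \<le> B * D k"
  shows "((\<lambda>r. weighted_norm p (\<lambda>k. c k r - c k t)) \<longlongrightarrow> 0) (at t within I)"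
  by (rule weighted_norm_tendsto[where g="\<lambda>_. B" and D=D]) (use assms D_nonneg D_summable in auto)

lemma diff_weighted_summable:
  assumes "\<And>k. \<bar>p k * x k\<bar> \<le> B * D k" "\<And>k. \<bar>p k * y k\<bar> \<le> B' * D k"
  shows "summable (\<lambda>k. (p k * (x k - y k))\<^sup>2)"
proof (rule weighted_summable[OF _ D_summable, where B="B + B'"])
  show "\<bar>p k * (x k - y k)\<bar> \<le> (B + B') * D k" for k
    using assms(1)[of k] assms(2)[of k] unfolding right_diff_distrib distrib_right by linarith
qed

lemma u_diff_expands: "r \<ge> 0 \<Longrightarrow> t \<ge> 0 \<Longrightarrow> expands \<Omega> w (\<lambda>k. U k r - U k t) (u r - u t)"
  unfolding fun_diff_def by (intro expands_diff w_L2 u_expands)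

lemma u_continuous_H: "continuous_into {0..} (H_scale \<Omega> lam w (\<gamma> + om)) (H_scale_norm \<Omega> lam w (\<gamma> + om)) u"
proof (rule continuous_intoI[where h="\<lambda>t r. weighted_norm (\<lambda>k. lam k powr ((\<gamma> + om) / 2)) (\<lambda>k. U k r - U k t)"])
  fix t :: real assume t: "t \<in> {0..}"
  show "u t \<in> H_scale \<Omega> lam w (\<gamma> + om)"
    unfolding expands_H_scale(1)[OF u_expands[OF t[unfolded atLeast_iff]]] by (rule weighted_summable[OF U_H D_summable]) (use t in auto)
  show "((\<lambda>r. weighted_norm (\<lambda>k. lam k powr ((\<gamma> + om) / 2)) (\<lambda>k. U k r - U k t)) \<longlongrightarrow> 0) (at t within {0..})"
    by (rule tendsto_weighted[where B=C, OF t U_cont U_H]) auto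
  fix r :: real assume r: "r \<in> {0..}"
  have "summable (\<lambda>k. (lam k powr ((\<gamma> + om) / 2) * (U k r - U k t))\<^sup>2)"
    by (rule diff_weighted_summable[OF U_H U_H]) (use r t in auto)
  then show "0 \<le> H_scale_norm \<Omega> lam w (\<gamma> + om) (u r - u t) \<and>
      H_scale_norm \<Omega> lam w (\<gamma> + om) (u r - u t) \<le> weighted_norm (\<lambda>k. lam k powr ((\<gamma> + om) / 2)) (\<lambda>k. U k r - U k t)"
    using expands_H_scale(2)[OF u_diff_expands[of r t]] r t weighted_norm_nonneg by auto
qed

lemma series_continuous_L2:
  assumes e: "orthonormal \<Omega> e" and Y: "\<And>t. t \<ge> 0 \<Longrightarrow> expands \<Omega> e (\<lambda>k. x k t) (Y t)"
    and x: "\<And>k. continuous_on {0..} (x k)" "\<And>k t. t \<ge> 0 \<Longrightarrow> \<bar>1 * x k t\<bar> \<le> B * D k"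
  shows "continuous_into {0..} (L2 \<Omega>) (L2_norm \<Omega>) Y"
proof (rule continuous_intoI[where h="\<lambda>t r. weighted_norm (\<lambda>_. 1) (\<lambda>k. x k r - x k t)"])
  fix t :: real assume t: "t \<in> {0..}"
  show "Y t \<in> L2 \<Omega>" by (rule expands_L2[OF Y]) (use t in auto)
  show "((\<lambda>r. weighted_norm (\<lambda>_. 1) (\<lambda>k. x k r - x k t)) \<longlongrightarrow> 0) (at t within {0..})"
    by (rule tendsto_weighted[OF t x(1), where B=B]) (use x(2) in auto)
  fix r :: real assume r: "r \<in> {0..}"
  have "expands \<Omega> e (\<lambda>k. x k r - x k t) (Y r - Y t)"
    unfolding fun_diff_def by (intro expands_diff orthonormalD(1)[OF e] Y) (use r t in auto)
  from expands_L2_norm[OF e this] L2_norm_nonneg[of \<Omega> "Y r - Y t"]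
  show "0 \<le> L2_norm \<Omega> (Y r - Y t) \<and> L2_norm \<Omega> (Y r - Y t) \<le> weighted_norm (\<lambda>_. 1) (\<lambda>k. x k r - x k t)" by simp
qed

lemma u_continuous_L2: "continuous_into {0..} (L2 \<Omega>) (L2_norm \<Omega>) u"
  by (rule series_continuous_L2[OF orthonormal_w u_expands U_cont U_L2])

lemma u_V: "t > 0 \<Longrightarrow> u t \<in> V_space \<Omega>"
  by (rule expands_V(1)[OF u_expands weighted_summable[OF U_V D_summable]]) auto

lemma u_V_norm: "t > 0 \<Longrightarrow> V_norm \<Omega> (u t) \<le> C * (t powr (- (a / 2)) * (1 + t)) * L * nD"
  unfolding expands_V(2)[OF u_expands[OF less_imp_le] weighted_summable[OF U_V D_summable]] nD_def
  by (rule weighted_norm_le[OF U_V D_summable]) (use C L_pos in auto)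

lemma u_diff_V_norm:
  assumes "r > 0" "t > 0"
  shows "V_norm \<Omega> (u r - u t) = weighted_norm (\<lambda>k. sqrt (lam k)) (\<lambda>k. U k r - U k t)"
  by (rule expands_V(2)[OF u_diff_expands diff_weighted_summable[OF U_V U_V]]) (use assms in auto)

text \<open>The smoothing bound blows up at zero, so only the version with a time-dependent factor
  applies, on the open half-line.\<close>

lemma u_V_tendsto:
  assumes t: "t \<in> {0<..}"
  shows "((\<lambda>r. weighted_norm (\<lambda>k. sqrt (lam k)) (\<lambda>k. U k r - U k t)) \<longlongrightarrow> 0) (at t within {0<..})"
proof (rule weighted_norm_tendsto[OF t _ _ _ D_nonneg D_summable])
  show "continuous_on {0<..} (U k)" for k by (rule continuous_on_subset[OF U_cont]) auto
  show "continuous_on {0<..} (\<lambda>t. C * (t powr (- (a / 2)) * (1 + t)) * L)" by (auto intro!: continuous_intros)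
  show "\<bar>sqrt (lam k) * U k r\<bar> \<le> C * (r powr (- (a / 2)) * (1 + r)) * L * D k" if "r \<in> {0<..}" for k r
    using U_V that by simp
qed

lemma u_continuous_V: "continuous_into {0<..} (V_space \<Omega>) (V_norm \<Omega>) u"
proof (rule continuous_intoI[OF _ u_V_tendsto])
  fix r t :: real assume rt: "r \<in> {0<..}" "t \<in> {0<..}"
  have "V_norm \<Omega> (u r - u t) \<ge> 0" unfolding V_norm_eq[OF V_weak_gradient[OF V_diff[OF u_V u_V]], of r t] using rt L2_norm_nonneg
    by (simp add: V_norm_eq[OF V_weak_gradient[OF V_diff[OF u_V u_V]]] L2_norm_nonneg)
  then show "0 \<le> V_norm \<Omega> (u r - u t) \<and> V_norm \<Omega> (u r - u t) \<le> weighted_norm (\<lambda>k. sqrt (lam k)) (\<lambda>k. U k r - U k t)"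
    using u_diff_V_norm rt by simp
qed (use u_V in auto)

lemma S_diff: "S r - S t = (\<lambda>x. (Sg r x - Sg t x) + ((R r - R t) *\<^sub>R P0 x + 1 *\<^sub>R (St r x - St t x)))"
  by (rule ext) (simp add: S_def Sp_def algebra_simps)

text \<open>One modulus for two norms: \<open>p\<close> is the weight of the scale for the
  \<open>D_scale\<close> norm and \<open>1\<close> for L2. The orthogonal component is measured in
  L2 in both cases.\<close>

definition "S_modulus p t r = weighted_norm p (\<lambda>k. s k r - s k t) + (\<bar>R r - R t\<bar> * L2_norm \<Omega> P0 + weighted_norm (\<lambda>_. 1) (\<lambda>k. q k r - q k t))"

lemma S_modulus_tendsto:
  assumes t: "t \<in> {0..}" and b: "\<And>k t. t \<ge> 0 \<Longrightarrow> \<bar>p k * s k t\<bar> \<le> B * D k"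
  shows "(S_modulus p t \<longlongrightarrow> 0) (at t within {0..})"
proof -
  have "(R \<longlongrightarrow> R t) (at t within {0..})" using R(1) t by (auto simp: continuous_on_def)
  then have "((\<lambda>r. \<bar>R r - R t\<bar> * L2_norm \<Omega> P0) \<longlongrightarrow> \<bar>R t - R t\<bar> * L2_norm \<Omega> P0) (at t within {0..})" by (intro tendsto_intros)
  moreover have "((\<lambda>r. weighted_norm p (\<lambda>k. s k r - s k t)) \<longlongrightarrow> 0) (at t within {0..})"
    by (rule tendsto_weighted[OF t s_cont, where B=B]) (use b in auto)
  moreover have "((\<lambda>r. weighted_norm (\<lambda>_. 1) (\<lambda>k. q k r - q k t)) \<longlongrightarrow> 0) (at t within {0..})"
    by (rule tendsto_weighted[OF t q_cont q_L2]) auto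
  ultimately have "(S_modulus p t \<longlongrightarrow> 0 + (\<bar>R t - R t\<bar> * L2_norm \<Omega> P0 + 0)) (at t within {0..})"
    unfolding S_modulus_def[abs_def] by (intro tendsto_add)
  then show ?thesis by simp
qed

lemma S_orth_diff:
  assumes "r \<ge> 0" "t \<ge> 0"
  defines "g \<equiv> \<lambda>x. (R r - R t) *\<^sub>R P0 x + 1 *\<^sub>R (St r x - St t x)"
  shows "g \<in> orth_complement \<Omega> (range eps)"
    "L2_norm \<Omega> g \<le> \<bar>R r - R t\<bar> * L2_norm \<Omega> P0 + weighted_norm (\<lambda>_. 1) (\<lambda>k. q k r - q k t)"
proof -
  have e: "expands \<Omega> epsT (\<lambda>k. q k r - q k t) (\<lambda>x. St r x - St t x)"
    by (intro expands_diff epsT_L2 St_expands assms)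
  show "g \<in> orth_complement \<Omega> (range eps)"
    unfolding g_def by (rule orth_complement_lincomb[OF P0 epsT_orth_complement[OF e]]) (use eps_L2 in auto)
  have "L2_norm \<Omega> g \<le> L2_norm \<Omega> (\<lambda>x. (R r - R t) *\<^sub>R P0 x) + L2_norm \<Omega> (\<lambda>x. St r x - St t x)"
    unfolding g_def scaleR_one by (intro L2_norm_triangle L2_scale P0_L2 expands_L2[OF e])
  then show "L2_norm \<Omega> g \<le> \<bar>R r - R t\<bar> * L2_norm \<Omega> P0 + weighted_norm (\<lambda>_. 1) (\<lambda>k. q k r - q k t)"
    by (simp add: L2_norm_scale expands_L2_norm[OF orthonormal_epsT e])
qed

lemma S_continuous_D: "continuous_into {0..} (D_scale \<Omega> lam w \<gamma>) (D_scale_norm \<Omega> lam w \<gamma>) S"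
proof (rule continuous_intoI[where h="S_modulus (\<lambda>k. lam k powr (\<gamma> / 2))"])
  fix t :: real assume t: "t \<in> {0..}"
  show "S t \<in> D_scale \<Omega> lam w \<gamma>"
    unfolding S_def by (subst expands_D_scale(1)[OF Sg_expands Sp_orth]) (use t in \<open>auto intro!: weighted_summable[OF s_D D_summable]\<close>)
  show "(S_modulus (\<lambda>k. lam k powr (\<gamma> / 2)) t \<longlongrightarrow> 0) (at t within {0..})"
    by (rule S_modulus_tendsto[OF t s_D])
  fix r :: real assume r: "r \<in> {0..}"
  note e = expands_diff[OF eps_L2 Sg_expands Sg_expands, of r t]
  note o = S_orth_diff[of r t]
  have sm: "summable (\<lambda>k. (lam k powr (\<gamma> / 2) * (s k r - s k t))\<^sup>2)"
    by (rule diff_weighted_summable[OF s_D s_D]) (use r t in auto)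
  show "0 \<le> D_scale_norm \<Omega> lam w \<gamma> (S r - S t) \<and> D_scale_norm \<Omega> lam w \<gamma> (S r - S t) \<le> S_modulus (\<lambda>k. lam k powr (\<gamma> / 2)) t r"
    unfolding S_diff using r t o
    by (subst (1 2) expands_D_scale(2)[OF e])
       (auto simp: S_modulus_def weighted_norm_sq[OF sm, symmetric] intro!: order_trans[OF sqrt_sum_squares_le_sum] weighted_norm_nonneg[OF sm] L2_norm_nonneg)
qed

lemma S_continuous_L2: "continuous_into {0..} (L2 \<Omega>) (L2_norm \<Omega>) S"
proof (rule continuous_intoI[where h="S_modulus (\<lambda>_. 1)"])
  fix t :: real assume t: "t \<in> {0..}"
  show "S t \<in> L2 \<Omega>" using t S_L2 by simp
  show "(S_modulus (\<lambda>_. 1) t \<longlongrightarrow> 0) (at t within {0..})"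
    by (rule S_modulus_tendsto[OF t s_L2])
  fix r :: real assume r: "r \<in> {0..}"
  have e: "expands \<Omega> eps (\<lambda>k. s k r - s k t) (\<lambda>x. Sg r x - Sg t x)"
    by (intro expands_diff eps_L2 Sg_expands) (use r t in auto)
  have o: "(\<lambda>x. (R r - R t) *\<^sub>R P0 x + 1 *\<^sub>R (St r x - St t x)) \<in> orth_complement \<Omega> (range eps)"
    by (rule S_orth_diff(1)) (use r t in auto)
  then have "(\<lambda>x. (R r - R t) *\<^sub>R P0 x + 1 *\<^sub>R (St r x - St t x)) \<in> L2 \<Omega>" by (simp add: orth_complement_def)
  from L2_norm_triangle[OF expands_L2[OF e] this] S_orth_diff(2)[of r t] r t
  show "0 \<le> L2_norm \<Omega> (S r - S t) \<and> L2_norm \<Omega> (S r - S t) \<le> S_modulus (\<lambda>_. 1) t r"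
    unfolding S_diff by (auto simp: L2_norm_nonneg S_modulus_def expands_L2_norm[OF orthonormal_eps e])
qed

text \<open>Each coefficient gains \<open>sqrt (lam k)\<close>, at least
  \<open>sqrt (lam 0)\<close>, in the norm of \<open>V\<close>; the inequality follows from the
  expansions of the field and its gradient.\<close>

lemma poincare:
  assumes f: "f \<in> V_space \<Omega>"
  shows "L2_norm \<Omega> f \<le> 1 / sqrt (lam 0) * V_norm \<Omega> f"
proof -
  define c where "c k = L2_inner \<Omega> f (w k)" for k
  note F = expands_wgrad[OF f, folded c_def] and f' = H_expands[OF V_subset_H[OF f], folded c_def[abs_def]]
  have sm: "summable (\<lambda>k. (\<bar>sqrt (lam k) * c k\<bar>)\<^sup>2)"
    using sums_summable[OF expands_norm[OF orthonormal_eps F]] by simp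
  have "weighted_norm (\<lambda>_. 1) c \<le> 1 / sqrt (lam 0) * sqrt (\<Sum>k. (\<bar>sqrt (lam k) * c k\<bar>)\<^sup>2)"
  proof (rule weighted_norm_le[OF _ sm])
    show "\<bar>1 * c k\<bar> \<le> 1 / sqrt (lam 0) * \<bar>sqrt (lam k) * c k\<bar>" for k
    proof -
      have "sqrt (lam 0) * \<bar>c k\<bar> \<le> sqrt (lam k) * \<bar>c k\<bar>"
        by (intro mult_right_mono) (use lam_ge in auto)
      then show ?thesis using lam_pos[of 0] lam_pos[of k] by (simp add: field_simps abs_mult)
    qed
  qed (use lam_pos[of 0] in simp)
  then show ?thesis
    using expands_V(2)[OF f'] sm by (simp add: expands_L2_norm[OF orthonormal_w f'] weighted_norm_def)
qed

lemma H1_norm_le_V_norm: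
  assumes f: "f \<in> V_space \<Omega>"
  shows "H1_norm \<Omega> f \<le> (1 + 1 / sqrt (lam 0)) * V_norm \<Omega> f"
  using H1_norm_bounds(3)[OF V_weak_gradient[OF f]] poincare[OF f] V_norm_eq[OF V_weak_gradient[OF f]] by (simp add: algebra_simps)

lemma u_continuous_H1: "continuous_into {0<..} (H10 \<Omega>) (H1_norm \<Omega>) u"
proof (rule continuous_intoI[where h="\<lambda>t r. (1 + 1 / sqrt (lam 0)) * weighted_norm (\<lambda>k. sqrt (lam k)) (\<lambda>k. U k r - U k t)"])
  fix r t :: real assume rt: "r \<in> {0<..}" "t \<in> {0<..}"
  show "((\<lambda>r. (1 + 1 / sqrt (lam 0)) * weighted_norm (\<lambda>k. sqrt (lam k)) (\<lambda>k. U k r - U k t)) \<longlongrightarrow> 0) (at t within {0<..})"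
    using tendsto_mult_left[OF u_V_tendsto[OF rt(2)], of "1 + 1 / sqrt (lam 0)"] by simp
  have V: "u r - u t \<in> V_space \<Omega>" using rt by (intro V_diff u_V) auto
  show "0 \<le> H1_norm \<Omega> (u r - u t) \<and> H1_norm \<Omega> (u r - u t) \<le> (1 + 1 / sqrt (lam 0)) * weighted_norm (\<lambda>k. sqrt (lam k)) (\<lambda>k. U k r - U k t)"
    using H1_norm_le_V_norm[OF V] u_diff_V_norm[of r t] rt order_trans[OF L2_norm_nonneg H1_norm_bounds(1)[OF V_weak_gradient[OF V]]] by simp
qed (use u_V in \<open>auto simp: V_space_def\<close>)

text \<open>The norm in \<open>V\<close> is bounded by a multiple of
  \<open>t powr (- (a / 2)) * (1 + t)\<close>, and \<open>p < 2 / a\<close> is the condition for its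
  \<open>p\<close>-th power to be integrable at zero.\<close>

lemma u_Lp_V:
  assumes p: "1 \<le> p" "p < 2 / a"
  shows "Lp_loc p (V_space \<Omega>) (V_norm \<Omega>) u"
proof (rule Lp_loc_continuous[OF u_continuous_V, where C="C * L * nD" and r="a / 2"])
  show "\<bar>V_norm \<Omega> g - V_norm \<Omega> h\<bar> \<le> V_norm \<Omega> (g - h)" if "g \<in> V_space \<Omega>" "h \<in> V_space \<Omega>" for g h
    by (rule V_norm_diff_abs[OF that])
  show "a / 2 * p < 1" using p ab by (simp add: field_simps)
  show "V_norm \<Omega> (u t) \<le> C * L * nD * (t powr - (a / 2) * (1 + t))" if "t > 0" for t
    using u_V_norm[OF that] by (simp add: mult_ac)
  show "0 \<le> V_norm \<Omega> g" if "g \<in> V_space \<Omega>" for g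
    using V_norm_eq[OF V_weak_gradient[OF that]] L2_norm_nonneg by simp
qed (use ab p in auto)

lemma u_L1_H1: "Lp_loc 1 (H10 \<Omega>) (H1_norm \<Omega>) u"
proof (rule Lp_loc_continuous[OF u_continuous_H1, where C="(1 + 1 / sqrt (lam 0)) * (C * L * nD)" and r="a / 2"])
  have H: "\<exists>G. has_weak_gradient \<Omega> g G" if "g \<in> H10 \<Omega>" for g using that by (auto simp: H10_def H1_def)
  show "0 \<le> H1_norm \<Omega> g" if "g \<in> H10 \<Omega>" for g
    using H[OF that] order_trans[OF L2_norm_nonneg H1_norm_bounds(1)] by blast
  show "\<bar>H1_norm \<Omega> g - H1_norm \<Omega> h\<bar> \<le> H1_norm \<Omega> (g - h)" if "g \<in> H10 \<Omega>" "h \<in> H10 \<Omega>" for g h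
    using H[OF that(1)] H[OF that(2)] H1_norm_diff_abs by blast
  show "H1_norm \<Omega> (u t) \<le> (1 + 1 / sqrt (lam 0)) * (C * L * nD) * (t powr - (a / 2) * (1 + t))" if "t > 0" for t
    using order_trans[OF H1_norm_le_V_norm[OF u_V[OF that]] mult_left_mono[OF u_V_norm[OF that]]] lam_pos[of 0] by (simp add: mult_ac)
qed (use ab in auto)

lemma S_L2_norm:
  assumes t: "t \<ge> 0"
  shows "L2_norm \<Omega> (Sp t) \<le> CR * L2_norm \<Omega> P0 + (C + CR) * L * nD" "L2_norm \<Omega> (Sg t) \<le> C * L * nD"
proof -
  have "L2_norm \<Omega> (St t) \<le> (C + CR) * L * nD"
    unfolding expands_L2_norm[OF orthonormal_epsT St_expands[OF t]] nD_def
    by (rule weighted_norm_le[OF q_L2[OF t] D_summable]) (use C L_pos CR_nonneg in auto)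
  moreover have "\<bar>R t\<bar> * L2_norm \<Omega> P0 \<le> CR * L2_norm \<Omega> P0"
    by (rule mult_right_mono[OF R(3)[OF t] L2_norm_nonneg])
  moreover have "L2_norm \<Omega> (Sp t) \<le> L2_norm \<Omega> (\<lambda>x. R t *\<^sub>R P0 x) + L2_norm \<Omega> (St t)"
    unfolding Sp_def by (intro L2_norm_triangle L2_scale P0_L2 expands_L2[OF St_expands[OF t]])
  ultimately show "L2_norm \<Omega> (Sp t) \<le> CR * L2_norm \<Omega> P0 + (C + CR) * L * nD"
    unfolding L2_norm_scale by linarith
  show "L2_norm \<Omega> (Sg t) \<le> C * L * nD"
    unfolding expands_L2_norm[OF orthonormal_eps Sg_expands[OF t]] nD_def
    by (rule weighted_norm_le[OF s_L2[OF t] D_summable]) (use C L_pos in auto)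
qed

lemma S_L1: "Lp_loc 1 (L2 \<Omega>) (L2_norm \<Omega>) S"
proof (rule Lp_loc_continuous[OF continuous_into_subset[OF S_continuous_L2], where C="C * L * nD + (CR * L2_norm \<Omega> P0 + (C + CR) * L * nD)" and r=0])
  show "\<bar>L2_norm \<Omega> g - L2_norm \<Omega> h\<bar> \<le> L2_norm \<Omega> (g - h)" if "g \<in> L2 \<Omega>" "h \<in> L2 \<Omega>" for g h :: mfield
    unfolding fun_diff_def by (rule L2_norm_diff_abs[OF that])
  fix t :: real assume t: "t > 0"
  have "L2_norm \<Omega> (S t) \<le> L2_norm \<Omega> (Sg t) + L2_norm \<Omega> (Sp t)"
    unfolding S_def by (intro L2_norm_triangle expands_L2[OF Sg_expands] Sp_L2) (use t in auto)
  also have "\<dots> \<le> C * L * nD + (CR * L2_norm \<Omega> P0 + (C + CR) * L * nD)"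
    using S_L2_norm[of t] t by simp
  finally have b: "L2_norm \<Omega> (S t) \<le> C * L * nD + (CR * L2_norm \<Omega> P0 + (C + CR) * L * nD)" (is "_ \<le> ?B") .
  have "?B * 1 \<le> ?B * (1 + t)" by (rule mult_left_mono) (use order_trans[OF L2_norm_nonneg b] t in auto)
  with b t show "L2_norm \<Omega> (S t) \<le> ?B * (t powr - 0 * (1 + t))" by simp
qed (auto simp: L2_norm_nonneg)

text \<open>A bound independent of the number of terms, as required for dominated convergence in
  time of the partial sums.\<close>

lemma partial_inner_bound:
  fixes c :: "nat \<Rightarrow> real"
  assumes e: "orthonormal \<Omega> e" and c: "\<And>k. \<bar>1 * c k\<bar> \<le> B * D k" and B: "B \<ge> 0" and M: "M \<in> L2 \<Omega>"
  shows "\<bar>\<Sum>k<n. c k * L2_inner \<Omega> (e k) M\<bar> \<le> B * nD * L2_norm \<Omega> M"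
proof -
  have "(\<Sum>k<n. (c k)\<^sup>2) \<le> (weighted_norm (\<lambda>_. 1) c)\<^sup>2"
    using weighted_norm_sq[OF weighted_summable[OF c D_summable]] weighted_summable[OF c D_summable] by (simp add: sum_le_suminf)
  then have "(L2_norm \<Omega> (\<lambda>x. \<Sum>k<n. c k *\<^sub>R e k x))\<^sup>2 \<le> (weighted_norm (\<lambda>_. 1) c)\<^sup>2"
    by (simp add: L2_norm_comb[OF e])
  then have "L2_norm \<Omega> (\<lambda>x. \<Sum>k<n. c k *\<^sub>R e k x) \<le> weighted_norm (\<lambda>_. 1) c"
    by (rule power2_le_imp_le) (rule weighted_norm_nonneg[OF weighted_summable[OF c D_summable]])
  also have "\<dots> \<le> B * nD" unfolding nD_def by (rule weighted_norm_le[OF c D_summable B])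
  finally have n: "L2_norm \<Omega> (\<lambda>x. \<Sum>k<n. c k *\<^sub>R e k x) \<le> B * nD" .
  have "(\<Sum>k<n. c k * L2_inner \<Omega> (e k) M) = L2_inner \<Omega> (\<lambda>x. \<Sum>k<n. c k *\<^sub>R e k x) M"
    by (rule L2_inner_comb_left[symmetric]) (use orthonormalD(1)[OF e] M in auto)
  also have "\<bar>\<dots>\<bar> \<le> L2_norm \<Omega> (\<lambda>x. \<Sum>k<n. c k *\<^sub>R e k x) * L2_norm \<Omega> M"
    by (rule L2_Cauchy_Schwarz[OF L2_comb[OF e] M]) simp
  also have "\<dots> \<le> B * nD * L2_norm \<Omega> M" by (rule mult_right_mono[OF n L2_norm_nonneg])
  finally show ?thesis .
qed

text \<open>Finite sums satisfy the integrated equation by linearity, and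
  \<open>volterra_limit\<close> removes the truncation. The assumption \<open>MN\<close> converts
  the sources of the scalar equations into the velocity tested against \<open>N\<close>, so one
  statement serves both \<open>eps\<close> and \<open>epsT\<close>.\<close>

lemma volterra_series:
  assumes e: "orthonormal \<Omega> e" and Y0: "expands \<Omega> e x0 Y0" and Y: "\<And>t. t \<ge> 0 \<Longrightarrow> expands \<Omega> e (\<lambda>k. x k t) (Y t)"
    and xc: "\<And>k. continuous_on {0..} (x k)" and v: "\<And>k. volterra (x0 k) (x k) (\<lambda>t. sqrt (lam k) * U k t)"
    and x: "\<And>k t. t \<ge> 0 \<Longrightarrow> \<bar>1 * x k t\<bar> \<le> B * D k" and B: "B \<ge> 0"
    and M: "M \<in> L2 \<Omega>" and N: "N \<in> L2 \<Omega>" and MN: "\<And>k. sqrt (lam k) * L2_inner \<Omega> (e k) M = - L2_inner \<Omega> (w k) N"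
  shows "volterra (L2_inner \<Omega> Y0 M) (\<lambda>t. L2_inner \<Omega> (Y t) M) (\<lambda>t. - L2_inner \<Omega> (u t) N)"
proof -
  note eL = orthonormalD(1)[OF e]
  have Yc: "continuous_on {0..} (\<lambda>t. L2_inner \<Omega> (Y t) M)"
    by (rule continuous_into_inner[OF series_continuous_L2[OF e Y xc x] M])
  define y0 where "y0 n = (\<Sum>k<n. x0 k * L2_inner \<Omega> (e k) M)" for n
  define y where "y n t = (\<Sum>k<n. x k t * L2_inner \<Omega> (e k) M)" for n t
  define z where "z n t = - (\<Sum>k<n. U k t * L2_inner \<Omega> (w k) N)" for n t
  have yc: "continuous_on {0..} (y n)" and zc: "continuous_on {0..} (z n)" for n
    unfolding y_def[abs_def] z_def[abs_def] by (intro continuous_intros xc U_cont)+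
  have vn: "volterra (y0 n) (y n) (z n)" for n
  proof (induction n)
    case 0
    then show ?case by (simp add: volterra_def y0_def y_def[abs_def] z_def[abs_def] conv_def)
  next
    \<comment> \<open>The new scalar equation is added with the coefficient of \<open>M\<close>
      along \<open>e n\<close> as its factor.\<close>
    case (Suc n)
    define m where "m = L2_inner \<Omega> (e n) M"
    have "volterra (1 * y0 n + m * x0 n) (\<lambda>t. 1 * y n t + m * x n t) (\<lambda>t. 1 * z n t + m * (sqrt (lam n) * U n t))"
      by (rule volterra_lincomb[OF Suc v yc xc zc]) (intro continuous_intros U_cont)
    moreover have "1 * z n t + m * (sqrt (lam n) * U n t) = z (Suc n) t" for t
    proof -
      have "m * (sqrt (lam n) * U n t) = U n t * (sqrt (lam n) * m)" by simp
      also have "\<dots> = - (U n t * L2_inner \<Omega> (w n) N)" unfolding m_def MN by simp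
      finally show ?thesis by (simp add: z_def)
    qed
    moreover have "1 * y0 n + m * x0 n = y0 (Suc n)" "\<And>t. 1 * y n t + m * x n t = y (Suc n) t"
      by (simp_all add: y0_def y_def m_def)
    ultimately have "volterra (y0 (Suc n)) (\<lambda>t. y (Suc n) t) (\<lambda>t. z (Suc n) t)" by (simp only:)
    then show ?case .
  qed
  define B1 where "B1 = lam 0 powr (- (om / 2)) * C * L"
  have B1: "B1 \<ge> 0" using C L_pos by (simp add: B1_def)
  have nn: "B * nD * L2_norm \<Omega> M \<ge> 0" "B1 * nD * L2_norm \<Omega> N \<ge> 0"
    using B B1 nD_nonneg L2_norm_nonneg[of \<Omega> M] L2_norm_nonneg[of \<Omega> N] by auto
  show ?thesis
  proof (rule volterra_limit[OF vn yc zc Yc, where B="B * nD * L2_norm \<Omega> M + B1 * nD * L2_norm \<Omega> N"])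
    show "continuous_on {0..} (\<lambda>t. - L2_inner \<Omega> (u t) N)"
      by (intro continuous_intros continuous_into_inner[OF u_continuous_L2 N])
    show "y0 \<longlonglongrightarrow> L2_inner \<Omega> Y0 M"
      using expands_inner[OF eL Y0 M] by (simp add: sums_def y0_def[abs_def])
    fix t :: real assume t: "t \<ge> 0"
    show "(\<lambda>n. y n t) \<longlonglongrightarrow> L2_inner \<Omega> (Y t) M"
      using expands_inner[OF eL Y[OF t] M] by (simp add: sums_def y_def[abs_def])
    show "(\<lambda>n. z n t) \<longlonglongrightarrow> - L2_inner \<Omega> (u t) N"
      using tendsto_minus[OF expands_inner[OF w_L2 u_expands[OF t] N, unfolded sums_def]] by (simp add: z_def[abs_def])
    fix n
    show "\<bar>y n t\<bar> \<le> B * nD * L2_norm \<Omega> M + B1 * nD * L2_norm \<Omega> N"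
      using partial_inner_bound[where c="\<lambda>k. x k t", OF e x[OF t] B M, of n] nn unfolding y_def by linarith
    show "\<bar>z n t\<bar> \<le> B * nD * L2_norm \<Omega> M + B1 * nD * L2_norm \<Omega> N"
      using partial_inner_bound[where c="\<lambda>k. U k t", OF orthonormal_w U_L2[OF t, folded B1_def] B1 N, of n] nn unfolding z_def abs_minus by linarith
  qed
qed

lemma volterra_cong:
  assumes v: "volterra y0 y z" and y: "\<And>t. t \<ge> 0 \<Longrightarrow> y' t = y t"
  shows "volterra y0 y' z"
proof -
  have "conv y' k t = conv y k t" "conv (\<lambda>_. 1) y' t = conv (\<lambda>_. 1) y t" for k t
    unfolding conv_def by (rule set_lebesgue_integral_cong; use y in force)+
  with v show ?thesis by (simp add: volterra_def)
qed

section \<open>The two weak equations for the assembled fields\<close>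

lemma conv_one_sum:
  "conv (\<lambda>_. 1) (\<lambda>t. \<Sum>k<n. s k t * m k) t = (\<Sum>k<n. conv (\<lambda>_. 1) (s k) t * m k)"
proof (induction n)
  case 0
  then show ?case by (simp add: conv_def)
next
  case (Suc n)
  have "conv (\<lambda>_. 1) (\<lambda>t. 1 * (\<Sum>k<n. s k t * m k) + m n * s n t) t = 1 * conv (\<lambda>_. 1) (\<lambda>t. \<Sum>k<n. s k t * m k) t + m n * conv (\<lambda>_. 1) (s n) t"
    by (intro conv_one_lincomb continuous_locally_integrable continuous_intros s_cont)
  with Suc show ?case by (simp add: mult.commute)
qed

text \<open>Only \<open>Sg\<close> is seen by a gradient of a field in \<open>V\<close>. Summing the
  scalar momentum equations against the coefficients of \<open>\<theta>\<close> gives the integrated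
  equation, to which \<open>momentum_scalar\<close> applies.\<close>

lemma momentum:
  assumes u0: "expands \<Omega> w c0 u0" and \<theta>: "\<theta> \<in> V_space \<Omega>" and \<psi>: "\<psi> \<in> time_test_functions"
  shows "momentum_equation \<Omega> u0 u S \<theta> \<psi>"
proof -
  have \<theta>L: "\<theta> \<in> L2 \<Omega>" by (rule weak_gradientD(1)[OF V_weak_gradient[OF \<theta>]])
  have GL: "wgrad \<Omega> \<theta> \<in> L2 \<Omega>" by (rule weak_gradientD(2)[OF V_weak_gradient[OF \<theta>]])
  define p where "p t = L2_inner \<Omega> (u t) \<theta>" for t
  define \<sigma> where "\<sigma> t = L2_inner \<Omega> (S t) (wgrad \<Omega> \<theta>)" for t
  define m where "m k = L2_inner \<Omega> (eps k) (wgrad \<Omega> \<theta>)" for k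
  have m: "m k = sqrt (lam k) * L2_inner \<Omega> (w k) \<theta>" for k unfolding m_def by (rule inner_eps_wgrad[OF \<theta>])
  have \<sigma>c: "continuous_on {0..} \<sigma>" unfolding \<sigma>_def[abs_def] by (rule continuous_into_inner[OF S_continuous_L2 GL])
  have \<sigma>g: "\<sigma> t = L2_inner \<Omega> (Sg t) (wgrad \<Omega> \<theta>)" if "t \<ge> 0" for t
    unfolding \<sigma>_def S_def L2_inner_add_left[OF expands_L2[OF Sg_expands[OF that]] Sp_L2[OF that] GL] orth_complement_wgrad[OF Sp_orth[OF that] \<theta>] by simp
  have \<sigma>s: "(\<lambda>n. \<Sum>k<n. s k t * m k) \<longlonglongrightarrow> \<sigma> t" if "t \<ge> 0" for t
    using expands_inner[OF eps_L2 Sg_expands[OF that] GL] by (simp add: sums_def \<sigma>g[OF that] m_def)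
  have eq: "p t = L2_inner \<Omega> u0 \<theta> - conv (\<lambda>_. 1) \<sigma> t" if t: "t \<ge> 0" for t
  proof (rule LIMSEQ_unique)
    show "(\<lambda>n. \<Sum>k<n. U k t * L2_inner \<Omega> (w k) \<theta>) \<longlonglongrightarrow> p t"
      using expands_inner[OF w_L2 u_expands[OF t] \<theta>L] by (simp add: sums_def p_def)
    have "(\<Sum>k<n. U k t * L2_inner \<Omega> (w k) \<theta>) = (\<Sum>k<n. c0 k * L2_inner \<Omega> (w k) \<theta>) - conv (\<lambda>_. 1) (\<lambda>t. \<Sum>k<n. s k t * m k) t" for n
      unfolding conv_one_sum sum_subtractf[symmetric] by (rule sum.cong[OF refl]) (simp add: U_eq[OF t] m algebra_simps)
    moreover have "(\<lambda>n. conv (\<lambda>_. 1) (\<lambda>t. \<Sum>k<n. s k t * m k) t) \<longlonglongrightarrow> conv (\<lambda>_. 1) \<sigma> t"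
    proof (rule conv_one_limit[OF _ \<sigma>c])
      show "continuous_on {0..} (\<lambda>t. \<Sum>k<n. s k t * m k)" for n by (intro continuous_intros s_cont)
      show "\<bar>\<Sum>k<n. s k r * m k\<bar> \<le> C * L * nD * L2_norm \<Omega> (wgrad \<Omega> \<theta>)" if "0 \<le> r" for n r
        unfolding m_def by (rule partial_inner_bound[where c="\<lambda>k. s k r", OF orthonormal_eps s_L2[OF that] _ GL]) (use C L_pos in auto)
    qed (rule \<sigma>s)
    ultimately show "(\<lambda>n. \<Sum>k<n. U k t * L2_inner \<Omega> (w k) \<theta>) \<longlonglongrightarrow> L2_inner \<Omega> u0 \<theta> - conv (\<lambda>_. 1) \<sigma> t"
      using expands_inner[OF w_L2 u0 \<theta>L] by (auto simp: sums_def intro!: tendsto_diff)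
  qed
  have 1: "(LINT x|lebesgue_on \<Omega>. (u t x \<bullet> \<theta> x) * r) = p t * r" for t r by (simp add: p_def L2_inner_def)
  have 2: "(LINT x|lebesgue_on \<Omega>. (S t x \<bullet> wgrad \<Omega> \<theta> x) * r) = \<sigma> t * r" for t r by (simp add: \<sigma>_def L2_inner_def)
  show ?thesis
    using momentum_scalar[OF \<sigma>c eq \<psi>] unfolding momentum_equation_def 1 2 L2_inner_def .
qed

text \<open>The stress splits into \<open>Sg\<close>, driven by the plain gradient with data
  \<open>S00\<close>; \<open>St\<close>, driven by the transposed gradient with zero data; and the
  freely relaxing multiple of \<open>P0\<close>. Each satisfies an integrated equation, and the
  equations add up.\<close>

lemma constitutive:
  assumes S0: "expands \<Omega> eps s0 S00" and v: "v \<in> test_functions \<Omega>" and \<psi>: "\<psi> \<in> time_test_functions"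
  shows "constitutive_equation \<Omega> (a - b) (2 - b) (\<lambda>x. S00 x + P0 x) u S v \<psi> i"
proof -
  define M where "M x = (axis i (v x) :: mat3)" for x
  define N1 where "N1 x = (axis i (\<Sum>j\<in>UNIV. partial j v x $ j) :: vec3)" for x
  define N2 where "N2 = partial i v"
  have pv: "partial j v \<in> test_functions \<Omega>" for j by (rule partial_test_function[OF v])
  have pvc: "continuous_on UNIV (partial j v)" for j using test_functionsD(1)[OF pv[of j]] by (auto dest: spec[of _ 0])
  have vc: "continuous_on UNIV v" using test_functionsD(1)[OF v] by (auto dest: spec[of _ 0])
  have ML2: "M \<in> L2 \<Omega>" unfolding M_def by (intro continuous_L2 continuous_on_axis vc)
  have N1L: "N1 \<in> L2 \<Omega>" unfolding N1_def by (intro continuous_L2 continuous_on_axis continuous_intros pvc)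
  have N2L: "N2 \<in> L2 \<Omega>" unfolding N2_def by (intro continuous_L2 pvc)
  have k1: "sqrt (lam k) * L2_inner \<Omega> (eps k) M = - L2_inner \<Omega> (w k) N1" for k
    using weak_gradient_row(1)[OF w_weak_gradient v, of k i] by (simp add: L2_inner_scale_left M_def[abs_def] N1_def[abs_def])
  have k2: "sqrt (lam k) * L2_inner \<Omega> (epsT k) M = - L2_inner \<Omega> (w k) N2" for k
    using weak_gradient_row(2)[OF w_weak_gradient v, of k i]
    by (simp add: L2_inner_scale_left[symmetric] M_def[abs_def] N2_def epsT_def[abs_def] transpose_scalar)
  note cont = continuous_into_inner[OF S_continuous_L2 ML2]
  have gc: "continuous_on {0..} (\<lambda>t. L2_inner \<Omega> (Sg t) M)"
    by (rule continuous_into_inner[OF series_continuous_L2[OF orthonormal_eps Sg_expands s_cont s_L2] ML2])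
  have tc: "continuous_on {0..} (\<lambda>t. L2_inner \<Omega> (St t) M)"
    by (rule continuous_into_inner[OF series_continuous_L2[OF orthonormal_epsT St_expands q_cont q_L2] ML2])
  have v1: "volterra (L2_inner \<Omega> S00 M) (\<lambda>t. L2_inner \<Omega> (Sg t) M) (\<lambda>t. - L2_inner \<Omega> (u t) N1)"
    by (rule volterra_series[OF orthonormal_eps S0 Sg_expands s_cont s_eq s_L2 _ ML2 N1L k1]) (use C L_pos in auto)
  have v2: "volterra (L2_inner \<Omega> (\<lambda>x. 0) M) (\<lambda>t. L2_inner \<Omega> (St t) M) (\<lambda>t. - L2_inner \<Omega> (u t) N2)"
  proof (rule volterra_series[OF orthonormal_epsT _ St_expands q_cont _ q_L2 _ ML2 N2L k2])
    show "expands \<Omega> epsT (\<lambda>k. 0) (\<lambda>x. 0)" by (simp add: expands_def L2_zero L2_norm_def L2_inner_def)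
    \<comment> \<open>The function \<open>s0 k * R t\<close> carries the data \<open>s0 k\<close>
      with zero source; subtracting it from \<open>s k\<close> removes the data and keeps the
      source.\<close>
    show "volterra 0 (q k) (\<lambda>t. sqrt (lam k) * U k t)" for k
      using volterra_lincomb[OF s_eq R(2) s_cont R(1), of k 1 "- s0 k"] U_cont by (simp add: q_def[abs_def] continuous_intros mult.commute)
  qed (use C L_pos CR_nonneg in auto)
  define \<sigma> where "\<sigma> t = L2_inner \<Omega> (S t) M" for t
  define \<mu> where "\<mu> t = - (L2_inner \<Omega> (u t) N1 + L2_inner \<Omega> (u t) N2)" for t
  have \<mu>c: "continuous_on {0..} \<mu>" unfolding \<mu>_def[abs_def]
    by (intro continuous_intros continuous_into_inner[OF u_continuous_L2] N1L N2L)
  \<comment> \<open>The factors \<open>1\<close> keep the shape of a linear combination; they are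
    removed once all three contributions are collected.\<close>
  have v12: "volterra (1 * L2_inner \<Omega> S00 M + 1 * L2_inner \<Omega> (\<lambda>x. 0) M) (\<lambda>t. 1 * L2_inner \<Omega> (Sg t) M + 1 * L2_inner \<Omega> (St t) M)
      (\<lambda>t. 1 * (- L2_inner \<Omega> (u t) N1) + 1 * (- L2_inner \<Omega> (u t) N2))"
    by (rule volterra_lincomb[OF v1 v2 gc tc]) (intro continuous_intros continuous_into_inner[OF u_continuous_L2] N1L N2L)+
  have "volterra (1 * (1 * L2_inner \<Omega> S00 M + 1 * L2_inner \<Omega> (\<lambda>x. 0) M) + L2_inner \<Omega> P0 M * 1)
      (\<lambda>t. 1 * (1 * L2_inner \<Omega> (Sg t) M + 1 * L2_inner \<Omega> (St t) M) + L2_inner \<Omega> P0 M * R t)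
      (\<lambda>t. 1 * (1 * (- L2_inner \<Omega> (u t) N1) + 1 * (- L2_inner \<Omega> (u t) N2)) + L2_inner \<Omega> P0 M * 0)"
    by (rule volterra_lincomb[OF v12 R(2) _ R(1)]) (intro continuous_intros gc tc continuous_into_inner[OF u_continuous_L2] N1L N2L)+
  then have "volterra (1 * (1 * L2_inner \<Omega> S00 M + 1 * L2_inner \<Omega> (\<lambda>x. 0) M) + L2_inner \<Omega> P0 M * 1) \<sigma>
      (\<lambda>t. 1 * (1 * (- L2_inner \<Omega> (u t) N1) + 1 * (- L2_inner \<Omega> (u t) N2)) + L2_inner \<Omega> P0 M * 0)"
  proof (rule volterra_cong)
    fix t :: real assume t: "t \<ge> 0"
    show "\<sigma> t = 1 * (1 * L2_inner \<Omega> (Sg t) M + 1 * L2_inner \<Omega> (St t) M) + L2_inner \<Omega> P0 M * R t"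
      unfolding \<sigma>_def S_def L2_inner_add_left[OF expands_L2[OF Sg_expands[OF t]] Sp_L2[OF t] ML2]
      unfolding Sp_def L2_inner_add_left[OF L2_scale[OF P0_L2] expands_L2[OF St_expands[OF t]] ML2] L2_inner_scale_left by simp
  qed
  moreover have "1 * (1 * L2_inner \<Omega> S00 M + 1 * L2_inner \<Omega> (\<lambda>x. 0) M) + L2_inner \<Omega> P0 M * 1 = L2_inner \<Omega> (\<lambda>x. S00 x + P0 x) M"
    using L2_inner_add_left[OF expands_L2[OF S0] P0_L2 ML2] by (simp add: L2_inner_def[of _ "\<lambda>x. 0"])
  moreover have "(\<lambda>t. 1 * (1 * (- L2_inner \<Omega> (u t) N1) + 1 * (- L2_inner \<Omega> (u t) N2)) + L2_inner \<Omega> P0 M * 0) = \<mu>"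
    by (rule ext) (simp add: \<mu>_def)
  ultimately have vol: "volterra (L2_inner \<Omega> (\<lambda>x. S00 x + P0 x) M) \<sigma> \<mu>" by (simp only:)
  have row: "(\<Sum>j\<in>UNIV. A $ i $ j * v x $ j) = A \<bullet> M x" for A :: mat3 and x
    by (simp add: M_def inner_axis) (simp add: inner_vec_def)
  have div: "(\<Sum>j\<in>UNIV. partial j v x $ j) * f x $ i + (\<Sum>j\<in>UNIV. f x $ j * partial i v x $ j) = f x \<bullet> N1 x + f x \<bullet> N2 x" for f :: vfield and x
    by (simp add: N1_def N2_def inner_axis) (simp add: inner_vec_def)
  have 1: "(LINT x|lebesgue_on \<Omega>. r * (F x \<bullet> M x)) = r * L2_inner \<Omega> F M" for F r by (simp add: L2_inner_def)
  have 2: "(LINT x|lebesgue_on \<Omega>. (F x \<bullet> M x) * r) = L2_inner \<Omega> F M * r" for F r by (simp add: L2_inner_def)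
  have 3: "(LINT x|lebesgue_on \<Omega>. r * (u t x \<bullet> N1 x + u t x \<bullet> N2 x)) = - (r * \<mu> t)" if t: "t \<ge> 0" for t r
  proof -
    have "(LINT x|lebesgue_on \<Omega>. u t x \<bullet> N1 x + u t x \<bullet> N2 x) = L2_inner \<Omega> (u t) N1 + L2_inner \<Omega> (u t) N2"
      unfolding L2_inner_def using expands_L2[OF u_expands[OF t]] N1L N2L by (intro Bochner_Integration.integral_add L2_inner_integrable)
    then show ?thesis by (simp only: integral_mult_right_zero \<mu>_def mult_minus_right minus_minus)
  qed
  have 4: "(LINT \<tau>:{0..t}|lebesgue. (LINT x|lebesgue_on \<Omega>. \<psi> t / (t - \<tau>) powr (2 - b) * (u \<tau> x \<bullet> N1 x + u \<tau> x \<bullet> N2 x)))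
      = - (LINT \<tau>:{0..t}|lebesgue. \<psi> t / (t - \<tau>) powr (2 - b) * \<mu> \<tau>)" for t
  proof -
    have "(LINT \<tau>:{0..t}|lebesgue. (LINT x|lebesgue_on \<Omega>. \<psi> t / (t - \<tau>) powr (2 - b) * (u \<tau> x \<bullet> N1 x + u \<tau> x \<bullet> N2 x)))
      = (LINT \<tau>:{0..t}|lebesgue. - (\<psi> t / (t - \<tau>) powr (2 - b) * \<mu> \<tau>))"
      by (rule set_lebesgue_integral_cong) (simp, intro allI impI 3, simp)
    also have "\<dots> = - (LINT \<tau>:{0..t}|lebesgue. \<psi> t / (t - \<tau>) powr (2 - b) * \<mu> \<tau>)"
      by (simp add: set_lebesgue_integral_def)
    finally show ?thesis .
  qed
  have 5: "(LINT t:{0..}|lebesgue. - f t) = - (LINT t:{0..}|lebesgue. f t)" for f :: "real \<Rightarrow> real"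
    by (simp add: set_lebesgue_integral_def)
  show ?thesis
    using constitutive_scalar[OF cont[folded \<sigma>_def] \<mu>c vol \<psi> refl refl]
    unfolding constitutive_equation_def row div 1 2 4 5 \<sigma>_def by (simp only: minus_mult_minus)
qed

section \<open>The estimate by the data\<close>

lemma S_D_norm:
  assumes t: "t \<ge> 0"
  shows "D_scale_norm \<Omega> lam w \<gamma> (S t) \<le> C * nD + (CR * L2_norm \<Omega> P0 + (C + CR) * L * nD)"
proof -
  have sm: "summable (\<lambda>k. (lam k powr (\<gamma> / 2) * s k t)\<^sup>2)" by (rule weighted_summable[OF s_D[OF t] D_summable])
  have "D_scale_norm \<Omega> lam w \<gamma> (S t) = sqrt ((weighted_norm (\<lambda>k. lam k powr (\<gamma> / 2)) (\<lambda>k. s k t))\<^sup>2 + (L2_norm \<Omega> (Sp t))\<^sup>2)"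
    unfolding S_def expands_D_scale(2)[OF Sg_expands[OF t] Sp_orth[OF t]] weighted_norm_sq[OF sm] ..
  also have "\<dots> \<le> weighted_norm (\<lambda>k. lam k powr (\<gamma> / 2)) (\<lambda>k. s k t) + L2_norm \<Omega> (Sp t)"
    by (rule sqrt_sum_squares_le_sum[OF weighted_norm_nonneg[OF sm] L2_norm_nonneg])
  also have "weighted_norm (\<lambda>k. lam k powr (\<gamma> / 2)) (\<lambda>k. s k t) \<le> C * nD"
    unfolding nD_def by (rule weighted_norm_le[OF s_D[OF t] D_summable]) (use C in simp)
  finally show ?thesis using S_L2_norm(1)[OF t] by linarith
qed

lemma u_H_norm: "t \<ge> 0 \<Longrightarrow> H_scale_norm \<Omega> lam w (\<gamma> + om) (u t) \<le> C * nD"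
  unfolding expands_H_scale(2)[OF u_expands] nD_def
  by (rule weighted_norm_le[OF U_H D_summable]) (use C in auto)

text \<open>The velocity and the component along \<open>eps\<close> cost \<open>C * nD\<close> each,
  the transposed component \<open>(C + CR) * L * nD\<close>, and the relaxing one \<open>CR\<close>
  times the norm of \<open>P0\<close>. The further factor \<open>2\<close> is that of
  \<open>nD_le\<close>.\<close>

lemma estimate:
  assumes u0: "expands \<Omega> w c0 u0" and S0: "expands \<Omega> eps s0 S00" and t: "t \<ge> 0"
  shows "H_scale_norm \<Omega> lam w (\<gamma> + om) (u t) + D_scale_norm \<Omega> lam w \<gamma> (S t)
    \<le> (2 * (2 * C + (C + CR) * L) + CR) * (H_scale_norm \<Omega> lam w (\<gamma> + om) u0 + D_scale_norm \<Omega> lam w \<gamma> (\<lambda>x. S00 x + P0 x))"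
proof -
  define x y z where "x = H_scale_norm \<Omega> lam w (\<gamma> + om) u0" and "y = D_scale_norm \<Omega> lam w \<gamma> (\<lambda>x. S00 x + P0 x)"
    and "z = 2 * C + (C + CR) * L"
  have x: "x = weighted_norm (\<lambda>k. lam k powr ((\<gamma> + om) / 2)) c0" unfolding x_def by (rule expands_H_scale(2)[OF u0])
  have y: "y = sqrt ((weighted_norm (\<lambda>k. lam k powr (\<gamma> / 2)) s0)\<^sup>2 + (L2_norm \<Omega> P0)\<^sup>2)"
    unfolding y_def expands_D_scale(2)[OF S0 P0] weighted_norm_sq[OF data(2)] ..
  have x0: "x \<ge> 0" unfolding x by (rule weighted_norm_nonneg[OF data(1)])
  have y1: "weighted_norm (\<lambda>k. lam k powr (\<gamma> / 2)) s0 \<le> y" and y2: "L2_norm \<Omega> P0 \<le> y"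
    unfolding y by (rule real_sqrt_sum_squares_ge1, rule real_sqrt_sum_squares_ge2)
  have z0: "z \<ge> 0" using C CR_nonneg L_pos by (simp add: z_def)
  have "H_scale_norm \<Omega> lam w (\<gamma> + om) (u t) + D_scale_norm \<Omega> lam w \<gamma> (S t) \<le> z * nD + CR * L2_norm \<Omega> P0"
    using u_H_norm[OF t] S_D_norm[OF t] by (simp add: z_def algebra_simps)
  also have "\<dots> \<le> z * (2 * (x + y)) + CR * (x + y)"
    using nD_le[folded x] y1 y2 x0 by (intro add_mono mult_left_mono z0 CR_nonneg) auto
  also have "\<dots> = (2 * z + CR) * (x + y)" by (simp add: algebra_simps)
  finally show ?thesis unfolding x_def y_def z_def .
qed

lemma weak_solution_u_S:
  assumes "expands \<Omega> w c0 u0" "expands \<Omega> eps s0 S00"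
  shows "weak_solution \<Omega> (a - b) (2 - b) u0 (\<lambda>x. S00 x + P0 x) u S"
  unfolding weak_solution_def
  by (intro conjI u_continuous_L2 u_L1_H1 continuous_into_subset[OF S_continuous_L2] S_L1 ballI allI impI
      momentum constitutive assms expands_H(2)[OF u_expands]) auto

end

theorem theorem5p1:
  fixes \<Omega> :: "(real^3) set"
    and m :: nat
    and \<alpha> \<beta> \<delta> \<omega> \<gamma> :: real
    and lam :: "nat \<Rightarrow> real"
    and w :: "nat \<Rightarrow> real^3 \<Rightarrow> real^3"
  assumes "bounded_domain \<Omega>"
    and "m \<ge> 1" and "Ck_boundary m \<Omega>"
    and "0 < \<alpha>" and "\<alpha> < \<beta>" and "\<beta> < 1"
    and "\<delta> = \<beta> - \<alpha>" and "\<omega> = \<delta> / (2 - \<delta>)"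
    and "stokes_eigensystem \<Omega> lam w"
    and "\<gamma> \<ge> 0"
  shows "\<exists>A>0. \<forall>u0 \<in> H_scale \<Omega> lam w (\<gamma> + \<omega>). \<forall>S0 \<in> D_scale \<Omega> lam w \<gamma>.
    \<exists>(u :: real \<Rightarrow> real^3 \<Rightarrow> real^3) (S :: real \<Rightarrow> real^3 \<Rightarrow> real^3^3).
      weak_solution \<Omega> \<alpha> \<beta> u0 S0 u S \<and>
      continuous_into {0..} (H_scale \<Omega> lam w (\<gamma> + \<omega>)) (H_scale_norm \<Omega> lam w (\<gamma> + \<omega>)) u \<and>
      continuous_into {0<..} (V_space \<Omega>) (V_norm \<Omega>) u \<and>
      (\<forall>p. 1 \<le> p \<and> p < 2 / (2 - \<delta>) \<longrightarrow> Lp_loc p (V_space \<Omega>) (V_norm \<Omega>) u) \<and>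
      continuous_into {0..} (D_scale \<Omega> lam w \<gamma>) (D_scale_norm \<Omega> lam w \<gamma>) S \<and>
      (\<forall>t\<ge>0. H_scale_norm \<Omega> lam w (\<gamma> + \<omega>) (u t) + D_scale_norm \<Omega> lam w \<gamma> (S t)
               \<le> A * (H_scale_norm \<Omega> lam w (\<gamma> + \<omega>) u0 + D_scale_norm \<Omega> lam w \<gamma> S0))"
proof -
  define a b where "a = 2 - \<delta>" and "b = 2 - \<beta>"
  interpret stokes \<Omega> lam w
    using assms by unfold_locales (auto simp: bounded_domain_def)
  interpret frac_kernel a b using assms by unfold_locales (auto simp: a_def b_def)
  have om: "om = \<omega>" unfolding om_def unfolding a_def using assms by simp
  have \<alpha>: "a - b = \<alpha>" and \<beta>: "2 - b = \<beta>" and \<delta>: "2 - \<delta> = a" using assms by (auto simp: a_def b_def)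
  obtain R CR where R: "continuous_on {0..} R" "volterra 1 R (\<lambda>_. 0)" "\<And>t. t \<ge> 0 \<Longrightarrow> \<bar>R t\<bar> \<le> CR"
    using relaxation_function by blast
  \<comment> \<open>A predicate on pairs, so that one choice per eigenvalue later selects velocity
    and stress coefficients together.\<close>
  define sol where "sol C l u0 s0 = (\<lambda>(u, s). continuous_on {0..} u \<and> continuous_on {0..} s \<and>
       (\<forall>t\<ge>0. u t = u0 - sqrt l * conv (\<lambda>_. 1) s t) \<and> volterra s0 s (\<lambda>t. sqrt l * u t) \<and>
       (\<forall>t\<ge>0. l powr (om / 2) * \<bar>u t\<bar> \<le> C * (l powr (om / 2) * \<bar>u0\<bar> + \<bar>s0\<bar>)) \<and>
       (\<forall>t\<ge>0. \<bar>s t\<bar> \<le> C * (l powr (om / 2) * \<bar>u0\<bar> + \<bar>s0\<bar>)) \<and>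
       (\<forall>t>0. sqrt l * \<bar>u t\<bar> \<le> C * (t powr (- (a / 2)) * (1 + t)) * (l powr (om / 2) * \<bar>u0\<bar> + \<bar>s0\<bar>)))"
    for C l u0 s0
  obtain C where C: "C > 0" and sol: "\<And>l u0 s0. l \<ge> lam 0 \<Longrightarrow> \<exists>p. sol C l u0 s0 p"
    using scalar_solution_exists[OF lam_pos[of 0]] unfolding sol_def split_paired_Ex prod.case by blast
  have CR: "CR \<ge> 0" using R(3)[of 0] by simp
  \<comment> \<open>The constant of \<open>estimate\<close> with \<open>L\<close> unfolded; it is
    fixed before the initial data are, as \<open>C\<close>, \<open>CR\<close> and
    \<open>lam 0\<close> do not depend on them.\<close>
  define A where "A = 2 * (2 * C + (C + CR) * (lam 0 powr (- (\<gamma> / 2)))) + CR"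
  have A: "A > 0" unfolding A_def using C CR by (intro add_pos_nonneg mult_pos_pos) auto
  have main: "\<exists>u S. weak_solution \<Omega> \<alpha> \<beta> u0 S0 u S \<and>
      continuous_into {0..} (H_scale \<Omega> lam w (\<gamma> + \<omega>)) (H_scale_norm \<Omega> lam w (\<gamma> + \<omega>)) u \<and>
      continuous_into {0<..} (V_space \<Omega>) (V_norm \<Omega>) u \<and>
      (\<forall>p. 1 \<le> p \<and> p < 2 / (2 - \<delta>) \<longrightarrow> Lp_loc p (V_space \<Omega>) (V_norm \<Omega>) u) \<and>
      continuous_into {0..} (D_scale \<Omega> lam w \<gamma>) (D_scale_norm \<Omega> lam w \<gamma>) S \<and>
      (\<forall>t\<ge>0. H_scale_norm \<Omega> lam w (\<gamma> + \<omega>) (u t) + D_scale_norm \<Omega> lam w \<gamma> (S t)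
               \<le> A * (H_scale_norm \<Omega> lam w (\<gamma> + \<omega>) u0 + D_scale_norm \<Omega> lam w \<gamma> S0))"
    if u0: "u0 \<in> H_scale \<Omega> lam w (\<gamma> + \<omega>)" and S0: "S0 \<in> D_scale \<Omega> lam w \<gamma>" for u0 S0
  proof -
    define x y where "x k = L2_inner \<Omega> u0 (w k)" and "y k = L2_inner \<Omega> S0 (eps k)" for k
    have ex: "expands \<Omega> w x u0" unfolding x_def[abs_def] by (rule H_expands) (use u0 in \<open>simp add: H_scale_def\<close>)
    \<comment> \<open>The split of the initial stress: \<open>F\<close> supplies the coefficients
      along \<open>eps\<close>, while \<open>G\<close> is the part that relaxes through
      \<open>R\<close>.\<close>
    obtain F G where ey: "expands \<Omega> eps y F" and G: "G \<in> orth_complement \<Omega> (range eps)" and FG: "S0 = (\<lambda>x. F x + G x)"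
      using D_decompose[of S0] S0 unfolding y_def[abs_def] D_scale_def by blast
    define p where "p k = (SOME p. sol C (lam k) (x k) (y k) p)" for k
    have p: "sol C (lam k) (x k) (y k) (p k)" for k
      unfolding p_def by (rule someI_ex[OF sol[OF lam_ge]])
    note q = p[unfolded sol_def case_prod_unfold]
    interpret evolution \<Omega> lam w a b \<gamma> C CR R x y G "\<lambda>k. fst (p k)" "\<lambda>k. snd (p k)"
    proof unfold_locales
      show "summable (\<lambda>k. (lam k powr ((\<gamma> + om) / 2) * x k)\<^sup>2)"
        using u0 unfolding om[symmetric] expands_H_scale(1)[OF ex] .
      show "summable (\<lambda>k. (lam k powr (\<gamma> / 2) * y k)\<^sup>2)"
        using S0 unfolding FG expands_D_scale(1)[OF ey G] .
    qed (use C R G assms(10) q in blast)+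
    show ?thesis
    proof (rule exI[of _ u], rule exI[of _ S], intro conjI allI impI)
      show "weak_solution \<Omega> \<alpha> \<beta> u0 S0 u S"
        using weak_solution_u_S[OF ex ey] unfolding \<alpha> \<beta> FG .
      show "continuous_into {0..} (H_scale \<Omega> lam w (\<gamma> + \<omega>)) (H_scale_norm \<Omega> lam w (\<gamma> + \<omega>)) u"
        using u_continuous_H unfolding om .
      show "Lp_loc p (V_space \<Omega>) (V_norm \<Omega>) u" if "1 \<le> p \<and> p < 2 / (2 - \<delta>)" for p
        using u_Lp_V that unfolding \<delta> by blast
      show "H_scale_norm \<Omega> lam w (\<gamma> + \<omega>) (u t) + D_scale_norm \<Omega> lam w \<gamma> (S t)
          \<le> A * (H_scale_norm \<Omega> lam w (\<gamma> + \<omega>) u0 + D_scale_norm \<Omega> lam w \<gamma> S0)" if "t \<ge> 0" for t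
        using estimate[OF ex ey that] unfolding om L_def A_def FG .
    qed (rule u_continuous_V S_continuous_D)+
  qed
  show ?thesis using A main by blast
qed

end
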